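(* Let $K$ be a field which is not separably closed. Assume that $K$ is henselian with respect to a valuation with separably closed residue field. Then $K$ admits a non-trivial $\emptyset$-definable henselian valuation.
   Context: A valuation $v$ on $K$ is $\emptyset$-definable if there is a parameter-free first-order formula in the language of rings defining its valuation ring $\mathcal{O}_v$ in $K$. *)

theory Defs
  imports "HOL-Algebra.Algebra"
begin

section \<open>Separably closed fields\<close>

text \<open>Polynomials are the coefficient lists of \<^theory>\<open>HOL-Algebra.Polynomials\<close>,
  highest coefficient first.\<close>

definition (in ring) pderiv :: "'a list \<Rightarrow> 'a list" where
  "pderiv p = normalize (map (\<lambda>i. [Suc i] \<cdot> coeff p (Suc i)) (rev [0..<degree p]))"

text \<open>\<open>p\<close> and its derivative have no common divisor except units. This excludes the zero
  polynomial, and allows nonzero constants.\<close>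

definition (in ring) separable_poly :: "'a list \<Rightarrow> bool" where
  "separable_poly p \<longleftrightarrow> p \<in> carrier (poly_ring R) \<and>
     (\<forall>d \<in> carrier (poly_ring R).
        d pdivides p \<longrightarrow> d pdivides (pderiv p) \<longrightarrow> d \<in> Units (poly_ring R))"

locale separably_closed = field L for L (structure) +
  assumes separable_splitted: "separable_poly P \<Longrightarrow> splitted P"

section \<open>Valuations\<close>

text \<open>Linearly ordered abelian groups with an explicit carrier, so that a statement can
  quantify existentially over the value group. Following \<^theory>\<open>HOL-Algebra.Group\<close>, the
  group is written multiplicatively; its neutral element is the value usually written \<open>0\<close>.\<close>

record 'g ordered_monoid = "'g monoid" +
  gle :: "'g \<Rightarrow> 'g \<Rightarrow> bool" (infix \<open>\<preceq>\<index>\<close> 50)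

locale ordered_comm_group = comm_group G
  for G :: "('g, 'n) ordered_monoid_scheme" (structure) +
  assumes gle_antisym: "\<lbrakk>x \<in> carrier G; y \<in> carrier G; x \<preceq> y; y \<preceq> x\<rbrakk> \<Longrightarrow> x = y"
    and gle_trans: "\<lbrakk>x \<in> carrier G; y \<in> carrier G; z \<in> carrier G; x \<preceq> y; y \<preceq> z\<rbrakk> \<Longrightarrow> x \<preceq> z"
    and gle_total: "\<lbrakk>x \<in> carrier G; y \<in> carrier G\<rbrakk> \<Longrightarrow> x \<preceq> y \<or> y \<preceq> x"
    and gle_mult: "\<lbrakk>x \<in> carrier G; y \<in> carrier G; z \<in> carrier G; x \<preceq> y\<rbrakk> \<Longrightarrow> z \<otimes> x \<preceq> z \<otimes> y"

text \<open>The value \<open>v 0 = \<infinity>\<close> is not represented: only the values of \<open>v\<close> on nonzero elements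
  matter, and zero is treated separately wherever it occurs. \<open>G\<close> is the full value group,
  that is, \<open>v\<close> maps the multiplicative group of \<open>K\<close> onto \<open>G\<close>.\<close>

locale valuation = field K + G: ordered_comm_group G
  for K (structure) and G :: "('g, 'n) ordered_monoid_scheme" and v +
  assumes val_epi: "v \<in> epi (Multiplicative_Group.mult_of K) G"
    and val_add: "\<lbrakk>x \<in> carrier K - {\<zero>}; y \<in> carrier K - {\<zero>}; x \<oplus> y \<noteq> \<zero>\<rbrakk>
           \<Longrightarrow> v x \<preceq>\<^bsub>G\<^esub> v (x \<oplus> y) \<or> v y \<preceq>\<^bsub>G\<^esub> v (x \<oplus> y)"

definition valuation_ring ::
  "('a, 'm) ring_scheme \<Rightarrow> ('g, 'n) ordered_monoid_scheme \<Rightarrow> ('a \<Rightarrow> 'g) \<Rightarrow> 'a set" where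
  "valuation_ring K G v = {x \<in> carrier K. x = \<zero>\<^bsub>K\<^esub> \<or> \<one>\<^bsub>G\<^esub> \<preceq>\<^bsub>G\<^esub> v x}"

definition valuation_ideal ::
  "('a, 'm) ring_scheme \<Rightarrow> ('g, 'n) ordered_monoid_scheme \<Rightarrow> ('a \<Rightarrow> 'g) \<Rightarrow> 'a set" where
  "valuation_ideal K G v =
     {x \<in> carrier K. x = \<zero>\<^bsub>K\<^esub> \<or> (\<one>\<^bsub>G\<^esub> \<preceq>\<^bsub>G\<^esub> v x \<and> v x \<noteq> \<one>\<^bsub>G\<^esub>)}"

definition residue_field ::
  "('a, 'm) ring_scheme \<Rightarrow> ('g, 'n) ordered_monoid_scheme \<Rightarrow> ('a \<Rightarrow> 'g) \<Rightarrow> 'a set ring" where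
  "residue_field K G v =
     (K\<lparr>carrier := valuation_ring K G v\<rparr>) Quot (valuation_ideal K G v)"

definition nontrivial_valuation ::
  "('a, 'm) ring_scheme \<Rightarrow> ('g, 'n) ordered_monoid_scheme \<Rightarrow> ('a \<Rightarrow> 'g) \<Rightarrow> bool" where
  "nontrivial_valuation K G v \<longleftrightarrow>
     valuation K G v \<and> (\<exists>x \<in> carrier K - {\<zero>\<^bsub>K\<^esub>}. v x \<noteq> \<one>\<^bsub>G\<^esub>)"

text \<open>Henselianity in the form of Hensel's Lemma: a simple root in the residue field of a
  polynomial over the valuation ring lifts to a root in the valuation ring. The conditions on
  \<open>f\<close> and \<open>a\<close> say that the residue of \<open>a\<close> is a simple root of the reduction of \<open>f\<close>.\<close>

definition henselian_valuation ::
  "('a, 'm) ring_scheme \<Rightarrow> ('g, 'n) ordered_monoid_scheme \<Rightarrow> ('a \<Rightarrow> 'g) \<Rightarrow> bool" where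
  "henselian_valuation K G v \<longleftrightarrow> valuation K G v \<and>
     (\<forall>f \<in> carrier (univ_poly K (valuation_ring K G v)). \<forall>a \<in> valuation_ring K G v.
        ring.eval K f a \<in> valuation_ideal K G v \<longrightarrow>
        ring.eval K (ring.pderiv K f) a \<notin> valuation_ideal K G v \<longrightarrow>
        (\<exists>b \<in> valuation_ring K G v.
           ring.eval K f b = \<zero>\<^bsub>K\<^esub> \<and> b \<ominus>\<^bsub>K\<^esub> a \<in> valuation_ideal K G v))"

section \<open>First-order formulas in the language of rings\<close>

datatype rterm =
    TVar nat
  | TZero
  | TOne
  | TMinus rterm
  | TAdd rterm rterm
  | TMult rterm rterm

datatype rform =
    FEq rterm rterm
  | FNot rform
  | FAnd rform rform
  | FEx nat rform

primrec tvars :: "rterm \<Rightarrow> nat set" where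
  "tvars (TVar i) = {i}"
| "tvars TZero = {}"
| "tvars TOne = {}"
| "tvars (TMinus s) = tvars s"
| "tvars (TAdd s t) = tvars s \<union> tvars t"
| "tvars (TMult s t) = tvars s \<union> tvars t"

primrec free_vars :: "rform \<Rightarrow> nat set" where
  "free_vars (FEq s t) = tvars s \<union> tvars t"
| "free_vars (FNot \<phi>) = free_vars \<phi>"
| "free_vars (FAnd \<phi> \<psi>) = free_vars \<phi> \<union> free_vars \<psi>"
| "free_vars (FEx i \<phi>) = free_vars \<phi> - {i}"

primrec tval :: "('a, 'm) ring_scheme \<Rightarrow> (nat \<Rightarrow> 'a) \<Rightarrow> rterm \<Rightarrow> 'a" where
  "tval R e (TVar i) = e i"
| "tval R e TZero = \<zero>\<^bsub>R\<^esub>"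
| "tval R e TOne = \<one>\<^bsub>R\<^esub>"
| "tval R e (TMinus s) = \<ominus>\<^bsub>R\<^esub> tval R e s"
| "tval R e (TAdd s t) = tval R e s \<oplus>\<^bsub>R\<^esub> tval R e t"
| "tval R e (TMult s t) = tval R e s \<otimes>\<^bsub>R\<^esub> tval R e t"

primrec sat :: "('a, 'm) ring_scheme \<Rightarrow> (nat \<Rightarrow> 'a) \<Rightarrow> rform \<Rightarrow> bool" where
  "sat R e (FEq s t) \<longleftrightarrow> tval R e s = tval R e t"
| "sat R e (FNot \<phi>) \<longleftrightarrow> \<not> sat R e \<phi>"
| "sat R e (FAnd \<phi> \<psi>) \<longleftrightarrow> sat R e \<phi> \<and> sat R e \<psi>"
| "sat R e (FEx i \<phi>) \<longleftrightarrow> (\<exists>x \<in> carrier R. sat R (e(i := x)) \<phi>)"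

text \<open>Only the variable \<open>0\<close> may be free, so the values assigned to the other variables are
  irrelevant and no parameters enter.\<close>

definition zero_definable_set :: "('a, 'm) ring_scheme \<Rightarrow> 'a set \<Rightarrow> bool" where
  "zero_definable_set R S \<longleftrightarrow>
     (\<exists>\<phi>. free_vars \<phi> \<subseteq> {0} \<and> S = {x \<in> carrier R. sat R ((\<lambda>_. \<zero>\<^bsub>R\<^esub>)(0 := x)) \<phi>})"

definition zero_definable_valuation ::
  "('a, 'm) ring_scheme \<Rightarrow> ('g, 'n) ordered_monoid_scheme \<Rightarrow> ('a \<Rightarrow> 'g) \<Rightarrow> bool" where
  "zero_definable_valuation K G v \<longleftrightarrow>
     valuation K G v \<and> zero_definable_set K (valuation_ring K G v)"

end

theory Submission
  imports Defs "HOL-Algebra.Algebraic_Closure_Type"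
begin

text \<open>Let \<open>V\<close> be the given valuation ring. It suffices to find a parameter-free definable set \<open>M\<close>, not
  \<open>{0}\<close> and not \<open>K\<close>, with \<open>V M \<subseteq> M\<close>. Its stabilizer \<open>{x. x M \<subseteq> M}\<close> is then a
  definable proper subring of \<open>K\<close> that contains \<open>V\<close>, and such a coarsening of a henselian
  valuation ring is a henselian valuation ring.

  Since \<open>K\<close> is not separably closed, it has a nontrivial finite Galois extension \<open>L\<close>. Its group
  acts trivially on the residue field of \<open>L\<close>, because that of \<open>K\<close> is separably closed. So either
  the value group of \<open>K\<close> is not \<open>p\<close>-divisible for some prime \<open>p\<close> other than the residue
  characteristic, or all of the group is wild, \<open>\<sigma> x / x\<close> being \<open>1\<close> in the residue field for all
  \<open>x\<close>. The latter yields a homomorphism onto \<open>\<int>/q\<close>, \<open>q\<close> being the residue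
  characteristic, and by Hilbert 90 an element \<open>a\<close> such that \<open>X^q - X - a\<close> has no root
  (if \<open>K\<close> has characteristic \<open>q\<close>) or \<open>X^q - a\<close> has no root while \<open>K\<close> contains the \<open>q\<close>-th
  roots of unity. By Hensel's Lemma all elements close enough to \<open>1\<close> are of the form \<open>y^p\<close> or
  \<open>y^q\<close>, and those close enough to \<open>0\<close> are of the form \<open>y^q - y\<close>; the ball \<open>M\<close> is defined
  from the set of all elements of this form.\<close>

text \<open>No formula for \<open>V\<close> itself is at hand, so the definition can only exploit
  how powers behave near \<open>0\<close> and \<open>1\<close>. The radius up to which they fill
  everything is unknown. It matters only that some ball is cut out: a \<open>V\<close>-stable set is
  totally ordered by divisibility and hence a \<open>V\<close>-module, whatever its radius. In the
  wild cases the radius is read off with \<open>x y / (x - y)\<close>. Subtracting reciprocals keeps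
  a small \<open>x\<close> small, but for suitable \<open>y\<close> moves an \<open>x\<close>
  outside the ball onto a forbidden element. The delicate \<open>x\<close> lie on the boundary,
  where the ball is a multiple of the maximal ideal of a coarsening of \<open>V\<close>; there
  additivity of the Frobenius decides. On the Galois side the differences
  \<open>\<sigma> x / x - 1\<close>, divided by the largest of them, become additive modulo the
  maximal ideal, and a maximal subgroup turns this into a character modulo \<open>q\<close>. The
  multiplicative use of Hilbert 90 presupposes roots of unity: they are put into \<open>L\<close>
  from the start, and wildness, applied to \<open>\<zeta> - 1\<close>, forces them into
  \<open>K\<close>.\<close>

hide_const (open) Divisibility.prime

section \<open>Valuation subrings of a field\<close>

definition coeffs_in :: "'a::zero set \<Rightarrow> 'a poly \<Rightarrow> bool" where
  "coeffs_in S p \<longleftrightarrow> (\<forall>i. coeff p i \<in> S)"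

lemma coeffs_in_pCons: "coeffs_in S (pCons a p) \<longleftrightarrow> a \<in> S \<and> coeffs_in S p"
proof
  assume h: "coeffs_in S (pCons a p)"
  have "coeff p i \<in> S" for i using h[unfolded coeffs_in_def, rule_format, of "Suc i"] by simp
  moreover have "a \<in> S" using h[unfolded coeffs_in_def, rule_format, of 0] by simp
  ultimately show "a \<in> S \<and> coeffs_in S p" by (auto simp: coeffs_in_def)
qed (auto simp: coeffs_in_def coeff_pCons split: nat.splits)

locale ring_set =
  fixes S :: "'a::field set"
  assumes one_in: "1 \<in> S"
    and diff_in: "\<And>x y. x \<in> S \<Longrightarrow> y \<in> S \<Longrightarrow> x - y \<in> S"
    and mult_in: "\<And>x y. x \<in> S \<Longrightarrow> y \<in> S \<Longrightarrow> x * y \<in> S"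
begin

lemma zero_in: "0 \<in> S"
  using diff_in[OF one_in one_in] by simp

lemma uminus_in: "x \<in> S \<Longrightarrow> - x \<in> S"
  using diff_in[OF zero_in] by simp

lemma uminus_in_iff: "- x \<in> S \<longleftrightarrow> x \<in> S"
  using uminus_in by force

lemma add_in: "x \<in> S \<Longrightarrow> y \<in> S \<Longrightarrow> x + y \<in> S"
  using diff_in[OF _ uminus_in[of y]] by simp

lemma power_in: "x \<in> S \<Longrightarrow> x ^ n \<in> S"
  by (induction n) (auto intro: one_in mult_in)

lemma of_nat_in: "of_nat n \<in> S"
  by (induction n) (auto intro: zero_in one_in add_in)

lemma of_int_in: "of_int n \<in> S"
  by (cases n) (auto intro: of_nat_in uminus_in diff_in one_in simp: uminus_in_iff simp del: of_nat_Suc)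

lemma sum_in: "(\<And>i. i \<in> A \<Longrightarrow> f i \<in> S) \<Longrightarrow> (\<Sum>i\<in>A. f i) \<in> S"
  by (induction A rule: infinite_finite_induct) (auto intro: zero_in add_in)

lemma prod_in: "(\<And>i. i \<in> A \<Longrightarrow> f i \<in> S) \<Longrightarrow> (\<Prod>i\<in>A. f i) \<in> S"
  by (induction A rule: infinite_finite_induct) (auto intro: one_in mult_in)

lemma poly_in: "coeffs_in S p \<Longrightarrow> x \<in> S \<Longrightarrow> poly p x \<in> S"
  unfolding poly_altdef coeffs_in_def by (intro sum_in mult_in power_in) auto

lemma coeffs_in_0: "coeffs_in S 0"
  by (simp add: coeffs_in_def zero_in)

lemma coeffs_in_1: "coeffs_in S 1"
  by (simp add: coeffs_in_def zero_in one_in)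

lemma coeffs_in_const: "a \<in> S \<Longrightarrow> coeffs_in S [:a:]"
  by (simp add: coeffs_in_pCons coeffs_in_0)

lemma coeffs_in_add: "coeffs_in S p \<Longrightarrow> coeffs_in S q \<Longrightarrow> coeffs_in S (p + q)"
  by (auto simp: coeffs_in_def add_in)

lemma coeffs_in_diff: "coeffs_in S p \<Longrightarrow> coeffs_in S q \<Longrightarrow> coeffs_in S (p - q)"
  by (auto simp: coeffs_in_def diff_in)

lemma coeffs_in_mult: "coeffs_in S p \<Longrightarrow> coeffs_in S q \<Longrightarrow> coeffs_in S (p * q)"
  by (auto simp: coeffs_in_def coeff_mult intro!: sum_in mult_in)

lemma coeffs_in_smult: "a \<in> S \<Longrightarrow> coeffs_in S q \<Longrightarrow> coeffs_in S (smult a q)"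
  by (auto simp: coeffs_in_def mult_in)

lemma coeffs_in_monom: "a \<in> S \<Longrightarrow> coeffs_in S (monom a n)"
  by (auto simp: coeffs_in_def zero_in)

lemma coeffs_in_prod: "(\<And>i. i \<in> A \<Longrightarrow> coeffs_in S (f i)) \<Longrightarrow> coeffs_in S (\<Prod>i\<in>A. f i)"
  by (induction A rule: infinite_finite_induct) (auto intro: coeffs_in_1 coeffs_in_mult)

lemma coeffs_in_pderiv: "coeffs_in S p \<Longrightarrow> coeffs_in S (pderiv p)"
  unfolding coeffs_in_def coeff_pderiv by (intro allI mult_in of_nat_in) auto

lemma coeffs_in_pcompose: "coeffs_in S p \<Longrightarrow> coeffs_in S q \<Longrightarrow> coeffs_in S (pcompose p q)"
  by (induction p) (auto simp: pcompose_pCons coeffs_in_pCons coeffs_in_0 coeffs_in_add coeffs_in_mult)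

end

lemma coeffs_in_mono: "S \<subseteq> T \<Longrightarrow> coeffs_in S p \<Longrightarrow> coeffs_in T p"
  by (auto simp: coeffs_in_def)

text \<open>Written through inverses, so that the ideal visibly shrinks when the ring grows; for a
  valuation ring, totality puts these elements into \<open>V\<close>.\<close>

definition max_ideal :: "'a::field set \<Rightarrow> 'a set" where
  "max_ideal V = {x. x = 0 \<or> inverse x \<notin> V}"

locale valuation_set = ring_set V for V :: "'a::field set" +
  assumes total: "x \<in> V \<or> inverse x \<in> V"
begin

abbreviation "\<mm> \<equiv> max_ideal V"

lemma max_ideal_subset: "x \<in> \<mm> \<Longrightarrow> x \<in> V"
  using total zero_in by (auto simp: max_ideal_def)

lemma zero_max: "0 \<in> \<mm>"
  by (simp add: max_ideal_def)

lemma one_notin_max: "1 \<notin> \<mm>"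
  by (simp add: max_ideal_def one_in)

lemma not_in_V: "x \<notin> V \<longleftrightarrow> x \<noteq> 0 \<and> inverse x \<in> \<mm>"
  using zero_in by (auto simp: max_ideal_def)

lemma max_mult: "c \<in> V \<Longrightarrow> x \<in> \<mm> \<Longrightarrow> c * x \<in> \<mm>"
proof -
  assume c: "c \<in> V" and x: "x \<in> \<mm>"
  show "c * x \<in> \<mm>"
  proof (rule ccontr)
    assume "c * x \<notin> \<mm>"
    hence n: "c * x \<noteq> 0" and i: "inverse (c * x) \<in> V" by (auto simp: max_ideal_def)
    have "inverse x = c * inverse (c * x)" using n by (auto simp: divide_simps)
    hence "inverse x \<in> V" using mult_in[OF c i] by (simp only:)
    thus False using x n by (auto simp: max_ideal_def)
  qed
qed

lemma max_mult': "c \<in> V \<Longrightarrow> x \<in> \<mm> \<Longrightarrow> x * c \<in> \<mm>"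
  using max_mult[of c x] by (simp add: mult.commute)

lemma max_uminus: "x \<in> \<mm> \<Longrightarrow> - x \<in> \<mm>"
  using max_mult[OF uminus_in[OF one_in]] by simp

lemma max_uminus_iff: "- x \<in> \<mm> \<longleftrightarrow> x \<in> \<mm>"
  using max_uminus by force

lemma comparable: "x / y \<in> V \<or> y / x \<in> V"
  using total[of "x / y"] by (simp add: inverse_eq_divide)

lemma div_max: "y \<noteq> 0 \<Longrightarrow> x / y \<notin> V \<longleftrightarrow> x \<noteq> 0 \<and> y / x \<in> \<mm>"
  using not_in_V[of "x / y"] by (auto simp: inverse_eq_divide)

lemma max_iff: "x \<noteq> 0 \<Longrightarrow> x \<in> \<mm> \<longleftrightarrow> 1 / x \<notin> V"
  by (auto simp: max_ideal_def inverse_eq_divide)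

lemma max_add: "x \<in> \<mm> \<Longrightarrow> y \<in> \<mm> \<Longrightarrow> x + y \<in> \<mm>"
proof -
  have *: "x + y \<in> \<mm>" if "x \<in> \<mm>" "y / x \<in> V" "x \<noteq> 0" for x y
  proof -
    have "x + y = (1 + y / x) * x" using that by (simp add: field_simps)
    thus ?thesis using that by (auto intro!: max_mult add_in one_in)
  qed
  assume "x \<in> \<mm>" "y \<in> \<mm>"
  thus ?thesis using *[of x y] *[of y x] comparable[of x y]
    by (cases "x = 0"; cases "y = 0") (auto simp: add.commute)
qed

lemma max_diff: "x \<in> \<mm> \<Longrightarrow> y \<in> \<mm> \<Longrightarrow> x - y \<in> \<mm>"
  using max_add[OF _ max_uminus[of y]] by simp

lemma max_sum: "(\<And>i. i \<in> A \<Longrightarrow> f i \<in> \<mm>) \<Longrightarrow> (\<Sum>i\<in>A. f i) \<in> \<mm>"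
  by (induction A rule: infinite_finite_induct) (auto intro: zero_max max_add)

lemma unit_iff: "x \<in> V - \<mm> \<longleftrightarrow> x \<noteq> 0 \<and> x \<in> V \<and> 1 / x \<in> V"
  by (auto simp: max_ideal_def inverse_eq_divide)

lemma unit_not0: "x \<in> V - \<mm> \<Longrightarrow> x \<noteq> 0"
  by (auto simp: zero_max)

lemma unit_inverse: "x \<in> V - \<mm> \<Longrightarrow> 1 / x \<in> V - \<mm>"
  using unit_iff[of x] unit_iff[of "1 / x"] by simp

lemma unit_mult: "x \<in> V - \<mm> \<Longrightarrow> y \<in> V - \<mm> \<Longrightarrow> x * y \<in> V - \<mm>"
  unfolding unit_iff using mult_in[of "1 / x" "1 / y"] by (auto intro: mult_in)

lemma unit_divide: "x \<in> V - \<mm> \<Longrightarrow> y \<in> V - \<mm> \<Longrightarrow> x / y \<in> V - \<mm>"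
  using unit_mult[OF _ unit_inverse] by simp

lemma divide_unit: "x \<in> V \<Longrightarrow> y \<in> V - \<mm> \<Longrightarrow> x / y \<in> V"
  using mult_in[of x "1 / y"] unit_iff[of y] by simp

lemma max_divide_unit: "x \<in> \<mm> \<Longrightarrow> y \<in> V - \<mm> \<Longrightarrow> x / y \<in> \<mm>"
  using max_mult[of "1 / y" x] unit_iff[of y] by simp

lemma max_prime: "x \<in> V \<Longrightarrow> y \<in> V \<Longrightarrow> x * y \<in> \<mm> \<Longrightarrow> x \<in> \<mm> \<or> y \<in> \<mm>"
  using unit_mult by blast

lemma unit_power: "x \<in> V - \<mm> \<Longrightarrow> x ^ n \<in> V - \<mm>"
  by (induction n) (use one_in one_notin_max unit_mult in auto)

lemma unit_prod: "(\<And>i. i \<in> A \<Longrightarrow> f i \<in> V - \<mm>) \<Longrightarrow> (\<Prod>i\<in>A. f i) \<in> V - \<mm>"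
  by (induction A rule: infinite_finite_induct) (use one_in one_notin_max unit_mult in auto)

lemma unit_add_max: "x \<in> V - \<mm> \<Longrightarrow> y \<in> \<mm> \<Longrightarrow> x + y \<in> V - \<mm>"
  using max_diff[of "x + y" y] max_ideal_subset by (auto intro: add_in)

lemma one_unit: "1 \<in> V - \<mm>"
  by (simp add: one_in one_notin_max)

lemma max_power: "n > 0 \<Longrightarrow> x \<in> \<mm> \<Longrightarrow> x ^ n \<in> \<mm>"
  using max_mult[OF power_in[of x "n - 1"]] max_ideal_subset[of x]
  by (cases n) (auto simp: mult.commute)

lemma power_in_V: "n > 0 \<Longrightarrow> x ^ n \<in> V \<Longrightarrow> x \<in> V"
  using max_power[of n "inverse x"] not_in_V[of x] not_in_V[of "x ^ n"] 
  by (auto simp: power_inverse)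

lemma power_in_max: "x ^ n \<in> \<mm> \<Longrightarrow> x \<in> \<mm>"
proof -
  assume h: "x ^ n \<in> \<mm>"
  hence n: "n > 0" using one_notin_max by (cases n) auto
  have "x \<in> V" using power_in_V[OF n max_ideal_subset[OF h]] .
  thus ?thesis using unit_power[of x n] h by auto
qed

lemma power_unit: "n > 0 \<Longrightarrow> x ^ n \<in> V - \<mm> \<Longrightarrow> x \<in> V - \<mm>"
  using power_in_V max_power by auto

lemma poly_in_max: "coeffs_in \<mm> p \<Longrightarrow> x \<in> V \<Longrightarrow> poly p x \<in> \<mm>"
  unfolding poly_altdef coeffs_in_def by (intro max_sum max_mult' power_in) auto

lemma coeffs_in_max_mult: "coeffs_in \<mm> p \<Longrightarrow> coeffs_in V q \<Longrightarrow> coeffs_in \<mm> (p * q)"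
  by (auto simp: coeffs_in_def coeff_mult intro!: max_sum max_mult')

lemma coeffs_in_max_add: "coeffs_in \<mm> p \<Longrightarrow> coeffs_in \<mm> q \<Longrightarrow> coeffs_in \<mm> (p + q)"
  by (auto simp: coeffs_in_def intro!: max_add)

lemma coeffs_in_max_diff: "coeffs_in \<mm> p \<Longrightarrow> coeffs_in \<mm> q \<Longrightarrow> coeffs_in \<mm> (p - q)"
  by (auto simp: coeffs_in_def intro!: max_diff)

text \<open>The top coefficient of the product with respect to the last unit coefficient of \<open>Z\<close>
  cannot vanish modulo the maximal ideal.\<close>

lemma monic_mult_max:
  assumes D: "coeffs_in V D" "lead_coeff D = 1" and Z: "coeffs_in V Z"
    and h: "\<And>i. i \<ge> degree D \<Longrightarrow> coeff (D * Z) i \<in> \<mm>"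
  shows "coeffs_in \<mm> Z"
proof (rule ccontr)
  assume "\<not> coeffs_in \<mm> Z"
  then obtain i0 where i0: "coeff Z i0 \<notin> \<mm>" by (auto simp: coeffs_in_def)
  let ?S = "{i. coeff Z i \<notin> \<mm>}"
  have fin: "finite ?S"
    by (rule finite_subset[of _ "{..degree Z}"]) (use zero_max in \<open>auto intro: le_degree\<close>)
  define i where "i = Max ?S"
  have i: "coeff Z i \<notin> \<mm>" using Max_in[OF fin] i0 unfolding i_def by blast
  have gt: "coeff Z j \<in> \<mm>" if "j > i" for j
    using Max_ge[OF fin, of j] that unfolding i_def by force
  have "coeff (D * Z) (degree D + i) = (\<Sum>k\<le>degree D + i. coeff D k * coeff Z (degree D + i - k))"
    by (rule coeff_mult)
  also have "\<dots> = coeff D (degree D) * coeff Z (degree D + i - degree D)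
      + (\<Sum>k\<in>{..degree D + i} - {degree D}. coeff D k * coeff Z (degree D + i - k))"
    by (rule sum.remove) auto
  finally have eq: "coeff Z i = coeff (D * Z) (degree D + i)
      - (\<Sum>k\<in>{..degree D + i} - {degree D}. coeff D k * coeff Z (degree D + i - k))"
    using D by simp
  have "coeff D k * coeff Z (degree D + i - k) \<in> \<mm>" if "k \<in> {..degree D + i} - {degree D}" for k
  proof (cases "k < degree D")
    case True
    thus ?thesis using D by (intro max_mult gt) (auto simp: coeffs_in_def)
  next
    case False
    thus ?thesis using that by (simp add: coeff_eq_0 zero_max)
  qed
  hence "coeff Z i \<in> \<mm>" unfolding eq by (intro max_diff max_sum h) auto
  thus False using i by simp
qed

end

lemma (in valuation_set) coarsening:
  assumes "ring_set W" "V \<subseteq> W"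
  shows "valuation_set W" "max_ideal W \<subseteq> \<mm>"
proof -
  interpret W: ring_set W by fact
  show "valuation_set W" by unfold_locales (use total assms in auto)
  show "max_ideal W \<subseteq> \<mm>" using assms by (auto simp: max_ideal_def)
qed

section \<open>Definable balls around zero\<close>

text \<open>Over a valuation ring, closure under \<open>V\<close> alone makes \<open>M\<close> a
  module, since of two elements one divides the other. The other two conditions keep the stabilizer
  from being the whole field.\<close>

definition proper_ball :: "'a::field set \<Rightarrow> 'a set \<Rightarrow> bool" where
  "proper_ball V M \<longleftrightarrow> (\<forall>c\<in>V. \<forall>x\<in>M. c * x \<in> M) \<and> (\<exists>x\<in>M. x \<noteq> 0) \<and> M \<noteq> UNIV"

section \<open>Powers near one and the tame ball\<close>

definition nonzero_powers :: "nat \<Rightarrow> 'a::field set" where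
  "nonzero_powers p = {y ^ p | y. y \<noteq> 0}"

lemma nonzero_powers_divide:
  "x \<in> nonzero_powers p \<Longrightarrow> y \<in> nonzero_powers p \<Longrightarrow> x / y \<in> nonzero_powers p"
  unfolding nonzero_powers_def by (force simp flip: power_divide)

lemma zero_notin_nonzero_powers: "0 \<notin> nonzero_powers p"
  by (auto simp: nonzero_powers_def)

lemma one_in_nonzero_powers: "1 \<in> nonzero_powers p"
  by (force simp: nonzero_powers_def intro: exI[of _ 1])

text \<open>When all units are \<open>p\<close>-th powers, these are exactly the nonpowers in the
  maximal ideal: for a nonpower \<open>x\<close>, smallness is tested by \<open>1 + x\<close> being
  a power, without mention of \<open>V\<close>.\<close>

definition tame_generators :: "nat \<Rightarrow> 'a::field set" where
  "tame_generators p = {x. x \<noteq> 0 \<and> x \<notin> nonzero_powers p \<and> 1 + x \<in> nonzero_powers p}"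

text \<open>Products of two generators are there to catch the \<open>p\<close>-th powers inside the
  ball: if such an \<open>x\<close> is a multiple of the generator \<open>y\<close>, then
  \<open>x / y\<close> is not a power and is again a generator.\<close>

definition tame_ball :: "nat \<Rightarrow> 'a::field set" where
  "tame_ball p = {x. x = 0 \<or> x \<in> tame_generators p \<or>
     (\<exists>y\<in>tame_generators p. \<exists>z\<in>tame_generators p. x = y * z)}"

text \<open>For \<open>x\<close> outside \<open>V\<close>, \<open>1 + x\<close> and \<open>x\<close>
  differ by the unit \<open>1 + 1 / x\<close>, a \<open>p\<close>-th power; so a nonpower
  \<open>x\<close> with \<open>1 + x\<close> a power has to lie in \<open>\<mm>\<close>. Hence the
  generators are the nonpowers of \<open>\<mm>\<close>, and the set is the union of the balls that
  they generate. It omits \<open>1\<close>, and it is not zero since \<open>t\<close> or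
  \<open>1 / t\<close> is a generator.\<close>

lemma (in valuation_set) tame_ball:
  fixes t :: 'a
  assumes units: "V - \<mm> \<subseteq> nonzero_powers p" and t: "t \<noteq> 0" "t \<notin> nonzero_powers p"
  shows "proper_ball V (tame_ball p)"
proof -
  let ?T = "nonzero_powers p :: 'a set" and ?G = "tame_generators p :: 'a set"
  have G: "x \<in> ?G \<longleftrightarrow> x \<noteq> 0 \<and> x \<notin> ?T \<and> x \<in> \<mm>" for x
  proof -
    have 1: "1 + x \<in> ?T" if "x \<in> \<mm>"
      using unit_add_max[OF one_unit that] units by blast
    have 2: "x \<in> \<mm>" if x: "x \<noteq> 0" "x \<notin> ?T" "1 + x \<in> ?T"
    proof (rule ccontr)
      assume "x \<notin> \<mm>"
      hence "x \<notin> V" using units x by auto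
      hence "1 / x \<in> \<mm>" using not_in_V by (simp add: inverse_eq_divide)
      hence "1 + 1 / x \<in> ?T" using unit_add_max[OF one_unit] units by blast
      hence "(1 + x) / (1 + 1 / x) \<in> ?T" using x nonzero_powers_divide by blast
      moreover have "1 + 1 / x \<noteq> 0" using \<open>1 + 1 / x \<in> ?T\<close> zero_notin_nonzero_powers by metis
      hence "(1 + x) / (1 + 1 / x) = x" using x(1) by (simp add: field_simps)
      ultimately show False using x by simp
    qed
    show ?thesis using 1 2 by (auto simp: tame_generators_def)
  qed
  have M: "x \<in> tame_ball p \<longleftrightarrow> x = 0 \<or> (\<exists>y\<in>?G. x / y \<in> V)" for x
  proof
    assume "x \<in> tame_ball p"
    then consider "x = 0" | "x \<in> ?G" | y z where "y \<in> ?G" "z \<in> ?G" "x = y * z"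
      unfolding tame_ball_def by blast
    thus "x = 0 \<or> (\<exists>y\<in>?G. x / y \<in> V)"
    proof cases
      case 2
      hence "x / x \<in> V" using G[of x] one_in by auto
      thus ?thesis using 2 by blast
    next
      case 3
      hence "x / y \<in> V" using G[of y] G[of z] max_ideal_subset by auto
      thus ?thesis using 3 by blast
    qed auto
  next
    assume "x = 0 \<or> (\<exists>y\<in>?G. x / y \<in> V)"
    thus "x \<in> tame_ball p"
    proof
      assume "\<exists>y\<in>?G. x / y \<in> V"
      then obtain y where y: "y \<in> ?G" "x / y \<in> V" by blast
      have y': "y \<noteq> 0" "y \<notin> ?T" "y \<in> \<mm>" using G y by auto
      have x: "x = y * (x / y)" using y' by simp
      have xm: "x \<in> \<mm>" using max_mult'[OF y(2) y'(3)] x by simp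
      show ?thesis
      proof (cases "x = 0 \<or> x \<notin> ?T")
        case True
        thus ?thesis using G xm by (auto simp: tame_ball_def)
      next
        case False
        hence n: "x / y \<notin> ?T" using nonzero_powers_divide[of x p "x / y"] y' by auto
        hence "x / y \<in> ?G" using G[of "x / y"] False y y' units by auto
        thus ?thesis using x y unfolding tame_ball_def by blast
      qed
    qed (simp add: tame_ball_def)
  qed
  show ?thesis unfolding proper_ball_def
  proof (intro conjI ballI)
    fix c x :: 'a assume "c \<in> V" "x \<in> tame_ball p"
    thus "c * x \<in> tame_ball p" unfolding M
      using mult_in[of c "x / y" for y] by (auto simp: mult.assoc)
  next
    have "1 / t \<notin> ?T" using nonzero_powers_divide[OF one_in_nonzero_powers, of "1 / t" p] t by auto
    hence "t \<in> ?G \<or> 1 / t \<in> ?G" using G[of t] G[of "1 / t"] t units total[of t]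
      not_in_V[of t] by (auto simp: inverse_eq_divide)
    thus "\<exists>x\<in>tame_ball p. x \<noteq> (0::'a)" using t by (auto simp: tame_ball_def)
  next
    have "\<not> 1 / y \<in> V" if "y \<in> ?G" for y using G[of y] that max_iff by auto
    hence "(1::'a) \<notin> tame_ball p" unfolding M by auto
    thus "tame_ball p \<noteq> (UNIV :: 'a set)" by auto
  qed
qed

text \<open>In terms of reciprocals, the element \<open>x y / (x - y)\<close> is the one with reciprocal
  \<open>1/y - 1/x\<close>.\<close>

definition stable_part :: "'a::field set \<Rightarrow> 'a set" where
  "stable_part D = {x. x \<notin> D \<and> (\<forall>y\<in>D. x * y / (x - y) \<notin> D)}"

text \<open>The linear term \<open>q y\<close> is split off because it dominates the other mixed
  terms once \<open>y\<close> is small. The cofactor is given by natural coefficients so that it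
  lies in every subring containing \<open>y\<close>.\<close>

lemma one_plus_prime_power:
  fixes y :: "'a::comm_ring_1"
  assumes "prime q"
  shows "\<exists>c :: nat \<Rightarrow> nat. (1 + y) ^ q = 1 + y ^ q + of_nat q * y * (1 + y * (\<Sum>k=2..<q. of_nat (c k) * y ^ (k - 2)))"
proof -
  have q: "q \<ge> 2" using assms prime_ge_2_nat by blast
  define c where "c k = (q choose k) div q" for k
  have c: "q choose k = q * c k" if "k \<in> {2..<q}" for k
    using that assms unfolding c_def by (auto intro!: dvd_mult_div_cancel[symmetric] dvd_choose_prime)
  have "(1 + y) ^ q = (\<Sum>k\<le>q. of_nat (q choose k) * y ^ k)"
    using binomial_ring[of y 1 q] by (simp add: add.commute)
  also have "{..q} = insert 0 (insert 1 (insert q {2..<q}))" using q by auto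
  also have "(\<Sum>k\<in>insert 0 (insert 1 (insert q {2..<q})). of_nat (q choose k) * y ^ k)
      = 1 + y ^ q + of_nat q * y + (\<Sum>k=2..<q. of_nat (q choose k) * y ^ k)"
    using q by (simp add: algebra_simps)
  also have "(\<Sum>k=2..<q. of_nat (q choose k) * y ^ k)
      = (\<Sum>k=2..<q. (of_nat q * y * y) * (of_nat (c k) * y ^ (k - 2)))"
  proof (rule sum.cong)
    fix k assume k: "k \<in> {2..<q}"
    hence "y ^ k = y * y * y ^ (k - 2)"
      by (metis power2_eq_square power_add le_add_diff_inverse atLeastLessThan_iff)
    thus "of_nat (q choose k) * y ^ k = (of_nat q * y * y) * (of_nat (c k) * y ^ (k - 2))"
      by (simp add: c[OF k] algebra_simps)
  qed simp
  also have "\<dots> = of_nat q * y * y * (\<Sum>k=2..<q. of_nat (c k) * y ^ (k - 2))"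
    by (simp add: sum_distrib_left)
  finally show ?thesis by (intro exI[of _ c]) (simp add: algebra_simps)
qed

lemma (in ring_set) one_plus_prime_power:
  assumes "prime q" "y \<in> S"
  obtains t where "t \<in> S" "(1 + y) ^ q = 1 + y ^ q + of_nat q * y * (1 + y * t)"
  using one_plus_prime_power[OF assms(1), of y] assms(2)
  by (metis (no_types, lifting) sum_in mult_in power_in of_nat_in)

lemma (in ring_set) frobenius_expand:
  assumes "prime q" "x \<in> S" "y \<in> S"
  obtains t where "t \<in> S" "(x + y) ^ q = x ^ q + y ^ q + of_nat q * t"
proof -
  have q: "q \<ge> 2" using assms(1) prime_ge_2_nat by blast
  define c where "c k = (q choose k) div q" for k
  have c: "q choose k = q * c k" if "k \<in> {1..<q}" for k
    using that assms unfolding c_def by (auto intro!: dvd_mult_div_cancel[symmetric] dvd_choose_prime)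
  have "(x + y) ^ q = (\<Sum>k\<le>q. of_nat (q choose k) * x ^ k * y ^ (q - k))"
    by (rule binomial_ring)
  also have "{..q} = insert 0 (insert q {1..<q})" using q by auto
  also have "(\<Sum>k\<in>insert 0 (insert q {1..<q}). of_nat (q choose k) * x ^ k * y ^ (q - k))
      = x ^ q + y ^ q + (\<Sum>k=1..<q. of_nat (q choose k) * x ^ k * y ^ (q - k))"
    using q by (simp add: algebra_simps)
  also have "(\<Sum>k=1..<q. of_nat (q choose k) * x ^ k * y ^ (q - k))
     = of_nat q * (\<Sum>k=1..<q. of_nat (c k) * x ^ k * y ^ (q - k))"
    unfolding sum_distrib_left by (rule sum.cong) (auto simp: c algebra_simps)
  finally have "(x + y) ^ q = x ^ q + y ^ q + of_nat q * (\<Sum>k=1..<q. of_nat (c k) * x ^ k * y ^ (q - k))" .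
  moreover have "(\<Sum>k=1..<q. of_nat (c k) * x ^ k * y ^ (q - k)) \<in> S"
    by (intro sum_in mult_in power_in of_nat_in assms)
  ultimately show ?thesis using that by blast
qed

lemma frobenius_char:
  fixes x y :: "'a::field"
  assumes "prime q" "of_nat q = (0::'a)"
  shows "(x + y) ^ q = x ^ q + y ^ q" "(x - y) ^ q = x ^ q - y ^ q"
proof -
  interpret ring_set "UNIV :: 'a set" by unfold_locales auto
  have *: "(x + y) ^ q = x ^ q + y ^ q" for x y :: 'a
    using frobenius_expand[OF assms(1), of x y] assms(2) by auto
  show "(x + y) ^ q = x ^ q + y ^ q" by (rule *)
  show "(x - y) ^ q = x ^ q - y ^ q" using *[of "x - y" y] by (simp add: algebra_simps)
qed

section \<open>The largest ball avoiding a given set\<close>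

context valuation_set
begin

text \<open>The largest \<open>V\<close>-stable set that avoids \<open>D\<close>;
  \<open>stable_part_eq_ball\<close> recovers it without mention of \<open>V\<close>.\<close>

definition ball_of :: "'a set \<Rightarrow> 'a set" where
  "ball_of D = {x. \<forall>c\<in>V. c * x \<notin> D}"

text \<open>The multiplier ring of the ball. It can be a proper coarsening of \<open>V\<close>, and
  it is the maximal ideal of this ring, not \<open>\<mm>\<close>, that describes the ball relative
  to a boundary element.\<close>

definition ball_ring :: "'a set \<Rightarrow> 'a set" where
  "ball_ring D = {c. \<forall>j\<in>ball_of D. c * j \<in> ball_of D}"

lemma ball_of_mult: "c \<in> V \<Longrightarrow> j \<in> ball_of D \<Longrightarrow> c * j \<in> ball_of D"
  unfolding ball_of_def using mult_in by (auto simp: mult.assoc[symmetric])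

lemma ball_of_add:
  assumes "x \<in> ball_of D" "y \<in> ball_of D"
  shows "x + y \<in> ball_of D"
proof -
  have *: "x + y \<in> ball_of D" if "x \<in> ball_of D" "y / x \<in> V" "x \<noteq> 0" for x y
  proof -
    have "x + y = (1 + y / x) * x" using that by (simp add: field_simps)
    thus ?thesis using that by (auto intro!: ball_of_mult add_in one_in)
  qed
  show ?thesis using *[of x y] *[of y x] comparable[of x y] assms
    by (cases "x = 0"; cases "y = 0") (auto simp: add.commute)
qed

lemma ball_of_uminus: "x \<in> ball_of D \<Longrightarrow> - x \<in> ball_of D"
  using ball_of_mult[OF uminus_in[OF one_in]] by simp

lemma ball_of_diff: "x \<in> ball_of D \<Longrightarrow> y \<in> ball_of D \<Longrightarrow> x - y \<in> ball_of D"
  using ball_of_add[OF _ ball_of_uminus[of y]] by simp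

lemma ball_ring: "valuation_set (ball_ring D)" "V \<subseteq> ball_ring D" "max_ideal (ball_ring D) \<subseteq> \<mm>"
proof -
  have "ring_set (ball_ring D)"
    by unfold_locales (auto simp: ball_ring_def left_diff_distrib mult.assoc intro!: ball_of_diff)
  moreover show "V \<subseteq> ball_ring D" by (auto simp: ball_ring_def ball_of_mult)
  ultimately show "valuation_set (ball_ring D)" "max_ideal (ball_ring D) \<subseteq> \<mm>"
    using coarsening by auto
qed

lemma ball_ring_mult: "c \<in> ball_ring D \<Longrightarrow> j \<in> ball_of D \<Longrightarrow> c * j \<in> ball_of D"
  by (simp add: ball_ring_def)

text \<open>If some \<open>y \<in> D'\<close> is deeper than \<open>x\<close>, then
  \<open>x y / (x - y) = y + y\<^sup>2/x + \<dots>\<close> lies in \<open>y + ball_of D\<close> for a suitable such \<open>y\<close>. Otherwise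
  \<open>ball_of D\<close> is the multiple of the maximal ideal of \<open>ball_ring D\<close> by \<open>x\<close>, and the
  condition \<open>1/y = 1/w + 1/x\<close> is tested modulo that ideal, where the complement of \<open>D\<close> consists of
  \<open>q\<close>-th powers and the Frobenius is additive.\<close>

lemma stable_part_eq_ball:
  fixes D D' :: "'a set" and q :: nat
  defines "J \<equiv> ball_of D" and "W \<equiv> ball_ring D"
  assumes D0: "0 \<notin> D" and D': "D' \<subseteq> D"
    and shift: "\<And>y j. y \<in> D' \<Longrightarrow> j \<in> J \<Longrightarrow> y + j \<in> D"
    and cofinal: "\<And>z. z \<notin> J \<Longrightarrow> \<exists>y\<in>D'. \<exists>c\<in>V. y = c * z"
    and q: "prime q"
    and c1: "\<And>x. x \<notin> D \<Longrightarrow> x \<notin> J \<Longrightarrow> J = {z. z / x \<in> max_ideal W} \<Longrightarrow> of_nat q \<in> max_ideal W"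
    and c2: "\<And>x w. x \<notin> D \<Longrightarrow> x \<notin> J \<Longrightarrow> J = {z. z / x \<in> max_ideal W} \<Longrightarrow> w \<notin> D \<Longrightarrow> w / x \<in> W
       \<Longrightarrow> \<exists>d. w - d ^ q \<in> J"
    and c3: "\<And>x y d. x \<notin> D \<Longrightarrow> x \<notin> J \<Longrightarrow> J = {z. z / x \<in> max_ideal W} \<Longrightarrow> y \<in> D' \<Longrightarrow> y / x \<in> W
       \<Longrightarrow> y - d ^ q \<in> J \<Longrightarrow> False"
  shows "stable_part D = J"
proof -
  interpret W: valuation_set W unfolding W_def by (rule ball_ring)
  have VW: "V \<subseteq> W" and mWm: "W.\<mm> \<subseteq> \<mm>" unfolding W_def by (rule ball_ring)+
  have JV: "c * j \<in> J" if "c \<in> V" "j \<in> J" for c j using that ball_of_mult unfolding J_def by blast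
  have JW: "c * j \<in> J" if "c \<in> W" "j \<in> J" for c j using that ball_ring_mult unfolding J_def W_def by blast
  have DJ: "y \<notin> J" if "y \<in> D" for y using that one_in unfolding J_def ball_of_def by force
  have J0: "0 \<in> J" using D0 unfolding J_def ball_of_def by auto
  show ?thesis
  proof (rule Set.set_eqI, rule iffI)
    fix x assume x: "x \<in> J"
    have "x * y / (x - y) \<notin> D" if y: "y \<in> D" for y
    proof -
      have y0: "y \<noteq> 0" using y D0 by auto
      \<comment> \<open>An element of the ball is strictly deeper than any \<open>y \<in> D\<close>,
        as \<open>y\<close> would otherwise be a multiple of it. So \<open>x y / (x - y)\<close> is
        \<open>x\<close> times the inverse of the unit \<open>x / y - 1\<close>.\<close>
      have m: "x / y \<in> \<mm>"
      proof (cases "x = 0")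
        case False
        show ?thesis
        proof (rule ccontr)
          assume "x / y \<notin> \<mm>"
          hence "y / x \<in> V" using False y0 max_iff[of "x / y"] by auto
          hence "y \<in> J" using JV[of "y / x" x] x False by simp
          thus False using DJ y by blast
        qed
      qed (simp add: zero_max)
      have u: "x / y - 1 \<in> V - \<mm>"
        using unit_add_max[of "-1" "x / y"] m one_unit by (simp add: uminus_in_iff max_uminus_iff)
      hence "1 / (x / y - 1) \<in> V" using unit_inverse by blast
      hence "1 / (x / y - 1) * x \<in> J" using JV x by blast
      also have "1 / (x / y - 1) * x = x * y / (x - y)"
      proof -
        have "x - y \<noteq> 0" using unit_not0[OF u] y0 by auto
        thus ?thesis using y0 by (simp add: field_simps)
      qed
      finally show ?thesis using DJ by blast
    qed
    thus "x \<in> stable_part D" using DJ x by (auto simp: stable_part_def)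
  next
    fix x assume "x \<in> stable_part D"
    hence xD: "x \<notin> D" and st: "\<And>y. y \<in> D \<Longrightarrow> x * y / (x - y) \<notin> D"
      by (auto simp: stable_part_def)
    show "x \<in> J"
    proof (rule ccontr)
      assume xJ: "x \<notin> J"
      have x0: "x \<noteq> 0" using xJ J0 by auto
      \<comment> \<open>The correction in
        \<open>x y / (x - y) = y + (y * y / x) / (1 - y / x)\<close> must not fall into the ball,
        since \<open>y\<close> shifted by the ball remains in \<open>D\<close>.\<close>
      have no: False if y: "y \<in> D'" "y / x \<in> \<mm>" "y * y / x \<in> J" for y
      proof -
        have u: "1 - y / x \<in> V - \<mm>"
          using unit_add_max[OF one_unit max_uminus[OF y(2)]] by simp
        hence "1 / (1 - y / x) \<in> V" using unit_inverse by blast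
        hence "1 / (1 - y / x) * (y * y / x) \<in> J" using JV y(3) by blast
        hence "y + 1 / (1 - y / x) * (y * y / x) \<in> D" using shift y(1) by blast
        also have "y + 1 / (1 - y / x) * (y * y / x) = x * y / (x - y)"
        proof -
          have "x - y \<noteq> 0" using unit_not0[OF u] x0 by auto
          thus ?thesis using x0 by (simp add: field_simps)
        qed
        finally show False using st y(1) D' by blast
      qed
      have deep: "y / x \<notin> W.\<mm>" if y: "y \<in> D'" for y
      proof
        assume e: "y / x \<in> W.\<mm>"
        have y0: "y \<noteq> 0" using y D' D0 by auto
        \<comment> \<open>Since \<open>x / y\<close> is no multiplier of the ball, it moves some
          \<open>j\<close> out of it; cofinality then yields \<open>y1 \<in> D'\<close> with
          \<open>y1 * (y / x) \<in> J\<close>. The deeper one of \<open>y\<close> and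
          \<open>y1\<close> contradicts \<open>no\<close>.\<close>
        have "x / y \<notin> W" using e W.max_iff[of "y / x"] y0 x0 by auto
        then obtain j where j: "j \<in> J" "x / y * j \<notin> J"
          by (auto simp: W_def ball_ring_def J_def)
        obtain y1 c where y1: "y1 \<in> D'" "c \<in> V" "y1 = c * (x / y * j)" using cofinal[OF j(2)] by blast
        have y10: "y1 \<noteq> 0" using y1 D' D0 by auto
        have y1e: "y1 * (y / x) \<in> J" using JV[OF y1(2) j(1)] y1(3) y0 x0 by (simp add: field_simps)
        consider "y1 / y \<in> V" | "y / y1 \<in> V" using comparable by blast
        thus False
        proof cases
          case 1
          have "y / x \<in> \<mm>" using e mWm by blast
          hence "y1 / y * (y / x) \<in> \<mm>" by (rule max_mult[OF 1])
          hence "y1 / x \<in> \<mm>" using y0 by simp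
          moreover have "y1 / y * (y1 * (y / x)) \<in> J" by (rule JV[OF 1 y1e])
          hence "y1 * y1 / x \<in> J" using y0 by simp
          ultimately show False using no y1 by blast
        next
          case 2
          have "y / y1 * (y1 * (y / x)) \<in> J" by (rule JV[OF 2 y1e])
          hence "y * y / x \<in> J" using y10 by simp
          thus False using no[OF y] e mWm by blast
        qed
      qed
      have Jeq: "J = {z. z / x \<in> W.\<mm>}"
      proof (rule Set.set_eqI, rule iffI)
        fix z assume z: "z \<in> J"
        show "z \<in> {z. z / x \<in> W.\<mm>}"
        proof (rule ccontr)
          assume "z \<notin> {z. z / x \<in> W.\<mm>}"
          hence zx: "z / x \<notin> W.\<mm>" by simp
          hence zx0: "z / x \<noteq> 0" using W.zero_max by metis
          hence "x / z \<in> W" using W.max_iff[OF zx0] zx by simp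
          hence "x \<in> J" using JW[of "x / z" z] z zx0 by simp
          thus False using xJ by blast
        qed
      next
        fix z assume z: "z \<in> {z. z / x \<in> W.\<mm>}"
        show "z \<in> J"
        proof (rule ccontr)
          assume "z \<notin> J"
          then obtain y c where y: "y \<in> D'" "c \<in> V" "y = c * z" using cofinal by blast
          hence "y / x = c * (z / x)" by simp
          hence "y / x \<in> W.\<mm>" using W.max_mult[of c "z / x"] VW y z by auto
          thus False using deep y by blast
        qed
      qed
      note C = xD xJ Jeq
      have Jx: "z / x \<in> W.\<mm> \<longleftrightarrow> z \<in> J" for z using Jeq by blast
      obtain y c where y: "y \<in> D'" "c \<in> V" "y = c * x" using cofinal[OF xJ] by blast
      have y0: "y \<noteq> 0" using y D' D0 by auto
      have yx: "y / x \<in> W" using y x0 VW by auto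
      have yD: "y \<in> D" using y D' by blast
      obtain b where b: "x - b ^ q \<in> J" using c2[OF C xD] x0 W.one_in by auto
      have b1: "1 - b ^ q / x \<in> W.\<mm>" using b Jx[of "x - b ^ q"] x0 by (simp add: diff_divide_distrib)
      have bu: "b ^ q / x \<in> W - W.\<mm>" using W.unit_add_max[OF W.one_unit W.max_uminus[OF b1]] by simp
      have b0: "b \<noteq> 0" using bu W.zero_max q prime_gt_0_nat[OF q] by (auto simp: zero_power)
      have xy: "1 - y / x \<in> W - W.\<mm>"
      proof -
        have "x - y \<notin> J"
        proof
          assume "x - y \<in> J"
          hence "y + (x - y) \<in> D" using shift y(1) by blast
          thus False using xD by simp
        qed
        hence "(x - y) / x \<notin> W.\<mm>" using Jx by blast
        thus ?thesis using W.diff_in[OF W.one_in yx] x0 by (simp add: diff_divide_distrib)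
      qed
      \<comment> \<open>Now \<open>x\<close> is a boundary element, and
        \<open>1 / y = 1 / x + 1 / w\<close>. Neither \<open>x\<close> nor \<open>w\<close> lies in
        \<open>D\<close>, so modulo \<open>J\<close> they are \<open>b ^ q\<close> and
        \<open>d ^ q\<close>. With \<open>e = d / b\<close>, additivity of the Frobenius turns
        \<open>y / x = (w / x) / (1 + w / x)\<close> into the \<open>q\<close>-th power of
        \<open>e / (1 + e)\<close>, which \<open>c3\<close> forbids.\<close>
      define w where "w = x * y / (x - y)"
      have xmy: "x - y \<noteq> 0" using W.unit_not0[OF xy] x0 by auto
      have wx: "w / x = (y / x) / (1 - y / x)" using xmy x0 unfolding w_def by (simp add: field_simps)
      have wW: "w / x \<in> W" unfolding wx by (rule W.divide_unit[OF yx xy])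
      have "w \<notin> D" unfolding w_def by (rule st[OF yD])
      then obtain d where d: "w - d ^ q \<in> J" using c2[OF C _ wW] by blast
      define e where "e = d / b"
      have dm: "w / x - d ^ q / x \<in> W.\<mm>" using d Jx[of "w - d ^ q"] by (simp add: diff_divide_distrib)
      have dW: "d ^ q / x \<in> W" using W.diff_in[OF wW W.max_ideal_subset[OF dm]] by simp
      have eq: "e ^ q = (d ^ q / x) / (b ^ q / x)" using x0 by (simp add: e_def power_divide)
      have eW: "e \<in> W" using W.power_in_V[of q e] W.divide_unit[OF dW bu] eq prime_gt_0_nat[OF q] by simp
      have em: "w / x - e ^ q \<in> W.\<mm>"
      proof -
        have "e ^ q * (b ^ q / x) = d ^ q / x" using b0 by (simp add: e_def power_divide)
        hence "w / x - e ^ q = (w / x - d ^ q / x) - e ^ q * (1 - b ^ q / x)"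
          by (simp only: right_diff_distrib) simp
        thus ?thesis using W.max_diff[OF dm W.max_mult[OF W.power_in[OF eW] b1]] by (simp only:)
      qed
      obtain t where t: "t \<in> W" "(1 + e) ^ q = 1 + e ^ q + of_nat q * e * (1 + e * t)"
        using W.one_plus_prime_power[OF q eW] by blast
      have fr: "(1 + e) ^ q - (1 + e ^ q) \<in> W.\<mm>"
        unfolding t(2) using W.max_mult'[OF _ c1[OF C], of "e * (1 + e * t)"] t eW
        by (auto simp: mult.assoc intro: W.mult_in W.add_in W.one_in)
      have gen: "1 + a / (1 - a) = 1 / (1 - a)" "a / (1 - a) / (1 / (1 - a)) = a" if "1 - a \<noteq> 0" for a :: 'a
        using that by (simp_all add: add_divide_eq_iff)
      have w1: "1 + w / x = 1 / (1 - y / x)" unfolding wx using gen(1)[OF W.unit_not0[OF xy]] .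
      have w1u: "1 + w / x \<in> W - W.\<mm>" unfolding w1 by (rule W.unit_inverse[OF xy])
      have e1: "(1 + e) ^ q \<in> W - W.\<mm>"
        using W.unit_add_max[OF w1u W.max_diff[OF fr em]] by simp
      have e1': "1 + e \<in> W - W.\<mm>" using W.power_unit[OF prime_gt_0_nat[OF q] e1] .
      define f where "f = e / (1 + e)"
      have fW: "f \<in> W" unfolding f_def by (rule W.divide_unit[OF eW e1'])
      have yw: "y / x = (w / x) / (1 + w / x)"
        unfolding w1 unfolding wx using gen(2)[OF W.unit_not0[OF xy]] by simp
      have "y / x - f ^ q = (w / x * (1 + e) ^ q - e ^ q * (1 + w / x)) / ((1 + w / x) * (1 + e) ^ q)"
        unfolding yw f_def power_divide by (rule diff_frac_eq[OF W.unit_not0[OF w1u] W.unit_not0[OF e1]])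
      also have "w / x * (1 + e) ^ q - e ^ q * (1 + w / x) =
          w / x * ((1 + e) ^ q - (1 + e ^ q)) + (w / x - e ^ q)" by (simp add: algebra_simps)
      finally have "y / x - f ^ q \<in> W.\<mm>"
        using W.max_divide_unit[OF W.max_add[OF W.max_mult[OF wW fr] em] W.unit_mult[OF w1u e1]] by simp
      moreover have "(y - (b * f) ^ q) / x = (y / x - f ^ q) + f ^ q * (1 - b ^ q / x)"
        using x0 by (simp add: field_simps power_mult_distrib)
      ultimately have "(y - (b * f) ^ q) / x \<in> W.\<mm>"
        using W.max_add[OF _ W.max_mult[OF W.power_in[OF fW] b1]] by simp
      hence "y - (b * f) ^ q \<in> J" using Jx by blast
      thus False using c3[OF C y(1) yx] by blast
    qed
  qed
qed

end

section \<open>Henselian valuation rings with separably closed residue field\<close>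

locale henselian_set = valuation_set V for V :: "'a::field set" +
  assumes hensel: "\<And>f a. coeffs_in V f \<Longrightarrow> a \<in> V \<Longrightarrow> poly f a \<in> max_ideal V \<Longrightarrow>
    poly (pderiv f) a \<notin> max_ideal V \<Longrightarrow> \<exists>b\<in>V. poly f b = 0 \<and> b - a \<in> max_ideal V"

text \<open>Separable closedness of the residue field, expressed by lifts to \<open>V\<close> of polynomials over it:
  a monic polynomial has a root or a common factor with its derivative.\<close>

definition residue_sep_closed :: "'a::field set \<Rightarrow> bool" where
  "residue_sep_closed V \<longleftrightarrow> (\<forall>P. coeffs_in V P \<and> lead_coeff P = 1 \<and> degree P \<ge> 1 \<longrightarrow>
     (\<exists>c\<in>V. poly P c \<in> max_ideal V) \<or>
     (\<exists>D E E'. coeffs_in V D \<and> coeffs_in V E \<and> coeffs_in V E' \<and> lead_coeff D = 1 \<and> lead_coeff E = 1 \<and>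
        degree D \<ge> 1 \<and> coeffs_in (max_ideal V) (P - D * E) \<and> coeffs_in (max_ideal V) (pderiv P - D * E')))"

definition artin_schreier_set :: "nat \<Rightarrow> 'a::field set" where
  "artin_schreier_set q = {a. \<forall>b. b ^ q - b \<noteq> a}"

text \<open>Shifted by one, because balls are centred at \<open>0\<close> while the powers fill a
  neighbourhood of \<open>1\<close>.\<close>

definition kummer_set :: "nat \<Rightarrow> 'a::field set" where
  "kummer_set q = {z. 1 + z \<notin> nonzero_powers q}"

locale henselian_sc = henselian_set +
  assumes residue: "residue_sep_closed V"
begin

section \<open>Lifting roots from the separably closed residue field\<close>

lemma residue_cases:
  assumes "coeffs_in V P" "lead_coeff P = 1" "degree P \<ge> 1"
  obtains (root) c where "c \<in> V" "poly P c \<in> \<mm>"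
    | (factor) D E E' where "coeffs_in V D" "coeffs_in V E" "coeffs_in V E'" "lead_coeff D = 1"
        "lead_coeff E = 1" "degree D \<ge> 1" "coeffs_in \<mm> (P - D * E)" "coeffs_in \<mm> (pderiv P - D * E')"
  using residue assms unfolding residue_sep_closed_def by metis

text \<open>Over the residue field a monic polynomial of positive degree cannot divide a nonzero
  constant. In terms of lifts, \<open>monic_mult_max\<close> makes the cofactor vanish modulo
  \<open>\<mm>\<close>.\<close>

lemma monic_factor_const:
  assumes D: "coeffs_in V D" "lead_coeff D = 1" "degree D \<ge> 1" and Z: "coeffs_in V Z"
    and h: "coeffs_in \<mm> ([:u:] - D * Z)"
  shows "u \<in> \<mm>"
proof -
  have "coeff (D * Z) i \<in> \<mm>" if "i \<ge> degree D" for i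
  proof -
    have "i \<noteq> 0" using that D by auto
    hence "coeff [:u:] i = 0" by (cases i) auto
    thus ?thesis using h[unfolded coeffs_in_def, rule_format, of i] by (simp add: max_uminus_iff)
  qed
  hence "coeffs_in \<mm> Z" using monic_mult_max[OF D(1,2) Z] by blast
  hence "coeffs_in \<mm> (Z * D)" using coeffs_in_max_mult D by blast
  hence "coeffs_in \<mm> ([:u:] - D * Z + Z * D)" using h coeffs_in_max_add by blast
  hence "coeffs_in \<mm> [:u:]" by (simp add: mult.commute)
  thus ?thesis by (auto simp: coeffs_in_def dest: spec[of _ 0])
qed

text \<open>A derivative that is a unit constant modulo \<open>\<mm>\<close> rules out a common
  factor and makes every residual root simple, so that Hensel's Lemma lifts it. The polynomials
  behind the Artin-Schreier and the Kummer ball are of this form.\<close>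

lemma root_const_deriv:
  assumes P: "coeffs_in V P" "lead_coeff P = 1" "degree P \<ge> 1"
    and u: "u \<in> V - \<mm>" and h: "coeffs_in \<mm> (pderiv P - [:u:])"
  shows "\<exists>b\<in>V. poly P b = 0"
  using P
proof (cases rule: residue_cases)
  case (root c)
  have "poly (pderiv P - [:u:]) c \<in> \<mm>" using poly_in_max[OF h root(1)] .
  hence "poly (pderiv P) c \<notin> \<mm>" using max_diff[of "poly (pderiv P) c" "poly (pderiv P) c - u"] u by auto
  thus ?thesis using hensel[OF P(1) root] by blast
next
  case (factor D E E')
  have "coeffs_in \<mm> (pderiv P - D * E' - (pderiv P - [:u:]))" using coeffs_in_max_diff[OF factor(8) h] .
  hence "coeffs_in \<mm> ([:u:] - D * E')" by (simp add: algebra_simps)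
  thus ?thesis using monic_factor_const[OF factor(1,4,6,3)] u by blast
qed

text \<open>For \<open>P = X^p - u\<close> the combination \<open>X P' - p P\<close> is the unit
  constant \<open>p u\<close>, which excludes a common factor of \<open>P\<close> and
  \<open>P'\<close>; a residual root is a unit, hence simple.\<close>

lemma root_tame:
  assumes p: "p > 0" "of_nat p \<notin> \<mm>" and u: "u \<in> V - \<mm>"
  shows "u \<in> nonzero_powers p"
proof -
  let ?P = "monom 1 p - [:u:]"
  have deg: "degree ?P = p"
    using p unfolding diff_conv_add_uminus by (subst degree_add_eq_left) (auto simp: degree_monom_eq)
  have pd: "pderiv ?P = monom (of_nat p) (p - 1)"
    using p by (cases p) (simp_all add: pderiv_diff pderiv_monom pderiv_pCons)
  have P: "coeffs_in V ?P" "lead_coeff ?P = 1" "degree ?P \<ge> 1"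
    using u p deg by (auto intro!: coeffs_in_diff coeffs_in_monom coeffs_in_const one_in
       simp: coeff_pCons split: nat.splits)
  have "\<exists>b\<in>V. poly ?P b = 0"
    using P
  proof (cases rule: residue_cases)
    case (root c)
    have c: "c ^ p - u \<in> \<mm>" using root by (simp add: poly_monom)
    have "c ^ p \<in> V - \<mm>" using unit_add_max[OF u c] by simp
    hence "c \<in> V - \<mm>" using power_unit p by blast
    hence "poly (pderiv ?P) c \<notin> \<mm>" unfolding pd using unit_mult[of "of_nat p" "c ^ (p - 1)"] unit_power p of_nat_in
      by (auto simp: poly_monom)
    thus ?thesis using hensel[OF P(1) root] by blast
  next
    case (factor D E E')
    let ?Z = "monom 1 1 * E' - [:of_nat p:] * E"
    have Z: "coeffs_in V ?Z"
      by (intro coeffs_in_diff coeffs_in_mult coeffs_in_monom coeffs_in_const one_in of_nat_in factor)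
    have "monom 1 1 * pderiv ?P - [:of_nat p:] * ?P = [:of_nat p * u:]"
      unfolding pd using p by (simp add: mult_monom smult_diff_right smult_monom)
    moreover have "coeffs_in \<mm> ((pderiv ?P - D * E') * monom 1 1 - (?P - D * E) * [:of_nat p:])"
      by (intro coeffs_in_max_diff coeffs_in_max_mult factor coeffs_in_monom coeffs_in_const one_in of_nat_in)
    hence "coeffs_in \<mm> ((monom 1 1 * pderiv ?P - [:of_nat p:] * ?P) - D * ?Z)"
      by (simp only: algebra_simps)
    ultimately have "coeffs_in \<mm> ([:of_nat p * u:] - D * ?Z)" by metis
    hence "of_nat p * u \<in> \<mm>" using monic_factor_const[OF factor(1,4,6) Z] by blast
    thus ?thesis using max_prime[OF of_nat_in _] u p by blast
  qed
  then obtain b where b: "b ^ p = u" by (auto simp: poly_monom)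
  moreover have "b \<noteq> 0" using b unit_not0[OF u] p by auto
  ultimately show ?thesis unfolding nonzero_powers_def by blast
qed

lemma tame_proper_ball:
  assumes "p > 0" "of_nat p \<notin> \<mm>" "t \<noteq> 0" "\<And>y. y \<noteq> 0 \<Longrightarrow> t / y ^ p \<notin> V - \<mm>"
  shows "proper_ball V (tame_ball p)"
proof (rule tame_ball)
  show "V - \<mm> \<subseteq> nonzero_powers p" using root_tame assms by blast
  show "t \<notin> nonzero_powers p"
  proof
    assume "t \<in> nonzero_powers p"
    then obtain y where "y \<noteq> 0" "t = y ^ p" by (auto simp: nonzero_powers_def)
    thus False using assms(4)[of y] one_unit by simp
  qed
qed fact

text \<open>In characteristic \<open>q\<close> the values of \<open>X^q - X\<close> form an additive
  group, which contains \<open>V\<close> because the derivative is \<open>-1\<close>. So the whole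
  complement is invariant under shifts by the ball, and \<open>D'\<close> can be taken to be
  \<open>D\<close>. On the boundary the linear term lies in the ball, so that modulo the ball these
  values are \<open>q\<close>-th powers.\<close>

lemma artin_schreier_proper_ball:
  assumes q: "prime q" "of_nat q = (0::'a)" and a: "(a :: 'a) \<in> artin_schreier_set q"
  shows "proper_ball V (stable_part (artin_schreier_set q))"
proof -
  let ?D = "artin_schreier_set q :: 'a set"
  have q2: "q \<ge> 2" using q prime_ge_2_nat by blast
  have VD: "c \<notin> ?D" if c: "c \<in> V" for c
  proof -
    let ?P = "monom 1 q - [:c, 1:]"
    have deg: "degree ?P = q"
      using q2 unfolding diff_conv_add_uminus by (subst degree_add_eq_left) (auto simp: degree_monom_eq)
    have pd: "pderiv ?P = [:-1:]"
      using q by (simp add: pderiv_diff pderiv_monom pderiv_pCons)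
    have "\<exists>b\<in>V. poly ?P b = 0"
    proof (rule root_const_deriv)
      show "coeffs_in V ?P"
        by (intro coeffs_in_diff coeffs_in_monom) (auto simp: coeffs_in_pCons coeffs_in_0 c one_in)
      show "lead_coeff ?P = 1" unfolding deg using q2 by (auto simp: coeff_pCons split: nat.splits)
      show "1 \<le> degree ?P" using q2 deg by simp
      show "-1 \<in> V - \<mm>" using one_unit by (auto simp: uminus_in_iff max_uminus_iff)
      show "coeffs_in \<mm> (pderiv ?P - [:-1:])" unfolding pd by (simp add: coeffs_in_def zero_max)
    qed
    then obtain b where "b ^ q - (c + b) = 0" by (auto simp: poly_monom)
    thus ?thesis unfolding artin_schreier_set_def by (auto simp: algebra_simps intro!: exI[of _ b])
  qed
  have NDE: "x \<notin> ?D \<longleftrightarrow> (\<exists>b. b ^ q - b = x)" for x by (simp add: artin_schreier_set_def)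
  have ND: "x + y \<notin> ?D" if xy: "x \<notin> ?D" "y \<notin> ?D" for x y
  proof -
    obtain b c where "b ^ q - b = x" "c ^ q - c = y" using xy NDE by blast
    hence "(b + c) ^ q - (b + c) = x + y" unfolding frobenius_char(1)[OF q] by (simp add: algebra_simps)
    thus ?thesis using NDE by blast
  qed
  have NDm: "- x \<notin> ?D" if xy: "x \<notin> ?D" for x
  proof -
    obtain b where "b ^ q - b = x" using xy NDE by blast
    hence "(0 - b) ^ q - (0 - b) = - x" unfolding frobenius_char(2)[OF q] using q2 by (auto simp: zero_power)
    thus ?thesis using NDE by blast
  qed
  let ?J = "ball_of ?D" and ?W = "ball_ring ?D"
  interpret W: valuation_set ?W by (rule ball_ring)
  have VW: "V \<subseteq> ?W" by (rule ball_ring)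
  have J1: "1 \<in> ?J" using VD by (auto simp: ball_of_def)
  have JD: "y \<notin> ?D" if "y \<in> ?J" for y using that one_in unfolding ball_of_def by force
  have WJ: "c \<in> ?J" if "c \<in> ?W" for c using ball_ring_mult[OF that J1] by simp
  \<comment> \<open>For \<open>d\<close> outside \<open>W\<close>, \<open>d / x\<close> is
    \<open>d ^ q / x\<close> times a positive power of \<open>1 / d \<in> W.\<mm>\<close>; for
    \<open>d\<close> in \<open>W\<close> it is enough that \<open>1\<close> lies in the
    ball.\<close>
  have small: "d ^ q / x \<in> ?W \<Longrightarrow> J = {z. z / x \<in> W.\<mm>} \<Longrightarrow> J = ?J \<Longrightarrow> d \<in> ?J" for d x J
  proof (cases "d \<in> ?W")
    case False
    assume h: "d ^ q / x \<in> ?W" "J = {z. z / x \<in> W.\<mm>}" "J = ?J"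
    have d: "d \<noteq> 0" "1 / d \<in> W.\<mm>" using False W.not_in_V[of d] by (auto simp: inverse_eq_divide)
    have "d ^ q / x * (1 / d) ^ (q - 1) \<in> W.\<mm>"
      by (intro W.max_mult W.max_power h d) (use q2 in auto)
    also have "d ^ q / x * (1 / d) ^ (q - 1) = d / x"
      using d(1) q2 by (simp add: power_divide power_diff)
    finally show ?thesis using h by blast
  qed (use WJ in blast)
  have "stable_part ?D = ?J"
  proof (rule stable_part_eq_ball)
    show "0 \<notin> ?D" using VD zero_in by blast
    show "?D \<subseteq> ?D" ..
    show "y + j \<in> ?D" if "y \<in> ?D" "j \<in> ?J" for y j
      using ND[of "y + j" "- j"] NDm JD that by auto
    show "\<exists>y\<in>?D. \<exists>c\<in>V. y = c * z" if "z \<notin> ?J" for z using that by (auto simp: ball_of_def)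
    show "prime q" by fact
    show "of_nat q \<in> W.\<mm>" using q W.zero_max by simp
  next
    fix x w assume h: "x \<notin> ?D" "x \<notin> ?J" "?J = {z. z / x \<in> W.\<mm>}" "w \<notin> ?D" "w / x \<in> ?W"
    obtain d where d: "d ^ q - d = w" using h(4) NDE by blast
    show "\<exists>d. w - d ^ q \<in> ?J"
    proof (cases "w \<in> ?J")
      case True
      thus ?thesis using q2 by (intro exI[of _ 0]) (simp add: zero_power)
    next
      case False
      have dW: "d \<notin> ?W" using WJ[of w] False W.power_in[of d q] W.diff_in d by blast
      hence d1: "d \<noteq> 0" "1 / d \<in> W.\<mm>" using W.not_in_V[of d] by (auto simp: inverse_eq_divide)
      have u: "1 - (1 / d) ^ (q - 1) \<in> ?W - W.\<mm>"
        using W.unit_add_max[OF W.one_unit W.max_uminus[OF W.max_power[of "q - 1" "1 / d"]]] q2 d1 by simp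
      have "d ^ q = d * d ^ (q - 1)" using q2 by (cases q) auto
      hence "w = d ^ q * (1 - (1 / d) ^ (q - 1))"
        using d1(1) by (simp add: d[symmetric] power_divide algebra_simps)
      hence "d ^ q / x = (w / x) / (1 - (1 / d) ^ (q - 1))" using W.unit_not0[OF u] by simp
      hence "d ^ q / x \<in> ?W" using W.divide_unit[OF h(5) u] by simp
      hence "d \<in> ?J" using small h(3) by blast
      hence "w - d ^ q \<in> ?J" using ball_of_uminus[of d] d by auto
      thus ?thesis by blast
    qed
  next
    fix x y d assume h: "x \<notin> ?D" "x \<notin> ?J" "?J = {z. z / x \<in> W.\<mm>}" "y \<in> ?D" "y / x \<in> ?W" "y - d ^ q \<in> ?J"
    have "(y - d ^ q) / x \<in> W.\<mm>" using h by blast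
    hence "y / x - (y - d ^ q) / x \<in> ?W" using h(5) W.max_ideal_subset W.diff_in by blast
    hence "d ^ q / x \<in> ?W" by (simp add: diff_divide_distrib)
    hence "d \<in> ?J" using small h(3) by blast
    hence "y - d ^ q + d \<in> ?J" using h ball_of_add by blast
    moreover have "d ^ q - d \<notin> ?D" using NDE by blast
    ultimately have "(y - d ^ q + d) + (d ^ q - d) \<notin> ?D" using ND JD by blast
    thus False using h(4) by simp
  qed
  moreover have "a \<notin> ?J" using JD a by blast
  moreover have "\<exists>x\<in>?J. x \<noteq> 0" using J1 by (intro bexI[of _ 1]) auto
  ultimately show ?thesis unfolding proper_ball_def using ball_of_mult by auto
qed

text \<open>At the scale of \<open>\<pi> = \<zeta> - 1\<close> the terms \<open>Y^q\<close> and
  \<open>q Y\<close> of \<open>(1 + Y)^q\<close> balance, since \<open>\<pi> ^ (q - 1)\<close> is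
  \<open>q\<close> times a unit. Hensel's Lemma therefore makes every
  \<open>1 + c * \<pi> ^ q\<close> with \<open>c \<in> V\<close> a \<open>q\<close>-th power, so
  that the ball is not zero. The unit \<open>u0\<close> supplies an integral element
  \<open>u0 - 1\<close> outside the ball, on which cofinality rests.\<close>

lemma kummer_proper_ball:
  fixes \<zeta> u0 :: 'a
  assumes q: "prime q" "of_nat q \<in> \<mm>" "of_nat q \<noteq> (0::'a)"
    and z: "\<zeta> ^ q = 1" "\<zeta> \<noteq> 1"
    and u0: "u0 \<in> V - \<mm>" "u0 \<notin> nonzero_powers q"
  shows "proper_ball V (stable_part (kummer_set q))"
proof -
  let ?D = "kummer_set q :: 'a set" and ?T = "nonzero_powers q :: 'a set"
  let ?J = "ball_of ?D" and ?W = "ball_ring ?D"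
  have q2: "q \<ge> 2" using q prime_ge_2_nat by blast
  have q0: "q > 0" using q2 by simp
  interpret W: valuation_set ?W by (rule ball_ring)
  have VW: "V \<subseteq> ?W" and mWm: "W.\<mm> \<subseteq> \<mm>" by (rule ball_ring)+
  have D: "y \<in> ?D \<longleftrightarrow> 1 + y \<notin> ?T" for y by (simp add: kummer_set_def)
  have pow: "y ^ q \<in> ?T" if "y \<noteq> 0" for y using that by (auto simp: nonzero_powers_def)
  define \<pi> where "\<pi> = \<zeta> - 1"
  have \<zeta>V: "\<zeta> \<in> V" using power_in_V[OF q0, of \<zeta>] z one_in by simp
  have \<pi>V: "\<pi> \<in> V" and \<pi>0: "\<pi> \<noteq> 0" using \<zeta>V z one_in by (auto simp: \<pi>_def diff_in)
  obtain t where t: "t \<in> V" "(1 + \<pi>) ^ q = 1 + \<pi> ^ q + of_nat q * \<pi> * (1 + \<pi> * t)"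
    using one_plus_prime_power[OF q(1) \<pi>V] by blast
  have "(1 + \<pi>) ^ q = 1" using z by (simp add: \<pi>_def)
  hence \<pi>q: "\<pi> ^ q = - (of_nat q * \<pi> * (1 + \<pi> * t))"
    using t(2) by (metis add.assoc add_cancel_right_right eq_neg_iff_add_eq_0)
  have "of_nat q * (- \<pi> * (1 + \<pi> * t)) \<in> \<mm>"
    by (intro max_mult' q mult_in add_in one_in t uminus_in \<pi>V)
  hence "\<pi> ^ q \<in> \<mm>" unfolding \<pi>q by (simp add: algebra_simps)
  hence \<pi>m: "\<pi> \<in> \<mm>" by (rule power_in_max)
  have ut: "- (1 + \<pi> * t) \<in> V - \<mm>"
    using unit_add_max[OF one_unit max_mult'[OF t(1) \<pi>m]] by (simp add: uminus_in_iff max_uminus_iff del: minus_add_distrib)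
  have \<pi>q1: "\<pi> ^ (q - 1) = of_nat q * (- (1 + \<pi> * t))"
  proof -
    have "\<pi> * \<pi> ^ (q - 1) = \<pi> ^ q" using q2 by (cases q) auto
    also have "\<dots> = \<pi> * (of_nat q * (- (1 + \<pi> * t)))" unfolding \<pi>q by (simp add: algebra_simps)
    finally show ?thesis using \<pi>0 by simp
  qed
  define u where "u = of_nat q / \<pi> ^ (q - 1)"
  have u: "u \<in> V - \<mm>"
  proof -
    have "u = 1 / (- (1 + \<pi> * t))" unfolding u_def \<pi>q1 using q(3) by simp
    thus ?thesis using unit_inverse[OF ut] by simp
  qed
  have qu: "of_nat q = u * \<pi> ^ (q - 1)" using \<pi>0 by (simp add: u_def)
  have \<pi>J: "\<pi> ^ q \<in> ?J"
  proof -
    have "1 + c * \<pi> ^ q \<in> ?T" if c: "c \<in> V" for c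
    proof -
      \<comment> \<open>Coefficients of \<open>((1 + \<pi> Y)^q - 1) / \<pi>^q - c\<close>: monic,
        with the unit \<open>u\<close> as linear coefficient and the remaining middle ones in
        \<open>\<mm>\<close>. The derivative is therefore congruent to \<open>u\<close>.\<close>
      define a where "a k = (if k = 0 then - c else of_nat (q choose k) * \<pi> ^ k / \<pi> ^ q)" for k
      define P where "P = (\<Sum>k\<le>q. monom (a k) k)"
      have cP: "coeff P k = (if k \<le> q then a k else 0)" for k
        unfolding P_def by (simp add: coeff_sum)
      have aq: "a q = 1" using q2 \<pi>0 by (simp add: a_def)
      have a1: "a 1 = u" 
      proof -
        have "\<pi> ^ q = \<pi> * \<pi> ^ (q - 1)" using q2 by (cases q) auto
        thus ?thesis using q2 \<pi>0 by (simp add: a_def u_def)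
      qed
      have am: "a k \<in> \<mm>" if k: "2 \<le> k" "k < q" for k
      proof -
        have "q dvd (q choose k)" using k q by (intro dvd_choose_prime) auto
        then obtain e where e: "q choose k = q * e" by blast
        have "\<pi> ^ q = \<pi> * \<pi> ^ (q - 1)" using q2 by (cases q) auto
        moreover have "\<pi> ^ k = \<pi> * \<pi> ^ (k - 1)" using k by (cases k) auto
        ultimately have "a k = of_nat e * u * \<pi> ^ (k - 1)" using k \<pi>0 e by (simp add: a_def u_def)
        moreover have "of_nat e * u * \<pi> ^ (k - 1) \<in> \<mm>"
          using k by (intro max_mult max_power mult_in of_nat_in \<pi>m) (use u in auto)
        ultimately show ?thesis by simp
      qed
      have aV: "a k \<in> V" if kq: "k \<le> q" for k
      proof -
        consider "k = 0" | "k = 1" | "2 \<le> k" "k < q" | "k = q" using kq by linarith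
        thus ?thesis
        proof cases
          case 1 thus ?thesis using c by (simp add: a_def uminus_in)
        next
          case 2 thus ?thesis using a1 u by simp
        next
          case 3 thus ?thesis using am max_ideal_subset by blast
        next
          case 4 thus ?thesis using aq one_in by simp
        qed
      qed
      have deg: "degree P = q"
        using cP aq by (intro antisym degree_le le_degree) auto
      have "\<exists>b\<in>V. poly P b = 0"
      proof (rule root_const_deriv)
        show "coeffs_in V P" using aV zero_in by (auto simp: coeffs_in_def cP)
        show "lead_coeff P = 1" using cP deg aq by simp
        show "degree P \<ge> 1" using deg q2 by simp
        show "u \<in> V - \<mm>" by (rule u)
        have "coeff (pderiv P - [:u:]) i \<in> \<mm>" for i
        proof (cases i)
          case 0
          thus ?thesis using a1 q2 zero_max by (simp add: coeff_pderiv cP)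
        next
          case (Suc j)
          consider "Suc i < q" | "Suc i = q" | "Suc i > q" by linarith
          thus ?thesis
          proof cases
            case 1
            thus ?thesis using am[of "Suc i"] Suc by (auto simp: coeff_pderiv cP simp del: of_nat_Suc intro!: max_mult of_nat_in)
          next
            case 2
            thus ?thesis using aq q(2) Suc by (simp add: coeff_pderiv cP del: of_nat_Suc)
          next
            case 3
            thus ?thesis using Suc zero_max by (simp add: coeff_pderiv cP)
          qed
        qed
        thus "coeffs_in \<mm> (pderiv P - [:u:])" by (simp add: coeffs_in_def)
      qed
      then obtain b where b: "b \<in> V" "poly P b = 0" by blast
      have "poly P b = (\<Sum>k\<le>q. a k * b ^ k)" by (simp add: P_def poly_sum poly_monom)
      also have "\<dots> = a 0 * b ^ 0 + (\<Sum>k\<in>{..q} - {0}. a k * b ^ k)"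
        by (rule sum.remove) auto
      also have "(\<Sum>k\<in>{..q} - {0}. a k * b ^ k) = (\<Sum>k\<in>{..q} - {0}. of_nat (q choose k) * (\<pi> * b) ^ k) / \<pi> ^ q"
        unfolding sum_divide_distrib by (rule sum.cong) (auto simp: a_def power_mult_distrib)
      also have "(\<Sum>k\<in>{..q} - {0}. of_nat (q choose k) * (\<pi> * b) ^ k) = (1 + \<pi> * b) ^ q - 1"
      proof -
        have "(1 + \<pi> * b) ^ q = (\<Sum>k\<le>q. of_nat (q choose k) * (\<pi> * b) ^ k)"
          using binomial_ring[of "\<pi> * b" 1 q] by (simp add: add.commute)
        also have "\<dots> = 1 + (\<Sum>k\<in>{..q} - {0}. of_nat (q choose k) * (\<pi> * b) ^ k)"
          by (subst sum.remove[of _ 0]) auto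
        finally show ?thesis by simp
      qed
      finally have "c = ((1 + \<pi> * b) ^ q - 1) / \<pi> ^ q" using b by (simp add: a_def)
      hence "1 + c * \<pi> ^ q = (1 + \<pi> * b) ^ q" using \<pi>0 by simp
      moreover have "1 + \<pi> * b \<noteq> 0"
        using unit_not0[OF unit_add_max[OF one_unit max_mult'[OF b(1) \<pi>m]]] .
      ultimately show ?thesis using pow by simp
    qed
    thus ?thesis by (auto simp: ball_of_def D)
  qed
  \<comment> \<open>Only where \<open>1 + y\<close> is a unit can a shift by the ball be absorbed,
    through \<open>1 + y + j = (1 + y) * (1 + j / (1 + y))\<close>. For instance \<open>-1\<close>
    lies in \<open>D\<close> but not in \<open>D'\<close>.\<close>
  define D' where "D' = {y \<in> ?D. 1 + y \<in> V - \<mm>}"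
  have JD: "y \<notin> ?D" if "y \<in> ?J" for y using that one_in unfolding ball_of_def by force
  have JT: "1 + j \<in> ?T" if "j \<in> ?J" for j using JD[OF that] D by blast
  have m1: "-1 \<in> ?D" by (simp add: D zero_notin_nonzero_powers)
  have Jm: "?J \<subseteq> \<mm>"
  proof
    fix j assume j: "j \<in> ?J"
    show "j \<in> \<mm>"
    proof (rule ccontr)
      assume "j \<notin> \<mm>"
      hence "j \<noteq> 0" "1 / j \<in> V" using max_iff[of j] zero_max by auto
      hence "- 1 \<in> ?J" using ball_of_mult[of "- (1 / j)" j] j uminus_in by auto
      thus False using JD m1 by blast
    qed
  qed
  have y0: "u0 - 1 \<in> D'" using u0 by (simp add: D'_def D)
  have y0V: "u0 - 1 \<in> V" using u0 one_in diff_in by blast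
  \<comment> \<open>Bounds the linear term of the expansion. If \<open>d / \<pi>\<close> lies in
    \<open>W\<close>, then \<open>q d\<close> is a \<open>W\<close>-multiple of
    \<open>\<pi> ^ q\<close>, which is in the ball. Otherwise \<open>q d / x\<close> is, up to a
    unit, \<open>d ^ q / x\<close> times a power of \<open>\<pi> / d \<in> W.\<mm>\<close>.\<close>
  have dec: "qd \<in> ?J" if x: "?J = {z. z / x \<in> W.\<mm>}" "d \<in> ?W" "qd = of_nat q * d" "\<pi> / d \<in> W.\<mm> \<Longrightarrow> d ^ q / x \<in> ?W" for d x qd
  proof (cases "d / \<pi> \<in> ?W")
    case True
    have "\<pi> ^ q = \<pi> * \<pi> ^ (q - 1)" using q2 by (cases q) auto
    hence "qd = u * (d / \<pi> * \<pi> ^ q)" using x(3) qu \<pi>0 by simp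
    moreover have "u * (d / \<pi> * \<pi> ^ q) \<in> ?J"
      using ball_of_mult ball_ring_mult[OF True \<pi>J] u by blast
    ultimately show ?thesis by simp
  next
    case False
    hence \<pi>d: "\<pi> / d \<in> W.\<mm>" and d0: "d \<noteq> 0" using W.div_max[OF \<pi>0, of d] by auto
    have "d ^ q = d * d ^ (q - 1)" using q2 by (cases q) auto
    hence "qd / x = u * (d ^ q / x * (\<pi> / d) ^ (q - 1))"
      using d0 by (simp add: x(3) qu power_divide)
    moreover have "u * (d ^ q / x * (\<pi> / d) ^ (q - 1)) \<in> W.\<mm>"
      using u VW q2 by (intro W.max_mult W.max_power \<pi>d x(4)) auto
    ultimately show ?thesis using x(1) by auto
  qed
  have "stable_part ?D = ?J"
  proof (rule stable_part_eq_ball)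
    show "0 \<notin> ?D" by (simp add: D one_in_nonzero_powers)
    show "D' \<subseteq> ?D" by (auto simp: D'_def)
    show "y + j \<in> ?D" if y: "y \<in> D'" and j: "j \<in> ?J" for y j
    proof -
      have y1: "1 + y \<in> V - \<mm>" "1 + y \<notin> ?T" using y by (auto simp: D'_def D)
      have "1 / (1 + y) * j \<in> ?J" using unit_inverse[OF y1(1)] ball_of_mult j by blast
      hence "1 + 1 / (1 + y) * j \<in> ?T" by (rule JT)
      moreover have "(1 + (y + j)) / (1 + 1 / (1 + y) * j) = 1 + y" 
      proof -
        have "1 + y \<noteq> 0" using unit_not0[OF y1(1)] .
        hence "1 + (y + j) = (1 + y) * (1 + 1 / (1 + y) * j)" by (simp add: distrib_left)
        moreover have "1 + 1 / (1 + y) * j \<noteq> 0" using calculation(1) \<open>1 + 1 / (1 + y) * j \<in> ?T\<close> zero_notin_nonzero_powers by metis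
        ultimately show ?thesis by simp
      qed
      ultimately show ?thesis using nonzero_powers_divide[of "1 + (y + j)" q "1 + 1 / (1 + y) * j"] y1(2)
        by (auto simp: D)
    qed
    show "\<exists>y\<in>D'. \<exists>c\<in>V. y = c * z" if zJ: "z \<notin> ?J" for z
    proof -
      obtain c where c: "c \<in> V" "c * z \<in> ?D" using zJ by (auto simp: ball_of_def)
      show ?thesis
      proof (cases "c * z \<in> \<mm>")
        case True
        hence "c * z \<in> D'" using unit_add_max[OF one_unit True] c by (simp add: D'_def)
        thus ?thesis using c by blast
      next
        case False
        hence "z \<notin> \<mm>" using max_mult c by blast
        hence z0: "z \<noteq> 0" "1 / z \<in> V" using max_iff[of z] zero_max by auto
        have "(u0 - 1) / z \<in> V" using mult_in[OF y0V z0(2)] by simp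
        moreover have "u0 - 1 = (u0 - 1) / z * z" using z0 by simp
        ultimately show ?thesis using y0 by blast
      qed
    qed
    show "prime q" by fact
  next
    fix x assume h: "x \<notin> ?D" "x \<notin> ?J" "?J = {z. z / x \<in> W.\<mm>}"
    have J0: "0 \<in> ?J" using JD ball_of_mult[OF zero_in \<pi>J] by simp
    have x0: "x \<noteq> 0" using h J0 by auto
    have Jx: "z / x \<in> W.\<mm> \<longleftrightarrow> z \<in> ?J" for z using h(3) by blast
    \<comment> \<open>The integral element \<open>u0 - 1\<close> is outside the ball, hence divides
      \<open>x\<close> in \<open>W\<close>.\<close>
    have xW: "x \<in> ?W"
    proof -
      have "u0 - 1 \<notin> ?J" using y0 JD by (auto simp: D'_def)
      hence n: "(u0 - 1) / x \<notin> W.\<mm>" using Jx by blast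
      hence "(u0 - 1) / x \<noteq> 0" using W.zero_max by metis
      hence "x / (u0 - 1) \<in> ?W" "u0 - 1 \<noteq> 0" using W.max_iff[of "(u0 - 1) / x"] n by auto
      thus ?thesis using W.mult_in[of "x / (u0 - 1)" "u0 - 1"] y0V VW by auto
    qed
    have JmW: "?J \<subseteq> W.\<mm>"
    proof
      fix j assume "j \<in> ?J"
      hence "x * (j / x) \<in> W.\<mm>" using W.max_mult[OF xW] Jx by blast
      thus "j \<in> W.\<mm>" using x0 by simp
    qed
    have \<pi>W: "\<pi> \<in> W.\<mm>" using W.power_in_max[of \<pi> q] \<pi>J JmW by blast
    show "of_nat q \<in> W.\<mm>" unfolding qu
      using u VW q2 by (intro W.max_mult W.max_power \<pi>W) auto
    show "\<exists>d. w - d ^ q \<in> ?J" if w: "w \<notin> ?D" "w / x \<in> ?W" for w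
    proof (cases "w \<in> ?J")
      case True
      thus ?thesis using q2 by (intro exI[of _ 0]) (simp add: zero_power)
    next
      case False
      obtain c where c: "1 + w = c ^ q" using w(1) D by (auto simp: nonzero_powers_def)
      have wW: "w \<in> ?W" using W.mult_in[OF xW w(2)] x0 by simp
      hence "c \<in> ?W" using W.power_in_V[OF q0, of c] W.add_in[OF W.one_in wW] unfolding c by blast
      hence dW: "c - 1 \<in> ?W" using W.diff_in W.one_in by blast
      obtain s where s: "s \<in> ?W" "(1 + (c - 1)) ^ q = 1 + (c - 1) ^ q + of_nat q * (c - 1) * (1 + (c - 1) * s)"
        using W.one_plus_prime_power[OF q(1) dW] by blast
      have s1: "1 + (c - 1) * s \<in> ?W" by (intro W.add_in W.one_in W.mult_in dW s)
      have "1 + w = 1 + ((c - 1) ^ q + of_nat q * (c - 1) * (1 + (c - 1) * s))"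
        using s(2) unfolding c by (simp add: add.assoc)
      hence ws: "w = (c - 1) ^ q + of_nat q * (c - 1) * (1 + (c - 1) * s)"
        by (simp only: add_left_cancel)
      have "of_nat q * (c - 1) \<in> ?J"
      proof (rule dec[OF h(3) dW refl])
        assume p: "\<pi> / (c - 1) \<in> W.\<mm>"
        have d0: "c - 1 \<noteq> 0"
        proof
          assume "c - 1 = 0"
          hence "w = 0" using ws q0 by (simp add: zero_power)
          thus False using False J0 by simp
        qed
        define r where "r = u * (\<pi> / (c - 1)) ^ (q - 1) * (1 + (c - 1) * s)"
        have r: "r \<in> W.\<mm>" unfolding r_def
          using u VW q2 by (intro W.max_mult'[OF s1] W.max_mult W.max_power p) auto
        have "(c - 1) ^ q = (c - 1) * (c - 1) ^ (q - 1)" using q2 by (cases q) auto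
        hence "w = (c - 1) ^ q * (1 + r)"
          unfolding ws r_def qu using d0 by (simp add: power_divide distrib_left)
        hence "(c - 1) ^ q / x = (w / x) / (1 + r)" using W.unit_not0[OF W.unit_add_max[OF W.one_unit r]] by simp
        thus "(c - 1) ^ q / x \<in> ?W" using W.divide_unit[OF w(2) W.unit_add_max[OF W.one_unit r]] by simp
      qed
      hence "(1 + (c - 1) * s) * (of_nat q * (c - 1)) \<in> ?J" using ball_ring_mult[OF s1] by blast
      hence "w - (c - 1) ^ q \<in> ?J" unfolding ws by (simp add: algebra_simps)
      thus ?thesis by blast
    qed
    show False if y: "y \<in> D'" "y / x \<in> ?W" "y - d ^ q \<in> ?J" for y d
    proof -
      have "(y - d ^ q) / x \<in> ?W" using y(3) Jx W.max_ideal_subset by blast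
      hence "y / x - (y - d ^ q) / x \<in> ?W" using y(2) W.diff_in by blast
      hence dx: "d ^ q / x \<in> ?W" by (simp add: diff_divide_distrib)
      hence "d ^ q \<in> ?W" using W.mult_in[OF xW] x0 by force
      hence dW: "d \<in> ?W" using W.power_in_V[OF q0] by blast
      obtain s where s: "s \<in> ?W" "(1 + d) ^ q = 1 + d ^ q + of_nat q * d * (1 + d * s)"
        using W.one_plus_prime_power[OF q(1) dW] by blast
      have s1: "1 + d * s \<in> ?W" by (intro W.add_in W.one_in W.mult_in dW s)
      have "of_nat q * d \<in> ?J" by (rule dec[OF h(3) dW refl dx])
      hence "(1 + d * s) * (of_nat q * d) \<in> ?J" using ball_ring_mult[OF s1] by blast
      hence "y - d ^ q - (1 + d * s) * (of_nat q * d) \<in> ?J" using y(3) ball_of_diff by blast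
      hence "(1 + y) - (1 + d) ^ q \<in> ?J" unfolding s(2) by (simp add: algebra_simps)
      then obtain j where j: "j \<in> ?J" "(1 + d) ^ q = (1 + y) + j"
        using ball_of_uminus by (metis add_diff_cancel_left' diff_add_cancel minus_diff_eq uminus_add_conv_diff)
      have y1: "1 + y \<in> ?W - W.\<mm>" using y(1) VW mWm by (auto simp: D'_def)
      have "y + j \<in> ?D"
      proof -
        have yy: "1 + y \<in> V - \<mm>" "1 + y \<notin> ?T" using y by (auto simp: D'_def D)
        have "1 / (1 + y) * j \<in> ?J" using unit_inverse[OF yy(1)] ball_of_mult j by blast
        hence jT: "1 + 1 / (1 + y) * j \<in> ?T" by (rule JT)
        have "1 + (y + j) = (1 + y) * (1 + 1 / (1 + y) * j)" using unit_not0[OF yy(1)] by (simp add: distrib_left)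
        hence "1 + y = (1 + (y + j)) / (1 + 1 / (1 + y) * j)" using jT zero_notin_nonzero_powers by (metis nonzero_mult_div_cancel_right)
        thus ?thesis using yy(2) nonzero_powers_divide[OF _ jT, of "1 + (y + j)"] D by auto
      qed
      moreover have "(1 + d) \<noteq> 0"
      proof
        assume "1 + d = 0"
        hence "(1 + y) + j = 0" using j(2) q0 by (simp add: zero_power)
        thus False using unit_add_max[of "1 + y" j] Jm j(1) y(1) zero_max by (auto simp: D'_def)
      qed
      hence "1 + (y + j) \<in> ?T" using pow[of "1 + d"] j(2) by (simp add: add.assoc)
      ultimately show False using D by blast
    qed
  qed
  moreover have "\<exists>x\<in>?J. x \<noteq> 0" using \<pi>J \<pi>0 by (intro bexI[of _ "\<pi> ^ q"]) auto
  moreover have "-1 \<notin> ?J" using JD m1 by blast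
  ultimately show ?thesis unfolding proper_ball_def using ball_of_mult by auto
qed

end

section \<open>Parameter-free definability\<close>

text \<open>Semantics with quantifiers over a whole type, where the operations are those of the type
  class. The passage to an explicit carrier is made once, in
  \<open>zero_definable_coset_val\<close>.\<close>

primrec type_tval :: "(nat \<Rightarrow> 'a::field) \<Rightarrow> rterm \<Rightarrow> 'a" where
  "type_tval e (TVar i) = e i"
| "type_tval e TZero = 0"
| "type_tval e TOne = 1"
| "type_tval e (TMinus s) = - type_tval e s"
| "type_tval e (TAdd s t) = type_tval e s + type_tval e t"
| "type_tval e (TMult s t) = type_tval e s * type_tval e t"

primrec type_sat :: "(nat \<Rightarrow> 'a::field) \<Rightarrow> rform \<Rightarrow> bool" where
  "type_sat e (FEq s t) \<longleftrightarrow> type_tval e s = type_tval e t"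
| "type_sat e (FNot \<phi>) \<longleftrightarrow> \<not> type_sat e \<phi>"
| "type_sat e (FAnd \<phi> \<psi>) \<longleftrightarrow> type_sat e \<phi> \<and> type_sat e \<psi>"
| "type_sat e (FEx i \<phi>) \<longleftrightarrow> (\<exists>x. type_sat (e(i := x)) \<phi>)"

text \<open>Definability is tracked semantically, for functions and predicates of assignments, so
  that the formulas for the balls never have to be written down.\<close>

definition dterm :: "((nat \<Rightarrow> 'a::field) \<Rightarrow> 'a) \<Rightarrow> bool" where
  "dterm t \<longleftrightarrow> (\<exists>s. \<forall>e. type_tval e s = t e)"

definition dpred :: "((nat \<Rightarrow> 'a::field) \<Rightarrow> bool) \<Rightarrow> bool" where
  "dpred P \<longleftrightarrow> (\<exists>\<phi>. \<forall>e. type_sat e \<phi> \<longleftrightarrow> P e)"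

definition definable :: "'a::field set \<Rightarrow> bool" where
  "definable M \<longleftrightarrow> dpred (\<lambda>e. e 0 \<in> M)"

section \<open>Closure properties of definability\<close>

named_theorems dintro

lemma dtermI: "(\<And>e. type_tval e s = t e) \<Longrightarrow> dterm t"
  by (auto simp: dterm_def)

lemma dpredI: "(\<And>e. type_sat e \<phi> \<longleftrightarrow> P e) \<Longrightarrow> dpred P"
  by (auto simp: dpred_def)

lemma dterm_var [dintro]: "dterm (\<lambda>e. e i)"
  by (rule dtermI[of "TVar i"]) simp

lemma dterm_zero [dintro]: "dterm (\<lambda>e. 0)"
  by (rule dtermI[of TZero]) simp

lemma dterm_one [dintro]: "dterm (\<lambda>e. 1)"
  by (rule dtermI[of TOne]) simp

lemma dterm_uminus [dintro]:
  assumes "dterm s"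
  shows "dterm (\<lambda>e. - s e)"
proof -
  obtain a where "\<And>e. type_tval e a = s e" using assms unfolding dterm_def by blast
  thus ?thesis by (intro dtermI[of "TMinus a"]) simp
qed

lemma dterm_add [dintro]:
  assumes "dterm s" "dterm t"
  shows "dterm (\<lambda>e. s e + t e)"
proof -
  obtain a where "\<And>e. type_tval e a = s e" using assms(1) unfolding dterm_def by blast
  moreover obtain b where "\<And>e. type_tval e b = t e" using assms(2) unfolding dterm_def by blast
  ultimately show ?thesis by (intro dtermI[of "TAdd a b"]) simp
qed

lemma dterm_mult [dintro]:
  assumes "dterm s" "dterm t"
  shows "dterm (\<lambda>e. s e * t e)"
proof -
  obtain a where "\<And>e. type_tval e a = s e" using assms(1) unfolding dterm_def by blast
  moreover obtain b where "\<And>e. type_tval e b = t e" using assms(2) unfolding dterm_def by blast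
  ultimately show ?thesis by (intro dtermI[of "TMult a b"]) simp
qed

lemma dterm_diff [dintro]:
  assumes "dterm s" "dterm t"
  shows "dterm (\<lambda>e. s e - t e)"
  unfolding diff_conv_add_uminus by (intro dterm_add dterm_uminus assms)

lemma dterm_power [dintro]:
  assumes "dterm s"
  shows "dterm (\<lambda>e. s e ^ n)"
proof (induction n)
  case (Suc n)
  show ?case using dterm_mult[OF assms Suc] by simp
qed (simp add: dterm_one)

lemma dpred_eq [dintro]:
  assumes "dterm s" "dterm t"
  shows "dpred (\<lambda>e. s e = t e)"
proof -
  obtain a where "\<And>e. type_tval e a = s e" using assms(1) unfolding dterm_def by blast
  moreover obtain b where "\<And>e. type_tval e b = t e" using assms(2) unfolding dterm_def by blast
  ultimately show ?thesis by (intro dpredI[of "FEq a b"]) simp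
qed

lemma dpred_not [dintro]:
  assumes "dpred P"
  shows "dpred (\<lambda>e. \<not> P e)"
proof -
  obtain a where "\<And>e. type_sat e a \<longleftrightarrow> P e" using assms unfolding dpred_def by blast
  thus ?thesis by (intro dpredI[of "FNot a"]) simp
qed

lemma dpred_and [dintro]:
  assumes "dpred P" "dpred Q"
  shows "dpred (\<lambda>e. P e \<and> Q e)"
proof -
  obtain a where "\<And>e. type_sat e a \<longleftrightarrow> P e" using assms(1) unfolding dpred_def by blast
  moreover obtain b where "\<And>e. type_sat e b \<longleftrightarrow> Q e" using assms(2) unfolding dpred_def by blast
  ultimately show ?thesis by (intro dpredI[of "FAnd a b"]) simp
qed

lemma dpred_or [dintro]:
  assumes "dpred P" "dpred Q"
  shows "dpred (\<lambda>e. P e \<or> Q e)"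
proof -
  have "dpred (\<lambda>e. \<not> (\<not> P e \<and> \<not> Q e))" by (intro dpred_and dpred_not assms)
  thus ?thesis by (simp only: de_Morgan_conj not_not)
qed

lemma dpred_imp [dintro]:
  assumes "dpred P" "dpred Q"
  shows "dpred (\<lambda>e. P e \<longrightarrow> Q e)"
  unfolding imp_conv_disj by (intro dpred_or dpred_not assms)

text \<open>The second premise is freshness of the variable \<open>i\<close>: the bound value may be
  stored there because \<open>P x\<close> does not look at it.\<close>

lemma dpred_ex:
  assumes "dpred (\<lambda>e. P (e i) e)" "\<And>x y e. P x (e(i := y)) = P x e"
  shows "dpred (\<lambda>e. \<exists>x. P x e)"
proof -
  obtain \<phi> where "\<And>e. type_sat e \<phi> \<longleftrightarrow> P (e i) e" using assms(1) unfolding dpred_def by blast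
  hence "type_sat e (FEx i \<phi>) \<longleftrightarrow> (\<exists>x. P x e)" for e using assms(2) by simp
  thus ?thesis unfolding dpred_def by blast
qed

lemma dpred_all:
  assumes "dpred (\<lambda>e. P (e i) e)" "\<And>x y e. P x (e(i := y)) = P x e"
  shows "dpred (\<lambda>e. \<forall>x. P x e)"
proof -
  have "dpred (\<lambda>e. \<exists>x. \<not> P x e)" by (rule dpred_ex[of _ i]) (use assms in \<open>auto intro: dpred_not\<close>)
  from dpred_not[OF this] show ?thesis by simp
qed

lemma definable_var [dintro]:
  assumes "definable M"
  shows "dpred (\<lambda>e. e k \<in> M)"
proof (cases "k = 0")
  case False
  have "dpred (\<lambda>e. \<exists>x. (e(0 := x)) 0 = (e(0 := x)) k \<and> (e(0 := x)) 0 \<in> M)"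
  proof -
    have "dpred (\<lambda>e. e 0 = e k \<and> e 0 \<in> M)" using assms unfolding definable_def by (intro dintro)
    then obtain \<phi> where "\<And>e. type_sat e \<phi> \<longleftrightarrow> e 0 = e k \<and> e 0 \<in> M" unfolding dpred_def by blast
    hence "\<And>e. type_sat e (FEx 0 \<phi>) \<longleftrightarrow> (\<exists>x. (e(0 := x)) 0 = (e(0 := x)) k \<and> (e(0 := x)) 0 \<in> M)" by simp
    thus ?thesis unfolding dpred_def by blast
  qed
  thus ?thesis using False by simp
qed (use assms in \<open>simp add: definable_def\<close>)

lemma definable_term:
  assumes "definable M" "dterm t" "\<And>y e. t (e(i := y)) = t e"
  shows "dpred (\<lambda>e. t e \<in> M)"
proof -
  have "dpred (\<lambda>e. \<exists>x. x = t e \<and> x \<in> M)"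
    by (rule dpred_ex[of _ i]) (use assms in \<open>auto intro!: dintro\<close>)
  thus ?thesis by simp
qed

lemma definable_nonzero_powers: "definable (nonzero_powers p :: 'a::field set)"
proof -
  have "dpred (\<lambda>e :: nat \<Rightarrow> 'a. \<exists>y. y \<noteq> 0 \<and> e 0 = y ^ p)"
    by (rule dpred_ex[of _ 1]) (auto intro!: dintro)
  thus ?thesis by (simp add: definable_def nonzero_powers_def conj_commute)
qed

lemma dpred_one_plus: "dpred (\<lambda>e :: nat \<Rightarrow> 'a::field. 1 + e 0 \<in> nonzero_powers p)"
  by (rule definable_term[OF definable_nonzero_powers dterm_add[OF dterm_one dterm_var], of 1]) simp

lemma definable_tame_generators: "definable (tame_generators p :: 'a::field set)"
proof -
  have "dpred (\<lambda>e :: nat \<Rightarrow> 'a. e 0 \<noteq> 0)"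
    by (intro dpred_not dpred_eq dterm_var dterm_zero)
  moreover have "dpred (\<lambda>e :: nat \<Rightarrow> 'a. e 0 \<notin> nonzero_powers p)"
    by (intro dpred_not definable_var definable_nonzero_powers)
  ultimately show ?thesis
    unfolding definable_def tame_generators_def mem_Collect_eq
    by (intro dpred_and dpred_one_plus)
qed

lemma definable_tame_ball: "definable (tame_ball p :: 'a::field set)"
proof -
  have "dpred (\<lambda>e :: nat \<Rightarrow> 'a. \<exists>y. y \<in> tame_generators p \<and> (\<exists>z. z \<in> tame_generators p \<and> e 0 = y * z))"
    by (rule dpred_ex[of _ 1], intro dintro definable_tame_generators, rule dpred_ex[of _ 2])
       (auto intro!: dintro definable_tame_generators)
  moreover have "dpred (\<lambda>e :: nat \<Rightarrow> 'a. e 0 = 0)" by (intro dintro)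
  moreover have "dpred (\<lambda>e :: nat \<Rightarrow> 'a. e 0 \<in> tame_generators p)"
    by (intro dintro definable_tame_generators)
  ultimately show ?thesis
    unfolding definable_def tame_ball_def mem_Collect_eq Bex_def by (intro dpred_or)
qed

lemma definable_stable_part:
  fixes D :: "'a::field set"
  assumes "definable D"
  shows "definable (stable_part D)"
proof -
  \<comment> \<open>Division is not a term, so the quotient is expressed as the unique
    \<open>w\<close> with \<open>w * (x - y) = x * y\<close>; here \<open>x - y\<close> is nonzero
    as \<open>x \<notin> D\<close> and \<open>y \<in> D\<close>.\<close>
  have "dpred (\<lambda>e :: nat \<Rightarrow> 'a. \<forall>y. y \<in> D \<longrightarrow> (\<forall>w. w * (e 0 - y) = e 0 * y \<longrightarrow> w \<notin> D))"
    by (rule dpred_all[of _ 1], intro dintro assms, rule dpred_all[of _ 2])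
       (auto intro!: dintro assms)
  hence "dpred (\<lambda>e :: nat \<Rightarrow> 'a. e 0 \<notin> D \<and> (\<forall>y. y \<in> D \<longrightarrow> (\<forall>w. w * (e 0 - y) = e 0 * y \<longrightarrow> w \<notin> D)))"
    using assms by (intro dintro)
  moreover have "x \<in> stable_part D \<longleftrightarrow> x \<notin> D \<and> (\<forall>y. y \<in> D \<longrightarrow> (\<forall>w. w * (x - y) = x * y \<longrightarrow> w \<notin> D))" for x
  proof -
    have "(\<forall>w. w * (x - y) = x * y \<longrightarrow> w \<notin> D) \<longleftrightarrow> x * y / (x - y) \<notin> D" if "x \<notin> D" "y \<in> D" for y
    proof -
      have "x - y \<noteq> 0" using that by auto
      hence "w * (x - y) = x * y \<longleftrightarrow> w = x * y / (x - y)" for w by (simp add: eq_divide_eq)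
      thus ?thesis by simp
    qed
    thus ?thesis by (auto simp: stable_part_def)
  qed
  ultimately show ?thesis by (simp add: definable_def)
qed

lemma definable_kummer: "definable (kummer_set q :: 'a::field set)"
  unfolding definable_def kummer_set_def mem_Collect_eq by (intro dpred_not dpred_one_plus)

lemma definable_artin_schreier: "definable (artin_schreier_set q :: 'a::field set)"
  unfolding definable_def artin_schreier_set_def mem_Collect_eq
  by (rule dpred_all[of _ 1], intro dpred_not dpred_eq dterm_diff dterm_power dterm_var) simp

section \<open>Stabilizers of balls, parameter-free formulas and henselian coarsenings\<close>

definition stabilizer :: "'a::field set \<Rightarrow> 'a set" where
  "stabilizer M = {x. \<forall>y\<in>M. x * y \<in> M}"

lemma definable_stabilizer:
  fixes M :: "'a::field set"
  assumes "definable M"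
  shows "definable (stabilizer M)"
proof -
  have "dpred (\<lambda>e :: nat \<Rightarrow> 'a. \<forall>y. y \<in> M \<longrightarrow> e 0 * y \<in> M)"
    by (rule dpred_all[of _ 1], intro dintro assms, rule definable_term[of _ _ 2])
       (auto intro!: dintro assms)
  thus ?thesis by (simp add: definable_def stabilizer_def Ball_def)
qed

lemma finite_tvars: "finite (tvars t)"
  by (induction t) auto

lemma finite_free_vars: "finite (free_vars \<phi>)"
  by (induction \<phi>) (auto simp: finite_tvars)

text \<open>A formula that defines \<open>M\<close> may still have free variables on whose values
  its truth does not depend. Binding them by existential quantifiers removes them and changes
  nothing else.\<close>

lemma definable_closed_formula:
  assumes "definable (M :: 'a::field set)"
  obtains \<phi> where "free_vars \<phi> \<subseteq> {0}" "\<And>e :: nat \<Rightarrow> 'a. type_sat e \<phi> \<longleftrightarrow> e 0 \<in> M"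
proof -
  obtain \<phi> where \<phi>: "\<And>e :: nat \<Rightarrow> 'a. type_sat e \<phi> \<longleftrightarrow> e 0 \<in> M"
    using assms unfolding definable_def dpred_def by blast
  have fv: "free_vars (foldr FEx xs \<phi>) = free_vars \<phi> - set xs" for xs
    by (induction xs) auto
  have st: "0 \<notin> set xs \<Longrightarrow> type_sat e (foldr FEx xs \<phi>) \<longleftrightarrow> e 0 \<in> M" for xs and e :: "nat \<Rightarrow> 'a"
    by (induction xs arbitrary: e) (auto simp: \<phi>)
  obtain xs where "set xs = free_vars \<phi> - {0}"
    using finite_list[of "free_vars \<phi> - {0}"] finite_free_vars by auto
  thus ?thesis using that[of "foldr FEx xs \<phi>"] fv[of xs] st[of xs] by auto
qed

text \<open>Closure under subtraction is inherited from \<open>M\<close>, where it comes from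
  factoring out the shallower of two elements. A quotient \<open>z / m\<close> with
  \<open>m \<in> M\<close> nonzero and \<open>z \<notin> M\<close> witnesses properness.\<close>

lemma (in valuation_set) stabilizer_proper_ball:
  assumes "proper_ball V M"
  shows "ring_set (stabilizer M)" "V \<subseteq> stabilizer M" "stabilizer M \<noteq> UNIV"
proof -
  have ball: "c * x \<in> M" if "c \<in> V" "x \<in> M" for c x using assms that by (auto simp: proper_ball_def)
  have add: "x - y \<in> M" if "x \<in> M" "y \<in> M" for x y
  proof -
    have *: "x - y \<in> M \<and> y - x \<in> M" if "x \<in> M" "y / x \<in> V" "x \<noteq> 0" for x y
    proof -
      have "x - y = (1 - y / x) * x" "y - x = (y / x - 1) * x" using that by (simp_all add: field_simps)
      thus ?thesis using that by (auto intro!: ball diff_in one_in)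
    qed
    have "- y \<in> M" using ball[OF uminus_in[OF one_in] that(2)] by simp
    thus ?thesis using *[of x y] *[of y x] comparable[of x y] that
      by (cases "x = 0"; cases "y = 0") auto
  qed
  show "ring_set (stabilizer M)"
    by unfold_locales (auto simp: stabilizer_def left_diff_distrib mult.assoc intro!: add)
  show "V \<subseteq> stabilizer M" by (auto simp: stabilizer_def ball)
  obtain m z where m: "m \<in> M" "m \<noteq> 0" "z \<notin> M" using assms by (auto simp: proper_ball_def)
  have "z / m * m \<notin> M" using m by simp
  hence "z / m \<notin> stabilizer M" using m(1) unfolding stabilizer_def by blast
  thus "stabilizer M \<noteq> UNIV" by auto
qed

text \<open>After translating the approximate root to \<open>0\<close> and substituting \<open>X = (f 0 / f' 0) Y\<close>, the polynomial becomes a multiple of one with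
  coefficients in \<open>V\<close>.\<close>

lemma (in henselian_set) henselian_coarsening:
  assumes "ring_set W" "V \<subseteq> W"
  shows "henselian_set W"
proof -
  interpret W: valuation_set W using coarsening assms by blast
  have mm: "W.\<mm> \<subseteq> \<mm>" using coarsening assms by blast
  show ?thesis
  proof unfold_locales
    fix f a assume f: "coeffs_in W f" and a: "a \<in> W" and fa: "poly f a \<in> W.\<mm>" and f'a: "poly (pderiv f) a \<notin> W.\<mm>"
    define g where "g = pcompose f [:a, 1:]"
    have gW: "coeffs_in W g" unfolding g_def
      by (intro W.coeffs_in_pcompose f) (simp add: coeffs_in_pCons W.coeffs_in_0 a W.one_in)
    have g0: "coeff g 0 = poly f a" unfolding g_def by (simp add: poly_0_coeff_0[symmetric] poly_pcompose)
    have g1: "coeff g 1 = poly (pderiv f) a"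
    proof -
      have "coeff g 1 = poly (pderiv g) 0" by (simp add: poly_0_coeff_0 coeff_pderiv)
      also have "\<dots> = poly (pderiv f) a" unfolding g_def
        by (simp add: pderiv_pcompose poly_pcompose pderiv_pCons)
      finally show ?thesis .
    qed
    define d where "d = coeff g 1"
    have "coeff g 1 \<in> W" using gW unfolding coeffs_in_def by blast
    hence dW: "d \<in> W - W.\<mm>" using f'a unfolding d_def g1 by blast
    hence d0: "d \<noteq> 0" by (rule W.unit_not0)
    define s where "s = coeff g 0 / d"
    have s: "s \<in> W.\<mm>" unfolding s_def using W.max_divide_unit fa g0 dW by auto
    show "\<exists>b\<in>W. poly f b = 0 \<and> b - a \<in> W.\<mm>"
    proof (cases "s = 0")
      case True
      hence "poly f a = 0" using g0 d0 by (simp add: s_def)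
      thus ?thesis using a W.zero_max by (intro bexI[of _ a]) auto
    next
      case False
      \<comment> \<open>Its coefficients in degrees \<open>0\<close> and \<open>1\<close> are
        \<open>1\<close> and the others lie in \<open>W.\<mm> \<subseteq> \<mm>\<close>, so modulo
        \<open>\<mm>\<close> it is \<open>1 + Y\<close>, with the simple root
        \<open>-1\<close>.\<close>
      define h where "h = smult (1 / (s * d)) (pcompose g [:0, s:])"
      have ch: "coeff h i = coeff g i * s ^ i / (s * d)" for i
      proof -
        have "coeff (pcompose g [:0, s:]) i = coeff g i * s ^ i"
        proof (induction g arbitrary: i)
          case (pCons a p)
          thus ?case by (cases i) (simp_all add: pcompose_pCons coeff_pCons algebra_simps)
        qed simp
        thus ?thesis by (simp add: h_def)
      qed
      have h0: "coeff h 0 = 1" using False d0 by (simp add: ch s_def)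
      have h1: "coeff h 1 = 1" using False d0 by (simp add: ch d_def)
      have hi: "coeff h i \<in> \<mm>" if "i \<ge> 2" for i
      proof -
        have "s ^ i = s * (s * s ^ (i - 2))" using that
          by (metis power_add power2_eq_square le_add_diff_inverse mult.assoc)
        hence "coeff h i = (s ^ (i - 2) * coeff g i / d) * s"
          using False d0 by (simp add: ch)
        moreover have "(s ^ (i - 2) * coeff g i / d) * s \<in> W.\<mm>"
          by (intro W.max_mult W.divide_unit W.mult_in W.power_in s dW)
             (use gW s W.max_ideal_subset in \<open>auto simp: coeffs_in_def\<close>)
        ultimately show ?thesis using mm by auto
      qed
      have hV: "coeffs_in V h"
      proof -
        have "coeff h i \<in> V" for i
        proof -
          consider "i = 0" | "i = 1" | "i \<ge> 2" by linarith
          thus ?thesis by cases (use h0 h1 hi one_in max_ideal_subset in auto)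
        qed
        thus ?thesis by (simp add: coeffs_in_def)
      qed
      define r where "r = h - [:1, 1:]"
      have rm: "coeffs_in \<mm> r"
      proof -
        have "coeff r i \<in> \<mm>" for i
        proof -
          consider "i = 0" | "i = 1" | j where "i = Suc (Suc j)"
            by (metis One_nat_def not0_implies_Suc)
          thus ?thesis by cases (use h0 h1 hi zero_max in \<open>auto simp: r_def\<close>)
        qed
        thus ?thesis by (simp add: coeffs_in_def)
      qed
      have hr: "h = [:1, 1:] + r" by (simp add: r_def)
      have m1: "- 1 \<in> V" using uminus_in one_in by blast
      have "poly h (- 1) \<in> \<mm>" using poly_in_max[OF rm m1] by (simp add: hr)
      moreover have "coeffs_in \<mm> (pderiv r)"
        using rm by (auto simp: coeffs_in_def coeff_pderiv simp del: of_nat_Suc intro!: max_mult of_nat_in)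
      hence "poly (pderiv r) (- 1) \<in> \<mm>" using poly_in_max m1 by blast
      hence "poly (pderiv h) (- 1) \<notin> \<mm>"
        using unit_add_max[OF one_unit] by (auto simp: hr pderiv_add pderiv_pCons)
      ultimately obtain y where y: "y \<in> V" "poly h y = 0" using hensel[OF hV m1] by blast
      have "poly g (s * y) = 0"
        using y(2) False d0 by (simp add: h_def poly_pcompose mult.commute)
      hence "poly f (a + s * y) = 0" by (simp add: g_def poly_pcompose)
      moreover have "s * y \<in> W.\<mm>" using W.max_mult' y assms(2) s by blast
      ultimately show ?thesis using a W.add_in W.max_ideal_subset
        by (intro bexI[of _ "a + s * y"]) auto
    qed
  qed
qed

section \<open>Finite Galois extensions inside an algebraically closed field\<close>

locale subfield_set = ring_set S for S :: "'a::field set" +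
  assumes inverse_in: "x \<in> S \<Longrightarrow> inverse x \<in> S"
begin

lemma divide_in: "x \<in> S \<Longrightarrow> y \<in> S \<Longrightarrow> x / y \<in> S"
  using mult_in[OF _ inverse_in[of y]] by (simp add: divide_inverse)

lemma monic_division:
  assumes p: "coeffs_in S p" "lead_coeff p = 1" and h: "coeffs_in S h"
  shows "\<exists>g r. coeffs_in S g \<and> coeffs_in S r \<and> h = p * g + r \<and> (r = 0 \<or> degree r < degree p)"
  using h
proof (induction "degree h" arbitrary: h rule: less_induct)
  case less
  show ?case
  proof (cases "h = 0 \<or> degree h < degree p")
    case True
    thus ?thesis using less.prems by (intro exI[of _ 0] exI[of _ h]) (auto simp: coeffs_in_0)
  next
    case False
    define g0 where "g0 = monom (lead_coeff h) (degree h - degree p)"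
    define h' where "h' = h - p * g0"
    have p0: "p \<noteq> 0" using p by auto
    have g0: "coeffs_in S g0" "g0 \<noteq> 0" "degree g0 = degree h - degree p"
      using less.prems False by (auto simp: g0_def coeffs_in_def zero_in degree_monom_eq)
    have h': "coeffs_in S h'" unfolding h'_def
      by (intro coeffs_in_diff coeffs_in_mult less.prems p g0)
    have deg: "degree (p * g0) = degree h" using degree_mult_eq[OF p0 g0(2)] g0(3) False by simp
    have "lead_coeff g0 = lead_coeff h" using False by (simp add: g0_def degree_monom_eq)
    hence lc: "lead_coeff (p * g0) = lead_coeff h" using p by (simp add: lead_coeff_mult)
    show ?thesis
    proof (cases "h' = 0")
      case True
      thus ?thesis using g0 by (intro exI[of _ g0] exI[of _ 0]) (auto simp: h'_def coeffs_in_0)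
    next
      case h0: False
      have "degree h' < degree h"
      proof -
        have "degree h' \<le> degree h" unfolding h'_def by (rule degree_diff_le) (simp_all add: deg)
        moreover have "degree h' \<noteq> degree h"
        proof
          assume "degree h' = degree h"
          hence "lead_coeff h' = 0" using lc deg by (simp add: h'_def)
          thus False using h0 by simp
        qed
        ultimately show ?thesis by simp
      qed
      from less.hyps[OF this h'] obtain g r where "coeffs_in S g" "coeffs_in S r" "h' = p * g + r"
        "r = 0 \<or> degree r < degree p" by blast
      thus ?thesis using g0
        by (intro exI[of _ "g + g0"] exI[of _ r]) (auto simp: h'_def algebra_simps coeffs_in_add)
    qed
  qed
qed

definition is_minpoly :: "'a \<Rightarrow> 'a poly \<Rightarrow> bool" where
  "is_minpoly x p \<longleftrightarrow> coeffs_in S p \<and> lead_coeff p = 1 \<and> poly p x = 0 \<and>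
     (\<forall>h. coeffs_in S h \<longrightarrow> poly h x = 0 \<longrightarrow> (\<exists>g. coeffs_in S g \<and> h = p * g))"

lemma minpoly_exists:
  assumes "coeffs_in S f" "f \<noteq> 0" "poly f x = 0"
  obtains p where "is_minpoly x p"
proof -
  define n where "n = (LEAST n. \<exists>f. coeffs_in S f \<and> f \<noteq> 0 \<and> poly f x = 0 \<and> degree f = n)"
  have "\<exists>f. coeffs_in S f \<and> f \<noteq> 0 \<and> poly f x = 0 \<and> degree f = n"
    unfolding n_def by (rule LeastI_ex) (use assms in blast)
  then obtain f where f: "coeffs_in S f" "f \<noteq> 0" "poly f x = 0" "degree f = n" by blast
  have least: "n \<le> degree h" if "coeffs_in S h" "h \<noteq> 0" "poly h x = 0" for h
    unfolding n_def by (rule Least_le) (use that in blast)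
  define p where "p = smult (inverse (lead_coeff f)) f"
  have p: "coeffs_in S p" "lead_coeff p = 1" "poly p x = 0" "degree p = n"
    using f by (auto simp: p_def coeffs_in_def intro!: mult_in inverse_in)
  have "\<exists>g. coeffs_in S g \<and> h = p * g" if h: "coeffs_in S h" "poly h x = 0" for h
  proof -
    obtain g r where gr: "coeffs_in S g" "coeffs_in S r" "h = p * g + r" "r = 0 \<or> degree r < degree p"
      using monic_division[OF p(1,2) h(1)] by blast
    have "poly r x = 0" using h(2) p(3) gr(3) by simp
    hence "r = 0" using least[OF gr(2)] gr(4) p(4) by force
    thus ?thesis using gr by auto
  qed
  thus ?thesis using that[of p] p by (auto simp: is_minpoly_def)
qed

end

section \<open>Homomorphisms given on a subfield\<close>

definition hom_on :: "'a::field set \<Rightarrow> ('a \<Rightarrow> 'a) \<Rightarrow> bool" where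
  "hom_on E \<phi> \<longleftrightarrow> \<phi> 1 = 1 \<and> (\<forall>x\<in>E. \<forall>y\<in>E. \<phi> (x + y) = \<phi> x + \<phi> y \<and> \<phi> (x * y) = \<phi> x * \<phi> y)"

locale field_hom = subfield_set E for E :: "'a::field set" +
  fixes \<phi> :: "'a \<Rightarrow> 'a"
  assumes hom: "hom_on E \<phi>"
begin

lemma hom_one: "\<phi> 1 = 1"
  using hom by (simp add: hom_on_def)

lemma hom_add: "x \<in> E \<Longrightarrow> y \<in> E \<Longrightarrow> \<phi> (x + y) = \<phi> x + \<phi> y"
  using hom by (simp add: hom_on_def)

lemma hom_mult: "x \<in> E \<Longrightarrow> y \<in> E \<Longrightarrow> \<phi> (x * y) = \<phi> x * \<phi> y"
  using hom by (simp add: hom_on_def)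

lemma hom_zero: "\<phi> 0 = 0"
  using hom_add[OF zero_in zero_in] by (metis add.right_neutral add_left_cancel)

lemma hom_uminus: "x \<in> E \<Longrightarrow> \<phi> (- x) = - \<phi> x"
  using hom_add[OF _ uminus_in[of x], of x] hom_zero by (simp add: add_eq_0_iff)

lemma hom_diff: "x \<in> E \<Longrightarrow> y \<in> E \<Longrightarrow> \<phi> (x - y) = \<phi> x - \<phi> y"
  using hom_add[OF _ uminus_in[of y], of x] hom_uminus[of y] by simp

lemma hom_inverse: "x \<in> E \<Longrightarrow> \<phi> (inverse x) = inverse (\<phi> x)"
proof (cases "x = 0")
  case False
  assume x: "x \<in> E"
  have "\<phi> x * \<phi> (inverse x) = 1" using hom_mult[OF x inverse_in[OF x]] hom_one False by simp
  thus ?thesis by (metis inverse_unique)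
qed (simp add: hom_zero)

lemma hom_divide: "x \<in> E \<Longrightarrow> y \<in> E \<Longrightarrow> \<phi> (x / y) = \<phi> x / \<phi> y"
  by (simp add: divide_inverse hom_mult hom_inverse inverse_in)

lemma hom_eq_0: "x \<in> E \<Longrightarrow> \<phi> x = 0 \<longleftrightarrow> x = 0"
proof
  assume "x \<in> E" "\<phi> x = 0"
  thus "x = 0" using hom_mult[OF _ inverse_in[of x], of x] hom_one by (cases "x = 0") auto
qed (simp add: hom_zero)

lemma hom_inj: "x \<in> E \<Longrightarrow> y \<in> E \<Longrightarrow> \<phi> x = \<phi> y \<longleftrightarrow> x = y"
  using hom_eq_0[OF diff_in, of x y] hom_diff[of x y] by simp

lemma hom_sum: "(\<And>i. i \<in> A \<Longrightarrow> f i \<in> E) \<Longrightarrow> \<phi> (\<Sum>i\<in>A. f i) = (\<Sum>i\<in>A. \<phi> (f i))"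
  by (induction A rule: infinite_finite_induct) (auto simp: hom_zero hom_add sum_in)

lemma hom_prod: "(\<And>i. i \<in> A \<Longrightarrow> f i \<in> E) \<Longrightarrow> \<phi> (\<Prod>i\<in>A. f i) = (\<Prod>i\<in>A. \<phi> (f i))"
  by (induction A rule: infinite_finite_induct) (auto simp: hom_one hom_mult prod_in)

lemma hom_power: "x \<in> E \<Longrightarrow> \<phi> (x ^ n) = \<phi> x ^ n"
  by (induction n) (auto simp: hom_one hom_mult power_in)

lemma hom_of_nat: "\<phi> (of_nat n) = of_nat n"
  by (induction n) (auto simp: hom_zero hom_one hom_add one_in of_nat_in)

lemma coeff_map: "coeff (map_poly \<phi> p) i = \<phi> (coeff p i)"
  by (simp add: coeff_map_poly hom_zero)

lemma map_mult: "coeffs_in E p \<Longrightarrow> coeffs_in E q \<Longrightarrow> map_poly \<phi> (p * q) = map_poly \<phi> p * map_poly \<phi> q"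
  by (rule poly_eqI) (auto simp: coeff_map coeff_mult coeffs_in_def hom_sum hom_mult mult_in)

lemma map_add: "coeffs_in E p \<Longrightarrow> coeffs_in E q \<Longrightarrow> map_poly \<phi> (p + q) = map_poly \<phi> p + map_poly \<phi> q"
  by (rule poly_eqI) (auto simp: coeff_map coeffs_in_def hom_add)

lemma map_diff: "coeffs_in E p \<Longrightarrow> coeffs_in E q \<Longrightarrow> map_poly \<phi> (p - q) = map_poly \<phi> p - map_poly \<phi> q"
  by (rule poly_eqI) (auto simp: coeff_map coeffs_in_def hom_diff)

lemma degree_map:
  assumes "coeffs_in E p"
  shows "degree (map_poly \<phi> p) = degree p"
proof (cases "p = 0")
  case False
  hence "coeff (map_poly \<phi> p) (degree p) \<noteq> 0"
    using assms by (simp add: coeff_map hom_eq_0 coeffs_in_def)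
  hence "degree p \<le> degree (map_poly \<phi> p)" by (rule le_degree)
  thus ?thesis using degree_le[of "degree p" "map_poly \<phi> p"] by (simp add: coeff_map coeff_eq_0 hom_zero)
qed simp

lemma poly_map: "coeffs_in E p \<Longrightarrow> x \<in> E \<Longrightarrow> poly (map_poly \<phi> p) (\<phi> x) = \<phi> (poly p x)"
  unfolding poly_altdef
  by (subst hom_sum)
     (auto simp: degree_map coeff_map coeffs_in_def hom_mult hom_power power_in intro!: mult_in sum.cong)

end

lemma map_poly_fixed:
  assumes "coeffs_in K f" "\<And>x. x \<in> K \<Longrightarrow> \<phi> x = x" "0 \<in> K"
  shows "map_poly \<phi> f = f"
  by (rule poly_eqI) (use assms in \<open>auto simp: coeff_map_poly coeffs_in_def\<close>)

locale algebraic_over = subfield_set K for K :: "'a::alg_closed_field set" +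
  assumes algebraic: "\<And>x :: 'a. \<exists>f. coeffs_in K f \<and> f \<noteq> 0 \<and> poly f x = 0"
begin

definition adjoin :: "'a set \<Rightarrow> 'a \<Rightarrow> 'a set" where
  "adjoin E x = {poly p x | p. coeffs_in E p}"

text \<open>Every element is algebraic over \<open>K\<close>, and a nonzero one has a minimal
  polynomial with nonzero constant term; solving for this term expresses the inverse as a polynomial
  in the element.\<close>

lemma subfield_setI: "ring_set E \<Longrightarrow> K \<subseteq> E \<Longrightarrow> subfield_set E"
proof -
  assume "ring_set E" and K: "K \<subseteq> E"
  interpret E: ring_set E by fact
  show ?thesis
  proof unfold_locales
    fix x assume x: "x \<in> E"
    obtain f where f: "coeffs_in K f" "f \<noteq> 0" "poly f x = 0" using algebraic by blast
    obtain p where p: "is_minpoly x p" using minpoly_exists[OF f] .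
    have pK: "coeffs_in K p" "lead_coeff p = 1" "poly p x = 0" using p by (auto simp: is_minpoly_def)
    show "inverse x \<in> E"
    proof (cases "x = 0")
      case False
      obtain a q where pq: "p = pCons a q" by (cases p)
      have a: "a \<in> K" and q: "coeffs_in K q" using pK coeffs_in_pCons pq by auto
      have "a \<noteq> 0"
      proof
        assume "a = 0"
        hence "poly q x = 0" using pK(3) False pq by simp
        then obtain g where g: "q = p * g" using p q by (auto simp: is_minpoly_def)
        have "q \<noteq> 0" using pK(2) pq \<open>a = 0\<close> by auto
        moreover have "degree p = Suc (degree q)" using \<open>q \<noteq> 0\<close> by (simp add: pq)
        moreover have "degree q = degree p + degree g" using g \<open>q \<noteq> 0\<close> by (simp add: degree_mult_eq)
        ultimately show False by simp
      qed
      have "a + x * poly q x = 0" using pK(3) pq by simp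
      hence "- (x * poly q x) = a" by (metis add_eq_0_iff2)
      moreover have "x * (- poly q x * inverse a) = - (x * poly q x) * inverse a" by simp
      ultimately have "x * (- poly q x * inverse a) = 1" using \<open>a \<noteq> 0\<close> by simp
      hence "inverse x = - poly q x * inverse a" by (rule inverse_unique)
      moreover have "- poly q x * inverse a \<in> E"
        using coeffs_in_mono[OF K q] a inverse_in K x by (intro E.mult_in E.uminus_in E.poly_in) auto
      ultimately show ?thesis by simp
    qed (use E.zero_in in simp)
  qed
qed

lemma adjoin:
  assumes E: "subfield_set E" "K \<subseteq> E"
  shows "subfield_set (adjoin E x)" "E \<subseteq> adjoin E x" "x \<in> adjoin E x"
proof -
  interpret E: subfield_set E by fact
  show sub: "E \<subseteq> adjoin E x"
  proof
    fix y assume "y \<in> E"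
    hence "coeffs_in E [:y:]" by (rule E.coeffs_in_const)
    moreover have "y = poly [:y:] x" by simp
    ultimately show "y \<in> adjoin E x" unfolding adjoin_def by blast
  qed
  have "coeffs_in E [:0, 1:]" by (simp add: coeffs_in_pCons E.coeffs_in_0 E.zero_in E.one_in)
  moreover have "x = poly [:0, 1:] x" by simp
  ultimately show "x \<in> adjoin E x" unfolding adjoin_def by blast
  show "subfield_set (adjoin E x)"
  proof (rule subfield_setI)
    show "K \<subseteq> adjoin E x" using sub E by blast
    show "ring_set (adjoin E x)"
    proof
      show "1 \<in> adjoin E x" using sub E.one_in by blast
      show "a - b \<in> adjoin E x" if ab: "a \<in> adjoin E x" "b \<in> adjoin E x" for a b
      proof -
        obtain p q where "coeffs_in E p" "coeffs_in E q" "a = poly p x" "b = poly q x"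
          using ab unfolding adjoin_def by blast
        hence "coeffs_in E (p - q)" "a - b = poly (p - q) x" by (auto intro: E.coeffs_in_diff)
        thus ?thesis unfolding adjoin_def by blast
      qed
      show "a * b \<in> adjoin E x" if ab: "a \<in> adjoin E x" "b \<in> adjoin E x" for a b
      proof -
        obtain p q where "coeffs_in E p" "coeffs_in E q" "a = poly p x" "b = poly q x"
          using ab unfolding adjoin_def by blast
        hence "coeffs_in E (p * q)" "a * b = poly (p * q) x" by (auto intro: E.coeffs_in_mult)
        thus ?thesis unfolding adjoin_def by blast
      qed
    qed
  qed
qed

text \<open>Two polynomials with the same value at \<open>x\<close> differ by a multiple of
  \<open>p\<close>, whose image under \<open>\<phi>\<close> vanishes at \<open>y\<close>; so the
  value at \<open>y\<close> does not depend on the polynomial chosen.\<close>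

lemma extend_simple:
  assumes E: "subfield_set E" "K \<subseteq> E" and \<phi>: "hom_on E \<phi>"
    and p: "subfield_set.is_minpoly E x p" and y: "poly (map_poly \<phi> p) y = 0"
  obtains \<psi> where "hom_on (adjoin E x) \<psi>" "\<And>z. z \<in> E \<Longrightarrow> \<psi> z = \<phi> z"
    "\<And>h. coeffs_in E h \<Longrightarrow> \<psi> (poly h x) = poly (map_poly \<phi> h) y"
proof -
  interpret E: subfield_set E by fact
  interpret \<phi>: field_hom E \<phi> by unfold_locales fact
  have pE: "coeffs_in E p" "\<And>h. coeffs_in E h \<Longrightarrow> poly h x = 0 \<Longrightarrow> \<exists>g. coeffs_in E g \<and> h = p * g"
    using p by (auto simp: E.is_minpoly_def)
  define \<psi> where "\<psi> z = poly (map_poly \<phi> (SOME h. coeffs_in E h \<and> poly h x = z)) y" for z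
  have *: "\<psi> (poly h x) = poly (map_poly \<phi> h) y" if h: "coeffs_in E h" for h
  proof -
    define h0 where "h0 = (SOME h'. coeffs_in E h' \<and> poly h' x = poly h x)"
    have h0: "coeffs_in E h0 \<and> poly h0 x = poly h x" unfolding h0_def by (rule someI[of _ h]) (use h in simp)
    have "coeffs_in E (h0 - h)" using h h0 E.coeffs_in_diff by blast
    moreover have "poly (h0 - h) x = 0" using h0 by simp
    ultimately obtain g where g: "coeffs_in E g" "h0 - h = p * g" using pE(2) by blast
    have "map_poly \<phi> h0 - map_poly \<phi> h = map_poly \<phi> p * map_poly \<phi> g"
      using \<phi>.map_diff[of h0 h] \<phi>.map_mult[OF pE(1) g(1)] h h0 g(2) by simp
    hence "poly (map_poly \<phi> h0 - map_poly \<phi> h) y = 0" using y by simp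
    thus ?thesis by (simp add: \<psi>_def h0_def[symmetric])
  qed
  have "hom_on (adjoin E x) \<psi>" unfolding hom_on_def
  proof (intro conjI ballI)
    show "\<psi> 1 = 1" using *[OF E.coeffs_in_1] by (simp add: \<phi>.hom_one map_poly_1')
    fix a b assume "a \<in> adjoin E x" "b \<in> adjoin E x"
    then obtain h k where hk: "coeffs_in E h" "coeffs_in E k" "a = poly h x" "b = poly k x"
      by (auto simp: adjoin_def)
    show "\<psi> (a + b) = \<psi> a + \<psi> b"
      using *[OF E.coeffs_in_add[OF hk(1,2)]] *[OF hk(1)] *[OF hk(2)] hk by (simp add: \<phi>.map_add)
    show "\<psi> (a * b) = \<psi> a * \<psi> b"
      using *[OF E.coeffs_in_mult[OF hk(1,2)]] *[OF hk(1)] *[OF hk(2)] hk by (simp add: \<phi>.map_mult)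
  qed
  moreover have "\<psi> z = \<phi> z" if "z \<in> E" for z
    using *[OF E.coeffs_in_const[OF that]] by (simp add: map_poly_pCons \<phi>.hom_zero)
  ultimately show ?thesis using that * by blast
qed

lemma extend_finite:
  assumes "finite R" "subfield_set E" "K \<subseteq> E" "hom_on E \<phi>"
  shows "\<exists>E' \<psi>. subfield_set E' \<and> E \<subseteq> E' \<and> R \<subseteq> E' \<and> hom_on E' \<psi> \<and> (\<forall>z\<in>E. \<psi> z = \<phi> z)"
  using assms
proof (induction R arbitrary: E \<phi> rule: finite_induct)
  case (insert x R)
  interpret E: subfield_set E by fact
  interpret \<phi>: field_hom E \<phi> by unfold_locales fact
  obtain f where "coeffs_in K f" "f \<noteq> 0" "poly f x = 0" using algebraic by blast
  then obtain p where p: "E.is_minpoly x p" using E.minpoly_exists coeffs_in_mono insert.prems by metis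
  have pE: "coeffs_in E p" "lead_coeff p = 1" "poly p x = 0" using p by (auto simp: E.is_minpoly_def)
  have "degree p \<noteq> 0"
  proof
    assume "degree p = 0"
    then obtain a where "p = [:a:]" by (rule degree_eq_zeroE)
    thus False using pE by simp
  qed
  hence "degree (map_poly \<phi> p) > 0" using \<phi>.degree_map pE by simp
  then obtain y where y: "poly (map_poly \<phi> p) y = 0" using alg_closed_imp_poly_has_root by blast
  obtain \<psi> where \<psi>: "hom_on (adjoin E x) \<psi>" "\<And>z. z \<in> E \<Longrightarrow> \<psi> z = \<phi> z"
    by (rule extend_simple[OF insert.prems p y]) blast
  note ad = adjoin[OF insert.prems(1,2), of x]
  obtain E' \<psi>' where "subfield_set E'" "adjoin E x \<subseteq> E'" "R \<subseteq> E'" "hom_on E' \<psi>'" "\<forall>z\<in>adjoin E x. \<psi>' z = \<psi> z"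
    using insert.IH[OF ad(1) _ \<psi>(1)] ad insert.prems by blast
  thus ?case using ad \<psi>(2) by (intro exI[of _ E'] exI[of _ \<psi>']) auto
qed auto

text \<open>Encodes that the splitting field of \<open>R\<close> is a finite Galois extension of
  \<open>K\<close>. Each root may come with its own polynomial, so that roots of unity can be added
  to the roots of a given polynomial.\<close>

definition separable_roots :: "'a set \<Rightarrow> bool" where
  "separable_roots R \<longleftrightarrow> finite R \<and> (\<forall>x\<in>R. \<exists>f. coeffs_in K f \<and> f \<noteq> 0 \<and> poly f x = 0 \<and>
     card {y. poly f y = 0} = degree f \<and> {y. poly f y = 0} \<subseteq> R)"

definition splitting_field :: "'a set \<Rightarrow> 'a set" where
  "splitting_field R = \<Inter>{E. subfield_set E \<and> K \<subseteq> E \<and> R \<subseteq> E}"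

text \<open>Continued by the identity outside the splitting field, automorphisms become functions on
  the type that can be compared and composed. Invertibility results later from injectivity and
  finiteness.\<close>

definition galois_group :: "'a set \<Rightarrow> ('a \<Rightarrow> 'a) set" where
  "galois_group R = {\<sigma>. hom_on (splitting_field R) \<sigma> \<and> (\<forall>x\<in>K. \<sigma> x = x) \<and>
     (\<forall>x\<in>splitting_field R. \<sigma> x \<in> splitting_field R) \<and> (\<forall>x. x \<notin> splitting_field R \<longrightarrow> \<sigma> x = x)}"

lemma splitting_field:
  shows "subfield_set (splitting_field R)" "K \<subseteq> splitting_field R" "R \<subseteq> splitting_field R"
proof -
  show K: "K \<subseteq> splitting_field R" "R \<subseteq> splitting_field R" by (auto simp: splitting_field_def)
  show "subfield_set (splitting_field R)"
  proof (rule subfield_setI[OF _ K(1)])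
    show "ring_set (splitting_field R)"
      unfolding splitting_field_def
      by unfold_locales (auto simp: subfield_set_def intro: ring_set.one_in ring_set.diff_in ring_set.mult_in)
  qed
qed

lemma splitting_field_least:
  "subfield_set E \<Longrightarrow> K \<subseteq> E \<Longrightarrow> R \<subseteq> E \<Longrightarrow> splitting_field R \<subseteq> E"
  by (auto simp: splitting_field_def)

lemma splitting_field_induct [consumes 1]:
  assumes x: "x \<in> splitting_field R" and R: "\<And>x. x \<in> R \<Longrightarrow> P x" and K: "\<And>x. x \<in> K \<Longrightarrow> P x"
    and d: "\<And>x y. x \<in> splitting_field R \<Longrightarrow> y \<in> splitting_field R \<Longrightarrow> P x \<Longrightarrow> P y \<Longrightarrow> P (x - y)"
    and m: "\<And>x y. x \<in> splitting_field R \<Longrightarrow> y \<in> splitting_field R \<Longrightarrow> P x \<Longrightarrow> P y \<Longrightarrow> P (x * y)"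
  shows "P x"
proof -
  interpret L: subfield_set "splitting_field R" by (rule splitting_field)
  let ?E = "{x \<in> splitting_field R. P x}"
  have KE: "K \<subseteq> ?E" "R \<subseteq> ?E" using splitting_field(2,3)[of R] R K by auto
  have "ring_set ?E" using KE one_in by unfold_locales (auto intro: L.diff_in L.mult_in d m)
  hence "subfield_set ?E" using KE by (intro subfield_setI)
  hence "splitting_field R \<subseteq> ?E" using splitting_field_least KE by blast
  thus ?thesis using x by blast
qed

lemma hom_on_mono: "hom_on E \<phi> \<Longrightarrow> F \<subseteq> E \<Longrightarrow> hom_on F \<phi>"
  by (auto simp: hom_on_def)

lemma hom_on_cong:
  assumes "ring_set E" "hom_on E \<phi>" "\<And>x. x \<in> E \<Longrightarrow> \<psi> x = \<phi> x"
  shows "hom_on E \<psi>"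
proof -
  interpret ring_set E by fact
  show ?thesis using assms one_in add_in mult_in by (auto simp: hom_on_def)
qed

lemma restrict_galois:
  assumes R: "separable_roots R" and E: "subfield_set E" "K \<subseteq> E" "R \<subseteq> E" and \<psi>: "hom_on E \<psi>"
    and fix_K: "\<And>x. x \<in> K \<Longrightarrow> \<psi> x = x"
  shows "(\<lambda>x. if x \<in> splitting_field R then \<psi> x else x) \<in> galois_group R"
proof -
  interpret L: subfield_set "splitting_field R" by (rule splitting_field)
  interpret E: subfield_set E by fact
  interpret \<psi>: field_hom E \<psi> by unfold_locales fact
  have LE: "splitting_field R \<subseteq> E" using splitting_field_least E by blast
  let ?s = "\<lambda>x. if x \<in> splitting_field R then \<psi> x else x"
  have "hom_on (splitting_field R) ?s"
    by (rule hom_on_cong[OF L.ring_set_axioms hom_on_mono[OF \<psi> LE]]) auto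
  moreover have "\<psi> x \<in> splitting_field R" if "x \<in> splitting_field R" for x
    using that
  proof (induction rule: splitting_field_induct)
    fix x assume x: "x \<in> R"
    obtain f where f: "coeffs_in K f" "poly f x = 0" "{y. poly f y = 0} \<subseteq> R"
      using R x unfolding separable_roots_def by blast
    have "poly (map_poly \<psi> f) (\<psi> x) = \<psi> (poly f x)"
      using \<psi>.poly_map coeffs_in_mono[OF E(2) f(1)] x E(3) by blast
    hence "poly f (\<psi> x) = 0" using map_poly_fixed[OF f(1) fix_K zero_in] f(2) \<psi>.hom_zero by simp
    thus "\<psi> x \<in> splitting_field R" using f(3) splitting_field(3) by blast
  next
    fix x assume "x \<in> K" thus "\<psi> x \<in> splitting_field R" using fix_K splitting_field(2) by auto
  next
    fix x y assume "x \<in> splitting_field R" "y \<in> splitting_field R" "\<psi> x \<in> splitting_field R" "\<psi> y \<in> splitting_field R"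
    thus "\<psi> (x - y) \<in> splitting_field R" "\<psi> (x * y) \<in> splitting_field R"
      using LE by (auto simp: \<psi>.hom_diff \<psi>.hom_mult subset_iff intro: L.diff_in L.mult_in)
  qed
  ultimately show ?thesis using fix_K splitting_field by (auto simp: galois_group_def)
qed

lemma galois_group_hom: "\<sigma> \<in> galois_group R \<Longrightarrow> field_hom (splitting_field R) \<sigma>"
  using splitting_field(1)[of R] by (auto simp: galois_group_def field_hom_def field_hom_axioms_def)

lemma galois_group_root:
  assumes R: "separable_roots R" and \<sigma>: "\<sigma> \<in> galois_group R" and x: "x \<in> R"
  shows "\<sigma> x \<in> R"
proof -
  interpret \<sigma>: field_hom "splitting_field R" \<sigma> using galois_group_hom \<sigma> .
  obtain f where f: "coeffs_in K f" "poly f x = 0" "{y. poly f y = 0} \<subseteq> R"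
    using R x unfolding separable_roots_def by blast
  have "poly (map_poly \<sigma> f) (\<sigma> x) = \<sigma> (poly f x)"
    using \<sigma>.poly_map coeffs_in_mono[OF splitting_field(2) f(1)] x splitting_field(3) by blast
  moreover have "map_poly \<sigma> f = f" by (rule map_poly_fixed[OF f(1) _ zero_in]) (use \<sigma> in \<open>auto simp: galois_group_def\<close>)
  ultimately have "poly f (\<sigma> x) = 0" using f(2) \<sigma>.hom_zero by simp
  thus ?thesis using f(3) by blast
qed

lemma galois_group_eqI:
  assumes "\<sigma> \<in> galois_group R" "\<tau> \<in> galois_group R" "\<And>x. x \<in> R \<Longrightarrow> \<sigma> x = \<tau> x"
  shows "\<sigma> = \<tau>"
proof
  fix x
  interpret \<sigma>: field_hom "splitting_field R" \<sigma> using galois_group_hom assms by blast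
  interpret \<tau>: field_hom "splitting_field R" \<tau> using galois_group_hom assms by blast
  show "\<sigma> x = \<tau> x"
  proof (cases "x \<in> splitting_field R")
    case True
    thus ?thesis
      by (induction rule: splitting_field_induct)
         (use assms in \<open>auto simp: galois_group_def \<sigma>.hom_diff \<tau>.hom_diff \<sigma>.hom_mult \<tau>.hom_mult\<close>)
  qed (use assms in \<open>simp add: galois_group_def\<close>)
qed

lemma finite_galois_group:
  assumes R: "separable_roots R"
  shows "finite (galois_group R)"
proof -
  let ?r = "\<lambda>\<sigma>. restrict \<sigma> R"
  have "inj_on ?r (galois_group R)"
  proof (rule inj_onI)
    fix \<sigma> \<tau> assume "\<sigma> \<in> galois_group R" "\<tau> \<in> galois_group R" and eq: "?r \<sigma> = ?r \<tau>"
    moreover have "\<sigma> x = \<tau> x" if "x \<in> R" for x using fun_cong[OF eq, of x] that by simp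
    ultimately show "\<sigma> = \<tau>" using galois_group_eqI by blast
  qed
  moreover have "?r ` galois_group R \<subseteq> R \<rightarrow>\<^sub>E R" using galois_group_root[OF R] by auto
  moreover have "finite (R \<rightarrow>\<^sub>E R)" using R by (intro finite_PiE) (auto simp: separable_roots_def)
  ultimately show ?thesis by (metis finite_imageD finite_subset)
qed

lemma galois_group_comp:
  assumes "\<sigma> \<in> galois_group R" "\<tau> \<in> galois_group R"
  shows "\<sigma> \<circ> \<tau> \<in> galois_group R"
  using assms by (auto simp: galois_group_def hom_on_def)

lemma galois_group_id: "id \<in> galois_group R"
  by (auto simp: galois_group_def hom_on_def)

lemma separable_divisor:
  fixes f :: "'a poly"
  assumes f: "f \<noteq> 0" "card {y. poly f y = 0} = degree f" and fpg: "f = p * g"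
  shows "card {y. poly p y = 0} = degree p" "{y. poly p y = 0} \<subseteq> {y. poly f y = 0}"
proof -
  have 0: "p \<noteq> 0" "g \<noteq> 0" using f fpg by auto
  have "{y. poly f y = 0} = {y. poly p y = 0} \<union> {y. poly g y = 0}" using fpg by auto
  hence "degree p + degree g \<le> card {y. poly p y = 0} + card {y. poly g y = 0}"
    using card_Un_le[of "{y. poly p y = 0}" "{y. poly g y = 0}"] f(2) fpg 0 by (simp add: degree_mult_eq)
  thus "card {y. poly p y = 0} = degree p" using card_poly_roots_bound[OF 0(1)] card_poly_roots_bound[OF 0(2)] by linarith
  show "{y. poly p y = 0} \<subseteq> {y. poly f y = 0}" using fpg by auto
qed

text \<open>Descent through intermediate fields. For a root \<open>a\<close> outside
  \<open>E\<close>, \<open>x\<close> is \<open>h(a)\<close> with \<open>h\<close> of smaller degree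
  than the minimal polynomial \<open>p\<close> of \<open>a\<close>. Each root \<open>b\<close> of
  \<open>p\<close> is the image of \<open>a\<close> under an automorphism that fixes
  \<open>E\<close>, and hence \<open>x\<close>; so \<open>h - x\<close> has \<open>degree p\<close>
  distinct roots and is zero.\<close>

lemma fixed_field:
  assumes R: "separable_roots R"
  shows "subfield_set E \<Longrightarrow> K \<subseteq> E \<Longrightarrow> E \<subseteq> splitting_field R \<Longrightarrow> x \<in> splitting_field R \<Longrightarrow>
    (\<And>\<sigma>. \<sigma> \<in> galois_group R \<Longrightarrow> (\<forall>y\<in>E. \<sigma> y = y) \<Longrightarrow> \<sigma> x = x) \<Longrightarrow> x \<in> E"
proof (induction "card (R - E)" arbitrary: E rule: less_induct)
  case less
  interpret E: subfield_set E by fact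
  have finR: "finite R" using R by (simp add: separable_roots_def)
  show ?case
  proof (cases "R \<subseteq> E")
    case True
    thus ?thesis using splitting_field_least less.prems by blast
  next
    case False
    then obtain a where a: "a \<in> R" "a \<notin> E" by blast
    obtain f where f: "coeffs_in K f" "f \<noteq> 0" "poly f a = 0" "card {y. poly f y = 0} = degree f" "{y. poly f y = 0} \<subseteq> R"
      using R a(1) unfolding separable_roots_def by blast
    have fE: "coeffs_in E f" using f(1) coeffs_in_mono less.prems by blast
    obtain p where p: "E.is_minpoly a p" using E.minpoly_exists[OF fE f(2,3)] .
    have pE: "coeffs_in E p" "lead_coeff p = 1" "poly p a = 0" using p by (auto simp: E.is_minpoly_def)
    obtain g where g: "f = p * g" using p fE f(3) unfolding E.is_minpoly_def by blast
    note sep = separable_divisor[OF f(2,4) g]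
    note ad = adjoin[OF less.prems(1,2), of a]
    have adL: "adjoin E a \<subseteq> splitting_field R"
    proof
      fix z assume "z \<in> adjoin E a"
      then obtain h where "coeffs_in E h" "z = poly h a" by (auto simp: adjoin_def)
      thus "z \<in> splitting_field R"
        using ring_set.poly_in[of "splitting_field R" h a] coeffs_in_mono[OF less.prems(3)] splitting_field[of R] a
        by (auto simp: subfield_set_def)
    qed
    have "x \<in> adjoin E a"
    proof (rule less.hyps)
      have "R - adjoin E a \<subset> R - E" using ad a by blast
      thus "card (R - adjoin E a) < card (R - E)" using finR by (intro psubset_card_mono) auto
      show "\<sigma> x = x" if "\<sigma> \<in> galois_group R" "\<forall>y\<in>adjoin E a. \<sigma> y = y" for \<sigma>
        using less.prems(5)[OF that(1)] that(2) ad(2) by blast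
    qed (use ad adL less.prems in auto)
    then obtain h0 where h0: "coeffs_in E h0" "x = poly h0 a" by (auto simp: adjoin_def)
    obtain q h where h: "coeffs_in E h" "h0 = p * q + h" "h = 0 \<or> degree h < degree p"
      using E.monic_division[OF pE(1,2) h0(1)] by blast
    have xh: "x = poly h a" using h0(2) h(2) pE(3) by simp
    have root: "poly h b = x" if b: "poly p b = 0" for b
    proof -
      have idE: "hom_on E id" by (simp add: hom_on_def)
      have mid: "map_poly id r = r" for r :: "'a poly" by (rule poly_eqI) (simp add: coeff_map_poly)
      have b': "poly (map_poly id p) b = 0" using b mid by simp
      obtain \<psi> where \<psi>: "hom_on (adjoin E a) \<psi>" "\<And>z. z \<in> E \<Longrightarrow> \<psi> z = id z"
          "\<And>h. coeffs_in E h \<Longrightarrow> \<psi> (poly h a) = poly (map_poly id h) b"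
        by (rule extend_simple[OF less.prems(1,2) idE p b']) blast
      obtain E' \<chi> where E': "subfield_set E'" "adjoin E a \<subseteq> E'" "R \<subseteq> E'" "hom_on E' \<chi>" "\<forall>z\<in>adjoin E a. \<chi> z = \<psi> z"
        using extend_finite[OF finR ad(1) _ \<psi>(1)] ad less.prems by blast
      have KE': "K \<subseteq> E'" using E'(2) ad less.prems by blast
      have fixE: "\<chi> z = z" if "z \<in> E" for z using E'(5) \<psi>(2)[OF that] ad that by auto
      let ?s = "\<lambda>x. if x \<in> splitting_field R then \<chi> x else x"
      have "?s \<in> galois_group R"
        by (rule restrict_galois[OF R E'(1) KE' E'(3,4)]) (use fixE less.prems in blast)
      moreover have "\<forall>y\<in>E. ?s y = y" using fixE by auto
      ultimately have "?s x = x" using less.prems(5) by blast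
      hence "\<chi> x = x" using less.prems by simp
      thus ?thesis using \<psi>(3)[OF h(1)] mid E'(5) \<open>x \<in> adjoin E a\<close> xh by simp
    qed
    have "h - [:x:] = 0"
    proof (rule ccontr)
      assume n: "h - [:x:] \<noteq> 0"
      have "degree p \<noteq> 0"
      proof
        assume "degree p = 0"
        then obtain c where "p = [:c:]" by (rule degree_eq_zeroE)
        thus False using pE by simp
      qed
      hence "degree (h - [:x:]) < degree p" using h(3) by (intro degree_diff_less) auto
      moreover have "{y. poly p y = 0} \<subseteq> {y. poly (h - [:x:]) y = 0}" using root by auto
      hence "card {y. poly p y = 0} \<le> card {y. poly (h - [:x:]) y = 0}"
        by (intro card_mono poly_roots_finite n)
      ultimately show False using card_poly_roots_bound[OF n] sep(1) by linarith
    qed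
    hence "x = coeff h 0" by (metis coeff_pCons_0 eq_iff_diff_eq_0)
    thus ?thesis using h(1) by (simp add: coeffs_in_def)
  qed
qed

end

section \<open>Extension of valuation rings\<close>

text \<open>The two relations lower the degree of each other, as in the classical proof of
  Chevalley's theorem.\<close>

lemma chevalley_descent:
  fixes y z :: "'a::field"
  assumes R: "ring_set R" and J: "J \<subseteq> R" "1 \<notin> J" "\<And>a b. a \<in> J \<Longrightarrow> b \<in> J \<Longrightarrow> a + b \<in> J"
      "\<And>a r. a \<in> J \<Longrightarrow> r \<in> R \<Longrightarrow> r * a \<in> J" "0 \<in> J"
    and yz: "y * z = 1"
    and p: "coeffs_in J p" "poly p y = 1" and r: "coeffs_in J r" "poly r z = 1"
    and deg: "degree r \<le> degree p"
  shows "\<exists>p'. coeffs_in J p' \<and> poly p' y = 1 \<and> degree p' < degree p"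
proof -
  interpret R: ring_set R by fact
  define n where "n = degree p"
  define k where "k = degree r"
  have y0: "y \<noteq> 0" using yz by auto
  have z: "z = 1 / y" using yz y0 by (simp add: field_simps)
  have n0: "n > 0"
  proof (rule ccontr)
    assume "\<not> n > 0"
    then obtain a where "p = [:a:]" unfolding n_def using degree_eq_zeroE by blast
    thus False using p J(2) by (auto simp: coeffs_in_def dest: spec[of _ 0])
  qed
  have Jsum: "(\<Sum>i\<in>A. f i) \<in> J" if "\<And>i. i \<in> A \<Longrightarrow> f i \<in> J" for A and f :: "nat \<Rightarrow> 'a"
    using that by (induction A rule: infinite_finite_induct) (auto intro: J)
  define b0 where "b0 = coeff r 0"
  define an where "an = coeff p n"
  have bJ: "coeff r j \<in> J" "coeff p j \<in> J" for j using r p by (auto simp: coeffs_in_def)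
  have b1: "1 - b0 \<in> R" unfolding b0_def using bJ J(1) by (intro R.diff_in R.one_in) auto
  \<comment> \<open>Multiplying \<open>poly r z = 1\<close> by \<open>y ^ n\<close> expresses
    \<open>(1 - b0) * y ^ n\<close> by lower powers of \<open>y\<close> with coefficients in
    \<open>J\<close>. This replaces the leading term of \<open>p\<close> after \<open>p\<close> has
    been multiplied by \<open>1 - b0\<close>; adding \<open>b0\<close> restores the value
    \<open>1\<close>.\<close>
  define p' where "p' = [:b0:] + smult (1 - b0) (p - monom an n) + smult an (\<Sum>j=1..k. monom (coeff r j) (n - j))"
  have cp': "coeff p' i = (if i = 0 then b0 else 0) + (1 - b0) * (coeff p i - (if i = n then an else 0))
      + (\<Sum>j=1..k. an * (if n - j = i then coeff r j else 0))" for i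
    by (simp add: p'_def coeff_sum sum_distrib_left coeff_pCons split: nat.splits)
  have neg: "- a \<in> J" if "a \<in> J" for a using J(4)[OF that, of "-1"] R.uminus_in[OF R.one_in] by simp
  have "coeff p' i \<in> J" for i
  proof -
    have "coeff p i - (if i = n then an else 0) \<in> J"
      using J(3)[OF bJ(2)[of i] neg[OF bJ(2)[of n]]] bJ by (auto simp: an_def)
    moreover have "(\<Sum>j=1..k. an * (if n - j = i then coeff r j else 0)) \<in> J"
    proof (rule Jsum)
      fix j
      have "an \<in> R" using bJ J(1) by (auto simp: an_def)
      thus "an * (if n - j = i then coeff r j else 0) \<in> J" using J(4,5) bJ by simp
    qed
    ultimately show ?thesis unfolding cp' using bJ J b1 by (intro J(3) J(4)) (auto simp: b0_def)
  qed
  moreover have "poly p' y = 1"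
  proof -
    have "poly r z = (\<Sum>j\<le>k. coeff r j * z ^ j)" by (simp add: poly_altdef k_def)
    also have "{..k} = insert 0 {1..k}" by auto
    finally have "1 = b0 + (\<Sum>j=1..k. coeff r j * z ^ j)" using r(2) by (simp add: b0_def)
    hence "1 - b0 = (\<Sum>j=1..k. coeff r j * z ^ j)" by (metis add_diff_cancel_left')
    hence "(1 - b0) * y ^ n = (\<Sum>j=1..k. coeff r j * z ^ j * y ^ n)" by (simp add: sum_distrib_right)
    also have "\<dots> = (\<Sum>j=1..k. coeff r j * y ^ (n - j))"
    proof (rule sum.cong)
      fix j assume "j \<in> {1..k}"
      hence "y ^ n = y ^ j * y ^ (n - j)" using deg by (simp add: n_def k_def flip: power_add)
      thus "coeff r j * z ^ j * y ^ n = coeff r j * y ^ (n - j)" using y0 by (simp add: z power_divide)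
    qed simp
    finally have "an * ((1 - b0) * y ^ n) = an * (\<Sum>j=1..k. coeff r j * y ^ (n - j))" by simp
    moreover have "poly p' y = b0 + (1 - b0) * (1 - an * y ^ n) + an * (\<Sum>j=1..k. coeff r j * y ^ (n - j))"
      using p(2) by (simp add: p'_def poly_sum poly_monom)
    moreover have "b0 + (1 - b0) * (1 - an * y ^ n) = 1 - an * ((1 - b0) * y ^ n)" by (simp add: algebra_simps)
    ultimately show ?thesis by (simp only: diff_add_cancel)
  qed
  moreover have "degree p' < n"
  proof -
    have "coeff p' i = 0" if "i > n - 1" for i
    proof -
      have "coeff p i - (if i = n then an else 0) = 0" using that n0 by (auto simp: an_def n_def coeff_eq_0)
      moreover have "(\<Sum>j=1..k. an * (if n - j = i then coeff r j else 0)) = 0"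
        using that n0 by (intro sum.neutral) auto
      ultimately show ?thesis using that by (simp add: cp')
    qed
    hence "degree p' \<le> n - 1" by (intro degree_le) auto
    thus ?thesis using n0 by simp
  qed
  ultimately show ?thesis unfolding coeffs_in_def n_def by blast
qed

text \<open>A ring maximal among those over \<open>A\<close> in which no nonzero element of
  \<open>P\<close> becomes invertible is a valuation ring. If it omits \<open>y\<close>, then
  adjoining \<open>y\<close> inverts an element of \<open>P\<close>, which is a relation
  \<open>1 = p(y)\<close> with coefficients in the ideal generated by \<open>P\<close>; such
  relations for both \<open>y\<close> and its inverse are excluded by descent.\<close>

theorem chevalley:
  fixes A P :: "'a::field set"
  assumes A: "ring_set A" and P: "P \<subseteq> A" "0 \<in> P" "\<And>x y. x \<in> P \<Longrightarrow> y \<in> P \<Longrightarrow> x / y \<in> A \<or> y / x \<in> A"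
      "\<And>x. x \<in> P \<Longrightarrow> x \<noteq> 0 \<Longrightarrow> inverse x \<notin> A"
  obtains V where "valuation_set V" "A \<subseteq> V" "P \<subseteq> max_ideal V"
proof -
  define F where "F = {R. ring_set R \<and> A \<subseteq> R \<and> (\<forall>x\<in>P - {0}. inverse x \<notin> R)}"
  have "\<exists>M\<in>F. \<forall>Y\<in>F. M \<subseteq> Y \<longrightarrow> Y = M"
  proof (rule subset_Zorn_nonempty)
    show "F \<noteq> {}" using A P(4) unfolding F_def by blast
    fix C assume C: "C \<noteq> {}" "subset.chain F C"
    have CF: "C \<subseteq> F" using C(2) by (auto simp: subset.chain_def)
    have tot: "Y \<subseteq> Z \<or> Z \<subseteq> Y" if "Y \<in> C" "Z \<in> C" for Y Z
      using C(2) that unfolding subset.chain_def by auto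
    have "ring_set (\<Union>C)"
    proof
      obtain Y where Y: "Y \<in> C" using C by blast
      hence "ring_set Y" using CF unfolding F_def by blast
      hence "1 \<in> Y" by (rule ring_set.one_in)
      thus "1 \<in> \<Union>C" using Y by blast
    next
      fix x y assume "x \<in> \<Union>C" "y \<in> \<Union>C"
      then obtain Y Y' where "Y \<in> C" "Y' \<in> C" "x \<in> Y" "y \<in> Y'" by blast
      then obtain Z where Z: "Z \<in> C" "x \<in> Z" "y \<in> Z" using tot by blast
      then interpret Z: ring_set Z using CF unfolding F_def by blast
      show "x - y \<in> \<Union>C" "x * y \<in> \<Union>C" using Z Z.diff_in Z.mult_in by blast+
    qed
    moreover have "A \<subseteq> \<Union>C" using C CF unfolding F_def by blast
    ultimately show "\<Union>C \<in> F" using CF unfolding F_def by blast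
  qed
  then obtain R where RF: "R \<in> F" and max: "\<And>Y. Y \<in> F \<Longrightarrow> R \<subseteq> Y \<Longrightarrow> Y = R" by blast
  have R: "ring_set R" using RF by (simp add: F_def)
  interpret R: ring_set R by fact
  have AR: "A \<subseteq> R" and PR: "\<And>x. x \<in> P \<Longrightarrow> x \<noteq> 0 \<Longrightarrow> inverse x \<notin> R" using RF by (auto simp: F_def)
  \<comment> \<open>Since the elements of \<open>P\<close> are comparable over \<open>A\<close>,
    single products already form an ideal.\<close>
  define J where "J = {x * r | x r. x \<in> P \<and> r \<in> R}"
  have J1: "J \<subseteq> R" using P(1) AR by (auto simp: J_def intro: R.mult_in)
  have J2: "1 \<notin> J"
  proof
    assume "1 \<in> J"
    then obtain x r where xr: "x \<in> P" "r \<in> R" "x * r = 1" by (auto simp: J_def)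
    hence "inverse x = r" by (metis inverse_unique)
    moreover have "x \<noteq> 0" using xr by auto
    ultimately show False using PR xr by blast
  qed
  have J3: "a + b \<in> J" if ab: "a \<in> J" "b \<in> J" for a b
  proof -
    obtain x r y s where h: "x \<in> P" "r \<in> R" "a = x * r" "y \<in> P" "s \<in> R" "b = y * s"
      using ab by (auto simp: J_def)
    have *: "x * r + y * s \<in> J" if "x \<in> P" "r \<in> R" "s \<in> R" "y / x \<in> A" "x \<noteq> 0" for x r y s
    proof -
      have "x * r + y * s = x * (r + y / x * s)" using that by (simp add: distrib_left)
      moreover have "r + y / x * s \<in> R" using that AR by (intro R.add_in R.mult_in) auto
      ultimately show ?thesis using that unfolding J_def by blast
    qed
    show ?thesis
    proof (cases "x = 0 \<or> y = 0")
      case True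
      thus ?thesis using ab h by auto
    next
      case False
      thus ?thesis using *[of x r s y] *[of y s r x] h P(3)[of x y] by (auto simp: add.commute)
    qed
  qed
  have J4: "r * a \<in> J" if ar: "a \<in> J" "r \<in> R" for a r
  proof -
    obtain x s where "x \<in> P" "s \<in> R" "a = x * s" using ar by (auto simp: J_def)
    hence "r * a = x * (r * s)" "r * s \<in> R" using ar by (auto intro: R.mult_in)
    thus ?thesis using \<open>x \<in> P\<close> unfolding J_def by blast
  qed
  have J5: "0 \<in> J" unfolding J_def using P(2) R.zero_in by force
  have rel: "\<exists>p. coeffs_in J p \<and> poly p y = 1" if y: "y \<notin> R" for y
  proof -
    define S where "S = {poly p y | p. coeffs_in R p}"
    have RS: "R \<subseteq> S"
    proof
      fix r assume "r \<in> R"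
      hence "coeffs_in R [:r:]" "r = poly [:r:] y" by (simp_all add: R.coeffs_in_const)
      thus "r \<in> S" unfolding S_def by blast
    qed
    have "coeffs_in R [:0, 1:]" "y = poly [:0, 1:] y"
      by (simp_all add: coeffs_in_pCons R.coeffs_in_0 R.one_in R.zero_in)
    hence yS: "y \<in> S" unfolding S_def by blast
    have "ring_set S"
    proof
      show "1 \<in> S" using RS R.one_in by blast
    next
      fix a b assume "a \<in> S" "b \<in> S"
      then obtain p q where "coeffs_in R p" "coeffs_in R q" "a = poly p y" "b = poly q y" unfolding S_def by blast
      hence "coeffs_in R (p - q)" "a - b = poly (p - q) y" "coeffs_in R (p * q)" "a * b = poly (p * q) y"
        by (simp_all add: R.coeffs_in_diff R.coeffs_in_mult)
      thus "a - b \<in> S" "a * b \<in> S" unfolding S_def by blast+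
    qed
    moreover have "S \<noteq> R" using y yS by blast
    ultimately have "\<exists>x\<in>P - {0}. inverse x \<in> S" using max[of S] RS AR unfolding F_def by blast
    then obtain x p where xp: "x \<in> P" "x \<noteq> 0" "inverse x = poly p y" "coeffs_in R p" by (auto simp: S_def)
    have "coeffs_in J (smult x p)" using xp by (auto simp: coeffs_in_def J_def)
    moreover have "poly (smult x p) y = 1" using xp by (simp flip: xp(3))
    ultimately show ?thesis by blast
  qed
  have desc: "\<exists>p'. coeffs_in J p' \<and> poly p' y = 1 \<and> degree p' < degree p"
    if "y * z = 1" "coeffs_in J p" "poly p y = 1" "coeffs_in J r" "poly r z = 1" "degree r \<le> degree p" for y z p r
    by (rule chevalley_descent[OF R J1 J2]) (fact J3 J4 J5 that)+
  have no: False if "y * z = 1" "coeffs_in J p" "poly p y = 1" "coeffs_in J r" "poly r z = 1" for y z p r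
    using that
  proof (induction "degree p + degree r" arbitrary: p r rule: less_induct)
    case less
    show ?case
    proof (cases "degree r \<le> degree p")
      case True
      then obtain p' where "coeffs_in J p'" "poly p' y = 1" "degree p' < degree p" using desc less.prems by blast
      thus ?thesis using less.hyps[of p' r] less.prems by simp
    next
      case False
      have zy: "z * y = 1" using less.prems(1) by (simp add: mult.commute)
      have "degree p \<le> degree r" using False by simp
      then obtain r' where "coeffs_in J r'" "poly r' z = 1" "degree r' < degree r" using desc[OF zy] less.prems by blast
      thus ?thesis using less.hyps[of p r'] less.prems by simp
    qed
  qed
  have "valuation_set R"
  proof unfold_locales
    fix x :: 'a
    show "x \<in> R \<or> inverse x \<in> R"
    proof (rule ccontr)
      assume h: "\<not> (x \<in> R \<or> inverse x \<in> R)"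
      hence "x \<noteq> 0" using R.zero_in by metis
      hence "x * inverse x = 1" by simp
      thus False using rel[of x] rel[of "inverse x"] no h by blast
    qed
  qed
  moreover have "P \<subseteq> max_ideal R" using PR by (auto simp: max_ideal_def)
  ultimately show ?thesis using that AR by blast
qed

section \<open>The residue characteristic\<close>

context valuation_set
begin

text \<open>Otherwise a Bezout identity of \<open>q\<close> and \<open>i\<close> would put
  \<open>1\<close> into \<open>\<mm>\<close>.\<close>

lemma coprime_notin_max:
  assumes "prime q" "of_nat q \<in> \<mm>" "of_nat i \<in> \<mm>"
  shows "q dvd i"
proof (rule ccontr)
  assume "\<not> q dvd i"
  hence "coprime (int q) (int i)" using assms(1) by (simp add: prime_imp_coprime)
  then obtain u v where "u * int q + v * int i = 1" by (metis bezout_int coprime_imp_gcd_eq_1)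
  hence "of_int u * of_nat q + of_int v * of_nat i = (1 :: 'a)"
    by (metis of_int_1 of_int_add of_int_mult of_int_of_nat_eq)
  moreover have "of_int u * of_nat q + of_int v * of_nat i \<in> \<mm>"
    by (intro max_add max_mult of_int_in assms)
  ultimately show False using one_notin_max by simp
qed

lemma prime_in_max:
  assumes "n > 0" "of_nat n \<in> \<mm>"
  obtains q where "prime q" "q dvd n" "of_nat q \<in> \<mm>"
proof -
  have "\<exists>q. prime q \<and> q dvd n \<and> of_nat q \<in> \<mm>" using assms
  proof (induction n rule: less_induct)
    case (less n)
    have "n \<noteq> 1" using less.prems one_notin_max by auto
    then obtain p where p: "prime p" "p dvd n" using prime_factor_nat by blast
    then obtain k where k: "n = p * k" by blast
    have "of_nat p * of_nat k \<in> \<mm>" using less.prems(2) k by simp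
    hence "of_nat p \<in> \<mm> \<or> of_nat k \<in> \<mm>" using max_prime of_nat_in by blast
    thus ?case
    proof
      assume "of_nat k \<in> \<mm>"
      moreover have "k > 0" "k < n" using k less.prems(1) prime_gt_1_nat[OF p(1)] by auto
      ultimately show ?thesis using less.IH[of k] k by (metis dvd_mult)
    qed (use p in blast)
  qed
  thus ?thesis using that by blast
qed

end

section \<open>The action of a finite Galois group on a henselian valuation\<close>

text \<open>\<open>V\<close> is any extension of the valuation ring to the whole type; only its
  trace on \<open>K\<close> is assumed to be henselian with separably closed residue field. That
  \<open>G\<close> preserves \<open>V\<close> on \<open>L\<close> is proved, in \<open>G_V\<close>.
  Inverses in \<open>G\<close> come from finiteness.\<close>

locale henselian_galois = valuation_set V for V :: "'a::field set" +
  fixes K L :: "'a set" and G :: "('a \<Rightarrow> 'a) set"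
  assumes K: "subfield_set K" and L: "subfield_set L" and KL: "K \<subseteq> L"
    and finite_G: "finite G" and id_G: "id \<in> G"
    and comp_G: "\<And>\<sigma> \<tau>. \<sigma> \<in> G \<Longrightarrow> \<tau> \<in> G \<Longrightarrow> \<sigma> \<circ> \<tau> \<in> G"
    and hom_G: "\<And>\<sigma>. \<sigma> \<in> G \<Longrightarrow> hom_on L \<sigma>"
    and maps_L: "\<And>\<sigma> x. \<sigma> \<in> G \<Longrightarrow> x \<in> L \<Longrightarrow> \<sigma> x \<in> L"
    and fix_out: "\<And>\<sigma> x. \<sigma> \<in> G \<Longrightarrow> x \<notin> L \<Longrightarrow> \<sigma> x = x"
    and fix_K: "\<And>\<sigma> x. \<sigma> \<in> G \<Longrightarrow> x \<in> K \<Longrightarrow> \<sigma> x = x"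
    and fixed_K: "\<And>x. x \<in> L \<Longrightarrow> (\<And>\<sigma>. \<sigma> \<in> G \<Longrightarrow> \<sigma> x = x) \<Longrightarrow> x \<in> K"
    and hensel: "\<And>f a. coeffs_in (V \<inter> K) f \<Longrightarrow> a \<in> V \<inter> K \<Longrightarrow> poly f a \<in> max_ideal V \<Longrightarrow>
      poly (pderiv f) a \<notin> max_ideal V \<Longrightarrow> \<exists>b\<in>V \<inter> K. poly f b = 0 \<and> b - a \<in> max_ideal V"
    and residue: "\<And>P. coeffs_in (V \<inter> K) P \<Longrightarrow> lead_coeff P = 1 \<Longrightarrow> degree P \<ge> 1 \<Longrightarrow>
      (\<exists>c\<in>V \<inter> K. poly P c \<in> max_ideal V) \<or>
      (\<exists>D E E'. coeffs_in (V \<inter> K) D \<and> coeffs_in (V \<inter> K) E \<and> coeffs_in (V \<inter> K) E' \<and>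
        lead_coeff D = 1 \<and> lead_coeff E = 1 \<and> degree D \<ge> 1 \<and>
        coeffs_in (max_ideal V) (P - D * E) \<and> coeffs_in (max_ideal V) (pderiv P - D * E'))"
begin

sublocale K: subfield_set K by (rule K)
sublocale L: subfield_set L by (rule L)

lemma field_hom_G: "\<sigma> \<in> G \<Longrightarrow> field_hom L \<sigma>"
  by unfold_locales (rule hom_G)

lemmas hom = field_hom.hom_add[OF field_hom_G] field_hom.hom_mult[OF field_hom_G]
  field_hom.hom_diff[OF field_hom_G] field_hom.hom_uminus[OF field_hom_G] field_hom.hom_one[OF field_hom_G]
  field_hom.hom_zero[OF field_hom_G] field_hom.hom_inverse[OF field_hom_G] field_hom.hom_divide[OF field_hom_G]
  field_hom.hom_power[OF field_hom_G] field_hom.hom_of_nat[OF field_hom_G]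

lemma inj_G: "\<sigma> \<in> G \<Longrightarrow> inj \<sigma>"
proof (rule injI)
  fix x y assume s: "\<sigma> \<in> G" and eq: "\<sigma> x = \<sigma> y"
  interpret s: field_hom L \<sigma> by (rule field_hom_G) fact
  show "x = y" using eq s.hom_inj[of x y] maps_L[OF s] fix_out[OF s] by metis
qed

lemma comp_image: "\<sigma> \<in> G \<Longrightarrow> (\<lambda>\<tau>. \<sigma> \<circ> \<tau>) ` G = G" "\<sigma> \<in> G \<Longrightarrow> inj_on (\<lambda>\<tau>. \<sigma> \<circ> \<tau>) G"
proof -
  assume s: "\<sigma> \<in> G"
  show i: "inj_on (\<lambda>\<tau>. \<sigma> \<circ> \<tau>) G"
    using inj_G[OF s] by (auto simp: inj_on_def fun_eq_iff)
  have "(\<lambda>\<tau>. \<sigma> \<circ> \<tau>) ` G \<subseteq> G" using comp_G[OF s] by auto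
  thus "(\<lambda>\<tau>. \<sigma> \<circ> \<tau>) ` G = G" using endo_inj_surj[OF finite_G _ i] by blast
qed

lemma inverse_G:
  assumes "\<sigma> \<in> G"
  obtains \<tau> where "\<tau> \<in> G" "\<sigma> \<circ> \<tau> = id" "\<tau> \<circ> \<sigma> = id"
proof -
  obtain \<tau> where t: "\<tau> \<in> G" "\<sigma> \<circ> \<tau> = id" using comp_image(1)[OF assms] id_G by (metis (no_types, lifting) imageE)
  have "\<sigma> (\<tau> (\<sigma> x)) = \<sigma> x" for x using fun_cong[OF t(2), of "\<sigma> x"] by simp
  hence "\<tau> \<circ> \<sigma> = id" using injD[OF inj_G[OF assms]] by (simp add: fun_eq_iff)
  thus ?thesis using that t by blast
qed

section \<open>Conjugates and the semilocal ring\<close>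

definition conjugates :: "'a \<Rightarrow> 'a set" where
  "conjugates x = (\<lambda>\<sigma>. \<sigma> x) ` G"

definition conjugates_poly :: "'a \<Rightarrow> 'a poly" where
  "conjugates_poly x = (\<Prod>y\<in>conjugates x. [:- y, 1:])"

lemma finite_conjugates: "finite (conjugates x)"
  by (simp add: conjugates_def finite_G)

lemma conjugates_self: "x \<in> conjugates x"
  unfolding conjugates_def using image_eqI[of x "\<lambda>\<sigma>. \<sigma> x" id G] id_G by simp

lemma conjugates_image: "\<sigma> \<in> G \<Longrightarrow> \<sigma> ` conjugates x = conjugates x"
proof -
  assume s: "\<sigma> \<in> G"
  have "\<sigma> ` conjugates x = (\<lambda>\<rho>. \<rho> x) ` ((\<lambda>\<tau>. \<sigma> \<circ> \<tau>) ` G)" by (auto simp: conjugates_def image_image)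
  thus ?thesis by (simp add: comp_image(1)[OF s] conjugates_def)
qed

lemma conjugates_poly:
  assumes x: "x \<in> L"
  shows "coeffs_in K (conjugates_poly x)" "lead_coeff (conjugates_poly x) = 1" "degree (conjugates_poly x) \<ge> 1"
    "poly (conjugates_poly x) y = 0 \<longleftrightarrow> y \<in> conjugates x"
proof -
  have oL: "conjugates x \<subseteq> L" using x maps_L by (auto simp: conjugates_def)
  show "lead_coeff (conjugates_poly x) = 1" by (simp add: conjugates_poly_def lead_coeff_prod)
  show "poly (conjugates_poly x) y = 0 \<longleftrightarrow> y \<in> conjugates x"
    using finite_conjugates by (simp add: conjugates_poly_def poly_prod)
  have "degree (conjugates_poly x) = card (conjugates x)"
    unfolding conjugates_poly_def by (subst degree_prod_sum_eq) auto
  thus "degree (conjugates_poly x) \<ge> 1" using finite_conjugates conjugates_self by (metis One_nat_def Suc_leI card_gt_0_iff empty_iff)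
  have cL: "coeffs_in L (\<Prod>y\<in>S. [:- y, 1:])" if "S \<subseteq> L" for S
    using that by (intro L.coeffs_in_prod)
      (auto simp: coeffs_in_pCons L.coeffs_in_0 L.one_in L.uminus_in_iff)
  have "map_poly \<sigma> (conjugates_poly x) = conjugates_poly x" if s: "\<sigma> \<in> G" for \<sigma>
  proof -
    interpret s: field_hom L \<sigma> by (rule field_hom_G) fact
    have "map_poly \<sigma> (\<Prod>y\<in>S. [:- y, 1:]) = (\<Prod>y\<in>S. [:- \<sigma> y, 1:])" if "S \<subseteq> L" "finite S" for S
      using that(2,1)
    proof (induction S rule: finite_induct)
      case (insert a S)
      have "coeffs_in L [:- a, 1:]" using insert.prems
        by (auto simp: coeffs_in_pCons L.coeffs_in_0 L.one_in L.uminus_in_iff)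
      hence "map_poly \<sigma> ([:- a, 1:] * (\<Prod>y\<in>S. [:- y, 1:])) = map_poly \<sigma> [:- a, 1:] * map_poly \<sigma> (\<Prod>y\<in>S. [:- y, 1:])"
        using insert.prems cL[of S] by (intro s.map_mult) auto
      moreover have "map_poly \<sigma> [:- a, 1:] = [:- \<sigma> a, 1:]"
        using insert.prems s.hom_one s.hom_zero s.hom_uminus[of a] by (simp add: map_poly_pCons)
      moreover have "map_poly \<sigma> (\<Prod>y\<in>S. [:- y, 1:]) = (\<Prod>y\<in>S. [:- \<sigma> y, 1:])" using insert by simp
      ultimately show ?case by (simp only: prod.insert[OF insert.hyps(1,2)])
    qed (simp add: s.hom_one)
    hence "map_poly \<sigma> (conjugates_poly x) = (\<Prod>y\<in>conjugates x. [:- \<sigma> y, 1:])"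
      using oL finite_conjugates by (simp add: conjugates_poly_def)
    also have "\<dots> = (\<Prod>y\<in>\<sigma> ` conjugates x. [:- y, 1:])"
      by (subst prod.reindex) (use inj_G[OF s] in \<open>auto simp: inj_on_def\<close>)
    finally show ?thesis by (simp add: conjugates_image[OF s] conjugates_poly_def)
  qed
  hence "\<sigma> (coeff (conjugates_poly x) i) = coeff (conjugates_poly x) i" if "\<sigma> \<in> G" for \<sigma> i
    using that by (metis coeff_map_poly hom(6))
  moreover have "coeff (conjugates_poly x) i \<in> L" for i using cL[OF oL] by (simp add: conjugates_poly_def coeffs_in_def)
  ultimately show "coeffs_in K (conjugates_poly x)" using fixed_K by (auto simp: coeffs_in_def)
qed

sublocale VK: ring_set "V \<inter> K"
  by unfold_locales (auto intro: one_in diff_in mult_in K.one_in K.diff_in K.mult_in)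

lemma conjugates_poly_V:
  assumes "x \<in> L" "\<And>\<sigma>. \<sigma> \<in> G \<Longrightarrow> \<sigma> x \<in> V"
  shows "coeffs_in (V \<inter> K) (conjugates_poly x)"
proof -
  have "coeffs_in V (conjugates_poly x)" unfolding conjugates_poly_def conjugates_def
    by (intro coeffs_in_prod) (use assms in \<open>auto simp: coeffs_in_pCons coeffs_in_0 one_in uminus_in_iff\<close>)
  thus ?thesis using conjugates_poly(1)[OF assms(1)] by (simp add: coeffs_in_def)
qed

text \<open>The largest \<open>G\<close>-invariant part of \<open>V \<inter> L\<close>, an
  intersection of conjugate valuation rings. That it is all of \<open>V \<inter> L\<close> follows
  from \<open>G_V\<close>.\<close>

definition semilocal :: "'a set" where
  "semilocal = {x \<in> L. \<forall>\<sigma>\<in>G. \<sigma> x \<in> V}"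

lemma semilocal_ring: "ring_set semilocal"
  by unfold_locales
    (auto simp: semilocal_def hom intro: one_in diff_in mult_in L.one_in L.diff_in L.mult_in)

sublocale A: ring_set semilocal by (rule semilocal_ring)

lemma semilocal_V: "x \<in> semilocal \<Longrightarrow> x \<in> V"
  using id_G unfolding semilocal_def by (metis (no_types, lifting) id_apply mem_Collect_eq)

lemma semilocal_maps: "x \<in> semilocal \<Longrightarrow> \<sigma> \<in> G \<Longrightarrow> \<sigma> x \<in> semilocal"
  using comp_G by (force simp: semilocal_def maps_L)

lemma VK_semilocal: "V \<inter> K \<subseteq> semilocal"
  using KL by (auto simp: semilocal_def fix_K)

text \<open>Modulo \<open>\<mm>\<close> the element is algebraic over the residue field of
  \<open>V \<inter> K\<close>, so its inverse is a polynomial in it. Dropping constant coefficients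
  in \<open>\<mm>\<close> from the conjugates polynomial, and dividing by \<open>x\<close> each
  time, leads to a relation with a unit \<open>c\<close> as constant term.\<close>

lemma residual_inverse:
  assumes x: "x \<in> semilocal" "x \<notin> \<mm>"
  shows "\<exists>y\<in>semilocal. x * y - 1 \<in> \<mm>"
proof -
  have xL: "x \<in> L" and xV: "\<And>\<sigma>. \<sigma> \<in> G \<Longrightarrow> \<sigma> x \<in> V" using x by (auto simp: semilocal_def)
  have xu: "x \<in> V" using semilocal_V x by blast
  have *: "\<exists>c q. c \<in> V \<inter> K \<and> c \<notin> \<mm> \<and> coeffs_in (V \<inter> K) q \<and> c + x * poly q x \<in> \<mm>"
    if "coeffs_in (V \<inter> K) P" "\<not> coeffs_in \<mm> P" "poly P x \<in> \<mm>" for P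
    using that
  proof (induction P)
    case 0
    thus ?case by (simp add: coeffs_in_def zero_max)
  next
    case (pCons a P)
    have a: "a \<in> V \<inter> K" "coeffs_in (V \<inter> K) P" using pCons.prems(1) by (simp_all only: coeffs_in_pCons)
    show ?case
    proof (cases "a \<in> \<mm>")
      case True
      have "x * poly P x \<in> \<mm>" using max_diff[OF pCons.prems(3) True] by simp
      moreover have "poly P x \<in> V" using a(2) by (intro poly_in coeffs_in_mono[OF _ a(2)] xu) auto
      ultimately have "poly P x \<in> \<mm>" using max_prime[OF xu] x by blast
      moreover have "\<not> coeffs_in \<mm> P" using pCons.prems(2) True by (simp add: coeffs_in_pCons)
      ultimately show ?thesis using pCons.IH a by blast
    next
      case False
      thus ?thesis using a pCons.prems(3) by (intro exI[of _ a] exI[of _ P]) auto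
    qed
  qed
  have n: "\<not> coeffs_in \<mm> (conjugates_poly x)"
    using conjugates_poly(2)[OF xL] one_notin_max by (metis coeffs_in_def)
  have "poly (conjugates_poly x) x = 0" using conjugates_poly(4)[OF xL] conjugates_self by blast
  moreover have "coeffs_in (V \<inter> K) (conjugates_poly x)"
    by (rule conjugates_poly_V[OF xL]) (use xV in blast)
  ultimately obtain c q where c: "c \<in> V \<inter> K" "c \<notin> \<mm>" "coeffs_in (V \<inter> K) q" "c + x * poly q x \<in> \<mm>"
    using *[OF _ n] zero_max by auto
  have c': "1 / c \<in> V \<inter> K" using c unit_iff[of c] K.divide_in[OF K.one_in] by blast
  define y where "y = - (poly q x * (1 / c))"
  have "y \<in> semilocal" unfolding y_def
    using VK_semilocal c' c(3) x by (intro A.uminus_in A.mult_in A.poly_in coeffs_in_mono[OF VK_semilocal c(3)]) auto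
  moreover have "x * y - 1 \<in> \<mm>"
  proof -
    have c0: "c \<noteq> 0" using c zero_max by auto
    have "x * y - 1 = - (1 / c) * (c + x * poly q x)" using c0 by (simp add: y_def field_simps)
    moreover have "- (1 / c) * (c + x * poly q x) \<in> \<mm>" using c' c by (intro max_mult uminus_in) auto
    ultimately show ?thesis by simp
  qed
  ultimately show ?thesis by blast
qed

text \<open>Division by an element of least value is the normalization used for coefficients, for
  conjugates and for the differences \<open>\<sigma> x / x - 1\<close>.\<close>

lemma max_value:
  fixes S :: "'a set"
  assumes "finite S" "S \<noteq> {}" "0 \<notin> S"
  shows "\<exists>s\<in>S. \<forall>t\<in>S. t / s \<in> V"
  using assms
proof (induction S rule: finite_ne_induct)
  case (singleton x)
  thus ?case using one_in by simp
next
  case (insert x S)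
  then obtain s where s: "s \<in> S" "\<forall>t\<in>S. t / s \<in> V" by auto
  show ?case
  proof (cases "x / s \<in> V")
    case True
    thus ?thesis using s by auto
  next
    case False
    hence sx: "s / x \<in> V" using comparable by blast
    have "t / x \<in> V" if "t \<in> S" for t
    proof -
      have "t / s * (s / x) \<in> V" using s(2) that sx mult_in by blast
      moreover have "s \<noteq> 0" using s insert.prems by auto
      ultimately show ?thesis by simp
    qed
    thus ?thesis using insert.prems one_in by auto
  qed
qed

lemma primitive_relation:
  assumes x: "x \<in> L"
  obtains f where "coeffs_in (V \<inter> K) f" "\<not> coeffs_in \<mm> f" "poly f x = 0"
proof -
  define P where "P = conjugates_poly x"
  have P: "coeffs_in K P" "lead_coeff P = 1" "poly P x = 0"
    using conjugates_poly[OF x] conjugates_self by (auto simp: P_def)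
  define S where "S = coeff P ` {i. i \<le> degree P \<and> coeff P i \<noteq> 0}"
  have "1 \<in> S" unfolding S_def using P(2) by force
  moreover have "finite S" "0 \<notin> S" by (auto simp: S_def)
  ultimately obtain s where s: "s \<in> S" "\<forall>t\<in>S. t / s \<in> V" using max_value[of S] by blast
  then obtain j where j: "s = coeff P j" "s \<noteq> 0" by (auto simp: S_def)
  have sK: "s \<in> K" using P(1) j by (auto simp: coeffs_in_def)
  define f where "f = smult (1 / s) P"
  have "coeff f i \<in> V" for i
  proof (cases "coeff P i = 0")
    case False
    hence "coeff P i \<in> S" unfolding S_def using le_degree by auto
    thus ?thesis using s(2) by (simp add: f_def)
  qed (simp add: f_def zero_in)
  moreover have "coeff f i \<in> K" for i
    using P(1) K.divide_in sK by (simp add: f_def coeffs_in_def)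
  moreover have "coeff f j = 1" using j by (simp add: f_def)
  hence "\<not> coeffs_in \<mm> f" using one_notin_max by (metis coeffs_in_def)
  ultimately show ?thesis using that[of f] P(3) by (auto simp: coeffs_in_def f_def)
qed

text \<open>Every element of \<open>V \<inter> L\<close> is a fraction with denominator in the semilocal ring outside the
  maximal ideal of \<open>V\<close>: split a primitive relation for \<open>x\<close> at the last unit coefficient.\<close>

lemma semilocal_fraction:
  assumes x: "x \<in> L" "x \<in> V"
  obtains y where "y \<in> semilocal" "y \<notin> \<mm>" "x * y \<in> semilocal"
proof (cases "x = 0")
  case True
  thus ?thesis using that[of 1] A.one_in one_notin_max A.zero_in by simp
next
  case x0: False
  have *: "\<exists>y\<in>semilocal. y \<notin> \<mm> \<and> x * y \<in> semilocal"
    if "coeffs_in (V \<inter> K) f" "\<not> coeffs_in \<mm> f" "coeffs_in (V \<inter> K) q" "poly f x + 1 / x * poly q (1 / x) = 0" for f q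
    using that
  proof (induction f arbitrary: q)
    case 0
    thus ?case by (simp add: coeffs_in_def zero_max)
  next
    case (pCons a f)
    have a: "a \<in> V \<inter> K" "coeffs_in (V \<inter> K) f" using pCons.prems(1) by (simp_all only: coeffs_in_pCons)
    show ?case
    proof (cases "coeffs_in \<mm> f")
      case False
      have "poly f x + 1 / x * poly (pCons a q) (1 / x) = (poly (pCons a f) x + 1 / x * poly q (1 / x)) / x"
        using x0 by (simp add: field_simps)
      hence "poly f x + 1 / x * poly (pCons a q) (1 / x) = 0" using pCons.prems(4) by simp
      moreover have "coeffs_in (V \<inter> K) (pCons a q)" using a pCons.prems(3) by (simp only: coeffs_in_pCons simp_thms)
      ultimately show ?thesis using pCons.IH a False by blast
    next
      case True
      \<comment> \<open>Thus \<open>y\<close> is a polynomial in \<open>x\<close>, and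
        \<open>x * y\<close> is one in \<open>1 / x\<close>. For each \<open>\<sigma>\<close> one of
        \<open>\<sigma> x\<close> and \<open>1 / \<sigma> x\<close> is in \<open>V\<close>, and
        either way both \<open>\<sigma> y\<close> and \<open>\<sigma> (x * y)\<close> are.\<close>
      define y where "y = poly (pCons a f) x"
      have ym: "y \<notin> \<mm>"
      proof
        assume "y \<in> \<mm>"
        moreover have "x * poly f x \<in> \<mm>" using poly_in_max[OF True x(2)] max_mult x(2) by blast
        ultimately have "a \<in> \<mm>" using max_diff[of y "x * poly f x"] by (simp add: y_def)
        thus False using pCons.prems(2) True by (simp add: coeffs_in_pCons)
      qed
      have fL: "coeffs_in L (pCons a f)" "coeffs_in L q" using coeffs_in_mono[OF _ pCons.prems(1), of L]
          coeffs_in_mono[OF _ pCons.prems(3), of L] KL by auto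
      have yL: "y \<in> L" unfolding y_def using L.poly_in[OF fL(1) x(1)] .
      have xL: "1 / x \<in> L" using L.divide_in[OF L.one_in x(1)] .
      have xy: "x * y = - poly q (1 / x)"
        using pCons.prems(4) x0 unfolding y_def[symmetric] by (simp add: field_simps eq_neg_iff_add_eq_0)
      have fixp: "\<sigma> (poly h w) = poly h (\<sigma> w)" if "\<sigma> \<in> G" "coeffs_in (V \<inter> K) h" "w \<in> L" for \<sigma> h w
      proof -
        interpret s: field_hom L \<sigma> by (rule field_hom_G) fact
        have hL: "coeffs_in L h" using coeffs_in_mono[OF _ that(2), of L] KL by auto
        have "map_poly \<sigma> h = h"
          by (rule map_poly_fixed[of K]) (use that fix_K K.zero_in in \<open>auto simp: coeffs_in_def\<close>)
        thus ?thesis using s.poly_map[OF hL that(3)] by simp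
      qed
      have "\<sigma> y \<in> V \<and> \<sigma> (x * y) \<in> V" if s: "\<sigma> \<in> G" for \<sigma>
      proof (cases "\<sigma> x \<in> V")
        case True
        have "\<sigma> y \<in> V" unfolding y_def using fixp[OF s pCons.prems(1) x(1)]
          poly_in[OF coeffs_in_mono[OF _ pCons.prems(1)] True] by auto
        thus ?thesis using hom(2)[OF s x(1) yL] mult_in True by simp
      next
        case False
        have sx: "\<sigma> (1 / x) = 1 / \<sigma> x" using hom(8)[OF s L.one_in x(1)] hom(5)[OF s] by simp
        have sV: "1 / \<sigma> x \<in> V" using False total[of "\<sigma> x"] by (auto simp: inverse_eq_divide)
        have s0: "\<sigma> x \<noteq> 0" using False zero_in by auto
        have "\<sigma> (x * y) = - poly q (\<sigma> (1 / x))" unfolding xy using hom(4)[OF s] L.poly_in[OF fL(2) xL]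
          fixp[OF s pCons.prems(3) xL] by simp
        hence *: "\<sigma> (x * y) \<in> V" using poly_in[OF coeffs_in_mono[OF _ pCons.prems(3)] sV] sx uminus_in by auto
        have "\<sigma> y = 1 / \<sigma> x * \<sigma> (x * y)" using hom(2)[OF s x(1) yL] s0 by simp
        thus ?thesis using * mult_in[OF sV *] by simp
      qed
      thus ?thesis using ym yL x(1) L.mult_in unfolding semilocal_def by blast
    qed
  qed
  obtain f where f: "coeffs_in (V \<inter> K) f" "\<not> coeffs_in \<mm> f" "poly f x = 0"
    using primitive_relation[OF x(1)] .
  have "\<exists>y\<in>semilocal. y \<notin> \<mm> \<and> x * y \<in> semilocal"
    by (rule *[OF f(1,2) VK.coeffs_in_0]) (use f in simp)
  thus ?thesis using that by blast
qed

definition decomposition :: "('a \<Rightarrow> 'a) set" where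
  "decomposition = {\<sigma> \<in> G. \<forall>x\<in>semilocal. \<sigma> x \<in> \<mm> \<longleftrightarrow> x \<in> \<mm>}"

text \<open>The elements \<open>\<tau>\<close> of \<open>G\<close> that satisfy the hypothesis in
  place of \<open>\<sigma>\<close> are permuted by composition with \<open>\<sigma>\<close>, as
  there are finitely many. The identity is one of them, so the inverse of \<open>\<sigma>\<close> is
  too, and this is the other inclusion.\<close>

lemma decompositionI:
  assumes s: "\<sigma> \<in> G" and h: "\<And>x. x \<in> semilocal \<Longrightarrow> \<sigma> x \<in> \<mm> \<Longrightarrow> x \<in> \<mm>"
  shows "\<sigma> \<in> decomposition"
proof -
  define S where "S = {\<tau> \<in> G. \<forall>x\<in>semilocal. \<tau> x \<in> \<mm> \<longrightarrow> x \<in> \<mm>}"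
  have sS: "\<sigma> \<circ> \<tau> \<in> S" if t: "\<tau> \<in> S" for \<tau>
  proof -
    have "x \<in> \<mm>" if "x \<in> semilocal" "\<sigma> (\<tau> x) \<in> \<mm>" for x
      using t that h[of "\<tau> x"] semilocal_maps[of x \<tau>] unfolding S_def by blast
    moreover have "\<sigma> \<circ> \<tau> \<in> G" using t comp_G[OF s] by (simp add: S_def)
    ultimately show ?thesis by (simp add: S_def)
  qed
  have "inj_on (\<lambda>\<tau>. \<sigma> \<circ> \<tau>) S" using comp_image(2)[OF s] by (rule inj_on_subset) (auto simp: S_def)
  moreover have "(\<lambda>\<tau>. \<sigma> \<circ> \<tau>) ` S \<subseteq> S" using sS by blast
  moreover have "finite S" using finite_G by (simp add: S_def)
  ultimately have "(\<lambda>\<tau>. \<sigma> \<circ> \<tau>) ` S = S" by (intro endo_inj_surj)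
  moreover have "id \<in> S" using id_G by (simp add: S_def)
  ultimately obtain \<tau> where t: "\<tau> \<in> S" "\<sigma> \<circ> \<tau> = id" by (metis (no_types, lifting) imageE)
  have "\<tau> (\<sigma> x) = x" for x using injD[OF inj_G[OF s]] fun_cong[OF t(2), of "\<sigma> x"] by simp
  hence "\<sigma> x \<in> \<mm>" if "x \<in> semilocal" "x \<in> \<mm>" for x
    using t(1) semilocal_maps[OF that(1) s] that(2) unfolding S_def by auto
  thus ?thesis using s h by (auto simp: decomposition_def)
qed

lemma decomposition_comp: "\<sigma> \<in> decomposition \<Longrightarrow> \<tau> \<in> decomposition \<Longrightarrow> \<sigma> \<circ> \<tau> \<in> decomposition"
  using comp_G semilocal_maps by (auto simp: decomposition_def)

text \<open>If the decomposition group \<open>D\<close> were smaller than \<open>G\<close>, the \<open>D\<close>-norm of a suitable element of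
  the semilocal ring would be \<open>1\<close> modulo the maximal ideal while all its other conjugates are \<open>0\<close>.
  By Hensel's Lemma its characteristic polynomial then has a root in \<open>K\<close>.\<close>

lemma decomposition_eq: "decomposition = G"
proof (rule ccontr)
  let ?D = decomposition
  assume "?D \<noteq> G"
  then obtain \<sigma>0 where \<sigma>0: "\<sigma>0 \<in> G" "\<sigma>0 \<notin> ?D" by (auto simp: decomposition_def)
  have DG: "?D \<subseteq> G" by (auto simp: decomposition_def)
  have finD: "finite ?D" "finite (G - ?D)" using finite_G DG finite_subset by auto
  \<comment> \<open>Failure of the criterion \<open>decompositionI\<close> gives
    \<open>x \<notin> \<mm>\<close> with \<open>\<sigma> x \<in> \<mm>\<close>; a residual inverse
    normalizes it to \<open>1\<close>.\<close>
  have "\<exists>e\<in>semilocal. e - 1 \<in> \<mm> \<and> \<sigma> e \<in> \<mm>" if s: "\<sigma> \<in> G - ?D" for \<sigma>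
  proof -
    obtain x where x: "x \<in> semilocal" "\<sigma> x \<in> \<mm>" "x \<notin> \<mm>" using s decompositionI by blast
    obtain y where y: "y \<in> semilocal" "x * y - 1 \<in> \<mm>" using residual_inverse x by blast
    have "\<sigma> (x * y) = \<sigma> x * \<sigma> y" using x y s hom(2)[of \<sigma> x y] by (auto simp: semilocal_def)
    moreover have "\<sigma> x * \<sigma> y \<in> \<mm>" using x y s by (intro max_mult') (auto simp: semilocal_def)
    ultimately show ?thesis using x y A.mult_in by (intro bexI[of _ "x * y"]) auto
  qed
  then obtain e where e: "\<And>\<sigma>. \<sigma> \<in> G - ?D \<Longrightarrow> e \<sigma> \<in> semilocal" "\<And>\<sigma>. \<sigma> \<in> G - ?D \<Longrightarrow> e \<sigma> - 1 \<in> \<mm>"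
      "\<And>\<sigma>. \<sigma> \<in> G - ?D \<Longrightarrow> \<sigma> (e \<sigma>) \<in> \<mm>" by metis
  have one_prod: "(\<Prod>i\<in>S. f i) - 1 \<in> \<mm>" if "\<And>i. i \<in> S \<Longrightarrow> f i \<in> V" "\<And>i. i \<in> S \<Longrightarrow> f i - 1 \<in> \<mm>"
    for f :: "('a \<Rightarrow> 'a) \<Rightarrow> 'a" and S
    using that
  proof (induction S rule: infinite_finite_induct)
    case (insert i S)
    have "(\<Prod>i\<in>insert i S. f i) - 1 = f i * ((\<Prod>i\<in>S. f i) - 1) + (f i - 1)"
      using insert by (simp add: algebra_simps)
    moreover have "f i * ((\<Prod>i\<in>S. f i) - 1) + (f i - 1) \<in> \<mm>" using insert by (intro max_add max_mult) auto
    ultimately show ?case by (simp only:)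
  qed (simp_all add: zero_max)
  have max_prod: "(\<Prod>i\<in>S. f i) \<in> \<mm>" if "finite S" "\<And>i. i \<in> S \<Longrightarrow> f i \<in> V" "j \<in> S" "f j \<in> \<mm>"
    for f :: "('a \<Rightarrow> 'a) \<Rightarrow> 'a" and S j
    using that by (subst prod.remove[of S j]) (auto intro!: max_mult' prod_in)
  \<comment> \<open>The product over all \<open>\<sigma>\<close> outside the decomposition group
    satisfies the congruences for all of them at once; its norm \<open>c\<close> over that group is
    moreover fixed by the group.\<close>
  define b where "b = (\<Prod>\<sigma>\<in>G - ?D. e \<sigma>)"
  have bA: "b \<in> semilocal" unfolding b_def by (intro A.prod_in e)
  have eL: "e \<sigma> \<in> L" if "\<sigma> \<in> G - ?D" for \<sigma> using e(1)[OF that] by (simp add: semilocal_def)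
  have b1: "b - 1 \<in> \<mm>" unfolding b_def by (intro one_prod e(2)) (use e(1) semilocal_V in blast)
  have bm: "\<sigma> b \<in> \<mm>" if s: "\<sigma> \<in> G - ?D" for \<sigma>
  proof -
    have "\<sigma> b = (\<Prod>\<tau>\<in>G - ?D. \<sigma> (e \<tau>))" unfolding b_def
      using field_hom.hom_prod[OF field_hom_G, of \<sigma> "G - ?D" e] s eL by blast
    moreover have "(\<Prod>\<tau>\<in>G - ?D. \<sigma> (e \<tau>)) \<in> \<mm>"
      using e s finD by (intro max_prod[of _ _ \<sigma>]) (auto simp: semilocal_def)
    ultimately show ?thesis by simp
  qed
  define c where "c = (\<Prod>\<tau>\<in>?D. \<tau> b)"
  have tbA: "\<tau> b \<in> semilocal" if "\<tau> \<in> G" for \<tau> using semilocal_maps[OF bA that] .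
  have cA: "c \<in> semilocal" unfolding c_def by (intro A.prod_in tbA) (use DG in blast)
  have cL: "c \<in> L" using cA by (simp add: semilocal_def)
  have sc: "\<sigma> c = (\<Prod>\<tau>\<in>?D. \<sigma> (\<tau> b))" if "\<sigma> \<in> G" for \<sigma>
    unfolding c_def using field_hom.hom_prod[OF field_hom_G[OF that], of ?D "\<lambda>\<tau>. \<tau> b"] tbA DG by (auto simp: semilocal_def)
  have c1: "c - 1 \<in> \<mm>" unfolding c_def
  proof (rule one_prod)
    fix \<tau> assume t: "\<tau> \<in> ?D"
    show "\<tau> b \<in> V" using tbA semilocal_V t DG by blast
    have "\<tau> (b - 1) \<in> \<mm>" using t b1 bA A.diff_in[OF bA A.one_in] by (auto simp: decomposition_def)
    moreover have "\<tau> (b - 1) = \<tau> b - 1"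
      using hom(3)[of \<tau> b 1] hom(5)[of \<tau>] t DG bA L.one_in by (auto simp: semilocal_def)
    ultimately show "\<tau> b - 1 \<in> \<mm>" by simp
  qed
  have cm: "c \<notin> \<mm>" using max_diff[of c "c - 1"] c1 one_notin_max by auto
  have cs: "\<sigma> c \<in> \<mm>" if s: "\<sigma> \<in> G" "\<sigma> \<notin> ?D" for \<sigma>
  proof -
    have "id \<in> ?D" using id_G by (simp add: decomposition_def)
    moreover have "\<sigma> b \<in> \<mm>" using bm s by blast
    ultimately show ?thesis unfolding sc[OF s(1)]
      using finD tbA semilocal_V semilocal_maps s DG by (intro max_prod[of _ _ id]) auto
  qed
  have cf: "\<sigma> c = c" if s: "\<sigma> \<in> ?D" for \<sigma>
  proof -
    have "inj_on (\<lambda>\<tau>. \<sigma> \<circ> \<tau>) ?D" using comp_image(2)[of \<sigma>] s DG inj_on_subset by blast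
    hence "(\<lambda>\<tau>. \<sigma> \<circ> \<tau>) ` ?D = ?D" using decomposition_comp[OF s] finD by (intro endo_inj_surj) auto
    hence "c = (\<Prod>\<tau>\<in>(\<lambda>\<tau>. \<sigma> \<circ> \<tau>) ` ?D. \<tau> b)" by (simp add: c_def)
    also have "\<dots> = (\<Prod>\<tau>\<in>?D. \<sigma> (\<tau> b))" by (subst prod.reindex) (use \<open>inj_on _ _\<close> in auto)
    finally show ?thesis using sc s DG by auto
  qed
  have conj: "y \<in> \<mm>" if "y \<in> conjugates c - {c}" for y
    using that cs cf by (auto simp: conjugates_def)
  define Q where "Q = (\<Prod>y\<in>conjugates c - {c}. [:- y, 1:])"
  have P: "conjugates_poly c = [:- c, 1:] * Q"
    unfolding conjugates_poly_def Q_def by (rule prod.remove[OF finite_conjugates conjugates_self])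
  have cV: "c \<in> V" using cA semilocal_V by blast
  have QV: "coeffs_in V Q" unfolding Q_def using conj max_ideal_subset
    by (intro coeffs_in_prod) (auto simp: coeffs_in_pCons coeffs_in_0 one_in uminus_in_iff)
  have PV: "coeffs_in (V \<inter> K) (conjugates_poly c)"
    by (rule conjugates_poly_V[OF cL]) (use cA in \<open>auto simp: semilocal_def\<close>)
  have c1': "1 - c \<in> \<mm>" using max_uminus[OF c1] by simp
  have Q1: "poly Q 1 \<in> V - \<mm>" unfolding Q_def poly_prod
  proof (rule unit_prod)
    fix y assume "y \<in> conjugates c - {c}"
    thus "poly [:- y, 1:] 1 \<in> V - \<mm>" using unit_add_max[OF one_unit max_uminus[OF conj]] by simp
  qed
  \<comment> \<open>Modulo \<open>\<mm>\<close> the conjugates polynomial of \<open>c\<close> is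
    \<open>X - 1\<close> times a power of \<open>X\<close>, so \<open>1\<close> is a simple residual
    root.\<close>
  have "poly (conjugates_poly c) 1 = (1 - c) * poly Q 1" unfolding P by (simp add: algebra_simps)
  moreover have "(1 - c) * poly Q 1 \<in> \<mm>" using max_mult'[OF _ c1'] Q1 by blast
  ultimately have "poly (conjugates_poly c) 1 \<in> \<mm>" by (simp only:)
  moreover have "poly (pderiv (conjugates_poly c)) 1 \<notin> \<mm>"
  proof -
    have "poly (pderiv (conjugates_poly c)) 1 = poly Q 1 + (1 - c) * poly (pderiv Q) 1"
      unfolding P pderiv_mult by (simp add: pderiv_pCons algebra_simps)
    moreover have "(1 - c) * poly (pderiv Q) 1 \<in> \<mm>"
      by (intro max_mult' c1' poly_in coeffs_in_pderiv QV one_in)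
    ultimately show ?thesis using unit_add_max[OF Q1] by auto
  qed
  ultimately obtain d where d: "d \<in> V \<inter> K" "poly (conjugates_poly c) d = 0"
    using hensel[OF PV VK.one_in] by blast
  \<comment> \<open>The root in \<open>K\<close> is a conjugate of \<open>c\<close>, so
    \<open>c\<close> itself lies in \<open>K\<close> and is fixed by \<open>G\<close>; but
    \<open>\<sigma>0\<close> moves it from outside \<open>\<mm>\<close> into
    \<open>\<mm>\<close>.\<close>
  then obtain \<sigma> where s: "\<sigma> \<in> G" "d = \<sigma> c" using conjugates_poly(4)[OF cL] by (auto simp: conjugates_def)
  obtain \<tau> where t: "\<tau> \<in> G" "\<tau> \<circ> \<sigma> = id" using inverse_G[OF s(1)] by metis
  have "c = \<tau> d" using fun_cong[OF t(2), of c] s(2) by simp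
  hence "c \<in> K" using fix_K[OF t(1)] d by auto
  hence "\<sigma>0 c = c" using fix_K[OF \<sigma>0(1)] by blast
  thus False using cs[OF \<sigma>0] cm by simp
qed

text \<open>An element of \<open>V \<inter> L\<close> is a fraction over the semilocal ring with
  denominator outside \<open>\<mm>\<close>, and since the decomposition group is all of
  \<open>G\<close>, the denominator stays outside \<open>\<mm>\<close>. This is the uniqueness of
  the extension of a henselian valuation.\<close>

lemma G_V: "\<sigma> \<in> G \<Longrightarrow> x \<in> L \<Longrightarrow> \<sigma> x \<in> V \<longleftrightarrow> x \<in> V"
proof -
  have *: "\<sigma> x \<in> V" if s: "\<sigma> \<in> G" and x: "x \<in> L" "x \<in> V" for \<sigma> x
  proof -
    obtain y where y: "y \<in> semilocal" "y \<notin> \<mm>" "x * y \<in> semilocal" using semilocal_fraction[OF x] .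
    have "\<sigma> y \<notin> \<mm>" using y s decomposition_eq unfolding decomposition_def by blast
    hence sy: "\<sigma> y \<in> V - \<mm>" using y s by (auto simp: semilocal_def)
    have "\<sigma> (x * y) \<in> V" using y s by (auto simp: semilocal_def)
    moreover have "\<sigma> (x * y) = \<sigma> x * \<sigma> y" using hom(2)[OF s x(1)] y by (auto simp: semilocal_def)
    ultimately have "\<sigma> x * \<sigma> y \<in> V" by simp
    from divide_unit[OF this sy] have "\<sigma> x * \<sigma> y / \<sigma> y \<in> V" .
    thus ?thesis using unit_not0[OF sy] by simp
  qed
  assume s: "\<sigma> \<in> G" and x: "x \<in> L"
  obtain \<tau> where t: "\<tau> \<in> G" "\<tau> \<circ> \<sigma> = id" using inverse_G[OF s] by metis
  have "\<tau> (\<sigma> x) = x" using fun_cong[OF t(2), of x] by simp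
  thus ?thesis using *[OF s x] *[OF t(1) maps_L[OF s x]] by auto
qed

lemma G_max: "\<sigma> \<in> G \<Longrightarrow> x \<in> L \<Longrightarrow> \<sigma> x \<in> \<mm> \<longleftrightarrow> x \<in> \<mm>"
  using G_V[of \<sigma> "inverse x"] field_hom.hom_eq_0[OF field_hom_G, of \<sigma> x] hom(7)[of \<sigma> x] L.inverse_in[of x]
  by (auto simp: max_ideal_def)

text \<open>A residue extension of a separably closed field is purely inseparable. A residual
  relation of least degree for \<open>x\<close> either has a root \<open>c\<close> in
  \<open>K\<close>, and then \<open>x\<close> is congruent to the fixed element \<open>c\<close>, or
  its derivative vanishes. In that case it is a polynomial in \<open>X^q\<close>, the induction
  applies to \<open>x ^ q\<close>, and the Frobenius is injective on residues.\<close>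

theorem inertia:
  assumes "\<sigma> \<in> G" "x \<in> L" "x \<in> V"
  shows "\<sigma> x - x \<in> \<mm>"
proof -
  have main: "\<sigma> x - x \<in> \<mm>" if "\<sigma> \<in> G" "x \<in> L" "x \<in> V" "coeffs_in (V \<inter> K) P" "lead_coeff P = 1" "poly P x \<in> \<mm>" for \<sigma> x P
    using that
  proof (induction "degree P" arbitrary: x P rule: less_induct)
    case less
    note P = less.prems(4,5,6) and x = less.prems(2,3) and s = less.prems(1)
    show ?case
    proof (cases "\<exists>P'. coeffs_in (V \<inter> K) P' \<and> lead_coeff P' = 1 \<and> poly P' x \<in> \<mm> \<and> degree P' < degree P")
      case True
      thus ?thesis using less.hyps less.prems by blast
    next
      case False
      hence min: "degree P \<le> degree P'" if "coeffs_in (V \<inter> K) P'" "lead_coeff P' = 1" "poly P' x \<in> \<mm>" for P'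
        using that by (meson not_le)
      have VV: "coeffs_in V p" if "coeffs_in (V \<inter> K) p" for p using coeffs_in_mono[OF _ that] by blast
      have deg: "degree P \<ge> 1"
      proof (rule ccontr)
        assume "\<not> degree P \<ge> 1"
        then obtain a where "P = [:a:]" using degree_eq_zeroE by (metis less_one not_le)
        thus False using P one_notin_max by simp
      qed
      consider (root) c where "c \<in> V \<inter> K" "poly P c \<in> \<mm>"
        | (factor) D E E' where "coeffs_in (V \<inter> K) D" "coeffs_in (V \<inter> K) E" "coeffs_in (V \<inter> K) E'"
          "lead_coeff D = 1" "lead_coeff E = 1" "degree D \<ge> 1"
          "coeffs_in \<mm> (P - D * E)" "coeffs_in \<mm> (pderiv P - D * E')"
        using residue[OF P(1,2) deg] by metis
      thus ?thesis
      proof cases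
        case (root c)
        define Q where "Q = synthetic_div P c"
        have PQ: "P = [:- c, 1:] * Q + [:poly P c:]"
          using synthetic_div_correct'[of c P] by (simp add: Q_def)
        have degQ: "degree Q = degree P - 1" by (simp add: Q_def degree_synthetic_div)
        have QV: "coeffs_in (V \<inter> K) Q" unfolding Q_def
        proof -
          have "coeffs_in (V \<inter> K) p \<Longrightarrow> coeffs_in (V \<inter> K) (synthetic_div p c)" for p
          proof (induction p)
            case (pCons a p)
            hence "coeffs_in (V \<inter> K) p" using coeffs_in_pCons by blast
            thus ?case using pCons VK.poly_in[OF _ root(1)] by (simp add: coeffs_in_pCons del: Int_iff)
          qed (simp add: VK.coeffs_in_0)
          thus "coeffs_in (V \<inter> K) (synthetic_div P c)" using P(1) .
        qed
        have lQ: "lead_coeff Q = 1"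
        proof -
          have "Q \<noteq> 0"
          proof
            assume "Q = 0"
            hence "degree P = 0" by (subst PQ) simp
            thus False using deg by simp
          qed
          hence dA: "degree ([:- c, 1:] * Q) = degree P" using degQ deg by (subst degree_mult_eq) auto
          define k where "k = degree P"
          have "coeff P k = coeff ([:- c, 1:] * Q + [:poly P c:]) k"
            by (rule arg_cong[OF PQ, of "\<lambda>p. coeff p k"])
          also have "\<dots> = coeff ([:- c, 1:] * Q) k" using deg by (simp add: k_def coeff_pCons split: nat.splits)
          finally have "lead_coeff ([:- c, 1:] * Q) = 1" using P(2) dA by (simp only: k_def)
          thus ?thesis by (simp only: lead_coeff_mult) simp
        qed
        have "(x - c) * poly Q x \<in> \<mm>"
        proof -
          have "poly P x = (x - c) * poly Q x + poly P c" by (subst PQ) (simp add: algebra_simps)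
          thus ?thesis using max_diff[OF P(3) root(2)] by simp
        qed
        moreover have "poly Q x \<notin> \<mm>" using min[OF QV lQ] degQ deg by auto
        moreover have "x - c \<in> V" "poly Q x \<in> V" using x root diff_in poly_in[OF VV[OF QV]] by auto
        ultimately have xc: "x - c \<in> \<mm>" using max_prime by blast
        have "c \<in> L" using root KL by blast
        hence "\<sigma> (x - c) = \<sigma> x - c" using hom(3)[OF s x(1)] fix_K[OF s] root by auto
        hence "\<sigma> x - c \<in> \<mm>" using G_max[OF s, of "x - c"] xc x(1) \<open>c \<in> L\<close> L.diff_in by auto
        thus ?thesis using max_diff[OF _ xc, of "\<sigma> x - c"] by simp
      next
        case (factor D E E')
        have ne: "D \<noteq> 0" "E \<noteq> 0" using factor(4,5) by auto
        have lDE: "lead_coeff (D * E) = 1" using factor by (simp add: lead_coeff_mult)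
        have dm: "coeff (P - D * E) i \<in> \<mm>" for i using factor(7) by (auto simp: coeffs_in_def)
        have degDE: "degree P = degree (D * E)"
        proof (rule ccontr)
          assume n: "degree P \<noteq> degree (D * E)"
          show False
          proof (cases "degree P < degree (D * E)")
            case True
            thus False using dm[of "degree (D * E)"] lDE one_notin_max max_uminus_iff[of 1] by (simp add: coeff_eq_0)
          next
            case False
            thus False using dm[of "degree P"] n P(2) one_notin_max by (simp add: coeff_eq_0)
          qed
        qed
        hence dPDE: "degree P = degree D + degree E" using ne by (simp add: degree_mult_eq)
        have "poly P x - poly (P - D * E) x \<in> \<mm>" using max_diff[OF P(3) poly_in_max[OF factor(7) x(2)]] .
        hence "poly D x * poly E x \<in> \<mm>" by simp
        hence "poly D x \<in> \<mm> \<or> poly E x \<in> \<mm>"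
          using max_prime poly_in[OF VV x(2)] factor by blast
        moreover have "poly E x \<notin> \<mm>" using min[OF factor(2,5)] dPDE factor(6) by auto
        ultimately have "degree P \<le> degree D" using min[OF factor(1,4)] by blast
        hence DP: "degree D = degree P" using dPDE by simp
        have pm: "coeffs_in \<mm> (pderiv P)"
        proof -
          have "coeff (D * E') i \<in> \<mm>" if "i \<ge> degree D" for i
          proof -
            have "coeff (pderiv P) i = 0" using that DP by (simp add: coeff_pderiv coeff_eq_0)
            thus ?thesis using factor(8)[unfolded coeffs_in_def, rule_format, of i] by (simp add: max_uminus_iff)
          qed
          hence "coeffs_in \<mm> E'" using monic_mult_max[OF VV[OF factor(1)] factor(4) VV[OF factor(3)]] by blast
          hence "coeffs_in \<mm> (E' * D)" using coeffs_in_max_mult VV[OF factor(1)] by blast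
          hence "coeffs_in \<mm> (pderiv P - D * E' + E' * D)" using coeffs_in_max_add factor(8) by blast
          thus ?thesis by (simp add: mult.commute)
        qed
        have pmi: "of_nat i * coeff P i \<in> \<mm>" for i
        proof (cases i)
          case (Suc j)
          thus ?thesis using pm[unfolded coeffs_in_def, rule_format, of j] by (simp add: coeff_pderiv del: of_nat_Suc)
        qed (simp add: zero_max)
        define n where "n = degree P"
        have "of_nat n \<in> \<mm>" using pmi[of n] P(2) by (simp add: n_def)
        then obtain q where q: "prime q" "q dvd n" "of_nat q \<in> \<mm>" using prime_in_max[of n] deg by (auto simp: n_def)
        have q2: "q \<ge> 2" using prime_ge_2_nat q by blast
        have coV: "coeff P i \<in> V \<inter> K" for i using P(1) by (simp add: coeffs_in_def)
        have qd: "coeff P i \<in> \<mm>" if "\<not> q dvd i" for i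
        proof -
          have "of_nat i \<notin> \<mm>" using coprime_notin_max[OF q(1,3)] that by blast
          thus ?thesis using max_prime[OF of_nat_in _ pmi] coV by blast
        qed
        obtain m where m: "n = q * m" using q by blast
        \<comment> \<open>Coefficients at exponents not divisible by \<open>q\<close> lie in
          \<open>\<mm>\<close>, so \<open>H(x^q)\<close> is congruent to
          \<open>P(x)\<close>.\<close>
        define H where "H = (\<Sum>j\<le>m. monom (coeff P (q * j)) j)"
        have cH: "coeff H j = (if j \<le> m then coeff P (q * j) else 0)" for j
          by (simp add: H_def coeff_sum)
        have "coeff H m = 1" using P(2) m by (simp add: cH n_def)
        hence dH: "degree H = m" using cH by (intro antisym degree_le le_degree) auto
        have HV: "coeffs_in (V \<inter> K) H" using coV VK.zero_in by (simp add: coeffs_in_def cH)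
        have "m < n" using m q2 deg mult_less_mono1[of 1 q m] by (cases "m = 0") (auto simp: n_def)
        have "poly P x = (\<Sum>i\<le>n. coeff P i * x ^ i)" by (simp add: poly_altdef n_def)
        also have "{..n} = (\<lambda>j. q * j) ` {..m} \<union> {i. i \<le> n \<and> \<not> q dvd i}"
          using m q2 by (auto simp: dvd_def image_iff)
        also have "(\<Sum>i\<in>(\<lambda>j. q * j) ` {..m} \<union> {i. i \<le> n \<and> \<not> q dvd i}. coeff P i * x ^ i)
          = (\<Sum>i\<in>(\<lambda>j. q * j) ` {..m}. coeff P i * x ^ i) + (\<Sum>i | i \<le> n \<and> \<not> q dvd i. coeff P i * x ^ i)"
          by (rule sum.union_disjoint) auto
        also have "(\<Sum>i\<in>(\<lambda>j. q * j) ` {..m}. coeff P i * x ^ i) = (\<Sum>j\<le>m. coeff P (q * j) * (x ^ q) ^ j)"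
          using q2 by (subst sum.reindex) (auto simp: inj_on_def power_mult)
        also have "\<dots> = poly H (x ^ q)" by (simp add: H_def poly_sum poly_monom)
        finally have "poly H (x ^ q) = poly P x - (\<Sum>i | i \<le> n \<and> \<not> q dvd i. coeff P i * x ^ i)" by simp
        also have "\<dots> \<in> \<mm>" by (intro max_diff max_sum P max_mult' qd power_in x) auto
        finally have Hx: "poly H (x ^ q) \<in> \<mm>" .
        have "\<sigma> (x ^ q) - x ^ q \<in> \<mm>"
          using less.hyps[of H "x ^ q"] dH \<open>m < n\<close> s x L.power_in power_in HV \<open>coeff H m = 1\<close> Hx by (simp add: n_def)
        hence d: "\<sigma> x ^ q - x ^ q \<in> \<mm>" using hom(9)[OF s x(1)] by simp
        have "\<sigma> x \<in> V" using G_V s x by blast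
        then obtain t where t: "t \<in> V" "((\<sigma> x - x) + x) ^ q = (\<sigma> x - x) ^ q + x ^ q + of_nat q * t"
          using frobenius_expand[OF q(1) diff_in] x by metis
        have "(\<sigma> x - x) ^ q = (\<sigma> x ^ q - x ^ q) - of_nat q * t" using t(2) by simp
        also have "\<dots> \<in> \<mm>" by (intro max_diff d max_mult' q t)
        finally show ?thesis by (rule power_in_max)
      qed
    qed
  qed
  have "coeffs_in (V \<inter> K) (conjugates_poly x)" using conjugates_poly_V assms G_V by blast
  moreover have "poly (conjugates_poly x) x = 0"
    using conjugates_poly(4)[OF assms(2)] conjugates_self by blast
  hence "poly (conjugates_poly x) x \<in> \<mm>" using zero_max by simp
  ultimately show ?thesis using main assms conjugates_poly(2)[OF assms(2)] by blast
qed

end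

section \<open>Wild extensions\<close>

lemma roots_bound:
  fixes p :: "'a::field poly"
  assumes "p \<noteq> 0" "degree p = card S" "finite S" "\<And>x. x \<in> S \<Longrightarrow> poly p x = 0" "poly p z = 0"
  shows "z \<in> S"
proof (rule ccontr)
  assume z: "z \<notin> S"
  have "card (insert z S) \<le> card {x. poly p x = 0}"
    using assms by (intro card_mono poly_roots_finite) auto
  also have "\<dots> \<le> degree p" using card_poly_roots_bound assms(1) by blast
  finally show False using z assms by simp
qed

lemma degree_monom_diff:
  fixes r :: "'a::field poly"
  assumes "degree r < n"
  shows "degree (monom 1 n - r) = n"
proof -
  have "degree (monom 1 n + - r) = degree (monom 1 n :: 'a poly)"
    by (rule degree_add_eq_left) (use assms in \<open>simp add: degree_monom_eq\<close>)
  thus ?thesis by (simp add: degree_monom_eq)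
qed

lemma prime_field_roots:
  fixes z :: "'a::field"
  assumes q: "prime q" "of_nat q = (0::'a)" and z: "z ^ q = z"
  obtains i :: nat where "z = of_nat i"
proof -
  have q2: "q \<ge> 2" using q prime_ge_2_nat by blast
  have pow: "of_nat i ^ q = (of_nat i :: 'a)" for i
  proof (induction i)
    case 0
    thus ?case using q2 by (simp add: zero_power)
  next
    case (Suc i)
    thus ?case using frobenius_char(1)[OF q, of 1 "of_nat i"] by simp
  qed
  have inj: "inj_on (of_nat :: nat \<Rightarrow> 'a) {..<q}"
  proof (rule linorder_inj_onI)
    fix i j :: nat assume ij: "i < j" "j \<in> {..<q}"
    hence "\<not> q dvd j - i" by (meson dvd_imp_le le_less_trans lessThan_iff less_imp_diff_less not_le zero_less_diff)
    hence "coprime (j - i) q" using q(1) by (metis coprime_commute prime_imp_coprime)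
    then obtain u v where "(j - i) * u = q * v + 1"
      using coprime_bezout_strong[of "j - i" q] q2 by auto
    hence "of_nat (j - i) * of_nat u = of_nat q * of_nat v + (1 :: 'a)" by (metis of_nat_1 of_nat_add of_nat_mult)
    hence "of_nat (j - i) \<noteq> (0 :: 'a)" using q(2) by auto
    thus "of_nat i \<noteq> (of_nat j :: 'a)" using ij by (simp add: of_nat_diff)
  qed auto
  define p :: "'a poly" where "p = monom 1 q - [:0, 1:]"
  have deg: "degree p = q" unfolding p_def by (rule degree_monom_diff) (use q2 in simp)
  have "z \<in> of_nat ` {..<q}"
  proof (rule roots_bound[of p])
    show "p \<noteq> 0" using deg q2 by auto
    show "degree p = card (of_nat ` {..<q} :: 'a set)" using card_image[OF inj] deg by simp
  qed (auto simp: p_def poly_monom pow z)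
  thus ?thesis using that by blast
qed

lemma root_of_unity_power:
  fixes \<zeta> :: "'a::field"
  assumes q: "prime q" and z: "\<zeta> ^ q = 1" "\<zeta> \<noteq> 1"
  shows "\<zeta> ^ n = 1 \<longleftrightarrow> q dvd n"
proof
  assume n: "\<zeta> ^ n = 1"
  show "q dvd n"
  proof (rule ccontr)
    assume nd: "\<not> q dvd n"
    hence "coprime n q" using q by (metis coprime_commute prime_imp_coprime)
    moreover have "q \<noteq> 1" using q by auto
    ultimately obtain u v where "n * u = q * v + 1" using coprime_bezout_strong[of n q] by auto
    hence "(\<zeta> ^ n) ^ u = (\<zeta> ^ q) ^ v * \<zeta>" by (metis power_add power_mult power_one_right)
    thus False using n z by simp
  qed
qed (use z in \<open>auto simp: power_mult\<close>)

lemma roots_of_unity: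
  fixes \<zeta> w :: "'a::field"
  assumes q: "prime q" and z: "\<zeta> ^ q = 1" "\<zeta> \<noteq> 1" and w: "w ^ q = 1"
  obtains j where "j < q" "w = \<zeta> ^ j"
proof -
  have q2: "q \<ge> 2" using q prime_ge_2_nat by blast
  have z0: "\<zeta> \<noteq> 0" using z(1) q2 by (auto simp: zero_power)
  have inj: "inj_on (\<lambda>i. \<zeta> ^ i) {..<q}"
  proof (rule linorder_inj_onI)
    fix i j :: nat assume ij: "i < j" "j \<in> {..<q}"
    hence "\<not> q dvd j - i" by (meson dvd_imp_le le_less_trans lessThan_iff less_imp_diff_less not_le zero_less_diff)
    hence "\<zeta> ^ (j - i) \<noteq> 1" using root_of_unity_power[OF q z] by blast
    moreover have "\<zeta> ^ j = \<zeta> ^ i * \<zeta> ^ (j - i)" using ij by (simp flip: power_add)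
    ultimately show "\<zeta> ^ i \<noteq> \<zeta> ^ j" using z0 by auto
  qed auto
  define p :: "'a poly" where "p = monom 1 q - 1"
  have deg: "degree p = q" unfolding p_def by (rule degree_monom_diff) (use q2 in simp)
  have "w \<in> (\<lambda>i. \<zeta> ^ i) ` {..<q}"
  proof (rule roots_bound[of p])
    show "p \<noteq> 0" using deg q2 by auto
    show "degree p = card ((\<lambda>i. \<zeta> ^ i) ` {..<q})" using card_image[OF inj] deg by simp
    show "poly p x = 0" if x: "x \<in> (\<lambda>i. \<zeta> ^ i) ` {..<q}" for x
    proof -
      obtain i where "x = \<zeta> ^ i" using x by blast
      hence "x ^ q = (\<zeta> ^ q) ^ i" by (simp add: mult.commute flip: power_mult)
      thus ?thesis using z by (simp add: p_def poly_monom)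
    qed
  qed (auto simp: p_def poly_monom w)
  thus ?thesis using that by blast
qed

section \<open>Independence of automorphisms, wild action and Hilbert 90\<close>

context henselian_galois
begin

text \<open>Dedekind's argument: multiplying the argument by some \<open>w\<close> on which
  \<open>\<rho>\<close> and \<open>\<tau>\<close> differ, and subtracting \<open>\<tau> w\<close>
  times the original relation, eliminates \<open>\<tau>\<close>. All maps agree outside
  \<open>L\<close>, so such a \<open>w\<close> exists in \<open>L\<close>.\<close>

lemma automorphisms_independent:
  assumes "finite S" "S \<subseteq> G" "\<And>y. y \<in> L \<Longrightarrow> (\<Sum>\<sigma>\<in>S. c \<sigma> * \<sigma> y) = 0" "\<sigma> \<in> S"
  shows "c \<sigma> = 0"
  using assms
proof (induction S arbitrary: c \<sigma> rule: finite_induct)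
  case (insert \<tau> S)
  have \<tau>: "\<tau> \<in> G" and S: "S \<subseteq> G" using insert.prems by auto
  have cS: "c \<rho> = 0" if \<rho>: "\<rho> \<in> S" for \<rho>
  proof -
    have \<rho>G: "\<rho> \<in> G" using \<rho> S by blast
    have "\<rho> \<noteq> \<tau>" using \<rho> insert.hyps by blast
    then obtain w where "\<rho> w \<noteq> \<tau> w" by blast
    then obtain w where w: "w \<in> L" "\<rho> w \<noteq> \<tau> w" using fix_out[OF \<rho>G] fix_out[OF \<tau>] by metis
    have "c \<rho> * (\<rho> w - \<tau> w) = 0"
    proof (rule insert.IH[OF S _ \<rho>])
      fix y assume y: "y \<in> L"
      have 1: "(\<Sum>\<sigma>\<in>S. c \<sigma> * \<sigma> y) = - (c \<tau> * \<tau> y)"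
        using insert.prems(2)[OF y] insert.hyps by (simp add: eq_neg_iff_add_eq_0 add.commute)
      have "(\<Sum>\<sigma>\<in>S. c \<sigma> * \<sigma> (w * y)) = - (c \<tau> * \<tau> (w * y))"
        using insert.prems(2)[OF L.mult_in[OF w(1) y]] insert.hyps by (simp add: eq_neg_iff_add_eq_0 add.commute)
      moreover have "(\<Sum>\<sigma>\<in>S. c \<sigma> * \<sigma> (w * y)) = (\<Sum>\<sigma>\<in>S. c \<sigma> * \<sigma> w * \<sigma> y)"
        using S w y by (intro sum.cong) (auto simp: hom(2))
      ultimately have 2: "(\<Sum>\<sigma>\<in>S. c \<sigma> * \<sigma> w * \<sigma> y) = - (c \<tau> * \<tau> w * \<tau> y)"
        using hom(2)[OF \<tau> w(1) y] by simp
      have "(\<Sum>\<sigma>\<in>S. c \<sigma> * (\<sigma> w - \<tau> w) * \<sigma> y)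
          = (\<Sum>\<sigma>\<in>S. c \<sigma> * \<sigma> w * \<sigma> y) - \<tau> w * (\<Sum>\<sigma>\<in>S. c \<sigma> * \<sigma> y)"
        by (simp add: sum_distrib_left algebra_simps sum_subtractf)
      thus "(\<Sum>\<sigma>\<in>S. c \<sigma> * (\<sigma> w - \<tau> w) * \<sigma> y) = 0" unfolding 1 2 by simp
    qed
    thus ?thesis using w by simp
  qed
  have "(\<Sum>\<sigma>\<in>insert \<tau> S. c \<sigma> * \<sigma> 1) = 0" using insert.prems(2)[OF L.one_in] .
  hence "c \<tau> = 0" using insert.hyps cS hom(5)[OF \<tau>] by simp
  thus ?case using insert.prems(3) cS by blast
qed simp

lemma dedekind_ex:
  assumes "\<And>\<sigma>. \<sigma> \<in> G \<Longrightarrow> c \<sigma> \<noteq> 0"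
  obtains y where "y \<in> L" "(\<Sum>\<sigma>\<in>G. c \<sigma> * \<sigma> y) \<noteq> 0"
proof -
  have "\<exists>y\<in>L. (\<Sum>\<sigma>\<in>G. c \<sigma> * \<sigma> y) \<noteq> 0"
  proof (rule ccontr)
    assume h: "\<not> (\<exists>y\<in>L. (\<Sum>\<sigma>\<in>G. c \<sigma> * \<sigma> y) \<noteq> 0)"
    have "c id = 0" by (rule automorphisms_independent[where c = c and S = G and \<sigma> = id]) (use h finite_G id_G in auto)
    thus False using assms[OF id_G] by contradiction
  qed
  thus ?thesis using that by blast
qed

lemma sum_comp: "\<rho> \<in> G \<Longrightarrow> (\<Sum>\<sigma>\<in>G. f (\<rho> \<circ> \<sigma>)) = (\<Sum>\<sigma>\<in>G. f \<sigma>)"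
  using sum.reindex[OF comp_image(2), of \<rho> f] comp_image(1)[of \<rho>] by simp

lemma of_int_max_iff:
  assumes "prime q" "of_nat q \<in> \<mm>"
  shows "of_int n \<in> \<mm> \<longleftrightarrow> int q dvd n"
proof
  assume h: "of_int n \<in> \<mm>"
  have "of_nat (nat \<bar>n\<bar>) \<in> \<mm>"
  proof (cases "n \<ge> 0")
    case False
    hence "of_nat (nat \<bar>n\<bar>) = - (of_int n :: 'a)" by (simp add: of_nat_nat)
    thus ?thesis using h max_uminus by simp
  qed (use h in \<open>simp add: of_nat_nat\<close>)
  hence "q dvd nat \<bar>n\<bar>" using coprime_notin_max assms by blast
  thus "int q dvd n" by (simp add: int_dvd_int_iff[symmetric])
next
  assume "int q dvd n"
  then obtain k where "n = int q * k" by blast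
  hence "of_int n = of_nat q * (of_int k :: 'a)" by simp
  thus "of_int n \<in> \<mm>" using max_mult'[OF of_int_in assms(2)] by simp
qed

text \<open>Divisibility of the value group of \<open>K\<close> by all primes other than the residue
  characteristic, expressed by units.\<close>

definition tamely_divisible :: bool where
  "tamely_divisible \<longleftrightarrow> (\<forall>p. prime p \<longrightarrow> of_nat p \<notin> \<mm> \<longrightarrow>
     (\<forall>x\<in>K - {0}. \<exists>y\<in>K - {0}. x / y ^ p \<in> V - \<mm>))"

lemma tamely_divisible_nat:
  assumes tame: tamely_divisible and "n > 0" "of_nat n \<notin> \<mm>" "x \<in> K - {0}"
  shows "\<exists>y\<in>K - {0}. x / y ^ n \<in> V - \<mm>"
  using assms(2-)
proof (induction n arbitrary: x rule: less_induct)
  case (less n)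
  show ?case
  proof (cases "n = 1")
    case True
    thus ?thesis using less.prems one_unit by (intro bexI[of _ x]) auto
  next
    case False
    then obtain p where p: "prime p" "p dvd n" using prime_factor_nat by blast
    then obtain k where k: "n = p * k" by blast
    have "of_nat p \<notin> \<mm>" "of_nat k \<notin> \<mm>"
      using less.prems(2) max_mult'[of "of_nat k" "of_nat p"] max_mult[of "of_nat p" "of_nat k"] of_nat_in k by auto
    moreover have "k > 0" "k < n" using k less.prems(1) prime_gt_1_nat[OF p(1)] by auto
    moreover obtain y where y: "y \<in> K - {0}" "x / y ^ p \<in> V - \<mm>"
      using tame p calculation(1) less.prems(3) unfolding tamely_divisible_def by blast
    ultimately obtain z where z: "z \<in> K - {0}" "y / z ^ k \<in> V - \<mm>" using less.IH by blast
    have "x / y ^ p * (y / z ^ k) ^ p \<in> V - \<mm>" using y z by (intro unit_mult unit_power)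
    moreover have "x / y ^ p * (y / z ^ k) ^ p = x / z ^ n"
      using y by (simp add: k power_divide mult.commute flip: power_mult)
    ultimately show ?thesis using z by auto
  qed
qed

text \<open>Uniqueness of the extension makes conjugates equal in value. A conjugate
  \<open>\<rho> x\<close> of least value divides \<open>\<rho> (\<tau> x)\<close>, and
  \<open>G_V\<close> cancels \<open>\<rho>\<close>.\<close>

lemma conjugate_unit:
  assumes x: "x \<in> L" "x \<noteq> 0" and s: "\<sigma> \<in> G"
  shows "\<sigma> x / x \<in> V - \<mm>"
proof -
  have x0: "\<sigma> x \<noteq> 0" if "\<sigma> \<in> G" for \<sigma> using field_hom.hom_eq_0[OF field_hom_G[OF that] x(1)] x(2) by simp
  have "0 \<notin> conjugates x" using x0 by (force simp: conjugates_def)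
  then obtain r where r: "r \<in> conjugates x" "\<forall>t\<in>conjugates x. t / r \<in> V"
    using max_value[OF finite_conjugates] conjugates_self by blast
  obtain \<rho> where \<rho>: "\<rho> \<in> G" "r = \<rho> x" using r by (auto simp: conjugates_def)
  have *: "\<tau> x / x \<in> V" if t: "\<tau> \<in> G" for \<tau>
  proof -
    have "\<rho> (\<tau> x) \<in> conjugates x" unfolding conjugates_def
      using image_eqI[of "\<rho> (\<tau> x)" "\<lambda>\<sigma>. \<sigma> x" "\<rho> \<circ> \<tau>" G] comp_G[OF \<rho>(1) t] by simp
    hence "\<rho> (\<tau> x) / \<rho> x \<in> V" using r \<rho> by blast
    hence "\<rho> (\<tau> x / x) \<in> V" using hom(8)[OF \<rho>(1) maps_L[OF t x(1)] x(1)] by simp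
    thus ?thesis using G_V[OF \<rho>(1) L.divide_in[OF maps_L[OF t x(1)] x(1)]] by simp
  qed
  obtain \<tau> where t: "\<tau> \<in> G" "\<sigma> \<circ> \<tau> = id" using inverse_G[OF s] by metis
  have "\<sigma> (\<tau> x / x) \<in> V" using *[OF t(1)] G_V[OF s L.divide_in[OF maps_L[OF t(1) x(1)] x(1)]] by simp
  moreover have "\<sigma> (\<tau> x) = x" using fun_cong[OF t(2), of x] by simp
  ultimately have "x / \<sigma> x \<in> V" using hom(8)[OF s maps_L[OF t(1) x(1)] x(1)] by simp
  thus ?thesis using *[OF s] x x0[OF s] unfolding unit_iff by simp
qed

lemma frobenius_one:
  assumes q: "prime q" "of_nat q \<in> \<mm>" and t: "t \<in> V" "t ^ (q ^ s) - 1 \<in> \<mm>"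
  shows "t - 1 \<in> \<mm>"
  using t
proof (induction s arbitrary: t)
  case (Suc s)
  have "t ^ q - 1 \<in> \<mm>" using Suc.IH[of "t ^ q"] Suc.prems power_in by (simp add: power_mult)
  moreover obtain r where r: "r \<in> V" "((t - 1) + 1) ^ q = (t - 1) ^ q + 1 ^ q + of_nat q * r"
    using frobenius_expand[OF q(1) diff_in one_in] Suc.prems(1) one_in by metis
  have "(t - 1) ^ q = (t ^ q - 1) - of_nat q * r" using r(2) by simp
  ultimately have "(t - 1) ^ q \<in> \<mm>" using max_diff max_mult'[OF r(1) q(2)] by simp
  thus ?case by (rule power_in_max)
qed simp

text \<open>The norm of \<open>x\<close> has the value of \<open>x ^ card G\<close>. Hence a power of \<open>x\<close> with exponent
  a power of the residue characteristic has the value of an element of \<open>K\<close>, and the action on units is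
  trivial modulo the maximal ideal.\<close>

lemma wild:
  assumes tame: tamely_divisible and s: "\<sigma> \<in> G" and x: "x \<in> L" "x \<noteq> 0"
  shows "\<sigma> x / x - 1 \<in> \<mm>"
proof -
  define N where "N = card G"
  have N0: "N > 0" using finite_G id_G by (auto simp: N_def card_gt_0_iff)
  \<comment> \<open>\<open>Q\<close> is the part of the group order that belongs to the residue
    characteristic, or \<open>1\<close> if the order is a unit. The third property is injectivity of
    the corresponding power of the Frobenius on residues.\<close>
  obtain Q m where Qm: "N = Q * m" "of_nat m \<notin> \<mm>" "\<And>t. t \<in> V \<Longrightarrow> t ^ Q - 1 \<in> \<mm> \<Longrightarrow> t - 1 \<in> \<mm>"
  proof (cases "of_nat N \<in> \<mm>")
    case True
    then obtain q where q: "prime q" "of_nat q \<in> \<mm>" using prime_in_max N0 by blast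
    obtain m where m: "N = q ^ multiplicity q N * m" "\<not> q dvd m"
      by (rule multiplicity_decompose'[of N q]) (use N0 q(1) in auto)
    have "of_nat m \<notin> \<mm>" using coprime_notin_max[OF q] m(2) by blast
    thus ?thesis using that m frobenius_one[OF q] by blast
  next
    case False
    thus ?thesis using that[of 1 N] by simp
  qed
  have m0: "m > 0" using Qm(1) N0 by (cases m) auto
  define n where "n = (\<Prod>\<tau>\<in>G. \<tau> x)"
  have nL: "n \<in> L" unfolding n_def using maps_L x by (intro L.prod_in) auto
  have x0: "\<tau> x \<noteq> 0" if "\<tau> \<in> G" for \<tau> using field_hom.hom_eq_0[OF field_hom_G[OF that] x(1)] x(2) by simp
  have n0: "n \<noteq> 0" unfolding n_def using finite_G x0 by simp
  have "\<rho> n = n" if r: "\<rho> \<in> G" for \<rho>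
  proof -
    have "\<rho> n = (\<Prod>\<tau>\<in>G. (\<rho> \<circ> \<tau>) x)"
      unfolding n_def using field_hom.hom_prod[OF field_hom_G[OF r], of G "\<lambda>\<tau>. \<tau> x"] maps_L x by simp
    also have "\<dots> = n" unfolding n_def
      using prod.reindex[OF comp_image(2)[OF r], of "\<lambda>\<tau>. \<tau> x"] comp_image(1)[OF r] by simp
    finally show ?thesis .
  qed
  hence nK: "n \<in> K - {0}" using fixed_K nL n0 by blast
  obtain y where y: "y \<in> K - {0}" "n / y ^ m \<in> V - \<mm>"
    using tamely_divisible_nat[OF tame m0 Qm(2) nK] by blast
  have yL: "y \<in> L" using y KL by blast
  have "(\<Prod>\<tau>\<in>G. \<tau> x / x) \<in> V - \<mm>" using conjugate_unit x by (intro unit_prod) auto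
  moreover have "(\<Prod>\<tau>\<in>G. \<tau> x / x) = n / x ^ N" by (simp add: prod_dividef n_def N_def)
  ultimately have "n / x ^ N \<in> V - \<mm>" by simp
  hence "n / y ^ m / (n / x ^ N) \<in> V - \<mm>" using unit_divide y by blast
  moreover have "n / y ^ m / (n / x ^ N) = (x ^ Q / y) ^ m"
    using n0 by (simp add: Qm(1) power_mult power_divide)
  ultimately have "(x ^ Q / y) ^ m \<in> V - \<mm>" by simp
  hence u: "x ^ Q / y \<in> V - \<mm>" by (rule power_unit[OF m0])
  have uL: "x ^ Q / y \<in> L" using x yL by (intro L.divide_in L.power_in)
  have sy: "\<sigma> y = y" using fix_K[OF s] y by blast
  have su: "\<sigma> (x ^ Q / y) = \<sigma> x ^ Q / y"
    using hom(8)[OF s L.power_in[OF x(1)] yL] hom(9)[OF s x(1)] sy by simp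
  have "\<sigma> (x ^ Q / y) - x ^ Q / y \<in> \<mm>" using inertia[OF s uL] u by blast
  hence "(\<sigma> x ^ Q / y - x ^ Q / y) / (x ^ Q / y) \<in> \<mm>" unfolding su using max_divide_unit u by blast
  moreover have "(\<sigma> x ^ Q / y - x ^ Q / y) / (x ^ Q / y) = (\<sigma> x / x) ^ Q - 1"
  proof -
    have "(a / y - b / y) / (b / y) = a / b - 1" if "y \<noteq> 0" "b \<noteq> 0" for a b y :: 'a
      using that by (simp add: divide_simps)
    thus ?thesis using y x by (simp add: power_divide)
  qed
  ultimately have "(\<sigma> x / x) ^ Q - 1 \<in> \<mm>" by simp
  thus ?thesis using Qm(3) conjugate_unit[OF x s] by blast
qed

lemma power_G: "\<sigma> \<in> G \<Longrightarrow> \<sigma> ^^ n \<in> G"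
  by (induction n) (auto simp: id_G comp_G)

lemma finite_order:
  assumes "\<sigma> \<in> G"
  obtains n where "n > 0" "\<sigma> ^^ n = id"
proof -
  have "\<not> inj (\<lambda>n. \<sigma> ^^ n)"
    using finite_G power_G[OF assms] by (metis finite_subset image_subsetI infinite_UNIV_nat finite_imageD)
  then obtain i j where ij: "i \<noteq> j" "\<sigma> ^^ i = \<sigma> ^^ j" by (auto simp: inj_def)
  have *: "\<exists>n>0. \<sigma> ^^ n = id" if ij: "i < j" "\<sigma> ^^ i = \<sigma> ^^ j" for i j
  proof -
    have "\<sigma> ^^ i \<circ> \<sigma> ^^ (j - i) = \<sigma> ^^ j" using ij(1) funpow_add[of i "j - i" \<sigma>] by simp
    hence "\<sigma> ^^ i \<circ> \<sigma> ^^ (j - i) = \<sigma> ^^ i \<circ> id" using ij(2) by simp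
    hence "(\<sigma> ^^ i) ((\<sigma> ^^ (j - i)) x) = (\<sigma> ^^ i) x" for x by (simp add: fun_eq_iff)
    hence "(\<sigma> ^^ (j - i)) x = x" for x by (rule injD[OF inj_G[OF power_G[OF assms]]])
    hence "\<sigma> ^^ (j - i) = id" by (simp add: fun_eq_iff)
    thus ?thesis using ij(1) by (intro exI[of _ "j - i"]) auto
  qed
  show ?thesis using *[of i j] *[of j i] ij that by (metis linorder_neqE_nat)
qed

text \<open>The elements \<open>a \<sigma> = \<sigma> x / x - 1\<close> satisfy \<open>a (\<sigma>
  \<circ> \<tau>) = a \<sigma> + \<sigma> (a \<tau>) + a \<sigma> * \<sigma> (a \<tau>)\<close>.
  They lie in \<open>\<mm>\<close>, so after division by the one of least value the product is
  negligible; and by \<open>wild\<close>, applied to \<open>a \<tau>\<close> itself,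
  \<open>\<sigma> (a \<tau>)\<close> may be replaced by \<open>a \<tau>\<close>.\<close>

lemma additive_character:
  assumes tame: tamely_divisible and x: "x \<in> L" "x \<notin> K"
  shows "\<exists>\<psi> \<sigma>1. (\<forall>\<sigma>\<in>G. \<psi> \<sigma> \<in> V) \<and> \<sigma>1 \<in> G \<and> \<psi> \<sigma>1 = 1 \<and> \<psi> id = 0 \<and>
    (\<forall>\<sigma>\<in>G. \<forall>\<tau>\<in>G. \<psi> (\<sigma> \<circ> \<tau>) - (\<psi> \<sigma> + \<psi> \<tau>) \<in> \<mm>)"
proof -
  have x0: "x \<noteq> 0" using x K.zero_in by auto
  define a where "a \<sigma> = \<sigma> x / x - 1" for \<sigma> :: "'a \<Rightarrow> 'a"
  have am: "a \<sigma> \<in> \<mm>" if "\<sigma> \<in> G" for \<sigma> unfolding a_def using wild[OF tame that x(1) x0] .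
  have aL: "a \<sigma> \<in> L" if "\<sigma> \<in> G" for \<sigma> unfolding a_def
    using x maps_L[OF that] by (intro L.diff_in L.divide_in L.one_in) auto
  have ac: "a (\<sigma> \<circ> \<tau>) = a \<sigma> + \<sigma> (a \<tau>) + a \<sigma> * \<sigma> (a \<tau>)" if st: "\<sigma> \<in> G" "\<tau> \<in> G" for \<sigma> \<tau>
  proof -
    have "\<sigma> (a \<tau>) = \<sigma> (\<tau> x) / \<sigma> x - 1" unfolding a_def
      using hom(3)[OF st(1) L.divide_in[OF maps_L[OF st(2) x(1)] x(1)] L.one_in]
        hom(8)[OF st(1) maps_L[OF st(2) x(1)] x(1)] hom(5)[OF st(1)] by simp
    moreover have "a (\<sigma> \<circ> \<tau>) = \<sigma> (\<tau> x) / x - 1" "a \<sigma> = \<sigma> x / x - 1" by (simp_all add: a_def)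
    moreover have "\<sigma> x \<noteq> 0" using field_hom.hom_eq_0[OF field_hom_G[OF st(1)] x(1)] x0 by simp
    ultimately show ?thesis using x0 by (simp only:) (simp add: field_simps)
  qed
  define S where "S = a ` G - {0}"
  obtain \<sigma>0 where "\<sigma>0 \<in> G" "\<sigma>0 x \<noteq> x" using fixed_K x by blast
  hence "a \<sigma>0 \<in> S" using x0 by (auto simp: S_def a_def)
  then obtain s where s: "s \<in> S" "\<forall>t\<in>S. t / s \<in> V"
    using max_value[of S] finite_G by (auto simp: S_def)
  then obtain \<sigma>1 where s1: "\<sigma>1 \<in> G" "s = a \<sigma>1" "s \<noteq> 0" by (auto simp: S_def)
  define \<psi> where "\<psi> \<sigma> = a \<sigma> / s" for \<sigma>
  have \<psi>V: "\<psi> \<sigma> \<in> V" if "\<sigma> \<in> G" for \<sigma>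
    using s(2) that zero_in by (cases "a \<sigma> = 0") (auto simp: \<psi>_def S_def)
  have "\<psi> (\<sigma> \<circ> \<tau>) - (\<psi> \<sigma> + \<psi> \<tau>) \<in> \<mm>" if st: "\<sigma> \<in> G" "\<tau> \<in> G" for \<sigma> \<tau>
  proof (cases "a \<tau> = 0")
    case True
    hence "\<psi> (\<sigma> \<circ> \<tau>) - (\<psi> \<sigma> + \<psi> \<tau>) = 0" using ac[OF st] hom(6)[OF st(1)] by (simp add: \<psi>_def)
    thus ?thesis using zero_max by simp
  next
    case False
    define w where "w = \<sigma> (a \<tau>) / a \<tau> - 1"
    have wm: "w \<in> \<mm>" unfolding w_def using wild[OF tame st(1) aL[OF st(2)] False] .
    have sw: "\<sigma> (a \<tau>) = (1 + w) * a \<tau>" using False by (simp add: w_def)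
    have "\<psi> (\<sigma> \<circ> \<tau>) - (\<psi> \<sigma> + \<psi> \<tau>) = w * \<psi> \<tau> + a \<sigma> * ((1 + w) * \<psi> \<tau>)"
      unfolding \<psi>_def ac[OF st] sw using s1(3) by (simp add: field_simps)
    moreover have "w * \<psi> \<tau> + a \<sigma> * ((1 + w) * \<psi> \<tau>) \<in> \<mm>"
      using \<psi>V[OF st(2)] am[OF st(1)] wm max_ideal_subset[OF wm]
      by (intro max_add max_mult' mult_in add_in one_in) auto
    ultimately show ?thesis by simp
  qed
  moreover have "\<psi> \<sigma>1 = 1" "\<psi> id = 0" using s1 x0 by (simp_all add: \<psi>_def a_def)
  ultimately show ?thesis using \<psi>V s1(1) by (intro exI[of _ \<psi>] exI[of _ \<sigma>1]) blast
qed

lemma additive_character_power: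
  assumes V: "\<And>\<sigma>. \<sigma> \<in> G \<Longrightarrow> \<psi> \<sigma> \<in> V" and "\<psi> id = 0"
    and add: "\<And>\<sigma> \<tau>. \<sigma> \<in> G \<Longrightarrow> \<tau> \<in> G \<Longrightarrow> \<psi> (\<sigma> \<circ> \<tau>) - (\<psi> \<sigma> + \<psi> \<tau>) \<in> \<mm>" and s: "\<sigma> \<in> G"
  shows "\<psi> (\<sigma> ^^ n) - of_nat n * \<psi> \<sigma> \<in> \<mm>"
proof (induction n)
  case 0
  show ?case using assms(2) zero_max by (simp add: id_def)
next
  case (Suc n)
  have "\<psi> (\<sigma> ^^ Suc n) - of_nat (Suc n) * \<psi> \<sigma>
      = (\<psi> (\<sigma> \<circ> \<sigma> ^^ n) - (\<psi> \<sigma> + \<psi> (\<sigma> ^^ n))) + (\<psi> (\<sigma> ^^ n) - of_nat n * \<psi> \<sigma>)"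
    by (simp add: algebra_simps)
  also have "\<dots> \<in> \<mm>" by (intro max_add add s power_G Suc)
  finally show ?case .
qed

text \<open>A maximal subgroup \<open>H\<close> of \<open>G\<close> that contains the kernel of \<open>\<psi>\<close> and not \<open>\<sigma>1\<close> has index \<open>q\<close>.
  The set \<open>W\<close> is the image of \<open>H\<close>, together with the maximal ideal.\<close>

lemma prime_character:
  assumes q: "prime q" "of_nat q \<in> \<mm>"
    and V: "\<And>\<sigma>. \<sigma> \<in> G \<Longrightarrow> \<psi> \<sigma> \<in> V" and s1: "\<sigma>1 \<in> G" "\<psi> \<sigma>1 = 1" and id: "\<psi> id = 0"
    and add: "\<And>\<sigma> \<tau>. \<sigma> \<in> G \<Longrightarrow> \<tau> \<in> G \<Longrightarrow> \<psi> (\<sigma> \<circ> \<tau>) - (\<psi> \<sigma> + \<psi> \<tau>) \<in> \<mm>"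
  shows "\<exists>\<chi> :: ('a \<Rightarrow> 'a) \<Rightarrow> int.
    (\<forall>\<sigma>\<in>G. \<forall>\<tau>\<in>G. int q dvd \<chi> (\<sigma> \<circ> \<tau>) - (\<chi> \<sigma> + \<chi> \<tau>)) \<and> \<not> int q dvd \<chi> \<sigma>1"
proof -
  note pow = additive_character_power[of \<psi>, OF V id add]
  define good where "good H \<longleftrightarrow> H \<subseteq> G \<and> (\<forall>\<sigma>\<in>H. \<forall>\<tau>\<in>H. \<sigma> \<circ> \<tau> \<in> H) \<and> (\<forall>\<sigma>\<in>G. \<psi> \<sigma> \<in> \<mm> \<longrightarrow> \<sigma> \<in> H) \<and> \<sigma>1 \<notin> H" for H
  have "good {\<sigma> \<in> G. \<psi> \<sigma> \<in> \<mm>}"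
  proof -
    have "\<psi> (\<sigma> \<circ> \<tau>) \<in> \<mm>" if "\<sigma> \<in> G" "\<tau> \<in> G" "\<psi> \<sigma> \<in> \<mm>" "\<psi> \<tau> \<in> \<mm>" for \<sigma> \<tau>
      using max_add[OF add[OF that(1,2)] max_add[OF that(3,4)]] by simp
    thus ?thesis using s1 one_notin_max comp_G by (auto simp: good_def)
  qed
  moreover have "\<forall>H. good H \<longrightarrow> card H < Suc (card G)" using card_mono[OF finite_G] by (auto simp: good_def less_Suc_eq_le)
  ultimately obtain H where H: "good H" "\<And>H'. good H' \<Longrightarrow> card H' \<le> card H"
    using ex_has_greatest_nat[of good _ card "Suc (card G)"] by blast
  have HG: "H \<subseteq> G" and Hc: "\<And>\<sigma> \<tau>. \<sigma> \<in> H \<Longrightarrow> \<tau> \<in> H \<Longrightarrow> \<sigma> \<circ> \<tau> \<in> H"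
    and Hk: "\<And>\<sigma>. \<sigma> \<in> G \<Longrightarrow> \<psi> \<sigma> \<in> \<mm> \<Longrightarrow> \<sigma> \<in> H" and H1: "\<sigma>1 \<notin> H"
    using H(1) by (auto simp: good_def)
  have idH: "id \<in> H" using Hk[OF id_G] id zero_max by simp
  have Hp: "h ^^ n \<in> H" if "h \<in> H" for h n using that by (induction n) (auto simp: idH Hc)
  have sat: "\<sigma> \<in> H" if s: "\<sigma> \<in> G" "h \<in> H" "\<psi> \<sigma> - \<psi> h \<in> \<mm>" for \<sigma> h
  proof -
    have hG: "h \<in> G" using s HG by blast
    obtain \<tau> where t: "\<tau> \<in> G" "h \<circ> \<tau> = id" "\<tau> \<circ> h = id" using inverse_G[OF hG] .
    have 1: "\<psi> (\<tau> \<circ> \<sigma>) - (\<psi> \<tau> + \<psi> \<sigma>) \<in> \<mm>" using add t s by blast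
    have 2: "\<psi> (\<tau> \<circ> h) - (\<psi> \<tau> + \<psi> h) \<in> \<mm>" using add t hG by blast
    have "(\<psi> (\<tau> \<circ> \<sigma>) - (\<psi> \<tau> + \<psi> \<sigma>)) - (\<psi> (\<tau> \<circ> h) - (\<psi> \<tau> + \<psi> h)) + (\<psi> \<sigma> - \<psi> h) \<in> \<mm>"
      by (intro max_add max_diff 1 2 s)
    hence "\<psi> (\<tau> \<circ> \<sigma>) \<in> \<mm>" using t(3) id by simp
    hence "\<tau> \<circ> \<sigma> \<in> H" using Hk comp_G t s by blast
    hence "h \<circ> (\<tau> \<circ> \<sigma>) \<in> H" using Hc s by blast
    moreover have "h \<circ> (\<tau> \<circ> \<sigma>) = \<sigma>" using t(2) by (simp add: o_assoc)
    ultimately show ?thesis by (simp only:)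
  qed
  define W where "W = {v \<in> V. \<exists>h\<in>H. v - \<psi> h \<in> \<mm>}"
  have Wm: "v \<in> W" if "v \<in> \<mm>" for v using that max_ideal_subset idH id by (force simp: W_def)
  have Wadd: "v + w \<in> W" if vw: "v \<in> W" "w \<in> W" for v w
  proof -
    obtain h k where hk: "h \<in> H" "k \<in> H" "v - \<psi> h \<in> \<mm>" "w - \<psi> k \<in> \<mm>" using vw by (auto simp: W_def)
    have "(v - \<psi> h) + (w - \<psi> k) - (\<psi> (h \<circ> k) - (\<psi> h + \<psi> k)) \<in> \<mm>"
      using max_diff[OF max_add[OF hk(3,4)] add[of h k]] hk HG by blast
    hence "v + w - \<psi> (h \<circ> k) \<in> \<mm>" by (simp add: algebra_simps)
    thus ?thesis using vw hk Hc add_in unfolding W_def by blast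
  qed
  have Wnat: "of_nat n * v \<in> W" if "v \<in> W" for n v
    using that by (induction n) (auto simp: algebra_simps intro: Wm zero_max Wadd)
  have Wneg: "- v \<in> W" if v: "v \<in> W" for v
  proof -
    have vV: "v \<in> V" using v by (simp add: W_def)
    have "of_nat (q - 1) * v + - (of_nat q * v) \<in> W"
      by (intro Wadd Wnat v Wm max_uminus max_mult'[OF vV] q)
    moreover have "of_nat (q - 1) * v + - (of_nat q * v) = - v"
      using prime_ge_1_nat[OF q(1)] by (simp add: of_nat_diff algebra_simps)
    ultimately show ?thesis by simp
  qed
  have Wint: "of_int n * v \<in> W" if "v \<in> W" for n :: int and v
  proof (cases "n \<ge> 0")
    case True
    thus ?thesis using Wnat[OF that, of "nat n"] by (simp add: of_nat_nat)
  next
    case False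
    thus ?thesis using Wneg[OF Wnat[OF that, of "nat (- n)"]] by (simp add: of_nat_nat)
  qed
  have W1: "1 \<notin> W" using sat[OF s1(1)] s1(2) H1 by (auto simp: W_def)
  have Wd: "int q dvd d" if d: "of_int d \<in> W" for d
  proof (rule ccontr)
    assume nd: "\<not> int q dvd d"
    hence "coprime (int q) d" using q(1) by (simp add: prime_imp_coprime)
    then obtain u v where "u * int q + v * d = 1" by (metis bezout_int coprime_imp_gcd_eq_1)
    hence "of_int (u * int q + v * d) = (1 :: 'a)" by simp
    hence "of_int u * of_nat q + of_int v * of_int d = (1 :: 'a)" by simp
    moreover have "of_int u * of_nat q + of_int v * of_int d \<in> W"
      by (intro Wadd Wint d Wm max_mult of_int_in q)
    ultimately show False using W1 by simp
  qed
  have ex: "\<exists>i :: int. \<psi> \<tau> - of_int i \<in> W" if t: "\<tau> \<in> G" for \<tau>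
  proof (cases "\<tau> \<in> H")
    case True
    hence "\<psi> \<tau> \<in> W" using V t zero_max by (force simp: W_def)
    thus ?thesis by (intro exI[of _ 0]) simp
  next
    case False
    \<comment> \<open>The group generated by \<open>H\<close> and \<open>\<tau>\<close>, described
      by the values of \<open>\<psi>\<close>. By maximality of \<open>H\<close> it contains
      \<open>\<sigma>1\<close>, so \<open>1\<close> is \<open>j * \<psi> \<tau>\<close> modulo
      \<open>W\<close> with \<open>j\<close> prime to \<open>q\<close>; an inverse \<open>v\<close>
      of \<open>j\<close> modulo \<open>q\<close> is then the value of \<open>\<psi> \<tau>\<close>
      modulo \<open>W\<close>.\<close>
    define H' where "H' = {g \<in> G. \<exists>j :: nat. \<psi> g - of_nat j * \<psi> \<tau> \<in> W}"
    have HW: "\<psi> h \<in> W" if "h \<in> H" for h using that V HG zero_max by (force simp: W_def)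
    have "H \<subseteq> H'" using HG HW by (force simp: H'_def intro: exI[of _ 0])
    moreover have "\<tau> \<in> H'" using t Wm[OF zero_max] by (auto simp: H'_def intro!: exI[of _ 1])
    ultimately have "H \<subset> H'" using False by blast
    moreover have "finite H'" using finite_G by (simp add: H'_def)
    ultimately have "card H < card H'" by (simp add: psubset_card_mono)
    hence "\<not> good H'" using H(2) by force
    moreover have "g \<circ> g' \<in> H'" if gg: "g \<in> H'" "g' \<in> H'" for g g'
    proof -
      obtain i j :: nat where ij: "\<psi> g - of_nat i * \<psi> \<tau> \<in> W" "\<psi> g' - of_nat j * \<psi> \<tau> \<in> W"
        using gg by (auto simp: H'_def)
      have "\<psi> (g \<circ> g') - (\<psi> g + \<psi> g') \<in> W" using gg add Wm by (auto simp: H'_def)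
      hence "\<psi> (g \<circ> g') - (\<psi> g + \<psi> g') + ((\<psi> g - of_nat i * \<psi> \<tau>) + (\<psi> g' - of_nat j * \<psi> \<tau>)) \<in> W"
        using Wadd ij by blast
      hence "\<psi> (g \<circ> g') - of_nat (i + j) * \<psi> \<tau> \<in> W" by (simp add: algebra_simps)
      thus ?thesis using gg comp_G unfolding H'_def by blast
    qed
    moreover have "\<forall>\<sigma>\<in>G. \<psi> \<sigma> \<in> \<mm> \<longrightarrow> \<sigma> \<in> H'" using Hk \<open>H \<subseteq> H'\<close> by blast
    moreover have "H' \<subseteq> G" by (auto simp: H'_def)
    ultimately have "\<sigma>1 \<in> H'" unfolding good_def by blast
    then obtain j :: nat where j: "1 - of_nat j * \<psi> \<tau> \<in> W" using s1 by (auto simp: H'_def)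
    have "\<not> int q dvd int j"
    proof
      assume "int q dvd int j"
      hence "of_nat j \<in> \<mm>" using of_int_max_iff[OF q, of "int j"] by simp
      hence "of_nat j * \<psi> \<tau> \<in> W" by (intro Wm max_mult' V t)
      thus False using Wadd[OF j] W1 by fastforce
    qed
    hence "coprime (int q) (int j)" using q(1) by (simp add: prime_imp_coprime)
    then obtain u v where uv: "u * int q + v * int j = 1" by (metis bezout_int coprime_imp_gcd_eq_1)
    hence "of_int (u * int q + v * int j) * \<psi> \<tau> = \<psi> \<tau>" by simp
    hence eq: "\<psi> \<tau> = of_int u * (of_nat q * \<psi> \<tau>) + of_int v * (of_nat j * \<psi> \<tau>)" by (simp add: algebra_simps)
    have "of_int u * (of_nat q * \<psi> \<tau>) + - (of_int v * (1 - of_nat j * \<psi> \<tau>)) \<in> W"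
      by (intro Wadd Wneg Wint j Wm max_mult' V t q)
    moreover have "of_int u * (of_nat q * \<psi> \<tau>) + - (of_int v * (1 - of_nat j * \<psi> \<tau>)) = \<psi> \<tau> - of_int v"
      by (subst (3) eq) (simp add: algebra_simps)
    ultimately have "\<psi> \<tau> - of_int v \<in> W" by simp
    thus ?thesis by blast
  qed
  then obtain \<chi> :: "('a \<Rightarrow> 'a) \<Rightarrow> int" where \<chi>: "\<And>\<tau>. \<tau> \<in> G \<Longrightarrow> \<psi> \<tau> - of_int (\<chi> \<tau>) \<in> W" by metis
  show ?thesis
  proof (intro exI[of _ \<chi>] conjI ballI)
    fix \<sigma> \<tau> assume st: "\<sigma> \<in> G" "\<tau> \<in> G"
    have "(\<psi> \<sigma> - of_int (\<chi> \<sigma>)) + (\<psi> \<tau> - of_int (\<chi> \<tau>)) + (\<psi> (\<sigma> \<circ> \<tau>) - (\<psi> \<sigma> + \<psi> \<tau>))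
        + - (\<psi> (\<sigma> \<circ> \<tau>) - of_int (\<chi> (\<sigma> \<circ> \<tau>))) \<in> W"
      using st comp_G add by (intro Wadd Wneg \<chi> Wm) auto
    hence "of_int (\<chi> (\<sigma> \<circ> \<tau>) - (\<chi> \<sigma> + \<chi> \<tau>)) \<in> W" by (simp add: algebra_simps)
    thus "int q dvd \<chi> (\<sigma> \<circ> \<tau>) - (\<chi> \<sigma> + \<chi> \<tau>)" by (rule Wd)
  next
    show "\<not> int q dvd \<chi> \<sigma>1"
    proof
      assume "int q dvd \<chi> \<sigma>1"
      hence "of_int (\<chi> \<sigma>1) \<in> W" using of_int_max_iff[OF q] Wm by blast
      hence "(\<psi> \<sigma>1 - of_int (\<chi> \<sigma>1)) + of_int (\<chi> \<sigma>1) \<in> W" using \<chi>[OF s1(1)] Wadd by blast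
      thus False using W1 s1 by simp
    qed
  qed
qed

text \<open>Additive Hilbert 90: an element \<open>y\<close> of nonzero trace yields
  \<open>x\<close> with \<open>\<rho> x = x + \<chi> \<rho>\<close> for all \<open>\<rho>\<close>,
  so \<open>x ^ q - x\<close> is fixed. A solution \<open>b\<close> in \<open>K\<close> would differ
  from \<open>x\<close> by an element of the prime field and put \<open>x\<close> into
  \<open>K\<close>; but \<open>\<sigma>1\<close> moves \<open>x\<close>.\<close>

lemma artin_schreier_element:
  assumes q: "prime q" "of_nat q = (0::'a)"
    and \<chi>: "\<And>\<sigma> \<tau>. \<sigma> \<in> G \<Longrightarrow> \<tau> \<in> G \<Longrightarrow> int q dvd \<chi> (\<sigma> \<circ> \<tau>) - (\<chi> \<sigma> + \<chi> \<tau>)" and s1: "\<sigma>1 \<in> G" "\<not> int q dvd \<chi> \<sigma>1"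
  shows "\<exists>a\<in>K. \<forall>b\<in>K. b ^ q - b \<noteq> a"
proof -
  have qm: "of_nat q \<in> \<mm>" using q zero_max by simp
  have int0: "(of_int n :: 'a) = 0" if d: "int q dvd n" for n
  proof -
    obtain k where "n = int q * k" using d by blast
    hence "(of_int n :: 'a) = of_nat q * of_int k" by simp
    thus ?thesis using q by simp
  qed
  obtain y where y: "y \<in> L" "(\<Sum>\<sigma>\<in>G. 1 * \<sigma> y) \<noteq> 0" using dedekind_ex[of "\<lambda>_. 1"] by auto
  define T where "T = (\<Sum>\<sigma>\<in>G. \<sigma> y)"
  define x0 where "x0 = (\<Sum>\<sigma>\<in>G. of_int (\<chi> \<sigma>) * \<sigma> y)"
  define x where "x = - x0 / T"
  have T0: "T \<noteq> 0" using y by (simp add: T_def)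
  have TL: "T \<in> L" unfolding T_def using maps_L y by (intro L.sum_in) auto
  have x0L: "x0 \<in> L" unfolding x0_def using maps_L y by (intro L.sum_in L.mult_in L.of_int_in) auto
  have xL: "x \<in> L" unfolding x_def using TL x0L by (intro L.divide_in L.uminus_in)
  have xr: "\<rho> x = x + of_int (\<chi> \<rho>)" if r: "\<rho> \<in> G" for \<rho>
  proof -
    interpret r: field_hom L \<rho> by (rule field_hom_G) fact
    have rint: "\<rho> (of_int n) = of_int n" for n using fix_K[OF r] K.of_int_in by blast
    have "\<rho> T = (\<Sum>\<sigma>\<in>G. (\<rho> \<circ> \<sigma>) y)" unfolding T_def using maps_L y by (subst r.hom_sum) auto
    hence rT: "\<rho> T = T" using sum_comp[OF r, of "\<lambda>\<sigma>. \<sigma> y"] by (simp add: T_def)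
    have "\<rho> x0 = (\<Sum>\<sigma>\<in>G. of_int (\<chi> \<sigma>) * (\<rho> \<circ> \<sigma>) y)"
      unfolding x0_def using maps_L y by (subst r.hom_sum) (auto simp: L.mult_in L.of_int_in r.hom_mult rint)
    also have "\<dots> = (\<Sum>\<sigma>\<in>G. (of_int (\<chi> (\<rho> \<circ> \<sigma>)) - of_int (\<chi> \<rho>)) * (\<rho> \<circ> \<sigma>) y)"
    proof (rule sum.cong)
      fix \<sigma> assume "\<sigma> \<in> G"
      hence "(of_int (\<chi> (\<rho> \<circ> \<sigma>) - (\<chi> \<rho> + \<chi> \<sigma>)) :: 'a) = 0" using \<chi>[OF r] int0 by blast
      hence "(of_int (\<chi> (\<rho> \<circ> \<sigma>)) - of_int (\<chi> \<rho>) :: 'a) = of_int (\<chi> \<sigma>)" by (simp add: algebra_simps)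
      thus "of_int (\<chi> \<sigma>) * (\<rho> \<circ> \<sigma>) y = (of_int (\<chi> (\<rho> \<circ> \<sigma>)) - of_int (\<chi> \<rho>)) * (\<rho> \<circ> \<sigma>) y" by simp
    qed simp
    also have "\<dots> = (\<Sum>\<sigma>\<in>G. (of_int (\<chi> \<sigma>) - of_int (\<chi> \<rho>)) * \<sigma> y)"
      by (rule sum_comp[OF r])
    also have "\<dots> = x0 - of_int (\<chi> \<rho>) * T"
      by (simp add: x0_def T_def left_diff_distrib sum_subtractf sum_distrib_left)
    finally have "\<rho> x0 = x0 - of_int (\<chi> \<rho>) * T" .
    moreover have "\<rho> x = - \<rho> x0 / \<rho> T"
      unfolding x_def using r.hom_divide[OF L.uminus_in[OF x0L] TL] r.hom_uminus[OF x0L] by (simp only:)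
    ultimately show ?thesis using rT T0 by (simp add: x_def diff_divide_distrib)
  qed
  have powi: "(of_int n :: 'a) ^ q = of_int n" for n
  proof -
    have pn: "of_nat i ^ q = (of_nat i :: 'a)" for i
    proof (induction i)
      case 0
      thus ?case using prime_gt_0_nat[OF q(1)] by (simp add: zero_power)
    next
      case (Suc i)
      thus ?case using frobenius_char(1)[OF q, of 1 "of_nat i"] by simp
    qed
    show ?thesis
    proof (cases "n \<ge> 0")
      case True
      thus ?thesis using pn[of "nat n"] by (simp add: of_nat_nat)
    next
      case False
      have "(0 - of_nat (nat (- n)) :: 'a) ^ q = 0 ^ q - of_nat (nat (- n)) ^ q" by (rule frobenius_char(2)[OF q])
      thus ?thesis using pn[of "nat (- n)"] False prime_gt_0_nat[OF q(1)] by (simp add: of_nat_nat zero_power)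
    qed
  qed
  define a where "a = x ^ q - x"
  have "\<rho> a = a" if r: "\<rho> \<in> G" for \<rho>
    using hom(3)[OF r L.power_in[OF xL] xL] hom(9)[OF r xL] xr[OF r] frobenius_char(1)[OF q] powi
    by (simp add: a_def)
  hence aK: "a \<in> K" using fixed_K xL by (auto simp: a_def intro: L.diff_in L.power_in)
  moreover have "b ^ q - b \<noteq> a" if b: "b \<in> K" for b
  proof
    assume "b ^ q - b = a"
    moreover have "x ^ q - b ^ q = a - (b ^ q - b) + (x - b)" by (simp add: a_def)
    ultimately have "x ^ q - b ^ q = x - b" by simp
    hence "(x - b) ^ q = x - b" using frobenius_char(2)[OF q, of x b] by simp
    then obtain i where "x - b = of_nat i" using prime_field_roots[OF q] by blast
    hence "x = b + of_nat i" by (simp add: algebra_simps)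
    hence "x \<in> K" using b K.add_in K.of_nat_in by simp
    hence "\<sigma>1 x = x" using fix_K s1 by blast
    hence "(of_int (\<chi> \<sigma>1) :: 'a) = 0" using xr[OF s1(1)] by simp
    thus False using of_int_max_iff[OF q(1) qm, of "\<chi> \<sigma>1"] s1 zero_max by simp
  qed
  ultimately show ?thesis by blast
qed

text \<open>If \<open>\<sigma> \<zeta> = \<zeta> ^ j\<close>, then
  \<open>\<sigma> (\<zeta> - 1) / (\<zeta> - 1)\<close> is a sum of \<open>j\<close> powers of
  \<open>\<zeta>\<close>, hence congruent to \<open>j\<close>; by \<open>wild\<close> it is
  congruent to \<open>1\<close>, so \<open>j = 1\<close>. Once \<open>\<zeta>\<close> is in
  \<open>K\<close>, each \<open>\<rho>\<close> multiplies a Lagrange resolvent \<open>x\<close> by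
  the root of unity \<open>e (\<chi> \<rho>)\<close>, so that \<open>x ^ q\<close> lies in
  \<open>K\<close> while \<open>\<sigma>1\<close> moves \<open>x\<close>.\<close>

lemma kummer_element:
  assumes tame: tamely_divisible
    and q: "prime q" "of_nat q \<in> \<mm>" and z: "\<zeta> \<in> L" "\<zeta> ^ q = 1" "\<zeta> \<noteq> 1"
    and \<chi>: "\<And>\<sigma> \<tau>. \<sigma> \<in> G \<Longrightarrow> \<tau> \<in> G \<Longrightarrow> int q dvd \<chi> (\<sigma> \<circ> \<tau>) - (\<chi> \<sigma> + \<chi> \<tau>)" and s1: "\<sigma>1 \<in> G" "\<not> int q dvd \<chi> \<sigma>1"
  shows "\<zeta> \<in> K \<and> (\<exists>a\<in>K - {0}. \<forall>b\<in>K. b ^ q \<noteq> a)"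
proof -
  have q2: "q \<ge> 2" using q prime_ge_2_nat by blast
  have zV: "\<zeta> \<in> V" using power_in_V[of q \<zeta>] z one_in q2 by simp
  have z1: "\<zeta> - 1 \<in> \<mm>" using frobenius_one[OF q zV, of 1] z zero_max by simp
  have zpow1: "\<zeta> ^ i - 1 \<in> \<mm>" for i
  proof (induction i)
    case (Suc i)
    have "\<zeta> ^ Suc i - 1 = \<zeta> * (\<zeta> ^ i - 1) + (\<zeta> - 1)" by (simp add: algebra_simps)
    thus ?case using max_add[OF max_mult[OF zV Suc] z1] by (simp only:)
  qed (simp add: zero_max)
  have "\<sigma> \<zeta> = \<zeta>" if s: "\<sigma> \<in> G" for \<sigma>
  proof -
    have "\<sigma> \<zeta> ^ q = 1" using hom(9)[OF s z(1), of q] hom(5)[OF s] z by simp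
    then obtain j where j: "j < q" "\<sigma> \<zeta> = \<zeta> ^ j" using roots_of_unity[OF q(1) z(2,3)] by blast
    have pL: "\<zeta> - 1 \<in> L" "\<zeta> - 1 \<noteq> 0" using z L.diff_in L.one_in by auto
    have "\<sigma> (\<zeta> - 1) / (\<zeta> - 1) - 1 \<in> \<mm>" by (rule wild[OF tame s pL])
    moreover have "\<sigma> (\<zeta> - 1) = \<zeta> ^ j - 1" using hom(3)[OF s z(1) L.one_in] hom(5)[OF s] j by simp
    moreover have "(\<zeta> ^ j - 1) / (\<zeta> - 1) = (\<Sum>i<j. \<zeta> ^ i)" using z(3) geometric_sum[of \<zeta> j] by simp
    ultimately have "(\<Sum>i<j. \<zeta> ^ i) - 1 \<in> \<mm>" by simp
    moreover have "(\<Sum>i<j. \<zeta> ^ i - 1) \<in> \<mm>" by (intro max_sum zpow1)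
    hence "(\<Sum>i<j. \<zeta> ^ i) - of_nat j \<in> \<mm>" by (simp add: sum_subtractf)
    ultimately have "((\<Sum>i<j. \<zeta> ^ i) - 1) - ((\<Sum>i<j. \<zeta> ^ i) - of_nat j) \<in> \<mm>" by (rule max_diff)
    hence "of_int (int j - 1) \<in> \<mm>" by simp
    hence dvd: "int q dvd int j - 1" using of_int_max_iff[OF q] by blast
    have "int j - 1 = 0"
    proof (rule ccontr)
      assume "int j - 1 \<noteq> 0"
      hence "int q \<le> \<bar>int j - 1\<bar>" using dvd_imp_le_int[OF _ dvd] by simp
      thus False using j q2 by auto
    qed
    thus ?thesis using j by simp
  qed
  hence zK: "\<zeta> \<in> K" using fixed_K z by blast
  \<comment> \<open>The power of \<open>\<zeta>\<close> with integer exponent \<open>n\<close>;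
    reduction modulo \<open>q\<close> makes the exponent natural.\<close>
  define e where "e n = \<zeta> ^ nat (n mod int q)" for n :: int
  have z0: "\<zeta> \<noteq> 0" using z(2) q2 by (auto simp: zero_power)
  have mod_pow: "\<zeta> ^ m = \<zeta> ^ (m mod q)" for m
  proof -
    have "\<zeta> ^ m = \<zeta> ^ (q * (m div q) + m mod q)" by simp
    also have "\<dots> = (\<zeta> ^ q) ^ (m div q) * \<zeta> ^ (m mod q)" by (simp only: power_add power_mult)
    finally show ?thesis using z by simp
  qed
  have e_add: "e (m + n) = e m * e n" for m n
  proof -
    have q0: "int q > 0" using q2 by simp
    have "nat ((m + n) mod int q) = (nat (m mod int q) + nat (n mod int q)) mod q"
    proof -
      have "int ((nat (m mod int q) + nat (n mod int q)) mod q) = (m + n) mod int q"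
        using q0 by (simp add: zmod_int mod_add_eq)
      thus ?thesis by (metis nat_int)
    qed
    thus ?thesis unfolding e_def by (metis mod_pow power_add)
  qed
  have e0: "e n = 1 \<longleftrightarrow> int q dvd n" for n
  proof -
    have q0: "int q > 0" using q2 by simp
    have "e n = 1 \<longleftrightarrow> q dvd nat (n mod int q)" unfolding e_def by (rule root_of_unity_power[OF q(1) z(2,3)])
    also have "\<dots> \<longleftrightarrow> int q dvd n mod int q" using q0 by (simp add: int_dvd_int_iff[symmetric])
    also have "\<dots> \<longleftrightarrow> int q dvd n" by (simp add: dvd_mod_iff)
    finally show ?thesis .
  qed
  have eK: "e n \<in> K" for n unfolding e_def by (intro K.power_in zK)
  have en0: "e n \<noteq> 0" for n unfolding e_def using z0 by simp
  obtain y where y: "y \<in> L" "(\<Sum>\<sigma>\<in>G. e (- \<chi> \<sigma>) * \<sigma> y) \<noteq> 0"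
    using dedekind_ex[of "\<lambda>\<sigma>. e (- \<chi> \<sigma>)"] en0 by auto
  define x where "x = (\<Sum>\<sigma>\<in>G. e (- \<chi> \<sigma>) * \<sigma> y)"
  have xL: "x \<in> L" unfolding x_def using maps_L y eK KL by (intro L.sum_in L.mult_in) auto
  have x0: "x \<noteq> 0" using y by (simp add: x_def)
  have xr: "\<rho> x = e (\<chi> \<rho>) * x" if r: "\<rho> \<in> G" for \<rho>
  proof -
    interpret r: field_hom L \<rho> by (rule field_hom_G) fact
    have "\<rho> x = (\<Sum>\<sigma>\<in>G. e (- \<chi> \<sigma>) * (\<rho> \<circ> \<sigma>) y)"
      unfolding x_def using maps_L y eK KL fix_K[OF r]
      by (subst r.hom_sum) (auto intro!: L.mult_in sum.cong simp: r.hom_mult subset_iff)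
    also have "\<dots> = (\<Sum>\<sigma>\<in>G. (e (\<chi> \<rho>) * e (- \<chi> (\<rho> \<circ> \<sigma>))) * (\<rho> \<circ> \<sigma>) y)"
    proof (rule sum.cong)
      fix \<sigma> assume "\<sigma> \<in> G"
      hence "e (\<chi> (\<rho> \<circ> \<sigma>) - (\<chi> \<rho> + \<chi> \<sigma>)) = 1" using \<chi>[OF r] e0 by blast
      moreover have "- \<chi> \<sigma> = (\<chi> (\<rho> \<circ> \<sigma>) - (\<chi> \<rho> + \<chi> \<sigma>)) + (\<chi> \<rho> + - \<chi> (\<rho> \<circ> \<sigma>))" by simp
      ultimately have "e (- \<chi> \<sigma>) = e (\<chi> \<rho>) * e (- \<chi> (\<rho> \<circ> \<sigma>))" using e_add by (metis mult_1)
      thus "e (- \<chi> \<sigma>) * (\<rho> \<circ> \<sigma>) y = (e (\<chi> \<rho>) * e (- \<chi> (\<rho> \<circ> \<sigma>))) * (\<rho> \<circ> \<sigma>) y" by simp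
    qed simp
    also have "\<dots> = (\<Sum>\<sigma>\<in>G. (e (\<chi> \<rho>) * e (- \<chi> \<sigma>)) * \<sigma> y)" by (rule sum_comp[OF r])
    also have "\<dots> = e (\<chi> \<rho>) * x" by (simp add: x_def sum_distrib_left mult.assoc)
    finally show ?thesis .
  qed
  have "\<rho> (x ^ q) = x ^ q" if r: "\<rho> \<in> G" for \<rho>
  proof -
    have "e (\<chi> \<rho>) ^ q = 1" unfolding e_def using z(2) by (metis power_commutes power_mult mult.commute power_one)
    thus ?thesis using hom(9)[OF r xL, of q] xr[OF r] by (simp add: power_mult_distrib)
  qed
  hence "x ^ q \<in> K" using fixed_K xL L.power_in by blast
  moreover have "b ^ q \<noteq> x ^ q" if b: "b \<in> K" for b
  proof
    assume eq: "b ^ q = x ^ q"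
    have b0: "b \<noteq> 0" using eq x0 q2 by (auto simp: zero_power)
    have "(x / b) ^ q = 1" using eq x0 by (simp add: power_divide)
    then obtain j where "x / b = \<zeta> ^ j" using roots_of_unity[OF q(1) z(2,3)] by blast
    hence "x = \<zeta> ^ j * b" using b0 by (simp add: field_simps)
    hence "x \<in> K" using b zK K.power_in K.mult_in by simp
    hence "e (\<chi> \<sigma>1) = 1" using xr[OF s1(1)] fix_K[OF s1(1)] x0 by simp
    thus False using e0 s1 by blast
  qed
  ultimately show ?thesis using zK x0 by (intro conjI bexI[of _ "x ^ q"]) auto
qed

text \<open>An element \<open>\<sigma>1\<close> of finite order \<open>n\<close> with
  \<open>\<psi> \<sigma>1 = 1\<close> forces \<open>n\<close> into \<open>\<mm>\<close>, so that
  there is a residue characteristic \<open>q\<close>. Whether \<open>q\<close> vanishes in the field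
  decides between the additive and the multiplicative form of Hilbert 90.\<close>

theorem trichotomy:
  assumes x: "x \<in> L" "x \<notin> K"
    and zeta: "\<forall>q. prime q \<longrightarrow> of_nat q \<in> \<mm> \<longrightarrow> of_nat q \<noteq> (0::'a) \<longrightarrow> (\<exists>\<zeta>\<in>L. \<zeta> ^ q = 1 \<and> \<zeta> \<noteq> 1)"
  obtains (tame) p x where "prime p" "of_nat p \<notin> \<mm>" "x \<in> K - {0}" "\<And>y. y \<in> K - {0} \<Longrightarrow> x / y ^ p \<notin> V - \<mm>"
    | (artin_schreier) q a where "prime q" "of_nat q = (0::'a)" "a \<in> K" "\<And>b. b \<in> K \<Longrightarrow> b ^ q - b \<noteq> a"
    | (kummer) q \<zeta> a where "prime q" "of_nat q \<in> \<mm>" "of_nat q \<noteq> (0::'a)" "\<zeta> \<in> K" "\<zeta> ^ q = 1" "\<zeta> \<noteq> 1"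
        "a \<in> K - {0}" "\<And>b. b \<in> K \<Longrightarrow> b ^ q \<noteq> a"
proof (cases tamely_divisible)
  case False
  thus ?thesis using tame unfolding tamely_divisible_def by blast
next
  case True
  obtain \<psi> \<sigma>1 where \<psi>: "\<And>\<sigma>. \<sigma> \<in> G \<Longrightarrow> \<psi> \<sigma> \<in> V" "\<sigma>1 \<in> G" "\<psi> \<sigma>1 = 1" "\<psi> id = 0"
    "\<And>\<sigma> \<tau>. \<sigma> \<in> G \<Longrightarrow> \<tau> \<in> G \<Longrightarrow> \<psi> (\<sigma> \<circ> \<tau>) - (\<psi> \<sigma> + \<psi> \<tau>) \<in> \<mm>"
    using additive_character[OF True x] by blast
  obtain n where n: "n > 0" "\<sigma>1 ^^ n = id" using finite_order[OF \<psi>(2)] .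
  have "\<psi> (\<sigma>1 ^^ n) - of_nat n * \<psi> \<sigma>1 \<in> \<mm>"
    using additive_character_power[of \<psi> \<sigma>1 n] \<psi> by blast
  hence "of_nat n \<in> \<mm>" using n \<psi> max_uminus_iff by simp
  then obtain q where q: "prime q" "of_nat q \<in> \<mm>" using prime_in_max n by blast
  have "\<exists>\<chi> :: ('a \<Rightarrow> 'a) \<Rightarrow> int.
      (\<forall>\<sigma>\<in>G. \<forall>\<tau>\<in>G. int q dvd \<chi> (\<sigma> \<circ> \<tau>) - (\<chi> \<sigma> + \<chi> \<tau>)) \<and> \<not> int q dvd \<chi> \<sigma>1"
    by (rule prime_character[OF q \<psi>])
  then obtain \<chi> :: "('a \<Rightarrow> 'a) \<Rightarrow> int" where \<chi>:
      "\<And>\<sigma> \<tau>. \<sigma> \<in> G \<Longrightarrow> \<tau> \<in> G \<Longrightarrow> int q dvd \<chi> (\<sigma> \<circ> \<tau>) - (\<chi> \<sigma> + \<chi> \<tau>)" "\<not> int q dvd \<chi> \<sigma>1"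
    by blast
  show ?thesis
  proof (cases "of_nat q = (0::'a)")
    case True
    have "\<exists>a\<in>K. \<forall>b\<in>K. b ^ q - b \<noteq> a"
      by (rule artin_schreier_element[OF q(1) True \<chi>(1) \<psi>(2) \<chi>(2)])
    then obtain a where a: "a \<in> K" "\<forall>b\<in>K. b ^ q - b \<noteq> a" by blast
    show ?thesis by (rule artin_schreier[OF q(1) True a(1)]) (use a(2) in blast)
  next
    case False
    obtain \<zeta> where z: "\<zeta> \<in> L" "\<zeta> ^ q = 1" "\<zeta> \<noteq> 1" using zeta q False by blast
    have "\<zeta> \<in> K \<and> (\<exists>a\<in>K - {0}. \<forall>b\<in>K. b ^ q \<noteq> a)"
      by (rule kummer_element[OF True q z \<chi>(1) \<psi>(2) \<chi>(2)])
    then obtain a where a: "\<zeta> \<in> K" "a \<in> K - {0}" "\<forall>b\<in>K. b ^ q \<noteq> a" by blast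
    show ?thesis by (rule kummer[OF q False a(1) z(2,3) a(2)]) (use a(3) in blast)
  qed
qed

end

section \<open>Existence of a definable ball\<close>

lemma card_simple_roots:
  fixes f :: "'a::alg_closed_field poly"
  assumes "f \<noteq> 0" "\<And>a. poly f a = 0 \<Longrightarrow> poly (pderiv f) a \<noteq> 0"
  shows "card {x. poly f x = 0} = degree f"
  using assms
proof (induction "degree f" arbitrary: f)
  case 0
  then obtain c where "f = [:c:]" using degree_eq_zeroE by metis
  thus ?case using 0 by auto
next
  case (Suc n)
  then obtain a where a: "poly f a = 0" using alg_closed_imp_poly_has_root by (metis zero_less_Suc)
  then obtain g where g: "f = [:- a, 1:] * g" unfolding poly_eq_0_iff_dvd by (auto elim: dvdE)
  have g0: "g \<noteq> 0" using g Suc.prems by auto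
  have dg: "degree f = Suc (degree g)" unfolding g using g0 by (subst degree_mult_eq) auto
  have pd: "poly (pderiv f) b = poly g b + (b - a) * poly (pderiv g) b" for b
    unfolding g pderiv_mult by (simp add: pderiv_pCons algebra_simps)
  have "poly (pderiv g) b \<noteq> 0" if "poly g b = 0" for b
    using Suc.prems(2)[of b] pd[of b] that g by auto
  hence "card {x. poly g x = 0} = degree g" using Suc.hyps dg g0 by simp
  moreover have "poly g a \<noteq> 0" using Suc.prems(2)[OF a] pd[of a] by simp
  moreover have "{x. poly f x = 0} = insert a {x. poly g x = 0}" unfolding g by auto
  ultimately show ?case using dg poly_roots_finite[OF g0] by simp
qed

lemma poly_map_to_ac: "poly (map_poly to_ac f) (to_ac x) = to_ac (poly f x)"
  by (induction f) (simp_all add: map_poly_pCons)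

lemma pderiv_map_to_ac: "pderiv (map_poly to_ac f) = map_poly to_ac (pderiv f)"
  by (rule poly_eqI) (simp add: coeff_pderiv coeff_map_poly del: of_nat_Suc)

lemma map_to_ac_add: "map_poly to_ac (f + g) = map_poly to_ac f + map_poly to_ac g"
  by (rule poly_eqI) (simp add: coeff_map_poly)

lemma map_to_ac_diff: "map_poly to_ac (f - g) = map_poly to_ac f - map_poly to_ac g"
  by (rule poly_eqI) (simp add: coeff_map_poly)

lemma map_to_ac_mult: "map_poly to_ac (f * g) = map_poly to_ac f * map_poly to_ac g"
  by (rule poly_eqI) (simp add: coeff_map_poly coeff_mult to_ac_sum)

lemma degree_map_to_ac: "degree (map_poly to_ac f) = degree f"
  by (rule degree_map_poly) simp

lemma coeffs_in_to_ac_image: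
  assumes "coeffs_in (to_ac ` S) F" "0 \<in> S"
  obtains f where "F = map_poly to_ac f" "coeffs_in S f"
proof
  define f where "f = map_poly of_ac F"
  have c: "to_ac (coeff f i) = coeff F i \<and> coeff f i \<in> S" for i
  proof -
    obtain s where "coeff F i = to_ac s" "s \<in> S" using assms(1) by (auto simp: coeffs_in_def)
    thus ?thesis by (simp add: f_def coeff_map_poly)
  qed
  show "F = map_poly to_ac f" by (rule poly_eqI) (simp add: coeff_map_poly c)
  show "coeffs_in S f" using c by (simp add: coeffs_in_def)
qed

lemma coeffs_in_map_to_ac: "coeffs_in (to_ac ` S) (map_poly to_ac f) \<longleftrightarrow> coeffs_in S f"
  by (auto simp: coeffs_in_def coeff_map_poly inj_image_mem_iff[OF inj_to_ac])

lemma algebraic_over_to_ac: "algebraic_over (range (to_ac :: 'a::field \<Rightarrow> _))"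
proof unfold_locales
  show "1 \<in> range (to_ac :: 'a \<Rightarrow> _)" by (metis rangeI to_ac_1)
  show "x - y \<in> range (to_ac :: 'a \<Rightarrow> _)" if "x \<in> range to_ac" "y \<in> range to_ac" for x y
    using that by (auto simp flip: to_ac_diff)
  show "x * y \<in> range (to_ac :: 'a \<Rightarrow> _)" if "x \<in> range to_ac" "y \<in> range to_ac" for x y
    using that by (auto simp flip: to_ac_mult)
  show "inverse x \<in> range (to_ac :: 'a \<Rightarrow> _)" if "x \<in> range to_ac" for x
    using that by (auto simp flip: to_ac_inverse)
  fix x :: "'a alg_closure"
  obtain p :: "'a poly" where "p \<noteq> 0" "poly (map_poly to_ac p) x = 0" using alg_closure_algebraic .
  moreover have "map_poly to_ac p \<noteq> 0" using \<open>p \<noteq> 0\<close> by (simp add: map_poly_eq_0_iff)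
  ultimately show "\<exists>f. coeffs_in (range to_ac) f \<and> f \<noteq> 0 \<and> poly f x = 0"
    by (intro exI[of _ "map_poly to_ac p"]) (auto simp: coeffs_in_def coeff_map_poly)
qed

context henselian_sc
begin

text \<open>The Bezout identity makes \<open>f\<close> separable, so its roots, together with the
  roots of unity that the Kummer case asks for, generate a Galois extension, nontrivial because of
  \<open>\<alpha>\<close>. \<open>V\<close> is first extended to the algebraic closure by
  \<open>chevalley\<close>; as its maximal ideal goes into the new maximal ideal, the extension
  induces \<open>V\<close> again.\<close>

theorem definable_ball:
  fixes f U W :: "'a poly"
  assumes bezout: "U * f + W * pderiv f = 1"
    and root: "poly (map_poly to_ac f) \<alpha> = 0" "\<alpha> \<notin> range to_ac"
  shows "\<exists>M. proper_ball V M \<and> definable M"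
proof -
  let ?K = "range (to_ac :: 'a \<Rightarrow> _)"
  interpret K: algebraic_over ?K by (rule algebraic_over_to_ac)
  note inj = inj_image_mem_iff[OF inj_to_ac]
  obtain Vc :: "'a alg_closure set" where Vc: "valuation_set Vc" "to_ac ` V \<subseteq> Vc" "to_ac ` \<mm> \<subseteq> max_ideal Vc"
  proof (rule chevalley[of "to_ac ` V" "to_ac ` \<mm>"])
    show "ring_set (to_ac ` V)"
    proof
      show "1 \<in> to_ac ` V" using one_in by (metis image_eqI to_ac_1)
      show "x - y \<in> to_ac ` V" if "x \<in> to_ac ` V" "y \<in> to_ac ` V" for x y
        using that by (auto simp flip: to_ac_diff intro: diff_in)
      show "x * y \<in> to_ac ` V" if "x \<in> to_ac ` V" "y \<in> to_ac ` V" for x y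
        using that by (auto simp flip: to_ac_mult intro: mult_in)
    qed
    show "to_ac ` \<mm> \<subseteq> to_ac ` V" using max_ideal_subset by blast
    show "0 \<in> to_ac ` \<mm>" using zero_max by (metis image_eqI to_ac_0)
    show "x / y \<in> to_ac ` V \<or> y / x \<in> to_ac ` V" if xy: "x \<in> to_ac ` \<mm>" "y \<in> to_ac ` \<mm>" for x y
    proof -
      obtain u v where "x = to_ac u" "y = to_ac v" using xy by blast
      thus ?thesis using comparable[of u v] by (auto simp flip: to_ac_divide simp: inj)
    qed
    show "inverse x \<notin> to_ac ` V" if "x \<in> to_ac ` \<mm>" "x \<noteq> 0" for x
      using that by (auto simp flip: to_ac_inverse simp: inj max_ideal_def)
  qed auto
  interpret C: valuation_set Vc by fact
  have VK: "to_ac x \<in> Vc \<longleftrightarrow> x \<in> V" for x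
  proof
    assume x: "to_ac x \<in> Vc"
    show "x \<in> V"
    proof (rule ccontr)
      assume "x \<notin> V"
      hence "x \<noteq> 0" "inverse x \<in> \<mm>" using not_in_V by auto
      hence "inverse (to_ac x) \<in> max_ideal Vc" "to_ac x \<noteq> 0" using Vc(3) by (auto simp flip: to_ac_inverse)
      thus False using x C.not_in_V by blast
    qed
  qed (use Vc in blast)
  have mK: "to_ac x \<in> max_ideal Vc \<longleftrightarrow> x \<in> \<mm>" for x
    using VK[of "inverse x"] by (simp add: max_ideal_def)
  have VKi: "Vc \<inter> ?K = to_ac ` V" using VK by auto
  define F where "F = map_poly to_ac f"
  have F0: "F \<noteq> 0"
  proof
    assume "F = 0"
    hence "f = 0" by (simp add: F_def map_poly_eq_0_iff)
    thus False using bezout by simp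
  qed
  have Fs: "poly (pderiv F) a \<noteq> 0" if a: "poly F a = 0" for a
  proof
    assume "poly (pderiv F) a = 0"
    moreover have "map_poly to_ac U * F + map_poly to_ac W * pderiv F = 1"
    proof -
      have "map_poly to_ac (U * f + W * pderiv f) = 1" unfolding bezout by (simp add: map_poly_1')
      thus ?thesis by (simp only: map_to_ac_add map_to_ac_mult F_def pderiv_map_to_ac)
    qed
    hence "poly (map_poly to_ac U * F + map_poly to_ac W * pderiv F) a = 1" by simp
    ultimately show False using a by simp
  qed
  \<comment> \<open>Contains at most the residue characteristic, and only if it differs from the
    characteristic of the field; a set treats all situations alike.\<close>
  define Q where "Q = {q :: nat. prime q \<and> of_nat q \<in> \<mm> \<and> of_nat q \<noteq> (0::'a)}"
  have "finite Q"
  proof (cases "Q = {}")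
    case False
    then obtain q where q: "q \<in> Q" by blast
    have "Q \<subseteq> {q}"
    proof
      fix r assume "r \<in> Q"
      hence "q dvd r" "prime r" "prime q" using q coprime_notin_max[of q r] by (auto simp: Q_def)
      thus "r \<in> {q}" using primes_dvd_imp_eq by blast
    qed
    thus ?thesis using finite_subset by blast
  qed simp
  define X1 :: "nat \<Rightarrow> 'a alg_closure poly" where "X1 q = monom 1 q - 1" for q
  have X1: "degree (X1 q) = q" "X1 q \<noteq> 0" "coeffs_in ?K (X1 q)" "card {x. poly (X1 q) x = 0} = degree (X1 q)"
    if q: "q \<in> Q" for q
  proof -
    have q0: "q > 0" using q prime_gt_0_nat by (auto simp: Q_def)
    show d: "degree (X1 q) = q" unfolding X1_def by (rule degree_monom_diff) (use q0 in simp)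
    show n: "X1 q \<noteq> 0" using d q0 by auto
    show "coeffs_in ?K (X1 q)" unfolding X1_def
      by (intro K.coeffs_in_diff K.coeffs_in_monom K.coeffs_in_1 K.one_in)
    show "card {x. poly (X1 q) x = 0} = degree (X1 q)"
    proof (rule card_simple_roots[OF n])
      fix a assume "poly (X1 q) a = 0"
      hence "a ^ q = 1" by (simp add: X1_def poly_monom)
      hence "a \<noteq> 0" using q0 by (auto simp: zero_power)
      moreover have "of_nat q \<noteq> (0 :: 'a alg_closure)" using q by (simp add: Q_def flip: to_ac_of_nat)
      ultimately show "poly (pderiv (X1 q)) a \<noteq> 0" by (simp add: X1_def pderiv_diff pderiv_monom poly_monom)
    qed
  qed
  define R where "R = {x. poly F x = 0} \<union> (\<Union>q\<in>Q. {x. poly (X1 q) x = 0})"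
  have R: "K.separable_roots R"
  proof -
    have "finite R" unfolding R_def using F0 X1(2) \<open>finite Q\<close> by (intro finite_UnI finite_UN_I poly_roots_finite)
    moreover have "\<exists>g. coeffs_in ?K g \<and> g \<noteq> 0 \<and> poly g x = 0 \<and> card {y. poly g y = 0} = degree g \<and> {y. poly g y = 0} \<subseteq> R"
      if xR: "x \<in> R" for x
    proof -
      consider "poly F x = 0" | q where "q \<in> Q" "poly (X1 q) x = 0" using xR unfolding R_def by blast
      thus ?thesis
    proof cases
      case 1
      moreover have "coeffs_in ?K F" by (auto simp: F_def coeffs_in_def coeff_map_poly)
      ultimately show ?thesis using F0 card_simple_roots[OF F0 Fs] by (intro exI[of _ F]) (auto simp: R_def)
    next
      case (2 q)
      thus ?thesis using X1[OF 2(1)] by (intro exI[of _ "X1 q"]) (auto simp: R_def)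
    qed
    qed
    ultimately show ?thesis unfolding K.separable_roots_def by blast
  qed
  let ?L = "K.splitting_field R" and ?G = "K.galois_group R"
  interpret G: henselian_galois Vc ?K ?L ?G
  proof unfold_locales
    show "1 \<in> ?L" "\<And>x y. x \<in> ?L \<Longrightarrow> y \<in> ?L \<Longrightarrow> x - y \<in> ?L" "\<And>x y. x \<in> ?L \<Longrightarrow> y \<in> ?L \<Longrightarrow> x * y \<in> ?L"
      "\<And>x. x \<in> ?L \<Longrightarrow> inverse x \<in> ?L"
    proof -
      interpret L: subfield_set ?L by (rule K.splitting_field)
      show "1 \<in> ?L" "\<And>x y. x \<in> ?L \<Longrightarrow> y \<in> ?L \<Longrightarrow> x - y \<in> ?L" "\<And>x y. x \<in> ?L \<Longrightarrow> y \<in> ?L \<Longrightarrow> x * y \<in> ?L"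
        "\<And>x. x \<in> ?L \<Longrightarrow> inverse x \<in> ?L"
        by (auto intro: L.one_in L.diff_in L.mult_in L.inverse_in)
    qed
    show "?K \<subseteq> ?L" by (rule K.splitting_field)
    show "finite ?G" by (rule K.finite_galois_group[OF R])
    show "id \<in> ?G" by (rule K.galois_group_id)
    show "\<sigma> \<circ> \<tau> \<in> ?G" if "\<sigma> \<in> ?G" "\<tau> \<in> ?G" for \<sigma> \<tau> using K.galois_group_comp that .
    show "hom_on ?L \<sigma>" if "\<sigma> \<in> ?G" for \<sigma> using that by (simp add: K.galois_group_def)
    show "\<sigma> x \<in> ?L" if "\<sigma> \<in> ?G" "x \<in> ?L" for \<sigma> x using that by (simp add: K.galois_group_def)
    show "\<sigma> x = x" if "\<sigma> \<in> ?G" "x \<notin> ?L" for \<sigma> x using that by (simp add: K.galois_group_def)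
    show "\<sigma> x = x" if "\<sigma> \<in> ?G" "x \<in> ?K" for \<sigma> x using that unfolding K.galois_group_def by blast
    show "x \<in> ?K" if "x \<in> ?L" "\<And>\<sigma>. \<sigma> \<in> ?G \<Longrightarrow> \<sigma> x = x" for x
      by (rule K.fixed_field[OF R]) (use that K.subfield_set_axioms K.splitting_field in auto)
  next
    fix g a assume g: "coeffs_in (Vc \<inter> ?K) g" and a: "a \<in> Vc \<inter> ?K" and ga: "poly g a \<in> max_ideal Vc"
      and g'a: "poly (pderiv g) a \<notin> max_ideal Vc"
    obtain g0 where g0: "g = map_poly to_ac g0" "coeffs_in V g0"
      using coeffs_in_to_ac_image[OF g[unfolded VKi] zero_in] .
    obtain a0 where a0: "a = to_ac a0" "a0 \<in> V" using a VKi by blast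
    have "poly g0 a0 \<in> \<mm>" using ga unfolding g0 a0 poly_map_to_ac mK .
    moreover have "poly (pderiv g0) a0 \<notin> \<mm>" using g'a unfolding g0 a0 pderiv_map_to_ac poly_map_to_ac mK .
    ultimately obtain b where "b \<in> V" "poly g0 b = 0" "b - a0 \<in> \<mm>" using hensel[OF g0(2) a0(2)] by blast
    thus "\<exists>b\<in>Vc \<inter> ?K. poly g b = 0 \<and> b - a \<in> max_ideal Vc" unfolding g0 a0
      by (intro bexI[of _ "to_ac b"]) (auto simp: poly_map_to_ac VK mK simp flip: to_ac_diff)
  next
    fix P assume P: "coeffs_in (Vc \<inter> ?K) P" "lead_coeff P = 1" "degree P \<ge> 1"
    obtain P0 where P0: "P = map_poly to_ac P0" "coeffs_in V P0"
      using coeffs_in_to_ac_image[OF P(1)[unfolded VKi] zero_in] .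
    have lc: "lead_coeff (map_poly to_ac p) = to_ac (lead_coeff p)" for p :: "'a poly"
      by (simp add: degree_map_to_ac coeff_map_poly)
    have ci: "coeffs_in (Vc \<inter> ?K) (map_poly to_ac p) \<longleftrightarrow> coeffs_in V p" for p
      unfolding VKi by (rule coeffs_in_map_to_ac)
    have cm: "coeffs_in (max_ideal Vc) (map_poly to_ac p) \<longleftrightarrow> coeffs_in \<mm> p" for p
      by (simp add: coeffs_in_def coeff_map_poly mK)
    have l0: "lead_coeff P0 = 1" using P(2) unfolding P0 lc by simp
    have d0: "degree P0 \<ge> 1" using P(3) unfolding P0 degree_map_to_ac .
    from P0(2) l0 d0
    show "(\<exists>c\<in>Vc \<inter> ?K. poly P c \<in> max_ideal Vc) \<or>
      (\<exists>D E E'. coeffs_in (Vc \<inter> ?K) D \<and> coeffs_in (Vc \<inter> ?K) E \<and> coeffs_in (Vc \<inter> ?K) E' \<and>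
        lead_coeff D = 1 \<and> lead_coeff E = 1 \<and> degree D \<ge> 1 \<and>
        coeffs_in (max_ideal Vc) (P - D * E) \<and> coeffs_in (max_ideal Vc) (pderiv P - D * E'))"
    proof (cases rule: residue_cases)
      case (root c)
      hence "to_ac c \<in> Vc \<inter> ?K" "poly P (to_ac c) \<in> max_ideal Vc"
        by (simp_all add: VK mK P0 poly_map_to_ac)
      thus ?thesis by blast
    next
      case (factor D E E')
      have "coeffs_in (max_ideal Vc) (P - map_poly to_ac D * map_poly to_ac E)"
        "coeffs_in (max_ideal Vc) (pderiv P - map_poly to_ac D * map_poly to_ac E')"
        unfolding P0 pderiv_map_to_ac map_to_ac_mult[symmetric] map_to_ac_diff[symmetric] cm
        using factor by blast+
      thus ?thesis using factor lc
        by (intro disjI2 exI[of _ "map_poly to_ac D"] exI[of _ "map_poly to_ac E"] exI[of _ "map_poly to_ac E'"])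
           (simp add: ci degree_map_to_ac coeff_map_poly)
    qed
  qed
  have \<alpha>L: "\<alpha> \<in> ?L" using root(1) K.splitting_field(3)[of R] by (auto simp: R_def F_def)
  have "\<exists>\<zeta>\<in>?L. \<zeta> ^ q = 1 \<and> \<zeta> \<noteq> 1"
    if "prime q" "of_nat q \<in> max_ideal Vc" "of_nat q \<noteq> (0 :: 'a alg_closure)" for q
  proof -
    have "of_nat q \<in> \<mm>" using that(2) mK[of "of_nat q"] by simp
    moreover have "of_nat q \<noteq> (0 :: 'a)" using that(3) to_ac_eq_0_iff[of "of_nat q :: 'a"] by simp
    ultimately have q: "q \<in> Q" using that(1) by (simp add: Q_def)
    have "\<not> {x. poly (X1 q) x = 0} \<subseteq> {1}"
    proof
      assume "{x. poly (X1 q) x = 0} \<subseteq> {1}"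
      hence "card {x. poly (X1 q) x = 0} \<le> card {1 :: 'a alg_closure}" by (intro card_mono) auto
      thus False using X1[OF q] prime_ge_2_nat[OF that(1)] by simp
    qed
    then obtain \<zeta> where "poly (X1 q) \<zeta> = 0" "\<zeta> \<noteq> 1" by blast
    moreover have "\<zeta> \<in> ?L" using K.splitting_field(3)[of R] q calculation by (auto simp: R_def)
    ultimately show ?thesis by (auto simp: X1_def poly_monom)
  qed
  hence zeta: "\<forall>q. prime q \<longrightarrow> of_nat q \<in> max_ideal Vc \<longrightarrow> of_nat q \<noteq> (0 :: 'a alg_closure) \<longrightarrow>
      (\<exists>\<zeta>\<in>?L. \<zeta> ^ q = 1 \<and> \<zeta> \<noteq> 1)" by blast
  from \<alpha>L root(2) zeta show ?thesis
  proof (cases rule: G.trichotomy)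
    case (tame p x)
    obtain x0 where x0: "x = to_ac x0" "x0 \<noteq> 0" using tame(3) by auto
    have "x0 / y ^ p \<notin> V - \<mm>" if "y \<noteq> 0" for y
      using tame(4)[of "to_ac y"] that by (auto simp: x0 VK mK simp flip: to_ac_power to_ac_divide)
    moreover have "of_nat p \<notin> \<mm>" using tame(2) mK[of "of_nat p"] by simp
    ultimately have "proper_ball V (tame_ball p)"
      using tame_proper_ball[of p x0] x0(2) prime_gt_0_nat[OF tame(1)] by blast
    thus ?thesis using definable_tame_ball by blast
  next
    case (artin_schreier q a)
    obtain a0 where a0: "a = to_ac a0" using artin_schreier(3) by blast
    have "b ^ q - b \<noteq> a0" for b
      using artin_schreier(4)[of "to_ac b"] by (auto simp: a0 simp flip: to_ac_power to_ac_diff)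
    hence "a0 \<in> artin_schreier_set q" by (simp add: artin_schreier_set_def)
    moreover have "of_nat q = (0 :: 'a)" using artin_schreier(2) to_ac_eq_0_iff[of "of_nat q :: 'a"] by simp
    ultimately have "proper_ball V (stable_part (artin_schreier_set q))"
      using artin_schreier_proper_ball[OF artin_schreier(1)] by blast
    thus ?thesis using definable_stable_part definable_artin_schreier by blast
  next
    case (kummer q \<zeta> a)
    obtain a0 z0 where a0: "a = to_ac a0" "a0 \<noteq> 0" "\<zeta> = to_ac z0" using kummer(4,7) by auto
    have na: "a0 \<notin> nonzero_powers q"
    proof
      assume "a0 \<in> nonzero_powers q"
      then obtain b where "a0 = b ^ q" by (auto simp: nonzero_powers_def)
      thus False using kummer(8)[of "to_ac b"] by (simp add: a0)
    qed
    have q: "of_nat q \<in> \<mm>" "of_nat q \<noteq> (0 :: 'a)" using kummer(2,3) mK[of "of_nat q"] to_ac_eq_0_iff[of "of_nat q :: 'a"] by simp_all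
    have z: "z0 ^ q = 1" "z0 \<noteq> 1" using kummer(5,6) by (simp_all add: a0 flip: to_ac_power)
    \<comment> \<open>\<open>kummer_proper_ball\<close> asks for a unit that is no
      \<open>q\<close>-th power, whereas \<open>a0\<close> may be a nonunit. If all units are
      \<open>q\<close>-th powers, the argument of the tame case works for \<open>q\<close> as
      well.\<close>
    show ?thesis
    proof (cases "V - \<mm> \<subseteq> nonzero_powers q")
      case True
      thus ?thesis using tame_ball[OF True a0(2) na] definable_tame_ball by blast
    next
      case False
      then obtain u where "u \<in> V - \<mm>" "u \<notin> nonzero_powers q" by blast
      hence "proper_ball V (stable_part (kummer_set q))"
        using kummer_proper_ball[OF kummer(1) q z] by blast
      thus ?thesis using definable_stable_part definable_kummer by blast
    qed
  qed
qed

end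

section \<open>Coefficient lists and polynomials\<close>

text \<open>Used twice: for the identification of a type with a carrier, with \<open>S\<close> the
  whole type, and for the residue map, with \<open>S\<close> the valuation ring.\<close>

locale coeff_hom = R: cring R + ring_set S
  for R :: "('r, 'm) ring_scheme" and S :: "'k::field set" +
  fixes \<rho> :: "'k \<Rightarrow> 'r"
  assumes rho_closed: "x \<in> S \<Longrightarrow> \<rho> x \<in> carrier R"
    and rho_add: "x \<in> S \<Longrightarrow> y \<in> S \<Longrightarrow> \<rho> (x + y) = \<rho> x \<oplus>\<^bsub>R\<^esub> \<rho> y"
    and rho_mult: "x \<in> S \<Longrightarrow> y \<in> S \<Longrightarrow> \<rho> (x * y) = \<rho> x \<otimes>\<^bsub>R\<^esub> \<rho> y"
    and rho_one: "\<rho> 1 = \<one>\<^bsub>R\<^esub>"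
begin

definition represents :: "'k poly \<Rightarrow> 'r list \<Rightarrow> bool" where
  "represents P l \<longleftrightarrow> coeffs_in S P \<and> l \<in> carrier (poly_ring R) \<and>
     (\<forall>i. R.coeff l i = \<rho> (poly.coeff P i))"

lemma rho_zero: "\<rho> 0 = \<zero>\<^bsub>R\<^esub>"
proof -
  have "\<rho> 0 \<oplus>\<^bsub>R\<^esub> \<rho> 0 = \<rho> 0" using rho_add[OF zero_in zero_in] by simp
  thus ?thesis using R.add.l_cancel_one[of "\<rho> 0" "\<rho> 0"] rho_closed[OF zero_in] by simp
qed

lemma rho_uminus: "x \<in> S \<Longrightarrow> \<rho> (- x) = \<ominus>\<^bsub>R\<^esub> \<rho> x"
proof -
  assume x: "x \<in> S"
  have "\<rho> (- x) \<oplus>\<^bsub>R\<^esub> \<rho> x = \<zero>\<^bsub>R\<^esub>" using rho_add[OF uminus_in[OF x] x] rho_zero by simp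
  thus ?thesis using R.minus_equality rho_closed x uminus_in by simp
qed

lemma rho_of_nat: "x \<in> S \<Longrightarrow> \<rho> (of_nat n * x) = [n] \<cdot>\<^bsub>R\<^esub> \<rho> x"
proof (induction n)
  case (Suc n)
  have "\<rho> (of_nat (Suc n) * x) = \<rho> (of_nat n * x + x)" by (simp add: algebra_simps)
  also have "\<dots> = [n] \<cdot>\<^bsub>R\<^esub> \<rho> x \<oplus>\<^bsub>R\<^esub> \<rho> x" using Suc rho_add mult_in of_nat_in by simp
  also have "\<dots> = [Suc n] \<cdot>\<^bsub>R\<^esub> \<rho> x" by (simp only: R.add.nat_pow_Suc)
  finally show ?case .
qed (simp add: rho_zero)

lemma rho_sum: "(\<And>k. f k \<in> S) \<Longrightarrow> (\<Oplus>\<^bsub>R\<^esub>k\<in>{..n::nat}. \<rho> (f k)) = \<rho> (sum f {..n})"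
proof (induction n)
  case 0
  thus ?case by (subst R.finsum_0) (auto intro: rho_closed)
next
  case (Suc n)
  have "(\<Oplus>\<^bsub>R\<^esub>k\<in>{..Suc n}. \<rho> (f k)) = \<rho> (f (Suc n)) \<oplus>\<^bsub>R\<^esub> (\<Oplus>\<^bsub>R\<^esub>k\<in>{..n}. \<rho> (f k))"
    using Suc.prems by (intro R.finsum_Suc) (auto intro: rho_closed)
  also have "\<dots> = \<rho> (f (Suc n) + sum f {..n})"
    using Suc.IH[OF Suc.prems] rho_add[OF Suc.prems[of "Suc n"] sum_in[of "{..n}" f, OF Suc.prems]] by simp
  also have "f (Suc n) + sum f {..n} = sum f {..Suc n}" by (simp add: add.commute)
  finally show ?case .
qed

lemma in_poly_carrier: "l \<in> carrier (poly_ring R) \<longleftrightarrow> polynomial\<^bsub>R\<^esub> (carrier R) l"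
  using univ_poly_carrier by blast

lemma set_poly_carrier: "l \<in> carrier (poly_ring R) \<Longrightarrow> set l \<subseteq> carrier R"
  unfolding in_poly_carrier polynomial_def by auto

lemma represents_unique: "represents P l \<Longrightarrow> represents P m \<Longrightarrow> l = m"
  unfolding represents_def in_poly_carrier
  using R.coeff_iff_polynomial_cond[of "carrier R" l m] by (auto intro!: ext)

lemma represents_coeffs:
  assumes "coeffs_in S P"
  shows "represents P (R.normalize (map \<rho> (rev (coeffs P))))"
proof -
  let ?l = "map \<rho> (rev (coeffs P))"
  have s: "set ?l \<subseteq> carrier R"
  proof
    fix y assume "y \<in> set ?l"
    then obtain x where "x \<in> set (coeffs P)" "y = \<rho> x" by auto
    moreover from this obtain i where "x = coeff P i" by (auto simp: coeffs_def split: if_splits)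
    ultimately show "y \<in> carrier R" using assms rho_closed by (auto simp: coeffs_in_def)
  qed
  have "R.coeff ?l i = \<rho> (poly.coeff P i)" for i
  proof (cases "i < length ?l")
    case True
    have "R.coeff ?l i = ?l ! (length ?l - 1 - i)" using R.coeff_nth[OF True] by simp
    also have "\<dots> = \<rho> (rev (coeffs P) ! (length (coeffs P) - 1 - i))" using True by simp
    also have "rev (coeffs P) ! (length (coeffs P) - 1 - i) = coeffs P ! i"
      using True by (simp add: rev_nth)
    also have "coeffs P ! i = coeff P i" using True
      by (metis coeffs_nth degree_eq_length_coeffs length_0_conv length_map length_rev less_nat_zero_code
          less_Suc_eq_le Suc_diff_1 neq0_conv coeffs_eq_Nil)
    finally show ?thesis .
  next
    case False
    hence "R.coeff ?l i = \<zero>\<^bsub>R\<^esub>" using R.coeff_length by simp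
    moreover have "coeff P i = 0" using False
      by (metis coeff_0 coeff_eq_0 degree_eq_length_coeffs length_0_conv length_map length_rev coeffs_eq_Nil
          less_le_trans not_less diff_less less_one neq0_conv)
    ultimately show ?thesis by (simp add: rho_zero)
  qed
  thus ?thesis using assms R.normalize_gives_polynomial[OF s] R.normalize_coeff[of ?l]
    unfolding represents_def in_poly_carrier by simp
qed

lemma represents_mult:
  assumes "represents P l" "represents Q m"
  shows "represents (P * Q) (l \<otimes>\<^bsub>poly_ring R\<^esub> m)"
proof -
  have c: "l \<in> carrier (poly_ring R)" "m \<in> carrier (poly_ring R)"
    and PQ: "coeffs_in S P" "coeffs_in S Q" using assms by (auto simp: represents_def)
  have "R.coeff (l \<otimes>\<^bsub>poly_ring R\<^esub> m) i = \<rho> (coeff (P * Q) i)" for i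
  proof -
    have "R.coeff (l \<otimes>\<^bsub>poly_ring R\<^esub> m) i = (\<Oplus>\<^bsub>R\<^esub>k\<in>{..i}. R.coeff l k \<otimes>\<^bsub>R\<^esub> R.coeff m (i - k))"
      using R.poly_mult_coeff[OF set_poly_carrier[OF c(1)] set_poly_carrier[OF c(2)]]
      by (simp add: univ_poly_mult)
    also have "\<dots> = (\<Oplus>\<^bsub>R\<^esub>k\<in>{..i}. \<rho> (coeff P k * coeff Q (i - k)))"
      using assms rho_mult by (auto simp: represents_def coeffs_in_def)
    also have "\<dots> = \<rho> (coeff (P * Q) i)"
      using PQ by (subst rho_sum) (auto simp: coeff_mult coeffs_in_def intro: mult_in)
    finally show ?thesis .
  qed
  thus ?thesis using R.poly_mult_closed[OF R.carrier_is_subring] c coeffs_in_mult[OF PQ]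
    by (auto simp: represents_def in_poly_carrier univ_poly_mult)
qed

lemma represents_pderiv:
  assumes "represents P l"
  shows "represents (pderiv P) (R.pderiv l)"
proof -
  let ?m = "map (\<lambda>i. [Suc i] \<cdot>\<^bsub>R\<^esub> R.coeff l (Suc i)) (rev [0..<length l - 1])"
  have l: "l \<in> carrier (poly_ring R)" and P: "coeffs_in S P" and c: "\<And>i. R.coeff l i = \<rho> (coeff P i)"
    using assms by (auto simp: represents_def)
  have cc: "[Suc i] \<cdot>\<^bsub>R\<^esub> R.coeff l (Suc i) = \<rho> (coeff (pderiv P) i)" for i
    using rho_of_nat[of "coeff P (Suc i)" "Suc i"] P by (simp only: coeff_pderiv c coeffs_in_def)
  have s: "set ?m \<subseteq> carrier R"
    using cc rho_closed coeffs_in_pderiv[OF P] by (auto simp: coeffs_in_def simp del: R.add.nat_pow_Suc)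
  have "R.coeff ?m i = \<rho> (coeff (pderiv P) i)" for i
  proof (cases "i < length ?m")
    case True
    have e: "rev [0..<n] ! (n - 1 - i) = i" if "i < n" for n
      using that by (subst rev_nth) auto
    have "R.coeff ?m i = ?m ! (length ?m - 1 - i)" using R.coeff_nth[OF True] by simp
    also have "\<dots> = [Suc i] \<cdot>\<^bsub>R\<^esub> R.coeff l (Suc i)"
      using True e[of "length l - 1"] by (subst nth_map) (auto simp del: R.add.nat_pow_Suc)
    finally show ?thesis using cc by (simp only:)
  next
    case False
    hence "R.coeff ?m i = \<zero>\<^bsub>R\<^esub>" using R.coeff_length by simp
    moreover have "R.coeff l (Suc i) = \<zero>\<^bsub>R\<^esub>" using False R.coeff_length[of l "Suc i"] by simp
    hence "\<rho> (coeff (pderiv P) i) = \<zero>\<^bsub>R\<^esub>" using cc[of i] by (simp only: R.add.nat_pow_one)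
    ultimately show ?thesis by simp
  qed
  thus ?thesis using coeffs_in_pderiv[OF P] R.normalize_gives_polynomial[OF s] R.normalize_coeff[of ?m]
    unfolding represents_def in_poly_carrier R.pderiv_def by simp
qed

lemma eval_coeffs:
  assumes "coeffs_in S P" "a \<in> S"
  shows "R.eval (map \<rho> (rev (coeffs P))) (\<rho> a) = \<rho> (poly P a)"
  using assms(1)
proof (induction P)
  case 0
  thus ?case by (simp add: rho_zero)
next
  case (pCons c P)
  have cP: "c \<in> S" "coeffs_in S P" using pCons.prems by (auto simp: coeffs_in_pCons)
  have s: "set (map \<rho> (rev (coeffs P))) \<subseteq> carrier R"
    using cP(2) by (auto simp: coeffs_def coeffs_in_def intro!: rho_closed split: if_splits)
  have "R.eval (map \<rho> (rev (coeffs (pCons c P)))) (\<rho> a)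
      = R.eval (map \<rho> (rev (coeffs P)) @ [\<rho> c]) (\<rho> a)"
    using pCons.hyps by (auto simp: cCons_def)
  also have "\<dots> = R.eval (map \<rho> (rev (coeffs P))) (\<rho> a) \<otimes>\<^bsub>R\<^esub> \<rho> a \<oplus>\<^bsub>R\<^esub> \<rho> c"
    using R.eval_append_aux[OF s] rho_closed assms(2) cP by simp
  also have "\<dots> = \<rho> (poly P a * a + c)"
    using pCons.IH cP rho_mult rho_add assms(2) poly_in mult_in by simp
  also have "poly P a * a + c = poly (pCons c P) a" by (simp add: algebra_simps)
  finally show ?case .
qed

lemma represents_eval:
  assumes "represents P l" "a \<in> S"
  shows "R.eval l (\<rho> a) = \<rho> (poly P a)"
proof -
  have P: "coeffs_in S P" using assms by (simp add: represents_def)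
  have s: "set (map \<rho> (rev (coeffs P))) \<subseteq> carrier R"
    using P by (auto simp: coeffs_def coeffs_in_def intro!: rho_closed split: if_splits)
  have "l = R.normalize (map \<rho> (rev (coeffs P)))"
    using represents_unique[OF assms(1) represents_coeffs[OF P]] .
  thus ?thesis using R.eval_normalize[OF s rho_closed[OF assms(2)]] eval_coeffs[OF P assms(2)] by simp
qed

lemma represents_set:
  assumes "represents P l" "y \<in> set l"
  shows "\<exists>i. y = \<rho> (coeff P i)"
proof -
  obtain j where j: "j < length l" "y = l ! j" using assms(2) by (auto simp: in_set_conv_nth)
  hence "y = R.coeff l (length l - 1 - j)" using R.coeff_nth[of "length l - 1 - j" l] by simp
  thus ?thesis using assms(1) by (auto simp: represents_def)
qed

lemma represents_hd:
  assumes "represents P l" "l \<noteq> []"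
  shows "\<rho> (coeff P (length l - 1)) \<noteq> \<zero>\<^bsub>R\<^esub>" "length l - 1 \<le> degree P"
proof -
  have "hd l \<noteq> \<zero>\<^bsub>R\<^esub>" using assms unfolding represents_def in_poly_carrier polynomial_def by auto
  moreover have "R.coeff l (length l - 1) = hd l"
    using assms(2) R.coeff_nth[of "length l - 1" l] by (simp add: hd_conv_nth)
  ultimately show n: "\<rho> (coeff P (length l - 1)) \<noteq> \<zero>\<^bsub>R\<^esub>" using assms(1) by (simp add: represents_def)
  hence "coeff P (length l - 1) \<noteq> 0" using rho_zero by auto
  thus "length l - 1 \<le> degree P" by (rule le_degree)
qed

lemma represents_length:
  assumes "represents P l" "\<rho> (lead_coeff P) \<noteq> \<zero>\<^bsub>R\<^esub>"
  shows "length l = Suc (degree P)"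
proof -
  have "degree P < length l"
  proof (rule ccontr)
    assume "\<not> degree P < length l"
    hence "R.coeff l (degree P) = \<zero>\<^bsub>R\<^esub>" using R.coeff_length by simp
    thus False using assms by (simp add: represents_def)
  qed
  moreover from this have "length l - 1 \<le> degree P" using represents_hd(2)[OF assms(1)] by (cases "l = []") auto
  ultimately show ?thesis by simp
qed

text \<open>Lifting coefficient by coefficient, with zeros beyond the list, keeps the degree. So the
  leading coefficient of the lift of a nonempty list has nonzero image; for the residue map it is a
  unit.\<close>

lemma represents_lift:
  assumes l: "l \<in> carrier (poly_ring R)" "set l \<subseteq> \<rho> ` S"
  shows "\<exists>P. represents P l \<and> degree P = length l - 1"
proof -
  define f where "f y = (SOME x. x \<in> S \<and> \<rho> x = y)" for y
  have f: "f y \<in> S \<and> \<rho> (f y) = y" if "y \<in> \<rho> ` S" for y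
  proof -
    have "\<exists>x. x \<in> S \<and> \<rho> x = y" using that by auto
    from someI_ex[OF this] show ?thesis by (simp add: f_def)
  qed
  define P where "P = Poly (map f (rev l))"
  have cP: "coeff P i = (if i < length l then f (l ! (length l - 1 - i)) else 0)" for i
    by (simp add: P_def coeff_Poly_eq nth_default_def rev_nth)
  have mem: "l ! j \<in> \<rho> ` S" if "j < length l" for j using that l by auto
  have in_S: "coeffs_in S P" using cP f mem by (auto simp: coeffs_in_def zero_in)
  have co: "R.coeff l i = \<rho> (coeff P i)" for i
  proof (cases "i < length l")
    case True
    thus ?thesis using R.coeff_nth[OF True] cP f mem[of "length l - 1 - i"] by simp
  next
    case False
    thus ?thesis using R.coeff_length[of l i] cP rho_zero by simp
  qed
  have rep: "represents P l" using in_S l co by (simp add: represents_def)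
  have "degree P \<le> length l - 1" using cP by (intro degree_le) auto
  hence "degree P = length l - 1"
    using represents_hd(2)[OF rep] by (cases "l = []") auto
  thus ?thesis using rep by auto
qed

end

section \<open>Fields with an explicit carrier\<close>

text \<open>Identifies \<open>K\<close> with a whole type, to which type class constructions such as
  \<open>alg_closure\<close> apply.\<close>

locale field_iso = K: field K for K :: "('a, 'm) ring_scheme" +
  fixes r :: "'k::field \<Rightarrow> 'a"
  assumes bij: "bij_betw r UNIV (carrier K)"
    and r_add: "r (x + y) = r x \<oplus>\<^bsub>K\<^esub> r y"
    and r_mult: "r (x * y) = r x \<otimes>\<^bsub>K\<^esub> r y"
    and r_one: "r 1 = \<one>\<^bsub>K\<^esub>"
begin

lemma r_closed: "r x \<in> carrier K"
  using bij by (auto simp: bij_betw_def)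

lemma r_eq_iff: "r x = r y \<longleftrightarrow> x = y"
  using bij by (auto simp: bij_betw_def inj_on_def)

lemma r_surj: "y \<in> carrier K \<Longrightarrow> \<exists>x. y = r x"
  using bij by (auto simp: bij_betw_def)

lemma range_r: "range r = carrier K"
  using bij by (auto simp: bij_betw_def)

sublocale P: coeff_hom K UNIV r
  by unfold_locales (auto simp: r_closed r_add r_mult r_one)

lemmas r_zero = P.rho_zero

lemma r_uminus: "r (- x) = \<ominus>\<^bsub>K\<^esub> r x"
  using P.rho_uminus by simp

lemma r_eq_zero_iff: "r x = \<zero>\<^bsub>K\<^esub> \<longleftrightarrow> x = 0"
  using r_eq_iff[of x 0] r_zero by simp

lemma r_diff: "r (x - y) = r x \<ominus>\<^bsub>K\<^esub> r y"
  using r_add[of x "- y"] r_uminus by (simp add: a_minus_def)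

lemma coeffs_in_UNIV: "coeffs_in UNIV p"
  by (simp add: coeffs_in_def)

lemma represents_ex: "\<exists>l. P.represents p l"
  using P.represents_coeffs[OF coeffs_in_UNIV] by blast

lemma represented_ex: "l \<in> carrier (poly_ring K) \<Longrightarrow> \<exists>p. P.represents p l"
  using P.represents_lift[of l] P.set_poly_carrier[of l] range_r by auto

lemma represents_dvd:
  assumes "P.represents p l" "P.represents q m" "p dvd q"
  shows "l pdivides\<^bsub>K\<^esub> m"
proof -
  obtain h where h: "q = p * h" using assms by auto
  obtain c where c: "P.represents h c" using represents_ex by blast
  have "m = l \<otimes>\<^bsub>poly_ring K\<^esub> c"
    using P.represents_unique[OF assms(2)] P.represents_mult[OF assms(1) c] h by simp
  moreover have "c \<in> carrier (poly_ring K)" using c by (simp add: P.represents_def)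
  ultimately show ?thesis unfolding pdivides_def by (auto intro: dividesI)
qed

lemma units_poly: "l \<in> Units (poly_ring K) \<Longrightarrow> \<exists>k\<in>carrier K - {\<zero>\<^bsub>K\<^esub>}. l = [k]"
  using K.univ_poly_units[OF K.carrier_is_subfield] by auto

text \<open>A nonzero element of least degree in the ideal generated by \<open>f\<close> and
  \<open>pderiv f\<close> divides both. Separability turns it into a unit, that is, a nonzero
  constant.\<close>

lemma separable_bezout:
  assumes l: "K.separable_poly l" and f: "P.represents f l"
  shows "\<exists>U W. U * f + W * pderiv f = 1"
proof -
  define I where "I = {U * f + W * pderiv f | U W. True}"
  have unit: "d \<in> Units (poly_ring K)" if "P.represents p d" "p dvd f" "p dvd pderiv f" for p d
  proof -
    have "d \<in> carrier (poly_ring K)" using that by (simp add: P.represents_def)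
    thus ?thesis using l represents_dvd[OF that(1) f that(2)]
        represents_dvd[OF that(1) P.represents_pderiv[OF f] that(3)]
      unfolding K.separable_poly_def by blast
  qed
  have ex: "\<exists>g\<in>I. g \<noteq> 0"
  proof (rule ccontr)
    assume n: "\<not> (\<exists>g\<in>I. g \<noteq> 0)"
    have "f = 1 * f + 0 * pderiv f" by simp
    hence "f \<in> I" unfolding I_def by blast
    hence f0: "f = 0" using n by auto
    \<comment> \<open>If \<open>f\<close> were zero, then zero would be a common divisor of
      \<open>f\<close> and its derivative, and so a unit.\<close>
    obtain d where d: "P.represents 0 d" using represents_ex by blast
    have "d \<in> Units (poly_ring K)" using unit[OF d] f0 by simp
    then obtain k where k: "k \<in> carrier K - {\<zero>\<^bsub>K\<^esub>}" "d = [k]" using units_poly by blast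
    have "K.coeff d 0 = \<zero>\<^bsub>K\<^esub>" using d r_zero by (simp add: P.represents_def)
    thus False using k by simp
  qed
  define Q where "Q g \<longleftrightarrow> g \<in> I \<and> g \<noteq> 0" for g
  have exQ: "\<exists>g. Q g" using ex by (auto simp: Q_def)
  define g where "g = (ARG_MIN degree g. Q g)"
  have Qg: "Q g" unfolding g_def using exQ by (metis arg_min_natI)
  have min: "degree g \<le> degree h" if "Q h" for h
    unfolding g_def using that by (rule arg_min_nat_le)
  obtain U W where g: "g = U * f + W * pderiv f" using Qg unfolding Q_def I_def by blast
  have dv: "g dvd h" if hI: "h \<in> I" for h
  proof -
    obtain A B where h: "h = A * f + B * pderiv f" using hI unfolding I_def by blast
    have "h mod g = h - (h div g) * g" by (simp add: minus_div_mult_eq_mod)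
    also have "\<dots> = (A - h div g * U) * f + (B - h div g * W) * pderiv f"
      by (subst h, subst (2) g) (simp add: algebra_simps)
    finally have "h mod g \<in> I" unfolding I_def by blast
    moreover have "h mod g = 0 \<or> degree (h mod g) < degree g"
      using Qg degree_mod_less[of g h] by (auto simp: Q_def)
    ultimately have "h mod g = 0" using min[of "h mod g"] unfolding Q_def by linarith
    thus ?thesis by auto
  qed
  have "f = 1 * f + 0 * pderiv f" "pderiv f = 0 * f + 1 * pderiv f" by auto
  hence "f \<in> I" "pderiv f \<in> I" unfolding I_def by blast+
  hence d: "g dvd f" "g dvd pderiv f" using dv by blast+
  obtain m where m: "P.represents g m" using represents_ex by blast
  obtain k where k: "k \<in> carrier K - {\<zero>\<^bsub>K\<^esub>}" "m = [k]" using units_poly unit[OF m d] by blast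
  have "r (lead_coeff g) \<noteq> \<zero>\<^bsub>K\<^esub>" using Qg r_eq_zero_iff by (simp add: Q_def)
  hence "degree g = 0" using P.represents_length[OF m] k by simp
  then obtain c where c: "g = [:c:]" by (rule degree_eq_zeroE)
  hence c0: "c \<noteq> 0" using Qg by (simp add: Q_def)
  have "smult (1 / c) U * f + smult (1 / c) W * pderiv f = smult (1 / c) g"
    by (simp add: g smult_add_right)
  also have "\<dots> = 1" using c c0 by simp
  finally show ?thesis by blast
qed

text \<open>If all roots of \<open>f\<close> in the algebraic closure came from the field, then,
  being simple, they would give \<open>degree f\<close> distinct roots in \<open>K\<close>, and the
  list would split.\<close>

theorem not_separably_closed_root:
  assumes "\<not> separably_closed K"
  obtains f U W :: "'k poly" and \<alpha> where "U * f + W * pderiv f = 1" "poly (map_poly to_ac f) \<alpha> = 0" "\<alpha> \<notin> range to_ac"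
proof -
  obtain l where l: "K.separable_poly l" "\<not> K.splitted l"
    using assms K.field_axioms unfolding separably_closed_def separably_closed_axioms_def by blast
  have lc: "l \<in> carrier (poly_ring K)" using l(1) by (simp add: K.separable_poly_def)
  obtain f where f: "P.represents f l" using represented_ex[OF lc] by blast
  obtain U W where UW: "U * f + W * pderiv f = 1" using separable_bezout[OF l(1) f] by blast
  have "\<exists>\<alpha>. poly (map_poly to_ac f) \<alpha> = 0 \<and> \<alpha> \<notin> range to_ac"
  proof (rule ccontr)
    assume n: "\<not> ?thesis"
    let ?F = "map_poly to_ac f"
    have f0: "f \<noteq> 0" using UW by auto
    have "map_poly to_ac U * ?F + map_poly to_ac W * pderiv ?F = map_poly to_ac (U * f + W * pderiv f)"
      by (simp add: map_to_ac_add map_to_ac_mult pderiv_map_to_ac)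
    hence B: "map_poly to_ac U * ?F + map_poly to_ac W * pderiv ?F = 1" using UW by simp
    have nc: "poly (pderiv ?F) x \<noteq> 0" if "poly ?F x = 0" for x
      using arg_cong[OF B, of "\<lambda>p. poly p x"] that by auto
    have "card {x. poly ?F x = 0} = degree ?F"
      using f0 nc by (intro card_simple_roots) auto
    moreover have "{x. poly ?F x = 0} = to_ac ` {x. poly f x = 0}"
      using n by (auto simp: poly_map_to_ac)
    ultimately have card: "card {x. poly f x = 0} = degree f"
      by (simp add: card_image inj_on_def degree_map_to_ac)
    have fin: "finite {x. poly f x = 0}" using f0 poly_roots_finite by blast
    have len: "length l = Suc (degree f)"
      using P.represents_length[OF f] f0 r_eq_zero_iff by simp
    have sub: "r ` {x. poly f x = 0} \<subseteq> set_mset (K.roots l)"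
    proof
      fix y assume "y \<in> r ` {x. poly f x = 0}"
      then obtain x where x: "y = r x" "poly f x = 0" by auto
      have "K.is_root l y"
        unfolding K.is_root_def using x P.represents_eval[OF f] r_zero r_closed len by auto
      thus "y \<in> set_mset (K.roots l)" using K.roots_mem_iff_is_root[OF lc] by simp
    qed
    have "degree f = card (r ` {x. poly f x = 0})"
      using card by (subst card_image) (auto simp: inj_on_def r_eq_iff)
    also have "\<dots> \<le> card (set_mset (K.roots l))" using sub by (intro card_mono) auto
    also have "\<dots> \<le> size (K.roots l)" 
      using size_mset_mono[OF mset_set_set_mset_msubset] by simp
    finally have "length l - 1 \<le> size (K.roots l)" using len by simp
    moreover have "size (K.roots l) \<le> length l - 1" using K.size_roots_le_degree[OF lc] .
    ultimately have "K.splitted l" unfolding K.splitted_def by simp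
    thus False using l by simp
  qed
  thus ?thesis using that UW by blast
qed

lemma univ_poly_carrier_iff:
  assumes l: "P.represents p l" and T: "T \<subseteq> carrier K" "\<zero>\<^bsub>K\<^esub> \<in> T"
  shows "l \<in> carrier (univ_poly K T) \<longleftrightarrow> (\<forall>i. r (coeff p i) \<in> T)"
proof
  assume "l \<in> carrier (univ_poly K T)"
  hence s: "set l \<subseteq> T" using univ_poly_carrier[of K T l] by (auto simp: polynomial_def)
  show "\<forall>i. r (coeff p i) \<in> T"
  proof
    fix i
    have "K.coeff l i \<in> T"
    proof (cases "i < length l")
      case True
      thus ?thesis using K.coeff_nth[OF True] s by auto
    next
      case False
      thus ?thesis using K.coeff_length[of l i] T by simp
    qed
    thus "r (coeff p i) \<in> T" using l by (simp add: P.represents_def)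
  qed
next
  assume h: "\<forall>i. r (coeff p i) \<in> T"
  have "polynomial\<^bsub>K\<^esub> (carrier K) l" using l by (simp add: P.represents_def P.in_poly_carrier)
  moreover have "set l \<subseteq> T" using P.represents_set[OF l] h by auto
  ultimately have "polynomial\<^bsub>K\<^esub> T l" by (auto simp: polynomial_def)
  thus "l \<in> carrier (univ_poly K T)" using univ_poly_carrier[of K T l] by blast
qed

end

context valuation
begin

lemma v_hom: "v \<in> hom (Multiplicative_Group.mult_of K) G"
  using val_epi by (simp add: epi_def)

lemma v_closed: "x \<in> carrier K - {\<zero>} \<Longrightarrow> v x \<in> carrier G"
  using v_hom by (auto simp: hom_def)

lemma v_mult: "x \<in> carrier K - {\<zero>} \<Longrightarrow> y \<in> carrier K - {\<zero>} \<Longrightarrow> v (x \<otimes> y) = v x \<otimes>\<^bsub>G\<^esub> v y"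
  using v_hom by (auto simp: hom_def)

lemma v_one: "v \<one> = \<one>\<^bsub>G\<^esub>"
  using hom_one[OF v_hom field_mult_group G.is_group] by simp

lemma nonneg_mult:
  assumes "x \<in> carrier G" "y \<in> carrier G" "\<one>\<^bsub>G\<^esub> \<preceq>\<^bsub>G\<^esub> x" "\<one>\<^bsub>G\<^esub> \<preceq>\<^bsub>G\<^esub> y"
  shows "\<one>\<^bsub>G\<^esub> \<preceq>\<^bsub>G\<^esub> x \<otimes>\<^bsub>G\<^esub> y"
  using G.gle_mult[of "\<one>\<^bsub>G\<^esub>" y x] G.gle_trans[of "\<one>\<^bsub>G\<^esub>" x "x \<otimes>\<^bsub>G\<^esub> y"] assms by simp

text \<open>An ordered group has no elements of order two; this makes the value of
  \<open>\<ominus> \<one>\<close> neutral.\<close>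

lemma square_one:
  assumes u: "u \<in> carrier G" "u \<otimes>\<^bsub>G\<^esub> u = \<one>\<^bsub>G\<^esub>"
  shows "u = \<one>\<^bsub>G\<^esub>"
  using G.gle_total[OF u(1) G.one_closed]
proof
  assume h: "u \<preceq>\<^bsub>G\<^esub> \<one>\<^bsub>G\<^esub>"
  hence "u \<otimes>\<^bsub>G\<^esub> u \<preceq>\<^bsub>G\<^esub> u \<otimes>\<^bsub>G\<^esub> \<one>\<^bsub>G\<^esub>" using u by (intro G.gle_mult) auto
  thus ?thesis using G.gle_antisym[of u "\<one>\<^bsub>G\<^esub>"] u h by simp
next
  assume h: "\<one>\<^bsub>G\<^esub> \<preceq>\<^bsub>G\<^esub> u"
  hence "u \<otimes>\<^bsub>G\<^esub> \<one>\<^bsub>G\<^esub> \<preceq>\<^bsub>G\<^esub> u \<otimes>\<^bsub>G\<^esub> u" using u by (intro G.gle_mult) auto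
  thus ?thesis using G.gle_antisym[of u "\<one>\<^bsub>G\<^esub>"] u h by simp
qed

lemma v_uminus:
  assumes x: "x \<in> carrier K - {\<zero>}"
  shows "v (\<ominus> x) = v x"
proof -
  have m: "\<ominus> \<one> \<in> carrier K - {\<zero>}" using one_not_zero add.inv_eq_1_iff by auto
  have "v (\<ominus> \<one>) \<otimes>\<^bsub>G\<^esub> v (\<ominus> \<one>) = v (\<ominus> \<one> \<otimes> \<ominus> \<one>)" using v_mult[OF m m] by simp
  also have "\<ominus> \<one> \<otimes> \<ominus> \<one> = \<one>" by (simp add: l_minus)
  finally have "v (\<ominus> \<one>) = \<one>\<^bsub>G\<^esub>" using square_one[OF v_closed[OF m]] v_one by simp
  moreover have "\<ominus> x = \<ominus> \<one> \<otimes> x" using x by (simp add: l_minus)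
  ultimately show ?thesis using v_mult[OF m x] v_closed[OF x] by simp
qed

lemma inv_nonneg_iff:
  assumes g: "g \<in> carrier G"
  shows "\<not> \<one>\<^bsub>G\<^esub> \<preceq>\<^bsub>G\<^esub> inv\<^bsub>G\<^esub> g \<longleftrightarrow> \<one>\<^bsub>G\<^esub> \<preceq>\<^bsub>G\<^esub> g \<and> g \<noteq> \<one>\<^bsub>G\<^esub>"
proof
  assume n: "\<not> \<one>\<^bsub>G\<^esub> \<preceq>\<^bsub>G\<^esub> inv\<^bsub>G\<^esub> g"
  hence "inv\<^bsub>G\<^esub> g \<preceq>\<^bsub>G\<^esub> \<one>\<^bsub>G\<^esub>" using G.gle_total[of "inv\<^bsub>G\<^esub> g" "\<one>\<^bsub>G\<^esub>"] g by auto
  hence "g \<otimes>\<^bsub>G\<^esub> inv\<^bsub>G\<^esub> g \<preceq>\<^bsub>G\<^esub> g \<otimes>\<^bsub>G\<^esub> \<one>\<^bsub>G\<^esub>" using g by (intro G.gle_mult) auto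
  moreover have "g \<noteq> \<one>\<^bsub>G\<^esub>" using n G.gle_total[of "\<one>\<^bsub>G\<^esub>" "\<one>\<^bsub>G\<^esub>"] by auto
  ultimately show "\<one>\<^bsub>G\<^esub> \<preceq>\<^bsub>G\<^esub> g \<and> g \<noteq> \<one>\<^bsub>G\<^esub>" using g by simp
next
  assume h: "\<one>\<^bsub>G\<^esub> \<preceq>\<^bsub>G\<^esub> g \<and> g \<noteq> \<one>\<^bsub>G\<^esub>"
  show "\<not> \<one>\<^bsub>G\<^esub> \<preceq>\<^bsub>G\<^esub> inv\<^bsub>G\<^esub> g"
  proof
    assume "\<one>\<^bsub>G\<^esub> \<preceq>\<^bsub>G\<^esub> inv\<^bsub>G\<^esub> g"
    hence "g \<otimes>\<^bsub>G\<^esub> \<one>\<^bsub>G\<^esub> \<preceq>\<^bsub>G\<^esub> g \<otimes>\<^bsub>G\<^esub> inv\<^bsub>G\<^esub> g" using g by (intro G.gle_mult) auto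
    thus False using h g G.gle_antisym[of g "\<one>\<^bsub>G\<^esub>"] by simp
  qed
qed

end

locale valued_iso = field_iso K r + val: valuation K G v
  for K :: "('a, 'm) ring_scheme" and G :: "('g, 'n) ordered_monoid_scheme" and v
    and r :: "'k::field \<Rightarrow> 'a"
begin

definition val_set :: "'k set" where
  "val_set = {x. r x \<in> valuation_ring K G v}"

lemma r_nonzero: "x \<noteq> 0 \<Longrightarrow> r x \<in> carrier K - {\<zero>\<^bsub>K\<^esub>}"
  using r_closed r_eq_zero_iff by auto

lemma val_set_iff: "x \<in> val_set \<longleftrightarrow> x = 0 \<or> \<one>\<^bsub>G\<^esub> \<preceq>\<^bsub>G\<^esub> v (r x)"
  by (auto simp: val_set_def valuation_ring_def r_closed r_eq_zero_iff)

lemma image_val_set: "r ` val_set = valuation_ring K G v"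
proof
  show "valuation_ring K G v \<subseteq> r ` val_set"
  proof
    fix y assume y: "y \<in> valuation_ring K G v"
    then obtain x where "y = r x" using r_surj[of y] by (auto simp: valuation_ring_def)
    thus "y \<in> r ` val_set" using y by (auto simp: val_set_def)
  qed
qed (auto simp: val_set_def)

lemma v_inverse: "x \<noteq> 0 \<Longrightarrow> v (r (inverse x)) = inv\<^bsub>G\<^esub> v (r x)"
proof -
  assume x: "x \<noteq> 0"
  have "v (r (inverse x)) \<otimes>\<^bsub>G\<^esub> v (r x) = v (r (inverse x) \<otimes>\<^bsub>K\<^esub> r x)"
    using val.v_mult r_nonzero x by simp
  also have "r (inverse x) \<otimes>\<^bsub>K\<^esub> r x = \<one>\<^bsub>K\<^esub>" using x by (simp flip: r_mult add: r_one)
  finally show ?thesis using val.v_one val.G.inv_equality val.v_closed r_nonzero x by simp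
qed

lemma valuation_set_val_set: "valuation_set val_set"
proof unfold_locales
  show "1 \<in> val_set"
    using val_set_iff[of 1] val.v_one r_one val.G.gle_total[of "\<one>\<^bsub>G\<^esub>" "\<one>\<^bsub>G\<^esub>"] by simp
next
  fix x y assume xy: "x \<in> val_set" "y \<in> val_set"
  show "x - y \<in> val_set"
  proof (cases "x = 0 \<or> y = 0 \<or> x = y")
    case True
    have "- y \<in> val_set" using xy(2) val.v_uminus[OF r_nonzero, of y]
      by (cases "y = 0") (auto simp: val_set_iff r_uminus)
    thus ?thesis using True xy by (auto simp: val_set_iff[of 0])
  next
    case False
    have s: "r x \<oplus>\<^bsub>K\<^esub> r (- y) = r (x - y)" using r_add[of x "- y"] by simp
    have vy: "v (r (- y)) = v (r y)" using False r_uminus val.v_uminus r_nonzero by simp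
    have "v (r x) \<preceq>\<^bsub>G\<^esub> v (r (x - y)) \<or> v (r y) \<preceq>\<^bsub>G\<^esub> v (r (x - y))"
      using val.val_add[of "r x" "r (- y)"] False r_nonzero[of x] r_nonzero[of "- y"] r_nonzero[of "x - y"]
      unfolding s vy by simp
    moreover have "v (r x) \<in> carrier G" "v (r y) \<in> carrier G" "v (r (x - y)) \<in> carrier G"
      using False by (auto intro!: val.v_closed r_nonzero)
    moreover have "\<one>\<^bsub>G\<^esub> \<preceq>\<^bsub>G\<^esub> v (r x)" "\<one>\<^bsub>G\<^esub> \<preceq>\<^bsub>G\<^esub> v (r y)" using xy False val_set_iff by auto
    ultimately have "\<one>\<^bsub>G\<^esub> \<preceq>\<^bsub>G\<^esub> v (r (x - y))"
      using val.G.gle_trans[OF val.G.one_closed] by blast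
    thus ?thesis using val_set_iff by blast
  qed
  show "x * y \<in> val_set"
  proof (cases "x = 0 \<or> y = 0")
    case True
    thus ?thesis using val_set_iff by auto
  next
    case False
    have "v (r (x * y)) = v (r x) \<otimes>\<^bsub>G\<^esub> v (r y)" using False r_mult val.v_mult r_nonzero by simp
    thus ?thesis using val.nonneg_mult val.v_closed r_nonzero xy val_set_iff False by simp
  qed
next
  fix x show "x \<in> val_set \<or> inverse x \<in> val_set"
  proof (cases "x = 0")
    case False
    thus ?thesis using val.inv_nonneg_iff[OF val.v_closed[OF r_nonzero[OF False]]]
      val_set_iff v_inverse by auto
  qed (simp add: val_set_iff)
qed

lemma max_ideal_val_set: "x \<in> max_ideal val_set \<longleftrightarrow> r x \<in> valuation_ideal K G v"
proof (cases "x = 0")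
  case True
  thus ?thesis by (simp add: max_ideal_def valuation_ideal_def r_zero)
next
  case False
  hence "x \<in> max_ideal val_set \<longleftrightarrow> \<not> \<one>\<^bsub>G\<^esub> \<preceq>\<^bsub>G\<^esub> inv\<^bsub>G\<^esub> v (r x)"
    using val_set_iff[of "inverse x"] v_inverse by (simp add: max_ideal_def)
  thus ?thesis using False val.inv_nonneg_iff[OF val.v_closed[OF r_nonzero[OF False]]]
    by (simp add: valuation_ideal_def r_closed r_eq_zero_iff)
qed

lemma henselian_iff: "henselian_valuation K G v \<longleftrightarrow> henselian_set val_set"
proof -
  have T: "valuation_ring K G v \<subseteq> carrier K" "\<zero>\<^bsub>K\<^esub> \<in> valuation_ring K G v"
    by (auto simp: valuation_ring_def)
  have co: "l \<in> carrier (univ_poly K (valuation_ring K G v)) \<longleftrightarrow> coeffs_in val_set p"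
    if "P.represents p l" for p l
    using univ_poly_carrier_iff[OF that T] by (simp add: coeffs_in_def val_set_def)
  have ev: "K.eval l (r a) = r (poly p a)" "K.eval (K.pderiv l) (r a) = r (poly (pderiv p) a)"
    if "P.represents p l" for p l a
    using P.represents_eval[OF that] P.represents_eval[OF P.represents_pderiv[OF that]] by auto
  show ?thesis
  proof
    assume h: "henselian_valuation K G v"
    interpret valuation_set val_set by (rule valuation_set_val_set)
    show "henselian_set val_set"
    proof unfold_locales
      fix f a
      assume f: "coeffs_in val_set f" and a: "a \<in> val_set" and m: "poly f a \<in> max_ideal val_set"
        and n: "poly (pderiv f) a \<notin> max_ideal val_set"
      obtain l where l: "P.represents f l" using represents_ex by blast
      have "\<exists>b\<in>valuation_ring K G v. K.eval l b = \<zero>\<^bsub>K\<^esub> \<and> b \<ominus>\<^bsub>K\<^esub> r a \<in> valuation_ideal K G v"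
      proof -
        have "l \<in> carrier (univ_poly K (valuation_ring K G v))" using co[OF l] f by simp
        moreover have "r a \<in> valuation_ring K G v" using a by (simp add: val_set_def)
        moreover have "K.eval l (r a) \<in> valuation_ideal K G v"
          "K.eval (K.pderiv l) (r a) \<notin> valuation_ideal K G v"
          using m n by (simp_all add: ev[OF l] max_ideal_val_set)
        ultimately show ?thesis using h unfolding henselian_valuation_def by blast
      qed
      then obtain b where b: "b \<in> val_set" "K.eval l (r b) = \<zero>\<^bsub>K\<^esub>" "r b \<ominus>\<^bsub>K\<^esub> r a \<in> valuation_ideal K G v"
        unfolding image_val_set[symmetric] by auto
      thus "\<exists>b\<in>val_set. poly f b = 0 \<and> b - a \<in> max_ideal val_set"
        using ev[OF l] r_eq_zero_iff by (intro bexI[of _ b]) (auto simp: max_ideal_val_set r_diff)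
    qed
  next
    assume "henselian_set val_set"
    then interpret henselian_set val_set .
    have "\<exists>b\<in>valuation_ring K G v. K.eval l b = \<zero>\<^bsub>K\<^esub> \<and> b \<ominus>\<^bsub>K\<^esub> a \<in> valuation_ideal K G v"
      if lT: "l \<in> carrier (univ_poly K (valuation_ring K G v))" and aT: "a \<in> valuation_ring K G v"
        and m: "K.eval l a \<in> valuation_ideal K G v"
        and n: "K.eval (K.pderiv l) a \<notin> valuation_ideal K G v" for l a
    proof -
      have "polynomial\<^bsub>K\<^esub> (valuation_ring K G v) l" using lT univ_poly_carrier by blast
      hence "polynomial\<^bsub>K\<^esub> (carrier K) l" using T(1) by (auto simp: polynomial_def)
      hence "l \<in> carrier (poly_ring K)" using P.in_poly_carrier by blast
      then obtain p where p: "P.represents p l" using represented_ex by blast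
      obtain x where x: "a = r x" "x \<in> val_set" using aT unfolding image_val_set[symmetric] by auto
      have "\<exists>b\<in>val_set. poly p b = 0 \<and> b - x \<in> max_ideal val_set"
      proof (rule hensel)
        show "coeffs_in val_set p" using co[OF p] lT by simp
        show "x \<in> val_set" by fact
        show "poly p x \<in> max_ideal val_set" using m x ev[OF p] max_ideal_val_set by simp
        show "poly (pderiv p) x \<notin> max_ideal val_set" using n x ev[OF p] max_ideal_val_set by simp
      qed
      then obtain b where b: "b \<in> val_set" "poly p b = 0" "b - x \<in> max_ideal val_set" by blast
      show ?thesis
      proof (intro bexI conjI)
        show "r b \<in> valuation_ring K G v" using b(1) by (simp add: val_set_def)
        show "K.eval l (r b) = \<zero>\<^bsub>K\<^esub>" using b(2) ev[OF p] r_zero by simp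
        show "r b \<ominus>\<^bsub>K\<^esub> a \<in> valuation_ideal K G v" using b(3) x by (simp add: max_ideal_val_set r_diff)
      qed
    qed
    thus "henselian_valuation K G v"
      unfolding henselian_valuation_def using val.valuation_axioms by blast
  qed
qed

definition residue :: "'k \<Rightarrow> 'a set" where
  "residue x = valuation_ideal K G v +>\<^bsub>K\<lparr>carrier := valuation_ring K G v\<rparr>\<^esub> r x"

lemma valuation_ring_ring: "ring (K\<lparr>carrier := valuation_ring K G v\<rparr>)"
proof (rule K.subring_is_ring, rule K.subringI)
  interpret valuation_set val_set by (rule valuation_set_val_set)
  show "valuation_ring K G v \<subseteq> carrier K" by (auto simp: valuation_ring_def)
  show "\<one>\<^bsub>K\<^esub> \<in> valuation_ring K G v" using one_in by (simp add: val_set_def r_one)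
  show "\<ominus>\<^bsub>K\<^esub> h \<in> valuation_ring K G v" if h: "h \<in> valuation_ring K G v" for h
  proof -
    obtain x where "h = r x" "x \<in> val_set" using h unfolding image_val_set[symmetric] by auto
    thus ?thesis using uminus_in[of x] by (simp add: val_set_def r_uminus)
  qed
  show "h \<otimes>\<^bsub>K\<^esub> k \<in> valuation_ring K G v" "h \<oplus>\<^bsub>K\<^esub> k \<in> valuation_ring K G v"
    if h: "h \<in> valuation_ring K G v" "k \<in> valuation_ring K G v" for h k
  proof -
    obtain x y where "h = r x" "x \<in> val_set" "k = r y" "y \<in> val_set"
      using h unfolding image_val_set[symmetric] by auto
    thus "h \<otimes>\<^bsub>K\<^esub> k \<in> valuation_ring K G v" "h \<oplus>\<^bsub>K\<^esub> k \<in> valuation_ring K G v"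
      using add_in[of x y] mult_in[of x y] by (simp_all add: val_set_def r_add r_mult)
  qed
qed

lemma ideal_valuation_ideal:
  "ideal (valuation_ideal K G v) (K\<lparr>carrier := valuation_ring K G v\<rparr>)"
proof -
  let ?A = "K\<lparr>carrier := valuation_ring K G v\<rparr>"
  interpret A: ring ?A by (rule valuation_ring_ring)
  interpret valuation_set val_set by (rule valuation_set_val_set)
  have sub: "valuation_ideal K G v \<subseteq> valuation_ring K G v"
    by (auto simp: valuation_ideal_def valuation_ring_def)
  have rep: "\<exists>x. h = r x \<and> x \<in> \<mm>" if h: "h \<in> valuation_ideal K G v" for h
    using h r_surj[of h] max_ideal_val_set by (auto simp: valuation_ideal_def)
  have add: "h \<oplus>\<^bsub>K\<^esub> k \<in> valuation_ideal K G v"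
    if h: "h \<in> valuation_ideal K G v" "k \<in> valuation_ideal K G v" for h k
  proof -
    obtain x y where "h = r x" "x \<in> \<mm>" "k = r y" "y \<in> \<mm>" using rep h by blast
    thus ?thesis using max_add[of x y] by (simp add: max_ideal_val_set r_add)
  qed
  have neg: "\<ominus>\<^bsub>?A\<^esub> h \<in> valuation_ideal K G v" if h: "h \<in> valuation_ideal K G v" for h
  proof -
    obtain x where x: "h = r x" "x \<in> \<mm>" using rep h by blast
    have nx: "r (- x) \<in> valuation_ideal K G v" using max_uminus[OF x(2)] by (simp add: max_ideal_val_set)
    have "r (- x) \<oplus>\<^bsub>K\<^esub> h = \<zero>\<^bsub>K\<^esub>" using r_add[of "- x" x] x by (simp add: r_zero)
    hence "\<ominus>\<^bsub>?A\<^esub> h = r (- x)" using A.minus_equality[of "r (- x)" h] h nx sub by auto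
    thus ?thesis using nx by simp
  qed
  have mult: "k \<otimes>\<^bsub>K\<^esub> h \<in> valuation_ideal K G v" "h \<otimes>\<^bsub>K\<^esub> k \<in> valuation_ideal K G v"
    if h: "h \<in> valuation_ideal K G v" "k \<in> valuation_ring K G v" for h k
  proof -
    obtain x where x: "h = r x" "x \<in> \<mm>" using rep h by blast
    obtain y where y: "k = r y" "y \<in> val_set" using h unfolding image_val_set[symmetric] by auto
    show "k \<otimes>\<^bsub>K\<^esub> h \<in> valuation_ideal K G v" "h \<otimes>\<^bsub>K\<^esub> k \<in> valuation_ideal K G v"
      using max_mult[OF y(2) x(2)] max_mult'[OF y(2) x(2)] x y by (simp_all add: max_ideal_val_set r_mult)
  qed
  show ?thesis
  proof (rule idealI[OF valuation_ring_ring])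
    show "subgroup (valuation_ideal K G v) (add_monoid ?A)"
    proof (rule subgroup.intro)
      show "inv\<^bsub>add_monoid ?A\<^esub> x \<in> valuation_ideal K G v" if "x \<in> valuation_ideal K G v" for x
        using neg[OF that] by (simp only: a_inv_def)
    qed (use sub add in \<open>auto simp: valuation_ideal_def\<close>)
  qed (use mult in auto)
qed

lemma residue_coeff_hom:
  assumes "cring (residue_field K G v)"
  shows "coeff_hom (residue_field K G v) val_set residue"
    and "x \<in> val_set \<Longrightarrow> residue x = \<zero>\<^bsub>residue_field K G v\<^esub> \<longleftrightarrow> x \<in> max_ideal val_set"
    and "residue ` val_set = carrier (residue_field K G v)"
proof -
  let ?A = "K\<lparr>carrier := valuation_ring K G v\<rparr>" and ?I = "valuation_ideal K G v"
  interpret F: cring "residue_field K G v" by fact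
  interpret I: ideal ?I ?A by (rule ideal_valuation_ideal)
  interpret valuation_set val_set by (rule valuation_set_val_set)
  have h: "((+>\<^bsub>?A\<^esub>) ?I) \<in> ring_hom ?A (residue_field K G v)"
    using I.rcos_ring_hom by (simp add: residue_field_def)
  have c: "r x \<in> carrier ?A" if "x \<in> val_set" for x using that by (simp add: val_set_def)
  show "coeff_hom (residue_field K G v) val_set residue"
  proof unfold_locales
    fix x y assume xy: "x \<in> val_set" "y \<in> val_set"
    show "residue x \<in> carrier (residue_field K G v)"
      unfolding residue_def using ring_hom_closed[OF h c[OF xy(1)]] .
    show "residue (x + y) = residue x \<oplus>\<^bsub>residue_field K G v\<^esub> residue y"
      unfolding residue_def r_add using ring_hom_add[OF h c[OF xy(1)] c[OF xy(2)]] by simp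
    show "residue (x * y) = residue x \<otimes>\<^bsub>residue_field K G v\<^esub> residue y"
      unfolding residue_def r_mult using ring_hom_mult[OF h c[OF xy(1)] c[OF xy(2)]] by simp
  next
    show "residue 1 = \<one>\<^bsub>residue_field K G v\<^esub>"
      unfolding residue_def r_one using ring_hom_one[OF h] by simp
  qed
  show "residue x = \<zero>\<^bsub>residue_field K G v\<^esub> \<longleftrightarrow> x \<in> max_ideal val_set" if x: "x \<in> val_set"
  proof -
    have "residue x = \<zero>\<^bsub>residue_field K G v\<^esub> \<longleftrightarrow> residue x = ?I"
      by (simp add: residue_field_def FactRing_def)
    also have "\<dots> \<longleftrightarrow> r x \<in> ?I"
      unfolding residue_def using I.rcos_const_imp_mem[OF c[OF x]] I.a_rcos_zero[OF ideal_valuation_ideal] by blast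
    finally show ?thesis by (simp add: max_ideal_val_set)
  qed
  have "carrier (residue_field K G v) = (\<Union>a\<in>valuation_ring K G v. {?I +>\<^bsub>?A\<^esub> a})"
    by (simp add: residue_field_def FactRing_def A_RCOSETS_def')
  also have "\<dots> = residue ` val_set"
    unfolding image_val_set[symmetric] residue_def by auto
  finally show "residue ` val_set = carrier (residue_field K G v)" by simp
qed

text \<open>If the reduction of \<open>P\<close> is separable, it splits and has a root, which lifts
  to \<open>c\<close>. If not, a nonunit common divisor of the reduction and its derivative is
  lifted together with the two cofactors.\<close>

theorem residue_sep_closed_val_set:
  assumes sc: "separably_closed (residue_field K G v)"
  shows "residue_sep_closed val_set"
proof -
  let ?F = "residue_field K G v"
  interpret F: separably_closed ?F by (rule sc)
  interpret valuation_set val_set by (rule valuation_set_val_set)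
  interpret h: coeff_hom ?F val_set residue by (rule residue_coeff_hom(1)[OF F.is_cring])
  note kernel = residue_coeff_hom(2)[OF F.is_cring] and onto = residue_coeff_hom(3)[OF F.is_cring]
  have lift: "\<exists>D. h.represents D d \<and> degree D = length d - 1" if "d \<in> carrier (poly_ring ?F)" for d
    using h.represents_lift[OF that] h.set_poly_carrier[OF that] onto by simp
  have diff: "coeffs_in \<mm> (A - B)" if "h.represents A l" "h.represents B l" for A B l
  proof -
    have "coeff A i - coeff B i \<in> \<mm>" for i
    proof -
      have m: "coeff A i \<in> val_set" "coeff B i \<in> val_set" and e: "residue (coeff A i) = residue (coeff B i)"
        using that by (auto simp: h.represents_def coeffs_in_def)
      have "residue (coeff A i - coeff B i) = residue (coeff A i) \<oplus>\<^bsub>?F\<^esub> \<ominus>\<^bsub>?F\<^esub> residue (coeff B i)"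
        using h.rho_add[OF m(1) uminus_in[OF m(2)]] h.rho_uminus[OF m(2)] by simp
      also have "\<dots> = \<zero>\<^bsub>?F\<^esub>" using e h.rho_closed[OF m(2)] F.r_neg by simp
      finally show ?thesis using kernel[OF diff_in[OF m]] by simp
    qed
    thus ?thesis by (simp add: coeffs_in_def)
  qed
  show ?thesis unfolding residue_sep_closed_def
  proof (intro allI impI)
    fix P assume "coeffs_in val_set P \<and> lead_coeff P = 1 \<and> degree P \<ge> 1"
    hence P: "coeffs_in val_set P" "lead_coeff P = 1" "degree P \<ge> 1" by auto
    obtain l where l: "h.represents P l" using h.represents_coeffs[OF P(1)] by blast
    have lc: "l \<in> carrier (poly_ring ?F)" using l by (simp add: h.represents_def)
    have len: "length l = Suc (degree P)"
      using h.represents_length[OF l] P(2) h.rho_one F.one_not_zero by simp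
    show "(\<exists>c\<in>val_set. poly P c \<in> \<mm>) \<or> (\<exists>D E E'. coeffs_in val_set D \<and> coeffs_in val_set E \<and>
        coeffs_in val_set E' \<and> lead_coeff D = 1 \<and> lead_coeff E = 1 \<and> 1 \<le> degree D \<and>
        coeffs_in \<mm> (P - D * E) \<and> coeffs_in \<mm> (pderiv P - D * E'))"
    proof (cases "F.separable_poly l")
      case True
      hence "F.splitted l" by (rule F.separable_splitted)
      hence "size (F.roots l) = length l - 1" by (simp add: F.splitted_def)
      hence "F.roots l \<noteq> {#}" using len P(3) by auto
      then obtain y where "y \<in> set_mset (F.roots l)" by auto
      hence y: "y \<in> carrier ?F" "F.eval l y = \<zero>\<^bsub>?F\<^esub>"
        using F.roots_mem_iff_is_root[OF lc] by (auto simp: F.is_root_def)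
      then obtain c where c: "c \<in> val_set" "y = residue c" using y(1) unfolding onto[symmetric] by auto
      have "residue (poly P c) = \<zero>\<^bsub>?F\<^esub>" using h.represents_eval[OF l c(1)] y c by simp
      thus ?thesis using kernel poly_in[OF P(1) c(1)] c by auto
    next
      case False
      then obtain d where d: "d \<in> carrier (poly_ring ?F)" "d pdivides\<^bsub>?F\<^esub> l" "d pdivides\<^bsub>?F\<^esub> F.pderiv l"
        and nu: "d \<notin> Units (poly_ring ?F)"
        using lc unfolding F.separable_poly_def by blast
      obtain e e' where e: "e \<in> carrier (poly_ring ?F)" "l = d \<otimes>\<^bsub>poly_ring ?F\<^esub> e"
        and e': "e' \<in> carrier (poly_ring ?F)" "F.pderiv l = d \<otimes>\<^bsub>poly_ring ?F\<^esub> e'"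
        using d(2,3) unfolding pdivides_def factor_def by blast
      have l0: "l \<noteq> []" using len by auto
      have d0: "d \<noteq> []" and e0: "e \<noteq> []" using l0 e(2) F.poly_mult_zero[OF h.set_poly_carrier[OF d(1)]]
        by (auto simp: univ_poly_mult)
      obtain D where D: "h.represents D d" "degree D = length d - 1" using lift[OF d(1)] by blast
      obtain E where E: "h.represents E e" "degree E = length e - 1" using lift[OF e(1)] by blast
      obtain E' where E': "h.represents E' e'" using lift[OF e'(1)] by blast
      have co: "coeffs_in val_set D" "coeffs_in val_set E" "coeffs_in val_set E'"
        using D E E' by (auto simp: h.represents_def)
      define a b where "a = lead_coeff D" and "b = lead_coeff E"
      have ab: "a \<in> val_set - \<mm>" "b \<in> val_set - \<mm>"
        using h.represents_hd(1)[OF D(1) d0] h.represents_hd(1)[OF E(1) e0] D(2) E(2) co kernel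
        by (auto simp: a_def b_def coeffs_in_def)
      note a0 = unit_not0[OF ab(1)] and b0 = unit_not0[OF ab(2)]
      have m: "coeffs_in \<mm> (P - D * E)"
        using diff[OF l] h.represents_mult[OF D(1) E(1)] e(2) by simp
      have m': "coeffs_in \<mm> (pderiv P - D * E')"
        using diff[OF h.represents_pderiv[OF l]] h.represents_mult[OF D(1) E'] e'(2) by simp
      have abm: "a * b \<in> val_set - \<mm>" using unit_mult[OF ab] .
      have degDE: "degree (D * E) = degree D + degree E" "lead_coeff (D * E) = a * b"
        using a0 b0 by (auto simp: a_def b_def degree_mult_eq coeff_mult_degree_sum)
      have deg: "degree P = degree (D * E)"
      proof (rule linorder_cases[of "degree P" "degree (D * E)"])
        assume "degree P < degree (D * E)"
        hence "- (a * b) \<in> \<mm>" using m[unfolded coeffs_in_def, rule_format, of "degree (D * E)"] degDE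
          by (simp add: coeff_eq_0)
        thus ?thesis using abm by (simp add: max_uminus_iff)
      next
        assume "degree (D * E) < degree P"
        hence "1 \<in> \<mm>" using m[unfolded coeffs_in_def, rule_format, of "degree P"] P(2)
          by (simp add: coeff_eq_0)
        thus ?thesis using one_notin_max by simp
      qed
      have ab1: "1 - a * b \<in> \<mm>"
        using m[unfolded coeffs_in_def, rule_format, of "degree P"] P(2) degDE deg by simp
      \<comment> \<open>The lifts \<open>D\<close> and \<open>E\<close> have unit leading
        coefficients \<open>a\<close> and \<open>b\<close> with \<open>a * b\<close> congruent to
        \<open>1\<close>. Dividing by them changes \<open>D * E\<close> only modulo
        \<open>\<mm>\<close>; \<open>E'\<close> absorbs the factor \<open>a\<close>, so
        \<open>D * E'\<close> is unchanged.\<close>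
      define D1 E1 E2 where "D1 = smult (1 / a) D" and "E1 = smult (1 / b) E" and "E2 = smult a E'"
      have ia: "1 / a \<in> val_set" "1 / b \<in> val_set" using unit_inverse ab by auto
      have c1: "coeffs_in val_set D1" "coeffs_in val_set E1" "coeffs_in val_set E2"
        unfolding D1_def E1_def E2_def using co ia ab by (auto intro: coeffs_in_smult)
      have le: "lead_coeff D1 = 1" "lead_coeff E1 = 1"
        using a0 b0 by (auto simp: D1_def E1_def a_def b_def)
      have dg: "degree D1 \<ge> 1"
      proof (rule ccontr)
        assume "\<not> ?thesis"
        hence "degree D = 0" using a0 by (auto simp: D1_def)
        hence "length d = 1" using D(2) d0 by (cases d) auto
        then obtain k where k: "d = [k]" by (auto simp: length_Suc_conv)
        hence "k \<in> carrier ?F - {\<zero>\<^bsub>?F\<^esub>}"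
          using d(1) unfolding h.in_poly_carrier by (auto simp: polynomial_def)
        thus False using nu k F.univ_poly_units[OF F.carrier_is_subfield] by auto
      qed
      have DE: "D * E = smult (a * b) (D1 * E1)" using a0 b0 by (simp add: D1_def E1_def)
      have "P - D1 * E1 = (P - D * E) - smult (1 - a * b) (D1 * E1)"
        unfolding DE by (simp add: smult_diff_left)
      moreover have "coeffs_in \<mm> (smult (1 - a * b) (D1 * E1))"
        using coeffs_in_mult[OF c1(1,2)] max_mult'[OF _ ab1] by (simp add: coeffs_in_def)
      ultimately have r1: "coeffs_in \<mm> (P - D1 * E1)" by (metis coeffs_in_max_diff[OF m])
      have "D * E' = D1 * E2" using a0 by (simp add: D1_def E2_def)
      hence "coeffs_in \<mm> (pderiv P - D1 * E2)" using m' by simp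
      thus ?thesis using c1 le dg r1 by blast
    qed
  qed
qed

end

section \<open>The valuation of a valuation ring\<close>

locale coset_valuation = field_iso K r + valuation_set W
  for K :: "('a, 'm) ring_scheme" and r :: "'k::field \<Rightarrow> 'a" and W :: "'k set"
begin

text \<open>The coset of \<open>x\<close> modulo the units of \<open>W\<close>, realized as a subset
  of the carrier of \<open>K\<close>, so that the value group lives in the type that the theorem
  prescribes.\<close>

definition cl :: "'k \<Rightarrow> 'a set" where
  "cl x = r ` {y. y \<noteq> 0 \<and> y / x \<in> W - \<mm>}"

definition rep :: "'a set \<Rightarrow> 'k" where
  "rep A = (SOME x. x \<noteq> 0 \<and> cl x = A)"

definition value_group :: "'a set ordered_monoid" where
  "value_group = \<lparr>carrier = cl ` {x. x \<noteq> 0}, monoid.mult = (\<lambda>A B. cl (rep A * rep B)), one = cl 1,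
     gle = (\<lambda>A B. rep B / rep A \<in> W)\<rparr>"

definition coset_val :: "'a \<Rightarrow> 'a set" where
  "coset_val y = cl (inv_into UNIV r y)"

lemma cl_eq_iff:
  assumes "x \<noteq> 0" "y \<noteq> 0"
  shows "cl x = cl y \<longleftrightarrow> y / x \<in> W - \<mm>"
proof
  assume "cl x = cl y"
  moreover have "r y \<in> cl y" using assms one_unit by (auto simp: cl_def)
  ultimately have "r y \<in> cl x" by simp
  thus "y / x \<in> W - \<mm>" by (auto simp: cl_def r_eq_iff)
next
  assume u: "y / x \<in> W - \<mm>"
  have "z / x \<in> W - \<mm> \<longleftrightarrow> z / y \<in> W - \<mm>" for z
  proof -
    have "z / x = z / y * (y / x)" "z / y = z / x / (y / x)" using assms by auto
    thus ?thesis using unit_mult[OF _ u, of "z / y"] unit_divide[OF _ u, of "z / x"] by metis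
  qed
  thus "cl x = cl y" by (simp add: cl_def)
qed

lemma rep_cl:
  assumes "x \<noteq> 0"
  shows "rep (cl x) \<noteq> 0" "cl (rep (cl x)) = cl x" "rep (cl x) / x \<in> W - \<mm>"
proof -
  have "\<exists>y. y \<noteq> 0 \<and> cl y = cl x" using assms by blast
  from someI_ex[OF this] show *: "rep (cl x) \<noteq> 0" "cl (rep (cl x)) = cl x" by (auto simp: rep_def)
  thus "rep (cl x) / x \<in> W - \<mm>" using cl_eq_iff[OF assms *(1)] by simp
qed

lemma carrier_value_group: "carrier value_group = cl ` {x. x \<noteq> 0}"
  by (simp add: value_group_def)

lemma one_value_group: "\<one>\<^bsub>value_group\<^esub> = cl 1"
  by (simp add: value_group_def)

lemma mult_cl:
  assumes "x \<noteq> 0" "y \<noteq> 0"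
  shows "cl x \<otimes>\<^bsub>value_group\<^esub> cl y = cl (x * y)"
proof -
  have "rep (cl x) * rep (cl y) / (x * y) \<in> W - \<mm>"
    using unit_mult[OF rep_cl(3)[OF assms(1)] rep_cl(3)[OF assms(2)]] by simp
  hence "cl (x * y) = cl (rep (cl x) * rep (cl y))"
    using cl_eq_iff[of "x * y" "rep (cl x) * rep (cl y)"] rep_cl(1) assms by simp
  thus ?thesis by (simp add: value_group_def)
qed

lemma gle_cl:
  assumes x: "x \<noteq> 0" and y: "y \<noteq> 0"
  shows "cl x \<preceq>\<^bsub>value_group\<^esub> cl y \<longleftrightarrow> y / x \<in> W"
proof -
  let ?u = "rep (cl x) / x" and ?w = "rep (cl y) / y"
  have u: "?u \<in> W - \<mm>" "?w \<in> W - \<mm>" using rep_cl(3) assms by auto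
  have n: "rep (cl x) \<noteq> 0" "rep (cl y) \<noteq> 0" using rep_cl(1) assms by auto
  have e: "rep (cl y) / rep (cl x) = y / x * (?w / ?u)" "y / x = rep (cl y) / rep (cl x) * (?u / ?w)"
    using n assms by auto
  have i: "?w / ?u \<in> W" "?u / ?w \<in> W" using unit_divide u by blast+
  have "rep (cl y) / rep (cl x) \<in> W \<longleftrightarrow> y / x \<in> W"
    using mult_in[OF _ i(1), of "y / x"] mult_in[OF _ i(2), of "rep (cl y) / rep (cl x)"]
    unfolding e[symmetric] by blast
  thus ?thesis by (simp add: value_group_def)
qed

lemma value_groupE:
  assumes "A \<in> carrier value_group"
  obtains x where "x \<noteq> 0" "A = cl x"
  using assms by (auto simp: carrier_value_group)

lemma comm_group_value_group: "comm_group value_group"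
proof (rule comm_groupI)
  fix A B assume "A \<in> carrier value_group" "B \<in> carrier value_group"
  then obtain x y where xy: "x \<noteq> 0" "A = cl x" "y \<noteq> 0" "B = cl y" by (metis value_groupE)
  thus "A \<otimes>\<^bsub>value_group\<^esub> B \<in> carrier value_group"
    using mult_cl[of x y] by (auto simp: carrier_value_group)
  show "A \<otimes>\<^bsub>value_group\<^esub> B = B \<otimes>\<^bsub>value_group\<^esub> A"
    using xy mult_cl[of x y] mult_cl[of y x] by (simp add: mult.commute)
  fix C assume "C \<in> carrier value_group"
  then obtain z where z: "z \<noteq> 0" "C = cl z" by (metis value_groupE)
  show "A \<otimes>\<^bsub>value_group\<^esub> B \<otimes>\<^bsub>value_group\<^esub> C = A \<otimes>\<^bsub>value_group\<^esub> (B \<otimes>\<^bsub>value_group\<^esub> C)"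
    using xy z by (simp add: mult_cl mult.assoc)
next
  show "\<one>\<^bsub>value_group\<^esub> \<in> carrier value_group" by (simp add: carrier_value_group one_value_group)
next
  fix A assume "A \<in> carrier value_group"
  then obtain x where x: "x \<noteq> 0" "A = cl x" by (metis value_groupE)
  show "\<one>\<^bsub>value_group\<^esub> \<otimes>\<^bsub>value_group\<^esub> A = A" using x by (simp add: one_value_group mult_cl)
  have "cl (inverse x) \<otimes>\<^bsub>value_group\<^esub> A = \<one>\<^bsub>value_group\<^esub>" using x by (simp add: one_value_group mult_cl)
  thus "\<exists>B\<in>carrier value_group. B \<otimes>\<^bsub>value_group\<^esub> A = \<one>\<^bsub>value_group\<^esub>"
    using x by (intro bexI[of _ "cl (inverse x)"]) (auto simp: carrier_value_group)
qed

lemma ordered_comm_group_value_group: "ordered_comm_group value_group"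
proof -
  interpret comm_group value_group by (rule comm_group_value_group)
  show ?thesis
  proof unfold_locales
    fix A B assume "A \<in> carrier value_group" "B \<in> carrier value_group"
    then obtain x y where xy: "x \<noteq> 0" "A = cl x" "y \<noteq> 0" "B = cl y" by (metis value_groupE)
    show "A \<preceq>\<^bsub>value_group\<^esub> B \<or> B \<preceq>\<^bsub>value_group\<^esub> A" using xy comparable[of x y] by (auto simp: gle_cl)
    show "A = B" if "A \<preceq>\<^bsub>value_group\<^esub> B" "B \<preceq>\<^bsub>value_group\<^esub> A"
    proof -
      have "y / x \<in> W" "1 / (y / x) \<in> W" using xy that by (auto simp: gle_cl)
      hence "y / x \<in> W - \<mm>" using xy unit_iff[of "y / x"] by simp
      thus ?thesis using xy cl_eq_iff by simp
    qed
    fix C assume "C \<in> carrier value_group"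
    then obtain z where z: "z \<noteq> 0" "C = cl z" by (metis value_groupE)
    show "A \<preceq>\<^bsub>value_group\<^esub> C" if "A \<preceq>\<^bsub>value_group\<^esub> B" "B \<preceq>\<^bsub>value_group\<^esub> C"
    proof -
      have "y / x * (z / y) \<in> W" using xy z that by (intro mult_in) (auto simp: gle_cl)
      moreover have "y / x * (z / y) = z / x" using xy by simp
      ultimately show ?thesis using xy z by (simp add: gle_cl)
    qed
    show "C \<otimes>\<^bsub>value_group\<^esub> A \<preceq>\<^bsub>value_group\<^esub> C \<otimes>\<^bsub>value_group\<^esub> B" if "A \<preceq>\<^bsub>value_group\<^esub> B"
      using xy z that by (simp add: gle_cl mult_cl)
  qed
qed

lemma coset_val_r: "coset_val (r x) = cl x"
  using inv_into_f_f[of r UNIV x] bij by (simp add: coset_val_def bij_betw_def)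

lemma nonzero_r:
  assumes "a \<in> carrier K - {\<zero>\<^bsub>K\<^esub>}"
  obtains x where "x \<noteq> 0" "a = r x"
  using assms r_surj[of a] r_zero by (metis Diff_iff singletonI)

lemma valuation_coset_val: "valuation K value_group coset_val"
proof -
  interpret H: ordered_comm_group value_group by (rule ordered_comm_group_value_group)
  have nz: "r x \<in> carrier K - {\<zero>\<^bsub>K\<^esub>} \<longleftrightarrow> x \<noteq> 0" for x using r_closed r_eq_zero_iff by auto
  show ?thesis
  proof unfold_locales
    have "coset_val \<in> hom (Multiplicative_Group.mult_of K) value_group"
    proof (rule homI)
      fix a assume "a \<in> carrier (Multiplicative_Group.mult_of K)"
      hence "a \<in> carrier K - {\<zero>\<^bsub>K\<^esub>}" by simp
      then obtain x where x: "x \<noteq> 0" "a = r x" by (rule nonzero_r)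
      thus "coset_val a \<in> carrier value_group" by (auto simp: coset_val_r carrier_value_group)
      fix b assume "b \<in> carrier (Multiplicative_Group.mult_of K)"
      hence "b \<in> carrier K - {\<zero>\<^bsub>K\<^esub>}" by simp
      then obtain y where y: "y \<noteq> 0" "b = r y" by (rule nonzero_r)
      show "coset_val (a \<otimes>\<^bsub>Multiplicative_Group.mult_of K\<^esub> b) = coset_val a \<otimes>\<^bsub>value_group\<^esub> coset_val b"
        using x y by (simp add: coset_val_r mult_cl flip: r_mult)
    qed
    moreover have "coset_val ` (carrier K - {\<zero>\<^bsub>K\<^esub>}) = cl ` {x. x \<noteq> 0}"
    proof (intro equalityI subsetI)
      fix A assume "A \<in> coset_val ` (carrier K - {\<zero>\<^bsub>K\<^esub>})"
      then obtain a where a: "a \<in> carrier K - {\<zero>\<^bsub>K\<^esub>}" "A = coset_val a" by blast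
      from a(1) obtain x where "x \<noteq> 0" "a = r x" by (rule nonzero_r)
      thus "A \<in> cl ` {x. x \<noteq> 0}" using a(2) by (auto simp: coset_val_r)
    next
      fix A assume "A \<in> cl ` {x. x \<noteq> 0}"
      then obtain x where "x \<noteq> 0" "A = coset_val (r x)" by (auto simp: coset_val_r)
      thus "A \<in> coset_val ` (carrier K - {\<zero>\<^bsub>K\<^esub>})" using nz[of x] by blast
    qed
    ultimately show "coset_val \<in> epi (Multiplicative_Group.mult_of K) value_group"
      by (simp add: epi_def carrier_value_group)
  next
    fix a b assume ab: "a \<in> carrier K - {\<zero>\<^bsub>K\<^esub>}" "b \<in> carrier K - {\<zero>\<^bsub>K\<^esub>}" "a \<oplus>\<^bsub>K\<^esub> b \<noteq> \<zero>\<^bsub>K\<^esub>"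
    obtain x where x: "x \<noteq> 0" "a = r x" using ab(1) by (rule nonzero_r)
    obtain y where y: "y \<noteq> 0" "b = r y" using ab(2) by (rule nonzero_r)
    have s: "a \<oplus>\<^bsub>K\<^esub> b = r (x + y)" using x y by (simp add: r_add)
    have n: "x + y \<noteq> 0" using ab(3) r_zero unfolding s by auto
    have "(x + y) / x = 1 + y / x" "(x + y) / y = x / y + 1" using x y by (auto simp: add_divide_distrib)
    hence "(x + y) / x \<in> W \<or> (x + y) / y \<in> W" using comparable[of x y] add_in one_in by auto
    thus "coset_val a \<preceq>\<^bsub>value_group\<^esub> coset_val (a \<oplus>\<^bsub>K\<^esub> b) \<or> coset_val b \<preceq>\<^bsub>value_group\<^esub> coset_val (a \<oplus>\<^bsub>K\<^esub> b)"
      unfolding s using x y n by (simp add: coset_val_r gle_cl)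
  qed
qed

lemma valuation_ring_coset_val: "r x \<in> valuation_ring K value_group coset_val \<longleftrightarrow> x \<in> W"
  using r_closed r_eq_zero_iff zero_in
  by (cases "x = 0") (simp_all add: valuation_ring_def coset_val_r one_value_group gle_cl)

lemma nontrivial_coset_val:
  assumes "W \<noteq> UNIV"
  shows "nontrivial_valuation K value_group coset_val"
proof -
  obtain x where x: "x \<notin> W" using assms by blast
  hence x0: "x \<noteq> 0" using zero_in by auto
  have "coset_val (r x) \<noteq> \<one>\<^bsub>value_group\<^esub>"
    using cl_eq_iff[of 1 x] x x0 by (auto simp: coset_val_r one_value_group)
  moreover have "r x \<in> carrier K - {\<zero>\<^bsub>K\<^esub>}" using r_closed r_eq_zero_iff x0 by auto
  ultimately show ?thesis unfolding nontrivial_valuation_def using valuation_coset_val by blast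
qed

lemma henselian_coset_val:
  assumes "henselian_set W"
  shows "henselian_valuation K value_group coset_val"
proof -
  interpret w: valued_iso K value_group coset_val r
    unfolding valued_iso_def using valuation_coset_val field_iso_axioms by blast
  have "w.val_set = W" using valuation_ring_coset_val by (auto simp: w.val_set_def)
  thus ?thesis using w.henselian_iff assms by simp
qed

lemma zero_definable_coset_val:
  assumes "definable W"
  shows "zero_definable_valuation K value_group coset_val"
proof -
  have tval: "tval K (r \<circ> e) t = r (type_tval e t)" for e t
    by (induction t) (simp_all add: r_zero r_one r_uminus r_add r_mult)
  have sat: "sat K (r \<circ> e) \<phi> \<longleftrightarrow> type_sat e \<phi>" for e \<phi>
  proof (induction \<phi> arbitrary: e)
    case (FEx i \<phi>)
    have "sat K (r \<circ> e) (FEx i \<phi>) \<longleftrightarrow> (\<exists>x. sat K ((r \<circ> e)(i := r x)) \<phi>)"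
      by (simp flip: range_r)
    also have "\<dots> \<longleftrightarrow> (\<exists>x. sat K (r \<circ> e(i := x)) \<phi>)" by (simp only: fun_upd_comp)
    also have "\<dots> \<longleftrightarrow> (\<exists>x. type_sat (e(i := x)) \<phi>)" by (simp only: FEx.IH)
    finally show ?case by (simp only: type_sat.simps)
  qed (simp_all add: tval r_eq_iff)
  obtain \<phi> where \<phi>: "free_vars \<phi> \<subseteq> {0}" "\<And>e :: nat \<Rightarrow> 'k. type_sat e \<phi> \<longleftrightarrow> e 0 \<in> W"
    using definable_closed_formula[OF assms] by blast
  have s: "sat K ((\<lambda>_. \<zero>\<^bsub>K\<^esub>)(0 := r x)) \<phi> \<longleftrightarrow> x \<in> W" for x
  proof -
    have "(\<lambda>_ :: nat. \<zero>\<^bsub>K\<^esub>)(0 := r x) = r \<circ> (\<lambda>_. 0)(0 := x)" by (auto simp: r_zero)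
    thus ?thesis using sat[of "(\<lambda>_. 0)(0 := x)" \<phi>] \<phi>(2)[of "(\<lambda>_. 0)(0 := x)"]
      by (simp only: fun_upd_same)
  qed
  have "valuation_ring K value_group coset_val = {a \<in> carrier K. sat K ((\<lambda>_. \<zero>\<^bsub>K\<^esub>)(0 := a)) \<phi>}"
    using valuation_ring_coset_val s unfolding range_r[symmetric]
    by (auto simp: valuation_ring_def simp flip: range_r)
  thus ?thesis unfolding zero_definable_valuation_def zero_definable_set_def
    using valuation_coset_val \<phi>(1) by blast
qed

end

theorem (in valued_iso) definable_henselian_valuation:
  assumes "\<not> separably_closed K" "henselian_valuation K G v" "separably_closed (residue_field K G v)"
  shows "\<exists>(H :: 'a set ordered_monoid) w. nontrivial_valuation K H w \<and> henselian_valuation K H w \<and>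
    zero_definable_valuation K H w"
proof -
  interpret henselian_sc val_set
    using henselian_iff assms residue_sep_closed_val_set
    by (simp add: henselian_sc_def henselian_sc_axioms_def)
  obtain f U W :: "'k poly" and \<alpha> where "U * f + W * pderiv f = 1" "poly (map_poly to_ac f) \<alpha> = 0" "\<alpha> \<notin> range to_ac"
    by (rule not_separably_closed_root[OF assms(1)])
  hence "\<exists>M. proper_ball val_set M \<and> definable M" by (rule definable_ball)
  then obtain M where M: "proper_ball val_set M" "definable M" by blast
  note st = stabilizer_proper_ball[OF M(1)]
  interpret S: henselian_set "stabilizer M" by (rule henselian_coarsening[OF st(1,2)])
  interpret coset_valuation K r "stabilizer M" ..
  show ?thesis
    using nontrivial_coset_val[OF st(3)] henselian_coset_val[OF S.henselian_set_axioms]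
      zero_definable_coset_val[OF definable_stabilizer[OF M(2)]] by blast
qed

section \<open>A field as a type\<close>

text \<open>The proof takes place in a type, but a locally fixed field cannot be turned into one. If the
  theorem fails for the types at hand, though, a globally chosen counterexample defines a type; the
  rationals keep this definition total otherwise.\<close>

definition counterexample ::
  "('a, 'm) ring_scheme \<Rightarrow> ('g, 'n) ordered_monoid_scheme \<Rightarrow> ('a \<Rightarrow> 'g) \<Rightarrow> bool" where
  "counterexample K G v \<longleftrightarrow> field K \<and> \<not> separably_closed K \<and> henselian_valuation K G v \<and>
     separably_closed (residue_field K G v) \<and>
     \<not> (\<exists>(H :: 'a set ordered_monoid) w. nontrivial_valuation K H w \<and> henselian_valuation K H w \<and>
          zero_definable_valuation K H w)"

text \<open>The type of \<open>K\<close> does not mention the types of the value group, so the first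
  argument carries them.\<close>

definition counterexample_field :: "('g \<times> 'n) itself \<Rightarrow> ('a, 'm) ring_scheme \<Rightarrow> bool" where
  "counterexample_field T K \<longleftrightarrow> (\<exists>(G :: ('g, 'n) ordered_monoid_scheme) v. counterexample K G v)"

definition chosen_field :: "('g \<times> 'n) itself \<Rightarrow> ('a, 'm) ring_scheme" where
  "chosen_field T = (SOME K. counterexample_field T K)"

text \<open>The sum type gives both alternatives a common type; each is copied into its summand as
  an image ring.\<close>

definition cex_ring :: "('a \<times> 'm \<times> 'g \<times> 'n) itself \<Rightarrow> ('a + rat) ring" where
  "cex_ring T = (if \<exists>K :: ('a, 'm) ring_scheme. counterexample_field TYPE('g \<times> 'n) K
     then image_ring Inl (chosen_field TYPE('g \<times> 'n) :: ('a, 'm) ring_scheme)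
     else image_ring Inr (ring_of_type_algebra :: rat ring))"

lemma counterexample_chosen_field:
  assumes "\<exists>K :: ('a, 'm) ring_scheme. counterexample_field (T :: ('g \<times> 'n) itself) K"
  shows "counterexample_field T (chosen_field T :: ('a, 'm) ring_scheme)"
  unfolding chosen_field_def using someI_ex[OF assms] .

lemma field_cex_ring: "field (cex_ring (T :: ('a \<times> 'm \<times> 'g \<times> 'n) itself))"
proof (cases "\<exists>K :: ('a, 'm) ring_scheme. counterexample_field TYPE('g \<times> 'n) K")
  case True
  hence "field (chosen_field TYPE('g \<times> 'n) :: ('a, 'm) ring_scheme)"
    using counterexample_chosen_field[OF True]
    by (auto simp: counterexample_field_def counterexample_def)
  thus ?thesis using True field.inj_imp_image_ring_is_field[of _ Inl] by (simp add: cex_ring_def)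
next
  case False
  have "field (ring_of_type_algebra :: rat ring)" by rule
  thus ?thesis using False field.inj_imp_image_ring_is_field[of _ Inr] by (simp add: cex_ring_def)
qed

typedef ('a, 'm, 'g, 'n) cex_field = "carrier (cex_ring TYPE('a \<times> 'm \<times> 'g \<times> 'n))"
  morphisms of_cex to_cex
proof -
  interpret R: field "cex_ring TYPE('a \<times> 'm \<times> 'g \<times> 'n)" by (rule field_cex_ring)
  show ?thesis using R.zero_closed by blast
qed

instantiation cex_field :: (type, type, type, type) field
begin

definition "0 = to_cex \<zero>\<^bsub>cex_ring TYPE('a \<times> 'b \<times> 'c \<times> 'd)\<^esub>"
definition "1 = to_cex \<one>\<^bsub>cex_ring TYPE('a \<times> 'b \<times> 'c \<times> 'd)\<^esub>"
definition "x + y = to_cex (of_cex x \<oplus>\<^bsub>cex_ring TYPE('a \<times> 'b \<times> 'c \<times> 'd)\<^esub> of_cex y)"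
definition "x * y = to_cex (of_cex x \<otimes>\<^bsub>cex_ring TYPE('a \<times> 'b \<times> 'c \<times> 'd)\<^esub> of_cex y)"
definition "- x = to_cex (\<ominus>\<^bsub>cex_ring TYPE('a \<times> 'b \<times> 'c \<times> 'd)\<^esub> of_cex x)"
definition "x - y = x + - (y :: ('a, 'b, 'c, 'd) cex_field)"
definition "inverse x = (if x = 0 then 0 else
  to_cex (inv\<^bsub>cex_ring TYPE('a \<times> 'b \<times> 'c \<times> 'd)\<^esub> of_cex x))"
definition "x div y = x * inverse (y :: ('a, 'b, 'c, 'd) cex_field)"

lemma of_cex_simps:
  fixes x y :: "('a, 'b, 'c, 'd) cex_field"
  defines "R \<equiv> cex_ring TYPE('a \<times> 'b \<times> 'c \<times> 'd)"
  shows "of_cex (0 :: ('a, 'b, 'c, 'd) cex_field) = \<zero>\<^bsub>R\<^esub>" "of_cex (1 :: ('a, 'b, 'c, 'd) cex_field) = \<one>\<^bsub>R\<^esub>"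
    "of_cex (x + y) = of_cex x \<oplus>\<^bsub>R\<^esub> of_cex y" "of_cex (x * y) = of_cex x \<otimes>\<^bsub>R\<^esub> of_cex y"
    "of_cex (- x) = \<ominus>\<^bsub>R\<^esub> of_cex x" "of_cex x \<in> carrier R"
    "x \<noteq> 0 \<Longrightarrow> of_cex (inverse x) = inv\<^bsub>R\<^esub> of_cex x" "x \<noteq> 0 \<Longrightarrow> of_cex x \<in> carrier R - {\<zero>\<^bsub>R\<^esub>}"
proof -
  interpret R: field R unfolding R_def by (rule field_cex_ring)
  have c: "of_cex z \<in> carrier R" for z :: "('a, 'b, 'c, 'd) cex_field"
    unfolding R_def by (rule of_cex)
  have i: "of_cex (to_cex a :: ('a, 'b, 'c, 'd) cex_field) = a" if "a \<in> carrier R" for a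
    using that to_cex_inverse unfolding R_def by blast
  show z: "of_cex (0 :: ('a, 'b, 'c, 'd) cex_field) = \<zero>\<^bsub>R\<^esub>"
    and "of_cex (1 :: ('a, 'b, 'c, 'd) cex_field) = \<one>\<^bsub>R\<^esub>"
    and "of_cex (x + y) = of_cex x \<oplus>\<^bsub>R\<^esub> of_cex y" and "of_cex (x * y) = of_cex x \<otimes>\<^bsub>R\<^esub> of_cex y"
    and "of_cex (- x) = \<ominus>\<^bsub>R\<^esub> of_cex x" and "of_cex x \<in> carrier R"
    unfolding zero_cex_field_def one_cex_field_def plus_cex_field_def times_cex_field_def
      uminus_cex_field_def R_def[symmetric] using c by (auto intro!: i)
  assume x: "x \<noteq> 0"
  thus n: "of_cex x \<in> carrier R - {\<zero>\<^bsub>R\<^esub>}" using c z of_cex_inject[of x 0] by auto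
  have "inv\<^bsub>R\<^esub> of_cex x \<in> carrier R" using n R.field_Units by auto
  thus "of_cex (inverse x) = inv\<^bsub>R\<^esub> of_cex x"
    using x i unfolding inverse_cex_field_def R_def by simp
qed

instance
proof
  interpret R: field "cex_ring TYPE('a \<times> 'b \<times> 'c \<times> 'd)" by (rule field_cex_ring)
  fix x y z :: "('a, 'b, 'c, 'd) cex_field"
  note s = of_cex_inject[symmetric] of_cex_simps
  show "x + y + z = x + (y + z)" by (simp add: s R.a_assoc)
  show "x + y = y + x" by (simp add: s R.a_comm)
  show "0 + x = x" by (simp add: s)
  show "- x + x = 0" by (simp add: s R.l_neg)
  show "x - y = x + - y" by (simp add: minus_cex_field_def)
  show "x * y * z = x * (y * z)" by (simp add: s R.m_assoc)
  show "x * y = y * x" by (simp add: s R.m_comm)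
  show "1 * x = x" by (simp add: s)
  show "(x + y) * z = x * z + y * z" by (simp add: s R.l_distr)
  show "(0 :: ('a, 'b, 'c, 'd) cex_field) \<noteq> 1" by (simp add: s)
  show "x div y = x * inverse y" by (simp add: divide_cex_field_def)
  show "inverse (0 :: ('a, 'b, 'c, 'd) cex_field) = 0" by (simp add: inverse_cex_field_def)
  show "inverse x * x = 1" if "x \<noteq> 0"
  proof -
    have "of_cex x \<in> Units (cex_ring TYPE('a \<times> 'b \<times> 'c \<times> 'd))"
      using of_cex_simps(8)[OF that] R.field_Units by simp
    hence "of_cex (inverse x * x) = of_cex (1 :: ('a, 'b, 'c, 'd) cex_field)"
      using of_cex_simps(7)[OF that] R.Units_l_inv by (simp add: of_cex_simps)
    thus ?thesis by (simp add: of_cex_inject)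
  qed
qed

end

lemma counterexample_field_iso:
  assumes "\<exists>K :: ('a, 'm) ring_scheme. counterexample_field TYPE('g \<times> 'n) K"
  shows "field_iso (chosen_field TYPE('g \<times> 'n) :: ('a, 'm) ring_scheme)
    (\<lambda>x :: ('a, 'm, 'g, 'n) cex_field. projl (of_cex x))"
proof -
  let ?K = "chosen_field TYPE('g \<times> 'n) :: ('a, 'm) ring_scheme"
  let ?R = "cex_ring TYPE('a \<times> 'm \<times> 'g \<times> 'n)"
  interpret K: field ?K
    using counterexample_chosen_field[OF assms] by (auto simp: counterexample_field_def counterexample_def)
  have R: "?R = image_ring Inl ?K" using assms by (simp add: cex_ring_def)
  have car: "carrier ?R = Inl ` carrier ?K" by (simp add: R image_ring_carrier)
  have h: "Inl \<in> ring_hom ?K ?R"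
    using inj_imp_image_ring_iso[of "Inl :: 'a \<Rightarrow> 'a + rat" ?K] unfolding R ring_iso_def by simp
  have ex: "\<exists>a\<in>carrier ?K. of_cex x = Inl a" for x :: "('a, 'm, 'g, 'n) cex_field"
    using of_cex[of x] unfolding car by auto
  show ?thesis
  proof unfold_locales
    show "bij_betw (\<lambda>x :: ('a, 'm, 'g, 'n) cex_field. projl (of_cex x)) UNIV (carrier ?K)"
    proof (rule bij_betw_byWitness[where f' = "\<lambda>a. to_cex (Inl a)"])
      show "\<forall>x\<in>UNIV. to_cex (Inl (projl (of_cex x))) = (x :: ('a, 'm, 'g, 'n) cex_field)"
      proof
        fix x :: "('a, 'm, 'g, 'n) cex_field"
        obtain a where "of_cex x = Inl a" using ex by blast
        thus "to_cex (Inl (projl (of_cex x))) = x" using of_cex_inverse[of x] by simp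
      qed
      show "\<forall>a\<in>carrier ?K. projl (of_cex (to_cex (Inl a) :: ('a, 'm, 'g, 'n) cex_field)) = a"
        by (auto simp: to_cex_inverse car)
      show "(\<lambda>x :: ('a, 'm, 'g, 'n) cex_field. projl (of_cex x)) ` UNIV \<subseteq> carrier ?K"
      proof clarify
        fix x :: "('a, 'm, 'g, 'n) cex_field"
        obtain a where "a \<in> carrier ?K" "of_cex x = Inl a" using ex by blast
        thus "projl (of_cex x) \<in> carrier ?K" by simp
      qed
    qed simp
    fix x y :: "('a, 'm, 'g, 'n) cex_field"
    obtain a b where ab: "a \<in> carrier ?K" "of_cex x = Inl a" "b \<in> carrier ?K" "of_cex y = Inl b"
      using ex by metis
    show "projl (of_cex (x + y)) = projl (of_cex x) \<oplus>\<^bsub>?K\<^esub> projl (of_cex y)"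
      using ab by (simp add: of_cex_simps flip: ring_hom_add[OF h ab(1,3)])
    show "projl (of_cex (x * y)) = projl (of_cex x) \<otimes>\<^bsub>?K\<^esub> projl (of_cex y)"
      using ab by (simp add: of_cex_simps flip: ring_hom_mult[OF h ab(1,3)])
  next
    show "projl (of_cex (1 :: ('a, 'm, 'g, 'n) cex_field)) = \<one>\<^bsub>?K\<^esub>"
      by (simp add: of_cex_simps flip: ring_hom_one[OF h])
  qed
qed

theorem theorem3p10:
  fixes K :: "('a, 'm) ring_scheme"
    and G :: "('g, 'n) ordered_monoid_scheme"
    and v :: "'a \<Rightarrow> 'g"
  assumes "field K"
    and "\<not> separably_closed K"
    and "henselian_valuation K G v"
    and "separably_closed (residue_field K G v)"
  shows "\<exists>(H :: 'a set ordered_monoid) (w :: 'a \<Rightarrow> 'a set).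
           nontrivial_valuation K H w \<and> henselian_valuation K H w \<and>
           zero_definable_valuation K H w"
proof (rule ccontr)
  assume "\<not> ?thesis"
  hence "counterexample K G v" using assms by (simp add: counterexample_def)
  hence ex: "\<exists>K :: ('a, 'm) ring_scheme. counterexample_field TYPE('g \<times> 'n) K"
    by (auto simp: counterexample_field_def)
  \<comment> \<open>The chosen field need not be the given one, but it is a counterexample for the
    same types, and it is isomorphic to a type.\<close>
  let ?K = "chosen_field TYPE('g \<times> 'n) :: ('a, 'm) ring_scheme"
  obtain G' :: "('g, 'n) ordered_monoid_scheme" and v' where c: "counterexample ?K G' v'"
    using counterexample_chosen_field[OF ex] by (auto simp: counterexample_field_def)
  interpret valued_iso ?K G' v' "\<lambda>x :: ('a, 'm, 'g, 'n) cex_field. projl (of_cex x)"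
    using counterexample_field_iso[OF ex] c
    by (simp add: valued_iso_def counterexample_def henselian_valuation_def)
  show False using definable_henselian_valuation c by (auto simp: counterexample_def)
qed

end
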